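(* Let $L$ be an even positive-definite lattice, $N$ a positive integer and $k\in\mathbb{Z}$. There is an isomorphism $$\mathbb{J}:\ M^!_{k-\frac12\mathrm{rk}(L)}(\rho_{U(N)\oplus L})\ \stackrel{\sim}{\longrightarrow}\ \bigoplus_{d\mid N}J^!_{k,L}(\Gamma_1(N/d))$$ which sends a vector-valued weakly holomorphic modular form $$F(\tau)=\sum_{n\in\mathbb{Q}}\ \sum_{a,b\in\mathbb{Z}/N\mathbb{Z}}\ \sum_{\gamma\in L'/L}c_{(a,b),\gamma}(n)\,q^n\,\mathfrak{e}_{(a,b)}\otimes\mathfrak{e}_\gamma$$ to the sequence of weakly holomorphic Jacobi forms $$\phi_d(\tau,\mathfrak{z})=\sum_{n\in\mathbb{Z}}\ \sum_{\ell\in L'}\Big(\sum_{a\in\mathbb{Z}/N\mathbb{Z}}e^{2\pi iad/N}c_{(a,0),\ell+L}(n-Q(\ell))\Big)q^n\zeta^\ell,\qquad d\mid N.$$ Moreover, $\mathbb{J}$ induces an isomorphism between the subspaces of holomorphic forms $$M_{k-\frac12\mathrm{rk}(L)}(\rho_{U(N)\oplus L})\ \stackrel{\sim}{\longrightarrow}\ \bigoplus_{d\mid N}J_{k,L}(\Gamma_1(N/d)).$$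
   Context: $q=e^{2\pi i\tau}$, $\zeta^\ell=e^{2\pi i(\ell,\mathfrak{z})}$, $Q(x)=(x,x)/2$. $U$ is the even unimodular lattice of signature $(1,1)$, $U(N)$ is $U$ with form multiplied by $N$, $L'$ is the dual of $L$. Elements of the discriminant group of $U(N)\oplus L$ are written $(a,b,\gamma)$, $a,b\in\mathbb{Z}/N\mathbb{Z}$, $\gamma\in L'/L$, with quadratic form $ab/N+Q(\gamma)$ mod $1$; the corresponding basis of the group ring is $\mathfrak{e}_{(a,b)}\otimes\mathfrak{e}_\gamma$. Weil representation. For an even lattice $M$ of signature $(b^+,b^-)$, $\rho_M$ is the representation of $\mathrm{Mp}_2(\mathbb{Z})$ on $\mathbb{C}[M'/M]$ (basis $e_x$) with $\rho_M(T)e_x=e^{-2\pi iQ(x)}e_x$ and $\rho_M(S)e_x=\frac{e^{2\pi i(b^+-b^-)/8}}{\sqrt{|M'/M|}}\sum_{y}e^{2\pi i(x,y)}e_y$, with $T=\left(\begin{pmatrix}1&1\\0&1\end{pmatrix},1\right)$, $S=\left(\begin{pmatrix}0&-1\\1&0\end{pmatrix},\sqrt\tau\right)$. $M^!_\kappa(\rho_M)$ is the space of holomorphic $f:\mathbb{H}\to\mathbb{C}[M'/M]$ with $f(A\tau)=\phi_A(\tau)^{2\kappa}\rho_M(A)f(\tau)$ for $(A,\phi_A)\in\mathrm{Mp}_2(\mathbb{Z})$ and a Fourier expansion $\sum_x\sum_{n\in\mathbb{Z}-Q(x),\,n\gg-\infty}c_x(n)q^ne_x$; $M_\kappa(\rho_M)$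 is the subspace with $c_x(n)=0$ for $n<0$. Jacobi forms. For a congruence subgroup $\Gamma\le\mathrm{SL}_2(\mathbb{Z})$, $J^!_{k,L}(\Gamma)$ is the space of weakly holomorphic Jacobi forms of weight $k$, index $L$ and trivial character on $\Gamma$: holomorphic $\varphi:\mathbb{H}\times(L\otimes\mathbb{C})\to\mathbb{C}$ with $\varphi|_{k,L}A=\varphi$ for $A\in\Gamma$, where for $A=\begin{pmatrix}a&b\\c&d\end{pmatrix}$, $\varphi|_{k,L}A(\tau,\mathfrak{z})=(c\tau+d)^{-k}\exp\left(-i\pi\frac{c(\mathfrak{z},\mathfrak{z})}{c\tau+d}\right)\varphi\left(\frac{a\tau+b}{c\tau+d},\frac{\mathfrak{z}}{c\tau+d}\right)$; with $\varphi(\tau,\mathfrak{z}+x\tau+y)=\exp(-i\pi((x,x)\tau+2(x,\mathfrak{z})))\varphi(\tau,\mathfrak{z})$ for $x,y\in L$; and such that for every $A\in\mathrm{SL}_2(\mathbb{Z})$, $\varphi|_{k,L}A=\sum_{n\gg-\infty}\sum_{\ell\in L'}f_A(n,\ell)q^n\zeta^\ell$ (with rational $n$ of bounded denominator). $J_{k,L}(\Gamma)$ is the subspace of holomorphic Jacobi forms, i.e. those with $f_A(n,\ell)=0$ whenever $2n-(\ell,\ell)<0$, for all $A$. *)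

theory Defs
  imports
    "HOL-Complex_Analysis.Complex_Analysis"
    "HOL-Library.Set_Algebras"
    "HOL-Number_Theory.Cong"
begin

section \<open>Lattices\<close>

text \<open>
  A lattice is a subgroup of a finite-dimensional real vector space generated by linearly
  independent vectors; it need not span the ambient space, so every rank, including \<open>0\<close>, occurs.
  The form is a real-valued function \<open>B\<close> on the ambient space. For a positive-definite lattice
  \<open>B\<close> is the inner product \<open>(\<bullet>)\<close>; every positive-definite lattice embeds isometrically in
  some Euclidean space.
\<close>

definition is_lattice :: "'v::euclidean_space set \<Rightarrow> bool" where
  "is_lattice M \<longleftrightarrow>
    (\<exists>E. independent E \<and> M = {v. \<exists>c::'v \<Rightarrow> int. v = (\<Sum>b\<in>E. of_int (c b) *\<^sub>R b)})"

definition even_posdef_lattice :: "'v::euclidean_space set \<Rightarrow> bool" where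
  "even_posdef_lattice L \<longleftrightarrow> is_lattice L \<and> (\<forall>x\<in>L. \<exists>m::int. x \<bullet> x = 2 * of_int m)"

definition dual_lattice :: "('v::euclidean_space \<Rightarrow> 'v \<Rightarrow> real) \<Rightarrow> 'v set \<Rightarrow> 'v set" where
  "dual_lattice B M = {y \<in> span M. \<forall>x\<in>M. B x y \<in> \<int>}"

definition disc_group :: "('v::euclidean_space \<Rightarrow> 'v \<Rightarrow> real) \<Rightarrow> 'v set \<Rightarrow> 'v set set" where
  "disc_group B M = (\<lambda>v. v +o M) ` dual_lattice B M"

text \<open>
  Representative of a class in \<open>M'/M\<close>. It is only used inside expressions that, for an even
  lattice, do not depend on the choice: \<open>B\<close> is well defined modulo \<open>1\<close> on classes, and so is
  the quadratic form \<open>Q(x) = (x,x)/2\<close>.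
\<close>

definition class_rep :: "'v set \<Rightarrow> 'v" where
  "class_rep x = (SOME v. v \<in> x)"

definition disc_bilin :: "('v \<Rightarrow> 'v \<Rightarrow> real) \<Rightarrow> 'v set \<Rightarrow> 'v set \<Rightarrow> real" where
  "disc_bilin B x y = B (class_rep x) (class_rep y)"

definition disc_quad :: "('v \<Rightarrow> 'v \<Rightarrow> real) \<Rightarrow> 'v set \<Rightarrow> real" where
  "disc_quad B x = B (class_rep x) (class_rep x) / 2"

text \<open>The signature is \<open>(b\<^sup>+, b\<^sup>-) = (pos_index B M, pos_index (- B) M)\<close>.\<close>

definition pos_index :: "('v::euclidean_space \<Rightarrow> 'v \<Rightarrow> real) \<Rightarrow> 'v set \<Rightarrow> nat" where
  "pos_index B M =
    Max {dim S |S. subspace S \<and> S \<subseteq> span M \<and> (\<forall>x\<in>S. x \<noteq> 0 \<longrightarrow> B x x > 0)}"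

definition signature_diff :: "('v::euclidean_space \<Rightarrow> 'v \<Rightarrow> real) \<Rightarrow> 'v set \<Rightarrow> int" where
  "signature_diff B M = int (pos_index B M) - int (pos_index (\<lambda>x y. - B x y) M)"

text \<open>
  \<open>U(N) \<oplus> L\<close>, with \<open>U = \<int>\<^sup>2\<close> carrying the form \<open>((s,t),(s',t')) = s t' + t s'\<close>.
  The element \<open>(a,b,\<gamma>)\<close> of its discriminant group, \<open>a, b \<in> \<int>/N\<int>\<close>, is the class
  of the dual vector \<open>(a/N, b/N, \<gamma>)\<close>, for which \<open>Q = ab/N + Q(\<gamma>)\<close>.
\<close>

definition UN_plus :: "'a::euclidean_space set \<Rightarrow> (real \<times> real \<times> 'a) set" where
  "UN_plus L = \<int> \<times> \<int> \<times> L"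

definition UN_plus_form ::
    "nat \<Rightarrow> real \<times> real \<times> 'a::euclidean_space \<Rightarrow> real \<times> real \<times> 'a \<Rightarrow> real" where
  "UN_plus_form N = (\<lambda>(s, t, x) (s', t', x'). real N * (s * t' + t * s') + x \<bullet> x')"

definition UN_class ::
    "nat \<Rightarrow> 'a::euclidean_space set \<Rightarrow> nat \<Rightarrow> nat \<Rightarrow> 'a \<Rightarrow> (real \<times> real \<times> 'a) set" where
  "UN_class N L a b v = (real a / real N, real b / real N, v) +o UN_plus L"


section \<open>The modular group and its metaplectic cover\<close>

definition UHP :: "complex set" where
  "UHP = {\<tau>. Im \<tau> > 0}"

definition ee :: "complex \<Rightarrow> complex" where
  "ee w = exp (2 * of_real pi * \<i> * w)"

definition SL2Z :: "(int^2^2) set" where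
  "SL2Z = {A. det A = 1}"

definition Gamma1 :: "nat \<Rightarrow> (int^2^2) set" where
  "Gamma1 m = {A \<in> SL2Z. [A$1$1 = 1] (mod int m) \<and> [A$2$2 = 1] (mod int m) \<and>
                          [A$2$1 = 0] (mod int m)}"

definition aut_factor :: "int^2^2 \<Rightarrow> complex \<Rightarrow> complex" where
  "aut_factor A \<tau> = of_int (A$2$1) * \<tau> + of_int (A$2$2)"

definition moebius_act :: "int^2^2 \<Rightarrow> complex \<Rightarrow> complex" where
  "moebius_act A \<tau> = (of_int (A$1$1) * \<tau> + of_int (A$1$2)) / aut_factor A \<tau>"

text \<open>
  Functions on the upper half-plane are total functions that vanish off the upper half-plane, so
  that equality of functions is equality on the upper half-plane. The same convention is used for
  vectors of \<open>\<complex>[M'/M]\<close>, for modular forms and for Jacobi forms.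
\<close>

definition Mp2Z :: "((int^2^2) \<times> (complex \<Rightarrow> complex)) set" where
  "Mp2Z = {(A, \<phi>). A \<in> SL2Z \<and> \<phi> holomorphic_on UHP \<and>
             (\<forall>\<tau>\<in>UHP. (\<phi> \<tau>)\<^sup>2 = aut_factor A \<tau>) \<and> (\<forall>\<tau>. \<tau> \<notin> UHP \<longrightarrow> \<phi> \<tau> = 0)}"

definition mp_mult ::
    "(int^2^2) \<times> (complex \<Rightarrow> complex) \<Rightarrow> (int^2^2) \<times> (complex \<Rightarrow> complex)
      \<Rightarrow> (int^2^2) \<times> (complex \<Rightarrow> complex)" where
  "mp_mult = (\<lambda>(A, \<phi>) (A', \<psi>).
     (A ** A', \<lambda>\<tau>. if \<tau> \<in> UHP then \<phi> (moebius_act A' \<tau>) * \<psi> \<tau> else 0))"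

definition mp_one :: "(int^2^2) \<times> (complex \<Rightarrow> complex)" where
  "mp_one = (mat 1, \<lambda>\<tau>. if \<tau> \<in> UHP then 1 else 0)"

definition mp_T :: "(int^2^2) \<times> (complex \<Rightarrow> complex)" where
  "mp_T = (vector [vector [1, 1], vector [0, 1]], \<lambda>\<tau>. if \<tau> \<in> UHP then 1 else 0)"

definition mp_S :: "(int^2^2) \<times> (complex \<Rightarrow> complex)" where
  "mp_S = (vector [vector [0, -1], vector [1, 0]], \<lambda>\<tau>. if \<tau> \<in> UHP then csqrt \<tau> else 0)"


section \<open>The Weil representation and vector-valued modular forms\<close>

definition group_ring :: "'d set \<Rightarrow> ('d \<Rightarrow> complex) set" where
  "group_ring X = {v. \<forall>x. x \<notin> X \<longrightarrow> v x = 0}"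

definition basis_vec :: "'d \<Rightarrow> 'd \<Rightarrow> complex" where
  "basis_vec x = (\<lambda>y. if y = x then 1 else 0)"

definition is_weil_rep ::
    "('v::euclidean_space \<Rightarrow> 'v \<Rightarrow> real) \<Rightarrow> 'v set
      \<Rightarrow> ((int^2^2) \<times> (complex \<Rightarrow> complex) \<Rightarrow> ('v set \<Rightarrow> complex) \<Rightarrow> 'v set \<Rightarrow> complex) \<Rightarrow> bool" where
  "is_weil_rep B M \<rho> \<longleftrightarrow>
    (let X = disc_group B M; V = group_ring X in
      (\<forall>g\<in>Mp2Z. \<rho> g ` V \<subseteq> V) \<and>
      (\<forall>g\<in>Mp2Z. \<forall>v\<in>V. \<forall>w\<in>V. \<forall>\<alpha> \<beta>.
         \<rho> g (\<lambda>x. \<alpha> * v x + \<beta> * w x) = (\<lambda>x. \<alpha> * \<rho> g v x + \<beta> * \<rho> g w x)) \<and>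
      (\<forall>v\<in>V. \<rho> mp_one v = v) \<and>
      (\<forall>g\<in>Mp2Z. \<forall>h\<in>Mp2Z. \<forall>v\<in>V. \<rho> (mp_mult g h) v = \<rho> g (\<rho> h v)) \<and>
      (\<forall>x\<in>X. \<rho> mp_T (basis_vec x) =
         (\<lambda>y. ee (- of_real (disc_quad B x)) * basis_vec x y)) \<and>
      (\<forall>x\<in>X. \<rho> mp_S (basis_vec x) =
         (\<lambda>z. ee (of_int (signature_diff B M) / 8) / of_real (sqrt (real (card X))) *
            (\<Sum>y\<in>X. ee (of_real (disc_bilin B x y)) * basis_vec y z))))"

text \<open>
  For an even lattice such a representation exists, and since \<open>S\<close> and \<open>T\<close> generate
  \<open>Mp\<^sub>2(\<int>)\<close> it is unique on \<open>Mp2Z\<close> and \<open>\<complex>[M'/M]\<close>, the only arguments at which it is used.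
\<close>

definition weil_rep ::
    "('v::euclidean_space \<Rightarrow> 'v \<Rightarrow> real) \<Rightarrow> 'v set
      \<Rightarrow> (int^2^2) \<times> (complex \<Rightarrow> complex) \<Rightarrow> ('v set \<Rightarrow> complex) \<Rightarrow> 'v set \<Rightarrow> complex" where
  "weil_rep B M = (SOME \<rho>. is_weil_rep B M \<rho>)"

definition vv_exponents :: "('v \<Rightarrow> 'v \<Rightarrow> real) \<Rightarrow> 'v set \<Rightarrow> real set" where
  "vv_exponents B x = {n. n + disc_quad B x \<in> \<int>}"

text \<open>
  \<open>vv_expansion B M F c\<close>: the function \<open>F\<close> has the Fourier expansion
  \<open>\<Sum>\<^sub>x \<Sum>\<^sub>n c\<^sub>x(n) q\<^sup>n e\<^sub>x\<close> with \<open>n \<in> \<int> - Q(x)\<close> bounded below.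
\<close>

definition vv_expansion ::
    "('v::euclidean_space \<Rightarrow> 'v \<Rightarrow> real) \<Rightarrow> 'v set \<Rightarrow> (complex \<Rightarrow> 'v set \<Rightarrow> complex)
      \<Rightarrow> ('v set \<Rightarrow> real \<Rightarrow> complex) \<Rightarrow> bool" where
  "vv_expansion B M F c \<longleftrightarrow>
    (\<exists>n0. \<forall>x\<in>disc_group B M. \<forall>n\<in>vv_exponents B x. n < n0 \<longrightarrow> c x n = 0) \<and>
    (\<forall>\<tau>\<in>UHP. \<forall>x\<in>disc_group B M.
       ((\<lambda>n. c x n * ee (of_real n * \<tau>)) has_sum F \<tau> x) (vv_exponents B x))"

text \<open>The weight \<open>\<kappa>\<close> is meant to be a half-integer, so that \<open>\<lfloor>2 * \<kappa>\<rfloor> = 2 * \<kappa>\<close>.\<close>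

definition weak_vv_forms ::
    "real \<Rightarrow> ('v::euclidean_space \<Rightarrow> 'v \<Rightarrow> real) \<Rightarrow> 'v set
      \<Rightarrow> (complex \<Rightarrow> 'v set \<Rightarrow> complex) set" where
  "weak_vv_forms \<kappa> B M = {F.
     (\<forall>\<tau>. \<tau> \<notin> UHP \<longrightarrow> F \<tau> = (\<lambda>_. 0)) \<and>
     (\<forall>\<tau>\<in>UHP. F \<tau> \<in> group_ring (disc_group B M)) \<and>
     (\<forall>x\<in>disc_group B M. (\<lambda>\<tau>. F \<tau> x) holomorphic_on UHP) \<and>
     (\<forall>(A, \<phi>)\<in>Mp2Z. \<forall>\<tau>\<in>UHP.
        F (moebius_act A \<tau>) = (\<lambda>x. \<phi> \<tau> powi \<lfloor>2 * \<kappa>\<rfloor> * weil_rep B M (A, \<phi>) (F \<tau>) x)) \<and>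
     (\<exists>c. vv_expansion B M F c)}"

definition vv_forms ::
    "real \<Rightarrow> ('v::euclidean_space \<Rightarrow> 'v \<Rightarrow> real) \<Rightarrow> 'v set
      \<Rightarrow> (complex \<Rightarrow> 'v set \<Rightarrow> complex) set" where
  "vv_forms \<kappa> B M = {F \<in> weak_vv_forms \<kappa> B M.
     \<exists>c. vv_expansion B M F c \<and>
         (\<forall>x\<in>disc_group B M. \<forall>n\<in>vv_exponents B x. n < 0 \<longrightarrow> c x n = 0)}"


section \<open>Jacobi forms of lattice index\<close>

text \<open>
  The complexification of a real space is modelled by pairs: \<open>(u, v)\<close> stands for \<open>u + \<i> v\<close>,
  and \<open>x \<in> L\<close> is embedded as \<open>(x, 0)\<close>.
\<close>

definition complexify :: "'a::euclidean_space set \<Rightarrow> ('a \<times> 'a) set" where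
  "complexify L = span L \<times> span L"

definition cscale :: "complex \<Rightarrow> 'a::euclidean_space \<times> 'a \<Rightarrow> 'a \<times> 'a" where
  "cscale w = (\<lambda>(u, v). (Re w *\<^sub>R u - Im w *\<^sub>R v, Re w *\<^sub>R v + Im w *\<^sub>R u))"

text \<open>The complex-bilinear (not sesquilinear) extension of the inner product.\<close>

definition cform :: "'a::euclidean_space \<times> 'a \<Rightarrow> 'a \<times> 'a \<Rightarrow> complex" where
  "cform = (\<lambda>(u, v) (u', v'). Complex (u \<bullet> u' - v \<bullet> v') (u \<bullet> v' + v \<bullet> u'))"

text \<open>Joint holomorphy on \<open>\<H> \<times> (L \<otimes> \<complex>)\<close>: existence of a complex-linear total derivative.\<close>

definition jointly_holomorphic ::
    "'a::euclidean_space set \<Rightarrow> (complex \<Rightarrow> 'a \<times> 'a \<Rightarrow> complex) \<Rightarrow> bool" where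
  "jointly_holomorphic L \<phi> \<longleftrightarrow>
    (\<forall>\<tau>\<in>UHP. \<forall>z\<in>complexify L. \<exists>D.
       ((\<lambda>(\<tau>, z). \<phi> \<tau> z) has_derivative D) (at (\<tau>, z) within UHP \<times> complexify L) \<and>
       (\<forall>w s. \<forall>y\<in>complexify L. D (w * s, cscale w y) = w * D (s, y)))"

definition jslash ::
    "int \<Rightarrow> int^2^2 \<Rightarrow> (complex \<Rightarrow> 'a::euclidean_space \<times> 'a \<Rightarrow> complex)
      \<Rightarrow> complex \<Rightarrow> 'a \<times> 'a \<Rightarrow> complex" where
  "jslash k A \<phi> \<tau> z =
     aut_factor A \<tau> powi (- k) *
     exp (- \<i> * of_real pi * (of_int (A$2$1) * cform z z / aut_factor A \<tau>)) *
     \<phi> (moebius_act A \<tau>) (cscale (1 / aut_factor A \<tau>) z)"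

text \<open>
  \<open>jacobi_expansion L \<psi> f\<close>: the function \<open>\<psi>\<close> has the expansion
  \<open>\<Sum>\<^sub>n \<Sum>\<^sub>l f(n,l) q\<^sup>n \<zeta>\<^sup>l\<close> over \<open>n \<in> \<rat>\<close>, \<open>l \<in> L'\<close>, with \<open>n\<close> of bounded denominator
  and bounded below.
\<close>

definition jacobi_expansion ::
    "'a::euclidean_space set \<Rightarrow> (complex \<Rightarrow> 'a \<times> 'a \<Rightarrow> complex) \<Rightarrow> (real \<Rightarrow> 'a \<Rightarrow> complex)
      \<Rightarrow> bool" where
  "jacobi_expansion L \<psi> f \<longleftrightarrow>
    (\<exists>D::nat. D > 0 \<and> (\<exists>n0. \<forall>n\<in>\<rat>. \<forall>l\<in>dual_lattice (\<bullet>) L.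
       f n l \<noteq> 0 \<longrightarrow> real D * n \<in> \<int> \<and> n0 \<le> n)) \<and>
    (\<forall>\<tau>\<in>UHP. \<forall>z\<in>complexify L.
       ((\<lambda>(n, l). f n l * ee (of_real n * \<tau>) * ee (cform (l, 0) z)) has_sum \<psi> \<tau> z)
         (\<rat> \<times> dual_lattice (\<bullet>) L))"

definition weak_jacobi_forms ::
    "int \<Rightarrow> 'a::euclidean_space set \<Rightarrow> (int^2^2) set
      \<Rightarrow> (complex \<Rightarrow> 'a \<times> 'a \<Rightarrow> complex) set" where
  "weak_jacobi_forms k L \<Gamma> = {\<phi>.
     (\<forall>\<tau> z. \<not> (\<tau> \<in> UHP \<and> z \<in> complexify L) \<longrightarrow> \<phi> \<tau> z = 0) \<and>
     jointly_holomorphic L \<phi> \<and>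
     (\<forall>A\<in>\<Gamma>. \<forall>\<tau>\<in>UHP. \<forall>z\<in>complexify L. jslash k A \<phi> \<tau> z = \<phi> \<tau> z) \<and>
     (\<forall>\<tau>\<in>UHP. \<forall>z\<in>complexify L. \<forall>x\<in>L. \<forall>y\<in>L.
        \<phi> \<tau> (z + cscale \<tau> (x, 0) + (y, 0)) =
          exp (- \<i> * of_real pi * (of_real (x \<bullet> x) * \<tau> + 2 * cform (x, 0) z)) * \<phi> \<tau> z) \<and>
     (\<forall>A\<in>SL2Z. \<exists>f. jacobi_expansion L (jslash k A \<phi>) f)}"

definition jacobi_forms ::
    "int \<Rightarrow> 'a::euclidean_space set \<Rightarrow> (int^2^2) set
      \<Rightarrow> (complex \<Rightarrow> 'a \<times> 'a \<Rightarrow> complex) set" where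
  "jacobi_forms k L \<Gamma> = {\<phi> \<in> weak_jacobi_forms k L \<Gamma>.
     \<forall>A\<in>SL2Z. \<exists>f. jacobi_expansion L (jslash k A \<phi>) f \<and>
       (\<forall>n\<in>\<rat>. \<forall>l\<in>dual_lattice (\<bullet>) L. 2 * n - l \<bullet> l < 0 \<longrightarrow> f n l = 0)}"


section \<open>Direct sums and isomorphisms\<close>

text \<open>Families \<open>(\<phi>\<^sub>d)\<close> over the finite index set of divisors of \<open>N > 0\<close>, zero elsewhere.\<close>

definition divisor_sum ::
    "nat \<Rightarrow> (nat \<Rightarrow> (complex \<Rightarrow> 'z \<Rightarrow> complex) set) \<Rightarrow> (nat \<Rightarrow> complex \<Rightarrow> 'z \<Rightarrow> complex) set" where
  "divisor_sum N X = {\<Phi>. (\<forall>d. d dvd N \<longrightarrow> \<Phi> d \<in> X d) \<and>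
                          (\<forall>d. \<not> d dvd N \<longrightarrow> \<Phi> d = (\<lambda>_ _. 0))}"

definition complex_linear_iso ::
    "((complex \<Rightarrow> 'x \<Rightarrow> complex) \<Rightarrow> nat \<Rightarrow> complex \<Rightarrow> 'z \<Rightarrow> complex)
      \<Rightarrow> (complex \<Rightarrow> 'x \<Rightarrow> complex) set \<Rightarrow> (nat \<Rightarrow> complex \<Rightarrow> 'z \<Rightarrow> complex) set \<Rightarrow> bool" where
  "complex_linear_iso J V W \<longleftrightarrow> bij_betw J V W \<and>
    (\<forall>F\<in>V. \<forall>G\<in>V. \<forall>\<alpha> \<beta>.
       J (\<lambda>\<tau> x. \<alpha> * F \<tau> x + \<beta> * G \<tau> x) = (\<lambda>d \<tau> z. \<alpha> * J F d \<tau> z + \<beta> * J G d \<tau> z))"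

end

theory Submission
  imports Defs "HOL-Probability.Characteristic_Functions"
begin

text \<open>
  Write \<open>r\<close> for the rank of \<open>L\<close>. The isomorphism rests on a single family of functions. To a vector
  \<open>v\<close> in the group ring of the discriminant group of \<open>U(N) \<oplus> L\<close> attach, for every pair of integers
  \<open>(u, w)\<close>, the theta function
  \[ \Phi(u, w)(\tau, z) = \sum_{l \in L'} \Big(\sum_{a \bmod N} e^{2\pi i a w/N} v_{(a,-u),l}\Big) q^{Q(l)} \zeta^l . \]
  The inner sum is a Fourier transform in one isotropic coordinate of \<open>U(N)\<close>; it is invertible, and theta
  functions with different coefficients are different, so \<open>v\<close> can be recovered from all the
  \<open>\<Phi>(u, w)\<close>. The reason for the transform is that it turns the part of the Weil representation coming
  from \<open>U(N)\<close> into a permutation: the transformation laws of theta functions under \<open>T\<close> and \<open>S\<close> say that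
  replacing \<open>v\<close> by its image under the Weil representation and acting on \<open>(\<tau>, z)\<close> by
  \<open>A\<close> has the effect of replacing the row vector \<open>(u, w)\<close> by \<open>(u, w) A\<close>, up to the automorphy factor of
  weight \<open>r/2\<close> (lemma \<open>weil_rep_characterisation\<close>). Read backwards, this property also constructs the Weil
  representation (lemma \<open>weil_rep_exists\<close>).
  Consequently a vector-valued function \<open>F\<close> satisfies the modular law of weight \<open>k - r/2\<close> if and only if the
  functions \<open>\<Phi>(u, w)\<close> built from the values of \<open>F\<close> satisfy \<open>\<Phi>(u, w) | A = \<Phi>((u, w) A)\<close> in weight
  \<open>k\<close> and index \<open>L\<close>, for all \<open>A\<close> in the modular group (lemma \<open>modular_law_iff\<close>).

  The indices matter only modulo \<open>N\<close>, and the orbits of the modular group on row vectors modulo \<open>N\<close> are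
  represented by \<open>(0, d)\<close> with \<open>d\<close> a divisor of \<open>N\<close>, the stabiliser of \<open>(0, d)\<close> being
  \<open>\<Gamma>\<^sub>1(N/d)\<close> (lemmas \<open>row_orbit\<close> and \<open>row_orbit_unique\<close>). So the whole family is equivalent to its
  members \<open>\<phi>\<^sub>d = \<Phi>(0, d)\<close>, each invariant under \<open>\<Gamma>\<^sub>1(N/d)\<close>, and these are the Jacobi forms of the statement.
  Given arbitrary Jacobi forms \<open>\<phi>\<^sub>d\<close>, the family is rebuilt by \<open>\<Phi>((0, d) A) = \<phi>\<^sub>d | A\<close>; every member satisfies the
  elliptic law, hence has a theta decomposition, and inverting the Fourier transform of its coefficients
  gives \<open>F\<close> (lemma \<open>jacobi_map_surj\<close>).

  The Fourier coefficients of \<open>\<Phi>(u, w)\<close> at \<open>(n, l)\<close> are finite linear combinations of coefficients of \<open>F\<close> at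
  the exponent \<open>n - Q(l)\<close>, and conversely. This gives the explicit formula, and it shows that \<open>F\<close> has no
  negative exponents precisely when no \<open>\<phi>\<^sub>d | A\<close> has a coefficient with \<open>2 n < (l, l)\<close>, which is the statement
  about holomorphic forms. Uniqueness of absolutely convergent Fourier expansions
  (lemma \<open>fourier_series_zero\<close>) is used throughout to compare coefficients.

  The analytic input is the inversion formula for theta functions. It is derived from Poisson summation for
  Gaussians, first on the integers, then on a lattice by induction on the rank, and from purely
  imaginary \<open>\<tau>\<close> to the upper half-plane by analytic continuation.
\<close>

section \<open>Exponentials and Fourier series on the circle\<close>

lemma ee_add: "ee (x + y) = ee x * ee y"
  by (simp add: ee_def ring_distribs exp_add)

lemma ee_0 [simp]: "ee 0 = 1"
  by (simp add: ee_def)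

lemma ee_nonzero [simp]: "ee x \<noteq> 0"
  by (simp add: ee_def)

lemma ee_minus: "ee (- x) = inverse (ee x)"
  by (simp add: ee_def exp_minus)

lemma ee_diff: "ee (x - y) = ee x / ee y"
  by (simp add: ee_def ring_distribs exp_diff)

lemma ee_minus_mult [simp]: "ee (- x) * ee x = 1" "ee x * ee (- x) = 1"
  by (simp_all add: ee_minus)

lemma norm_ee: "norm (ee z) = exp (- 2 * pi * Im z)"
  by (simp add: ee_def)

lemma norm_ee_of_real [simp]: "norm (ee (of_real x)) = 1"
  by (simp add: norm_ee)

lemma cnj_ee: "cnj (ee z) = ee (- cnj z)"
  by (simp add: ee_def exp_cnj)

lemma ee_of_int [simp]: "ee (of_int n) = 1"
  using exp_integer_2pi[of "of_int n"] by (simp add: ee_def mult_ac)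

lemma ee_of_real_Ints: "x \<in> \<int> \<Longrightarrow> ee (of_real x) = 1"
  by (metis Ints_cases ee_of_int of_real_of_int_eq)

lemma ee_of_nat_mult: "ee (of_nat n * x) = ee x ^ n"
  unfolding ee_def exp_of_nat_mult[symmetric] by (simp add: mult_ac)

lemma ee_eq_1_imp: "ee (of_real x) = 1 \<Longrightarrow> x \<in> \<int>"
  unfolding ee_def
  by (auto simp: exp_eq_1 complex_is_Int_iff)

lemma continuous_on_ee [continuous_intros]:
  "continuous_on S f \<Longrightarrow> continuous_on S (\<lambda>x. ee (f x))"
  unfolding ee_def by (intro continuous_intros)

lemma holomorphic_on_ee [holomorphic_intros]:
  "f holomorphic_on S \<Longrightarrow> (\<lambda>x. ee (f x)) holomorphic_on S"
  unfolding ee_def by (intro holomorphic_intros)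

text \<open>
  On the circle the real and imaginary parts are Laurent polynomials in \<open>w\<close>, and a shift by a power of \<open>w\<close>
  turns a Laurent polynomial into a polynomial. This is what connects the Stone--Weierstrass theorem for
  polynomial functions on the plane with Fourier coefficients.
\<close>
lemma trig_polynomial:
  assumes "real_polynomial_function f"
  shows "\<exists>n p. \<forall>x. complex_of_real (f (ee (of_real x))) = poly p (ee (of_real x)) * ee (- (of_nat n * of_real x))"
  using assms
proof induction
  case (linear f)
  define a where "a = f 1" define b where "b = f \<i>"
  have f: "f w = Re w * a + Im w * b" for w
  proof -
    interpret bounded_linear f by fact
    have "f w = f (Re w *\<^sub>R 1 + Im w *\<^sub>R \<i>)"
      by (rule arg_cong[of _ _ f]) (simp add: complex_eq_iff)
    then show ?thesis by (simp add: add scaleR a_def b_def)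
  qed
  define u v where "u = (of_real a - \<i> * of_real b) / 2" and "v = (of_real a + \<i> * of_real b) / 2"
  have 1: "complex_of_real (f (ee (of_real x))) = u * ee (of_real x) + v * ee (- of_real x)" for x
  proof -
    have "ee (- of_real x) = cnj (ee (of_real x))" by (simp add: cnj_ee)
    then show ?thesis by (simp add: f u_def v_def complex_eq_iff field_simps)
  qed
  show ?case
    by (rule exI[of _ 1], rule exI[of _ "[:v, 0, u:]"], rule allI, subst 1)
       (simp add: algebra_simps flip: ee_add)
next
  case (const c)
  show ?case by (rule exI[of _ 0], rule exI[of _ "[:of_real c:]"]) simp
next
  case (add f g)
  then obtain m p n q where
    f: "\<And>x. complex_of_real (f (ee (of_real x))) = poly p (ee (of_real x)) * ee (- (of_nat m * of_real x))" and
    g: "\<And>x. complex_of_real (g (ee (of_real x))) = poly q (ee (of_real x)) * ee (- (of_nat n * of_real x))"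
    by blast
  show ?case
    by (rule exI[of _ "m + n"], rule exI[of _ "p * monom 1 n + q * monom 1 m"], rule allI)
       (simp add: f g poly_monom ee_minus ee_diff ring_distribs ee_of_nat_mult power_add field_simps)
next
  case (mult f g)
  then obtain m p n q where
    f: "\<And>x. complex_of_real (f (ee (of_real x))) = poly p (ee (of_real x)) * ee (- (of_nat m * of_real x))" and
    g: "\<And>x. complex_of_real (g (ee (of_real x))) = poly q (ee (of_real x)) * ee (- (of_nat n * of_real x))"
    by blast
  show ?case
    by (rule exI[of _ "m + n"], rule exI[of _ "p * q"], rule allI)
       (simp add: f g ee_minus ee_diff ring_distribs ee_of_nat_mult power_add field_simps)
qed

text \<open>
  All integrals of \<open>d\<close> against trigonometric polynomials vanish. Since \<open>d\<close> descends to the circle, its complex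
  conjugate is a uniform limit of such polynomials, so the integral of \<open>\<bar>d\<bar>\<^sup>2\<close> is \<open>0\<close>.
\<close>
lemma fourier_coefficients_zero:
  fixes d :: "real \<Rightarrow> complex"
  assumes cont: "continuous_on {0..1} d" and per: "d 0 = d 1"
    and coeff: "\<And>k::int. integral {0..1} (\<lambda>x. d x * ee (of_int k * of_real x)) = 0"
    and x: "x \<in> {0..1}"
  shows "d x = 0"
proof -
  define D where "D = (\<lambda>x. cnj (d x)) \<circ> (\<lambda>z. Arg2pi z / (2 * pi))"
  have "homotopic_loops UNIV (\<lambda>x. cnj (d x)) (\<lambda>x. cnj (d x))"
    using cont per by (auto simp: homotopic_loops_refl path_def pathfinish_def pathstart_def intro!: continuous_intros)
  from homotopic_with_imp_continuous[OF homotopic_loops_imp_homotopic_circlemaps[OF this]]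
  have contD: "continuous_on (sphere 0 1) D" by (simp add: D_def)
  have D: "D (ee (of_real x)) = cnj (d x)" if "x \<in> {0..1}" for x
  proof (cases "x = 1")
    case True
    have "Arg2pi 1 = 0" by (rule Arg2pi_unique[of 1]) auto
    moreover have "ee (of_real x) = 1" using True ee_of_int[of 1] by simp
    ultimately show ?thesis using True per by (simp add: D_def)
  next
    case False
    have "Arg2pi (ee (of_real x)) = 2 * pi * x"
      by (rule Arg2pi_unique[of 1]) (use that False in \<open>auto simp: ee_def algebra_simps\<close>)
    then show ?thesis by (simp add: D_def)
  qed
  have intd: "integral {0..1} (\<lambda>x. d x * of_real (f (ee (of_real x)))) = 0"
    if rpf: "real_polynomial_function f" for f
  proof -
    obtain n p where p: "\<And>x. complex_of_real (f (ee (of_real x))) = poly p (ee (of_real x)) * ee (- (of_nat n * of_real x))"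
      using trig_polynomial[OF rpf] by blast
    have eq: "d x * of_real (f (ee (of_real x)))
        = (\<Sum>i\<le>degree p. coeff p i * (d x * ee (of_int (int i - int n) * of_real x)))" for x
      unfolding p poly_altdef sum_distrib_left sum_distrib_right
      by (rule sum.cong[OF refl]) (simp add: ring_distribs ee_diff ee_minus ee_of_nat_mult divide_inverse)
    have *: "(\<lambda>x. d x * ee (of_int k * of_real x)) integrable_on {0..1}" for k
      by (intro integrable_continuous_real continuous_intros cont)
    have **: "((\<lambda>x. d x * ee (of_int k * of_real x)) has_integral 0) {0..1}" for k
      using * coeff[of k] by (metis integrable_integral)
    have "((\<lambda>x. d x * of_real (f (ee (of_real x)))) has_integral (\<Sum>i\<le>degree p. coeff p i * 0)) {0..1}"
      unfolding eq by (intro has_integral_sum has_integral_mult_right **) auto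
    then show ?thesis by (simp add: integral_unique)
  qed
  have contd2: "continuous_on {0..1} (\<lambda>x. (cmod (d x))\<^sup>2)" by (intro continuous_intros cont)
  have "bounded (d ` {0..1})" using cont compact_continuous_image compact_imp_bounded compact_Icc by blast
  then obtain B where B: "B > 0" "\<And>x. x \<in> {0..1} \<Longrightarrow> norm (d x) \<le> B"
    unfolding bounded_pos by auto
  have small: "integral {0..1} (\<lambda>x. (cmod (d x))\<^sup>2) \<le> B * e" if e: "e > 0" for e
  proof -
    obtain g where g: "polynomial_function g" "\<And>z. z \<in> sphere 0 1 \<Longrightarrow> norm (D z - g z) < e"
      using Stone_Weierstrass_polynomial_function[OF compact_sphere contD e] by blast
    have rp: "real_polynomial_function (Re \<circ> g)" "real_polynomial_function (Im \<circ> g)"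
      using g(1) bounded_linear_Re bounded_linear_Im unfolding polynomial_function_def by blast+
    let ?h = "\<lambda>x. g (ee (complex_of_real x))"
    have conth: "continuous_on {0..1} ?h"
      by (intro continuous_on_compose2[OF continuous_on_polymonial_function[OF g(1), of UNIV]] continuous_intros) auto
    have i1: "(\<lambda>x. d x * of_real (Re (?h x))) integrable_on {0..1}"
      and i2: "(\<lambda>x. d x * of_real (Im (?h x))) integrable_on {0..1}"
      by (intro integrable_continuous_real continuous_intros cont conth)+
    have "((\<lambda>x. d x * of_real (Re (?h x)) + \<i> * (d x * of_real (Im (?h x)))) has_integral 0 + \<i> * 0) {0..1}"
      using integrable_integral[OF i1] integrable_integral[OF i2] intd[OF rp(1)] intd[OF rp(2)]
      by (intro has_integral_add has_integral_mult_right) (simp_all add: o_def)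
    moreover have "d x * of_real (Re (?h x)) + \<i> * (d x * of_real (Im (?h x))) = d x * ?h x" for x
      by (subst (3) complex_eq) (simp add: algebra_simps)
    ultimately have h0: "((\<lambda>x. d x * ?h x) has_integral 0) {0..1}" by simp
    have "((\<lambda>x. (cmod (d x))\<^sup>2) has_integral integral {0..1} (\<lambda>x. (cmod (d x))\<^sup>2)) {0..1}"
      using contd2 integrable_continuous_real by blast
    from has_integral_of_real[OF this]
    have "((\<lambda>x. d x * cnj (d x)) has_integral of_real (integral {0..1} (\<lambda>x. (cmod (d x))\<^sup>2))) {0..1}"
      by (simp add: complex_norm_square[symmetric] flip: of_real_power)
    from has_integral_diff[OF this h0]
    have hi: "((\<lambda>x. d x * (cnj (d x) - ?h x)) has_integral of_real (integral {0..1} (\<lambda>x. (cmod (d x))\<^sup>2))) {0..1}"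
      by (simp add: algebra_simps)
    have "norm (complex_of_real (integral {0..1} (\<lambda>x. (cmod (d x))\<^sup>2))) \<le> (B * e) * measure lborel (cbox (0::real) 1)"
    proof (rule has_integral_bound)
      show "((\<lambda>x. d x * (cnj (d x) - ?h x)) has_integral of_real (integral {0..1} (\<lambda>x. (cmod (d x))\<^sup>2))) (cbox 0 1)"
        using hi by simp
      fix x :: real assume "x \<in> cbox 0 1"
      then have x: "x \<in> {0..1}" by simp
      have "norm (cnj (d x) - ?h x) < e" using g(2)[of "ee (of_real x)"] D[OF x] by simp
      then show "norm (d x * (cnj (d x) - ?h x)) \<le> B * e"
        using B x by (simp add: norm_mult mult_mono less_imp_le)
    qed (use B e in auto)
    then show ?thesis by simp
  qed
  have "integral {0..1} (\<lambda>x. (cmod (d x))\<^sup>2) \<le> 0"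
  proof (rule field_le_epsilon)
    fix e :: real assume "e > 0"
    then show "integral {0..1} (\<lambda>x. (cmod (d x))\<^sup>2) \<le> 0 + e"
      using small[of "e / B"] B by simp
  qed
  moreover have "integral {0..1} (\<lambda>x. (cmod (d x))\<^sup>2) \<ge> 0"
    by (rule Henstock_Kurzweil_Integration.integral_nonneg) (use contd2 integrable_continuous_real in auto)
  ultimately have "integral {0..1} (\<lambda>x. (cmod (d x))\<^sup>2) = 0" by simp
  then have "(cmod (d x))\<^sup>2 = 0"
    using integral_eq_0_iff[OF contd2] x by auto
  then show ?thesis by simp
qed

section \<open>Poisson summation for Gaussians on the line\<close>

text \<open>
  After an affine substitution this is the characteristic function of the standard normal distribution.
\<close>
lemma gaussian_fourier_transform:
  fixes t s :: real
  assumes t: "t > 0"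
  shows "((\<lambda>x. of_real (exp (- pi * t * x\<^sup>2)) * ee (of_real (s * x))) has_integral
          of_real (exp (- pi * s\<^sup>2 / t) / sqrt t)) UNIV"
    and "integrable lborel (\<lambda>x. of_real (exp (- pi * t * x\<^sup>2)) * ee (of_real (s * x)))"
proof -
  let ?n = "\<lambda>x. complex_of_real (std_normal_density x)"
  define c where "c = sqrt (2 * pi * t)"
  have c: "c > 0" using t by (simp add: c_def)
  have c2: "c * c = 2 * pi * t" using t by (simp add: c_def)
  define u where "u = 2 * pi * s / c"
  have int0: "integrable lborel (\<lambda>x. std_normal_density x *\<^sub>R iexp (u * x))"
    by (rule Bochner_Integration.integrable_bound[OF integrable_normal_density[of 1 0]]) (auto simp: normal_density_nonneg)
  have "(LINT x|std_normal_distribution. iexp (u * x)) = of_real (exp (- u\<^sup>2 / 2))"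
    using char_std_normal_distribution unfolding char_def by metis
  then have 1: "(LINT x|lborel. std_normal_density x *\<^sub>R iexp (u * x)) = of_real (exp (- u\<^sup>2 / 2))"
    by (subst (asm) integral_density) (auto simp: normal_density_nonneg)
  have eq: "std_normal_density (0 + c * x) *\<^sub>R iexp (u * (0 + c * x))
      = of_real (1 / sqrt (2 * pi)) * (of_real (exp (- pi * t * x\<^sup>2)) * ee (of_real (s * x)))" for x
  proof -
    have cx: "(c * x)\<^sup>2 / 2 = pi * t * x\<^sup>2"
      using c2 by (simp add: power2_eq_square field_simps)
    have "u * (c * x) = 2 * pi * (s * x)"
      using c by (simp add: u_def)
    then have "\<i> * of_real (u * (0 + c * x)) = 2 * of_real pi * \<i> * of_real (s * x)"
      by (metis add_0 mult.assoc mult.commute of_real_mult of_real_numeral)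
    moreover have "std_normal_density (0 + c * x) = (1 / sqrt (2 * pi)) * exp (- pi * t * x\<^sup>2)"
      using cx by (simp add: std_normal_density_def)
    ultimately show ?thesis
      unfolding ee_def scaleR_conv_of_real by (simp only:) simp
  qed
  have 2: "(LINT x|lborel. std_normal_density x *\<^sub>R iexp (u * x))
      = of_real (c / sqrt (2 * pi)) * (LINT x|lborel. of_real (exp (- pi * t * x\<^sup>2)) * ee (of_real (s * x)))"
    using c by (subst lborel_integral_real_affine[of c _ 0]) (simp_all only: eq, simp_all add: scaleR_conv_of_real)
  have "integrable lborel (\<lambda>x. std_normal_density (0 + c * x) *\<^sub>R iexp (u * (0 + c * x)))"
    using lborel_integrable_real_affine[OF int0, of c 0] c by simp
  then have "integrable lborel (\<lambda>x. of_real (1 / sqrt (2 * pi)) * (of_real (exp (- pi * t * x\<^sup>2)) * ee (of_real (s * x))))"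
    unfolding eq .
  from integrable_mult_right[OF this, of "of_real (sqrt (2 * pi))"]
  show int: "integrable lborel (\<lambda>x. of_real (exp (- pi * t * x\<^sup>2)) * ee (of_real (s * x)))"
    unfolding mult.assoc[symmetric] of_real_mult[symmetric] by simp
  have u: "u\<^sup>2 / 2 = pi * s\<^sup>2 / t"
    using t c c2 by (simp add: u_def power2_eq_square field_simps)
  have c': "c / sqrt (2 * pi) = sqrt t"
    by (simp add: c_def real_sqrt_mult)
  have "(LINT x|lborel. of_real (exp (- pi * t * x\<^sup>2)) * ee (of_real (s * x))) = complex_of_real (exp (- pi * s\<^sup>2 / t) / sqrt t)"
    using 1 2 u t unfolding c' by (simp add: field_simps)
  with has_integral_integral_lborel[OF int]
  show "((\<lambda>x. of_real (exp (- pi * t * x\<^sup>2)) * ee (of_real (s * x))) has_integral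
          of_real (exp (- pi * s\<^sup>2 / t) / sqrt t)) UNIV"
    by simp
qed

lemma summable_gaussian_int:
  assumes a: "a > 0"
  shows "(\<lambda>m::int. exp (- a * (real_of_int m)\<^sup>2)) summable_on UNIV"
proof -
  have geo: "(\<lambda>n::nat. exp (- a) ^ n) summable_on UNIV"
    using a by (intro summable_nonneg_imp_summable_on summable_geometric) auto
  have nat: "(\<lambda>n::nat. exp (- a * (real n)\<^sup>2)) summable_on UNIV"
  proof (rule summable_on_comparison_test[OF geo])
    fix n :: nat
    have "real n \<le> real n * real n" by (metis le_square of_nat_le_iff of_nat_mult)
    then have "a * real n \<le> a * (real n * real n)" using a by (intro mult_left_mono) auto
    then show "exp (- a * (real n)\<^sup>2) \<le> exp (- a) ^ n"
      by (simp add: power2_eq_square mult_ac flip: exp_of_nat_mult)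
  qed auto
  have 1: "(\<lambda>m::int. exp (- a * (real_of_int m)\<^sup>2)) summable_on (int ` UNIV)"
    using nat by (subst summable_on_reindex) (auto simp: o_def)
  have 2: "(\<lambda>m::int. exp (- a * (real_of_int m)\<^sup>2)) summable_on ((\<lambda>n. - int n) ` UNIV)"
    using nat by (subst summable_on_reindex) (auto simp: o_def inj_on_def)
  have "UNIV = range int \<union> range (\<lambda>n. - int n)"
    by (auto simp: image_iff) (metis int_cases2)
  with summable_on_union[OF 1 2] show ?thesis by simp
qed

lemma gaussian_shift_bound:
  fixes a m x :: real
  assumes "a > 0"
  shows "exp (- a * (m + x)\<^sup>2) \<le> exp (a * x\<^sup>2) * exp (- (a / 2) * m\<^sup>2)"
proof -
  have "m\<^sup>2 \<le> 2 * (m + x)\<^sup>2 + 2 * x\<^sup>2"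
    using zero_le_power2[of "m + 2 * x"] by (simp add: power2_eq_square algebra_simps)
  then have "(a / 2) * m\<^sup>2 \<le> (a / 2) * (2 * (m + x)\<^sup>2 + 2 * x\<^sup>2)"
    using assms by (intro mult_left_mono) auto
  then show ?thesis by (simp add: algebra_simps flip: exp_add)
qed

lemma summable_gaussian_shift_int:
  assumes a: "a > 0"
  shows "(\<lambda>m::int. exp (- a * (real_of_int m + x)\<^sup>2)) summable_on UNIV"
  by (rule summable_on_comparison_test[OF summable_on_cmult_right[OF summable_gaussian_int[of "a / 2"]]])
     (use a gaussian_shift_bound[OF a, of _ x] in auto)

lemma summable_phase:
  fixes f :: "'i \<Rightarrow> real"
  assumes "f summable_on A" "\<And>i. i \<in> A \<Longrightarrow> f i \<ge> 0"
  shows "(\<lambda>i. complex_of_real (f i) * ee (of_real (g i))) summable_on A"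
  by (rule abs_summable_summable, rule summable_on_comparison_test[OF assms(1)])
     (use assms(2) in \<open>auto simp: norm_mult\<close>)

text \<open>
  Poisson summation. As functions of \<open>v\<close>, both sides become periodic and continuous after multiplication by
  \<open>e^{2 \<pi> i v z}\<close>, and they have the same Fourier coefficients: on the left the integrals over unit intervals
  add up to the Fourier transform of a Gaussian.
\<close>
lemma theta_inversion_1d:
  fixes t v z :: real
  assumes t: "t > 0"
  shows "(\<Sum>\<^sub>\<infinity>m::int. of_real (exp (- pi * t * (of_int m + v)\<^sup>2)) * ee (of_real (of_int m * z))) =
         of_real (1 / sqrt t) * (\<Sum>\<^sub>\<infinity>k::int. of_real (exp (- pi * (of_int k + z)\<^sup>2 / t)) * ee (- of_real (v * (of_int k + z))))"
proof -
  define \<phi> where "\<phi> x = complex_of_real (exp (- pi * t * x\<^sup>2)) * ee (of_real (z * x))" for x :: real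
  define M where "M = (\<lambda>m::int. exp (pi * t) * exp (- (pi * t / 2) * (real_of_int m)\<^sup>2))"
  have Msum: "M summable_on UNIV"
    unfolding M_def using t by (intro summable_on_cmult_right summable_gaussian_int) auto
  have \<phi>M: "norm (\<phi> (of_int m + x)) \<le> M m" if "x \<in> {0..1}" for m x
  proof -
    have "x\<^sup>2 \<le> 1" using that by (simp add: power_le_one)
    then have "exp (pi * t * x\<^sup>2) \<le> exp (pi * t)" using t by simp
    then have "exp (pi * t * x\<^sup>2) * exp (- (pi * t / 2) * (real_of_int m)\<^sup>2) \<le> M m"
      unfolding M_def by (intro mult_right_mono) auto
    moreover have "norm (\<phi> (of_int m + x)) = exp (- (pi * t) * (of_int m + x)\<^sup>2)"
      unfolding \<phi>_def norm_mult norm_ee by simp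
    ultimately show ?thesis
      using gaussian_shift_bound[of "pi * t" "of_int m" x] t by simp
  qed
  define g where "g = (\<lambda>x. \<Sum>\<^sub>\<infinity>m::int. \<phi> (of_int m + x))"
  have cont\<phi>: "continuous_on S (\<lambda>x. \<phi> (f x))" if "continuous_on S f" for S :: "real set" and f
    unfolding \<phi>_def by (intro continuous_intros that)
  have ul: "uniform_limit {0..1} (\<lambda>X x. \<Sum>m\<in>X. \<phi> (of_int m + x)) g (finite_subsets_at_top UNIV)"
    unfolding g_def by (rule Weierstrass_m_test_general[OF _ Msum]) (use \<phi>M in auto)
  have contg: "continuous_on {0..1} g"
    by (rule uniform_limit_theorem[OF _ ul]) (auto intro!: always_eventually continuous_intros cont\<phi>)
  have g_per: "g 0 = g 1"
    unfolding g_def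
    by (subst infsum_reindex_bij_betw[of "\<lambda>m. m + 1" UNIV UNIV, symmetric])
       (auto simp: add_ac intro!: bij_betwI[of _ _ _ "\<lambda>m. m - 1"])
  define c where "c k = complex_of_real (exp (- pi * (of_int k + z)\<^sup>2 / t) / sqrt t)" for k :: int
  have csum: "(\<lambda>k. norm (c k)) summable_on UNIV"
  proof -
    have "(\<lambda>k::int. exp (- (pi / t) * (real_of_int k + z)\<^sup>2) * (1 / sqrt t)) summable_on UNIV"
      using t by (intro summable_on_cmult_left summable_gaussian_shift_int) auto
    moreover have "norm (c k) = exp (- (pi / t) * (real_of_int k + z)\<^sup>2) * (1 / sqrt t)" for k
      using t unfolding c_def norm_of_real by simp
    ultimately show ?thesis by simp
  qed
  define h where "h = (\<lambda>x. \<Sum>\<^sub>\<infinity>k::int. c k * ee (- (of_int k * of_real x)))"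
  have nee: "cmod (ee (- (of_int k * complex_of_real x))) = 1" for k x
    by (simp add: norm_ee)
  have ulh: "uniform_limit {0..1} (\<lambda>X x. \<Sum>k\<in>X. c k * ee (- (of_int k * of_real x))) h (finite_subsets_at_top UNIV)"
    unfolding h_def by (rule Weierstrass_m_test_general[OF _ csum]) (auto simp: norm_mult nee)
  have conth: "continuous_on {0..1} h"
    by (rule uniform_limit_theorem[OF _ ulh]) (auto intro!: always_eventually continuous_intros)
  have h_per: "h 0 = h 1" by (simp add: h_def ee_minus)
  have intee: "integral {0..1} (\<lambda>x. ee (of_int j * of_real x)) = (if j = 0 then 1 else 0)" for j :: int
  proof (cases "j = 0")
    case False
    have "((\<lambda>x. ee (of_int j * of_real x)) has_integral
        (ee (of_int j * of_real 1) / (2 * of_real pi * \<i> * of_int j) - ee (of_int j * of_real 0) / (2 * of_real pi * \<i> * of_int j))) {0..1::real}"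
      by (rule fundamental_theorem_of_calculus)
         (use False in \<open>auto simp: ee_def intro!: derivative_eq_intros has_vector_derivative_real_field\<close>)
    then show ?thesis using False by (simp add: integral_unique)
  qed simp
  \<comment> \<open>The series \<open>h\<close> converges uniformly, so it may be integrated term by term.\<close>
  have FCh: "integral {0..1} (\<lambda>x. h x * ee (of_int k * of_real x)) = c k" for k
  proof -
    have "uniform_limit {0..1} (\<lambda>X x. (\<Sum>j\<in>X. c j * ee (- (of_int j * of_real x))) * ee (of_int k * of_real x))
            (\<lambda>x. h x * ee (of_int k * of_real x)) (finite_subsets_at_top UNIV)"
      by (rule uniform_lim_mult[OF ulh uniform_limit_const])
         (auto intro!: compact_imp_bounded compact_continuous_image continuous_intros conth)
    then obtain I J where I: "\<And>X. ((\<lambda>x. (\<Sum>j\<in>X. c j * ee (- (of_int j * of_real x))) * ee (of_int k * of_real x)) has_integral I X) {0..1}"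
      and J: "((\<lambda>x. h x * ee (of_int k * of_real x)) has_integral J) {0..1}" "(I \<longlongrightarrow> J) (finite_subsets_at_top UNIV)"
      by (rule uniform_limit_integral) (auto intro!: continuous_intros)
    have IX: "I X = (\<Sum>j\<in>X. c j * (if k - j = 0 then 1 else 0))" if "finite X" for X
    proof -
      have "((\<lambda>x. \<Sum>j\<in>X. c j * ee (of_int (k - j) * of_real x)) has_integral (\<Sum>j\<in>X. c j * integral {0..1} (\<lambda>x. ee (of_int (k - j) * of_real x)))) {0..1}"
        using that by (intro has_integral_sum has_integral_mult_right integrable_integral integrable_continuous_real continuous_intros) auto
      moreover have "(\<Sum>j\<in>X. c j * ee (- (of_int j * of_real x))) * ee (of_int k * of_real x) = (\<Sum>j\<in>X. c j * ee (of_int (k - j) * of_real x))" for x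
        unfolding sum_distrib_right by (rule sum.cong[OF refl]) (simp add: ring_distribs ee_diff ee_minus field_simps)
      ultimately have "I X = (\<Sum>j\<in>X. c j * integral {0..1} (\<lambda>x. ee (of_int (k - j) * of_real x)))"
        using has_integral_unique[OF I[of X]] by presburger
      then show ?thesis unfolding intee by simp
    qed
    have "I X = c k" if "finite X" "{k} \<subseteq> X" for X
    proof -
      have "I X = (\<Sum>j\<in>X. if k = j then c k else 0)" unfolding IX[OF that(1)] by (rule sum.cong) auto
      then show ?thesis using that by simp
    qed
    then have "eventually (\<lambda>X. I X = c k) (finite_subsets_at_top UNIV)"
      unfolding eventually_finite_subsets_at_top by (intro exI[of _ "{k}"]) auto
    then have "(I \<longlongrightarrow> c k) (finite_subsets_at_top UNIV)" by (rule tendsto_eventually)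
    with J show ?thesis using tendsto_unique[OF finite_subsets_at_top_neq_bot] integral_unique by metis
  qed
  \<comment> \<open>For \<open>g\<close> the integrals over unit intervals are glued to an integral over the line.\<close>
  have FCg: "integral {0..1} (\<lambda>x. g x * ee (of_int k * of_real x)) = c k" for k
  proof -
    let ?\<psi> = "\<lambda>x. \<phi> x * ee (of_int k * of_real x)"
    have \<psi>: "?\<psi> x = of_real (exp (- pi * t * x\<^sup>2)) * ee (of_real ((of_int k + z) * x))" for x
      by (simp add: \<phi>_def ring_distribs ee_add mult_ac)
    have uni: "(?\<psi> has_integral c k) UNIV" and uni2: "integrable lborel ?\<psi>"
      unfolding \<psi> c_def using gaussian_fourier_transform[OF t, of "of_int k + z"] by simp_all
    have contpsi: "continuous_on S ?\<psi>" for S by (intro continuous_intros cont\<phi>)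
    have "uniform_limit {0..1} (\<lambda>X x. (\<Sum>m\<in>X. \<phi> (of_int m + x)) * ee (of_int k * of_real x))
            (\<lambda>x. g x * ee (of_int k * of_real x)) (finite_subsets_at_top UNIV)"
      by (rule uniform_lim_mult[OF ul uniform_limit_const])
         (auto intro!: compact_imp_bounded compact_continuous_image continuous_intros contg)
    then obtain I J where I: "\<And>X. ((\<lambda>x. (\<Sum>m\<in>X. \<phi> (of_int m + x)) * ee (of_int k * of_real x)) has_integral I X) {0..1}"
      and J: "((\<lambda>x. g x * ee (of_int k * of_real x)) has_integral J) {0..1}" "(I \<longlongrightarrow> J) (finite_subsets_at_top UNIV)"
      by (rule uniform_limit_integral) (auto intro!: continuous_intros cont\<phi>)
    define b where "b m = integral {of_int m..of_int m + 1} ?\<psi>" for m :: int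
    have b: "((\<lambda>x. \<phi> (of_int m + x) * ee (of_int k * of_real x)) has_integral b m) {0..1}" for m :: int
    proof -
      have "(?\<psi> has_integral b m) (cbox (of_int m) (of_int m + 1))"
        unfolding b_def using contpsi by (simp add: integrable_continuous_real integrable_integral)
      from has_integral_affinity[OF this, of 1 "of_int m"]
      have "((\<lambda>x. ?\<psi> (x + of_int m)) has_integral b m) ((\<lambda>x. x - real_of_int m) ` {of_int m..of_int m + 1})"
        by simp
      moreover have "(\<lambda>x. x - real_of_int m) ` {of_int m..of_int m + 1} = {0..1}"
        by (simp add: image_diff_atLeastAtMost)
      moreover have "?\<psi> (x + of_int m) = \<phi> (of_int m + x) * ee (of_int k * of_real x)" for x
        using ee_of_int[of "k * m"] by (simp add: add.commute ring_distribs ee_add)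
      ultimately show ?thesis by simp
    qed
    have IX: "I X = sum b X" if "finite X" for X
    proof -
      have "((\<lambda>x. \<Sum>m\<in>X. \<phi> (of_int m + x) * ee (of_int k * of_real x)) has_integral sum b X) {0..1}"
        using that by (intro has_integral_sum b) auto
      then show ?thesis using has_integral_unique[OF I[of X]] by (simp add: sum_distrib_right)
    qed
    have "filterlim (\<lambda>n. {- int n..<int n}) (finite_subsets_at_top UNIV) sequentially"
      unfolding filterlim_finite_subsets_at_top
    proof (intro allI impI)
      fix X :: "int set" assume "finite X \<and> X \<subseteq> UNIV"
      then have "finite X" by simp
      then obtain N where N: "\<And>x. x \<in> X \<Longrightarrow> \<bar>x\<bar> \<le> N"
        by (metis finite_imageI Max_ge imageI)
      show "\<forall>\<^sub>F n in sequentially. finite {- int n..<int n} \<and> X \<subseteq> {- int n..<int n} \<and> {- int n..<int n} \<subseteq> UNIV"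
        by (rule eventually_sequentiallyI[of "nat N + 1"]) (use N in \<open>force\<close>)
    qed
    with J(2) have lim1: "(\<lambda>n. I {- int n..<int n}) \<longlonglongrightarrow> J" by (rule filterlim_compose)
    have sumint: "(?\<psi> has_integral sum b {- int n..<int n}) {- real n..real n}" for n
    proof (induction n)
      case (Suc n)
      have bb: "(?\<psi> has_integral b m) {of_int m..of_int m + 1}" for m
        unfolding b_def using contpsi by (simp add: integrable_continuous_real integrable_integral)
      have "{- int (Suc n)..<int (Suc n)} = insert (- int n - 1) (insert (int n) {- int n..<int n})"
        by auto
      then have "sum b {- int (Suc n)..<int (Suc n)} = b (- int n - 1) + (sum b {- int n..<int n} + b (int n))"
        by simp
      moreover have "(?\<psi> has_integral (b (- int n - 1) + (sum b {- int n..<int n} + b (int n)))) {- real n - 1..real n + 1}"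
        by (rule has_integral_combine[where c="- real n"], simp, simp, use bb[of "- int n - 1"] in simp,
            rule has_integral_combine[where c="real n"], simp, simp, rule Suc, use bb[of "int n"] in simp)
      moreover have "{- real (Suc n)..real (Suc n)} = {- real n - 1..real n + 1}" by auto
      ultimately show ?case by metis
    qed (simp add: has_integral_refl)
    have "(\<lambda>n. integral {- real n..real n} ?\<psi>) \<longlonglongrightarrow> integral UNIV ?\<psi>"
    proof -
      have dc: "(\<lambda>n. integral UNIV (\<lambda>x. if x \<in> {- real n..real n} then ?\<psi> x else 0)) \<longlonglongrightarrow> integral UNIV ?\<psi>"
      proof (rule dominated_convergence(2)[where h="\<lambda>x. norm (?\<psi> x)"])
        show "(\<lambda>x. if x \<in> {- real n..real n} then ?\<psi> x else 0) integrable_on UNIV" for n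
          using contpsi by (simp only: integrable_restrict_UNIV) (simp add: integrable_continuous_real)
        show "(\<lambda>x. norm (?\<psi> x)) integrable_on UNIV"
          using uni2 integrable_on_lborel integrable_norm by blast
        show "norm (if x \<in> {- real n..real n} then ?\<psi> x else 0) \<le> norm (?\<psi> x)" for n x by auto
        fix x :: real
        obtain N where "\<bar>x\<bar> \<le> real N" using real_arch_simple by blast
        then have "\<forall>\<^sub>F n in sequentially. (if x \<in> {- real n..real n} then ?\<psi> x else 0) = ?\<psi> x"
          by (intro eventually_sequentiallyI[of N]) auto
        then show "(\<lambda>n. if x \<in> {- real n..real n} then ?\<psi> x else 0) \<longlonglongrightarrow> ?\<psi> x"
          by (rule tendsto_eventually)
      qed
      then show ?thesis by (simp only: integral_restrict_UNIV)
    qed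
    then have "(\<lambda>n. I {- int n..<int n}) \<longlonglongrightarrow> c k"
      unfolding integral_unique[OF sumint] integral_unique[OF uni] by (simp add: IX)
    with lim1 J(1) show ?thesis using LIMSEQ_unique integral_unique by metis
  qed
  have gh: "g x = h x" if "x \<in> {0..1}" for x
  proof -
    have "(\<lambda>x. g x - h x) x = 0"
    proof (rule fourier_coefficients_zero[OF _ _ _ that])
      show "continuous_on {0..1} (\<lambda>x. g x - h x)" by (intro continuous_intros contg conth)
      fix k :: int
      have "integral {0..1} (\<lambda>x. g x * ee (of_int k * of_real x) - h x * ee (of_int k * of_real x)) = 0"
        by (subst Henstock_Kurzweil_Integration.integral_diff)
           (auto simp: FCg FCh intro!: integrable_continuous_real continuous_intros contg conth)
      then show "integral {0..1} (\<lambda>x. (g x - h x) * ee (of_int k * of_real x)) = 0"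
        by (simp add: algebra_simps)
    qed (use g_per h_per in simp)
    then show ?thesis by simp
  qed
  \<comment> \<open>Equality on the unit interval extends to the line by periodicity.\<close>
  have gper: "g (frac v) = g v"
  proof -
    have "g v = (\<Sum>\<^sub>\<infinity>m::int. \<phi> (of_int (m + \<lfloor>v\<rfloor>) + frac v))"
      by (simp add: g_def frac_def)
    also have "\<dots> = g (frac v)"
      unfolding g_def
      by (rule infsum_reindex_bij_betw[of "\<lambda>m. m + \<lfloor>v\<rfloor>" UNIV UNIV]) (auto intro!: bij_betwI[of _ _ _ "\<lambda>m. m - \<lfloor>v\<rfloor>"])
    finally show ?thesis by simp
  qed
  have hper: "h (frac v) = h v"
  proof -
    have "ee (- (of_int k * of_real (frac v))) = ee (- (of_int k * of_real v))" for k
      using ee_of_int[of "k * \<lfloor>v\<rfloor>"] by (simp add: frac_def algebra_simps ee_diff ee_minus divide_inverse)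
    then show ?thesis by (simp add: h_def)
  qed
  have main: "g v = h v"
    using gh[of "frac v"] gper hper frac_ge_0 frac_lt_1 by (metis atLeastAtMost_iff less_imp_le)
  have "(\<Sum>\<^sub>\<infinity>m::int. of_real (exp (- pi * t * (of_int m + v)\<^sup>2)) * ee (of_real (of_int m * z))) = ee (- of_real (v * z)) * g v"
    unfolding g_def \<phi>_def by (subst infsum_cmult_right'[symmetric]) (simp add: ring_distribs ee_add ee_minus field_simps)
  also have "\<dots> = ee (- of_real (v * z)) * h v" by (simp add: main)
  also have "\<dots> = of_real (1 / sqrt t) * (\<Sum>\<^sub>\<infinity>k::int. of_real (exp (- pi * (of_int k + z)\<^sup>2 / t)) * ee (- of_real (v * (of_int k + z))))"
    unfolding h_def c_def by (subst (1 2) infsum_cmult_right'[symmetric]) (simp add: ring_distribs ee_diff ee_minus field_simps)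
  finally show ?thesis .
qed

section \<open>Integral spans and their duals\<close>

definition zspan :: "'a::euclidean_space set \<Rightarrow> 'a set" where
  "zspan E = {v. \<exists>c::'a \<Rightarrow> int. v = (\<Sum>b\<in>E. of_int (c b) *\<^sub>R b)}"

lemma zspanI: "v = (\<Sum>b\<in>E. of_int (c b) *\<^sub>R b) \<Longrightarrow> v \<in> zspan E"
  unfolding zspan_def by blast

definition zdual :: "'a::euclidean_space set \<Rightarrow> 'a set" where
  "zdual E = {y \<in> span E. \<forall>b\<in>E. b \<bullet> y \<in> \<int>}"

lemma zspan_subset_span: "zspan E \<subseteq> span E"
  unfolding zspan_def by clarify (intro span_sum span_scale span_base)

lemma zspan_base: "finite E \<Longrightarrow> b \<in> E \<Longrightarrow> b \<in> zspan E"
  unfolding zspan_def mem_Collect_eq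
  by (rule exI[of _ "\<lambda>b'. if b' = b then 1 else 0"])
     (simp add: if_distrib[of of_int] if_distrib[of "\<lambda>x. x *\<^sub>R _"] cong: if_cong)

lemma span_zspan: "finite E \<Longrightarrow> span (zspan E) = span E"
  by (meson span_eq span_superset subset_trans zspan_base zspan_subset_span subsetI)

lemma dual_lattice_zspan: 
  assumes "finite E" shows "dual_lattice (\<bullet>) (zspan E) = zdual E"
proof -
  have "x \<bullet> y \<in> \<int>" if "\<And>b. b \<in> E \<Longrightarrow> b \<bullet> y \<in> \<int>" "x \<in> zspan E" for x y
    using that unfolding zspan_def by (auto simp: inner_sum_left intro!: Ints_sum Ints_mult)
  then show ?thesis
    unfolding dual_lattice_def zdual_def span_zspan[OF assms] using zspan_base[OF assms] by blast
qed

section \<open>Gaussian sums\<close>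

lemma summable_on_product:
  fixes f :: "'i \<Rightarrow> real" and g :: "'j \<Rightarrow> real"
  assumes "f summable_on A" "g summable_on B" "\<And>x. x \<in> A \<Longrightarrow> f x \<ge> 0" "\<And>y. y \<in> B \<Longrightarrow> g y \<ge> 0"
  shows "(\<lambda>(x, y). f x * g y) summable_on A \<times> B"
  by (rule summable_on_SigmaI[where g="\<lambda>x. f x * infsum g B"])
     (use assms in \<open>auto intro!: has_sum_cmult_right summable_on_cmult_left\<close>)

text \<open>
  An infinite sum that does not converge has the value \<open>0\<close> by convention, whereas the product formula gives a
  positive value.
\<close>
lemma summable_gaussian_PiE:
  assumes "finite E" "a > 0"
  shows "(\<lambda>m. \<Prod>b\<in>E. exp (- a * (real_of_int (m b))\<^sup>2)) summable_on (PiE E (\<lambda>_. UNIV))"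
proof (rule ccontr)
  let ?f = "\<lambda>b m. exp (- a * (real_of_int m)\<^sup>2)"
  assume "\<not> ?thesis"
  then have 0: "infsum (\<lambda>m. \<Prod>b\<in>E. ?f b (m b)) (PiE E (\<lambda>_. UNIV)) = 0" by (rule infsum_not_exists)
  have "infsum (\<lambda>m. \<Prod>b\<in>E. ?f b (m b)) (PiE E (\<lambda>_. UNIV)) = (\<Prod>b\<in>E. infsum (?f b) UNIV)"
    by (rule infsum_prod_PiE_abs) (use assms summable_gaussian_int in auto)
  moreover have "infsum (?f b) UNIV \<ge> ?f b 0" for b
    using finite_sum_le_infsum[OF summable_gaussian_int[OF assms(2)], of "{0}"] by simp
  then have "(\<Prod>b\<in>E. infsum (?f b) UNIV) > 0"
    by (intro prod_pos) (smt (verit) exp_gt_zero)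
  ultimately show False using 0 by linarith
qed

text \<open>
  Both a lattice and its dual have this property, for a suitable finite set \<open>E\<close> of vectors, and it is all that
  the convergence of Gaussian sums and the finiteness of bounded subsets depend on.
\<close>
definition integrally_separated :: "'a::euclidean_space set \<Rightarrow> 'a set \<Rightarrow> bool" where
  "integrally_separated E A \<longleftrightarrow> finite E \<and> (\<forall>x\<in>A. \<forall>b\<in>E. x \<bullet> b \<in> \<int>) \<and>
     (\<forall>x\<in>A. \<forall>y\<in>A. (\<forall>b\<in>E. x \<bullet> b = y \<bullet> b) \<longrightarrow> x = y)"

lemma integrally_separated_inj:
  assumes "integrally_separated E A"
  shows "inj_on (\<lambda>x. \<lambda>b\<in>E. \<lfloor>x \<bullet> b\<rfloor>) A"
proof (rule inj_onI)
  fix x y assume xy: "x \<in> A" "y \<in> A" "(\<lambda>b\<in>E. \<lfloor>x \<bullet> b\<rfloor>) = (\<lambda>b\<in>E. \<lfloor>y \<bullet> b\<rfloor>)"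
  have "x \<bullet> b = y \<bullet> b" if "b \<in> E" for b
  proof -
    have "\<lfloor>x \<bullet> b\<rfloor> = \<lfloor>y \<bullet> b\<rfloor>" using fun_cong[OF xy(3), of b] that by simp
    moreover have "x \<bullet> b \<in> \<int>" "y \<bullet> b \<in> \<int>" using assms xy that unfolding integrally_separated_def by auto
    ultimately show ?thesis by (metis Ints_cases floor_of_int)
  qed
  then show "x = y" using assms xy unfolding integrally_separated_def by blast
qed

text \<open>
  The coordinates of \<open>x\<close> are bounded by a multiple of the norm of \<open>x\<close>, so the Gaussian is dominated by a
  product of Gaussians in the integral coordinates.
\<close>
lemma integrally_separated_gaussian:
  fixes A :: "'a::euclidean_space set"
  assumes sep: "integrally_separated E A" and a: "a > 0"
  shows "(\<lambda>x. exp (- a * (norm x)\<^sup>2)) summable_on A"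
proof -
  define K where "K = 1 + (\<Sum>b\<in>E. (norm b)\<^sup>2)"
  have K: "K > 0" unfolding K_def by (smt (verit) sum_nonneg zero_le_power2)
  have fin: "finite E" using sep by (simp add: integrally_separated_def)
  let ?h = "\<lambda>x. \<lambda>b\<in>E. \<lfloor>x \<bullet> b\<rfloor>"
  have "(\<lambda>m. \<Prod>b\<in>E. exp (- (a / K) * (real_of_int (m b))\<^sup>2)) summable_on (?h ` A)"
    by (rule summable_on_subset[OF summable_gaussian_PiE[OF fin, of "a / K"]]) (use a K in auto)
  then have 1: "(\<lambda>x. \<Prod>b\<in>E. exp (- (a / K) * (real_of_int (?h x b))\<^sup>2)) summable_on A"
    by (subst (asm) summable_on_reindex[OF integrally_separated_inj[OF sep]]) (simp add: o_def)
  show ?thesis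
  proof (rule summable_on_comparison_test[OF 1])
    fix x assume x: "x \<in> A"
    have i: "real_of_int (?h x b) = x \<bullet> b" if "b \<in> E" for b
      using sep x that unfolding integrally_separated_def by (auto simp: floor_of_int elim!: Ints_cases)
    have "(\<Sum>b\<in>E. (x \<bullet> b)\<^sup>2) \<le> (\<Sum>b\<in>E. (norm x)\<^sup>2 * (norm b)\<^sup>2)"
      by (intro sum_mono) (metis abs_le_square_iff Cauchy_Schwarz_ineq2 abs_mult abs_norm_cancel power_mult_distrib)
    also have "\<dots> \<le> (norm x)\<^sup>2 * K"
      unfolding K_def sum_distrib_left[symmetric] by (intro mult_left_mono) auto
    finally have "(a / K) * (\<Sum>b\<in>E. (x \<bullet> b)\<^sup>2) \<le> (a / K) * ((norm x)\<^sup>2 * K)"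
      using a K by (intro mult_left_mono) auto
    also have "\<dots> = a * (norm x)\<^sup>2" using K by simp
    finally have "exp (- a * (norm x)\<^sup>2) \<le> exp (- (a / K) * (\<Sum>b\<in>E. (x \<bullet> b)\<^sup>2))" by simp
    also have "\<dots> = (\<Prod>b\<in>E. exp (- (a / K) * (x \<bullet> b)\<^sup>2))"
      using fin by (simp add: exp_sum sum_distrib_left sum_negf[symmetric])
    also have "\<dots> = (\<Prod>b\<in>E. exp (- (a / K) * (real_of_int (?h x b))\<^sup>2))"
      by (rule prod.cong[OF refl]) (simp only: i)
    finally show "exp (- a * (norm x)\<^sup>2) \<le> (\<Prod>b\<in>E. exp (- (a / K) * (real_of_int (?h x b))\<^sup>2))" .
  qed auto
qed

lemma integrally_separated_bounded_finite:
  fixes A :: "'a::euclidean_space set"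
  assumes sep: "integrally_separated E A"
  shows "finite {x \<in> A. norm x \<le> r}"
proof -
  have fin: "finite E" using sep by (simp add: integrally_separated_def)
  define K where "K = \<lceil>\<bar>r\<bar> * (\<Sum>b\<in>E. norm b)\<rceil>"
  let ?h = "\<lambda>x. \<lambda>b\<in>E. \<lfloor>x \<bullet> b\<rfloor>"
  have "?h ` {x \<in> A. norm x \<le> r} \<subseteq> PiE E (\<lambda>_. {-K..K})"
  proof clarsimp
    fix x b assume x: "x \<in> A" "norm x \<le> r" and b: "b \<in> E"
    have "\<bar>x \<bullet> b\<bar> \<le> norm x * norm b" by (rule Cauchy_Schwarz_ineq2)
    also have "\<dots> \<le> \<bar>r\<bar> * (\<Sum>b\<in>E. norm b)"
      using x b fin by (intro mult_mono member_le_sum) auto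
    also have "\<dots> \<le> of_int K" unfolding K_def by linarith
    finally show "- K \<le> \<lfloor>x \<bullet> b\<rfloor> \<and> \<lfloor>x \<bullet> b\<rfloor> \<le> K" by linarith
  qed
  moreover have "finite (PiE E (\<lambda>_. {-K..K}))" using fin by (intro finite_PiE) auto
  ultimately have "finite (?h ` {x \<in> A. norm x \<le> r})" by (rule finite_subset)
  then show ?thesis
    by (rule finite_imageD) (rule inj_on_subset[OF integrally_separated_inj[OF sep]], auto)
qed

lemma gaussian_shift_summable:
  fixes A :: "'a::euclidean_space set"
  assumes sep: "integrally_separated E A" and a: "a > 0"
  shows "(\<lambda>x. exp (- a * (norm (x + v))\<^sup>2)) summable_on A"
proof (rule summable_on_comparison_test)
  show "(\<lambda>x. exp (a * (norm v)\<^sup>2) * exp (- (a / 2) * (norm x)\<^sup>2)) summable_on A"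
    using a by (intro summable_on_cmult_right integrally_separated_gaussian[OF sep]) auto
  fix x assume "x \<in> A"
  have "(norm x)\<^sup>2 \<le> 2 * (norm (x + v))\<^sup>2 + 2 * (norm v)\<^sup>2"
    using inner_ge_zero[of "x + 2 *\<^sub>R v"] by (simp add: power2_norm_eq_inner inner_simps algebra_simps inner_commute)
  then have "(a / 2) * (norm x)\<^sup>2 \<le> (a / 2) * (2 * (norm (x + v))\<^sup>2 + 2 * (norm v)\<^sup>2)"
    using a by (intro mult_left_mono) auto
  then show "exp (- a * (norm (x + v))\<^sup>2) \<le> exp (a * (norm v)\<^sup>2) * exp (- (a / 2) * (norm x)\<^sup>2)"
    by (simp add: algebra_simps flip: exp_add)
qed auto

section \<open>Poisson summation for Gaussians on a lattice\<close>

lemma orthogonal_span_zero: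
  fixes x :: "'a::euclidean_space"
  assumes "x \<in> span E" "\<And>b. b \<in> E \<Longrightarrow> x \<bullet> b = 0" shows "x = 0"
proof -
  have "orthogonal x x"
    by (rule orthogonal_to_span[OF assms(1)]) (use assms(2) in \<open>simp add: orthogonal_def\<close>)
  then show ?thesis by (simp add: orthogonal_def)
qed

lemma zdual_separated:
  assumes "finite E" shows "integrally_separated E (zdual E)"
  unfolding integrally_separated_def
proof (intro conjI ballI impI)
  fix x y assume xy: "x \<in> zdual E" "y \<in> zdual E" "\<forall>b\<in>E. x \<bullet> b = y \<bullet> b"
  have "x - y = 0"
    by (rule orthogonal_span_zero[of _ E]) (use xy in \<open>auto simp: zdual_def span_diff inner_diff_left\<close>)
  then show "x = y" by simp
qed (use assms in \<open>auto simp: zdual_def inner_commute\<close>)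

text \<open>
  Each \<open>e b\<close> is a multiple of the component of \<open>b\<close> orthogonal to the other elements of \<open>E\<close>.
\<close>
lemma dual_basis:
  fixes E :: "'a::euclidean_space set"
  assumes "independent E"
  obtains e where "\<And>b b'. b \<in> E \<Longrightarrow> b' \<in> E \<Longrightarrow> b' \<bullet> e b = (if b' = b then 1 else 0)"
proof -
  have "\<exists>w. \<forall>b'\<in>E. b' \<bullet> w = (if b' = b then 1 else 0)" if b: "b \<in> E" for b
  proof -
    obtain p q where pq: "p \<in> span (E - {b})" "\<And>w. w \<in> span (E - {b}) \<Longrightarrow> orthogonal q w" "b = p + q"
      using orthogonal_subspace_decomp_exists by blast
    have "q \<noteq> 0" using pq b assms unfolding dependent_def by auto
    have "p \<bullet> q = 0" using pq(2)[OF pq(1)] by (simp add: orthogonal_def inner_commute)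
    then have bq: "b \<bullet> q = q \<bullet> q" using pq by (simp add: inner_simps)
    have "b' \<bullet> q = 0" if "b' \<in> E" "b' \<noteq> b" for b'
      using pq(2)[of b'] that by (simp add: span_base orthogonal_def inner_commute)
    then show ?thesis
      using bq \<open>q \<noteq> 0\<close> by (intro exI[of _ "(1 / (q \<bullet> q)) *\<^sub>R q"]) auto
  qed
  then show ?thesis using that by metis
qed

lemma zspan_separated:
  assumes "finite E" "independent E"
  obtains E' where "integrally_separated E' (zspan E)"
proof -
  obtain e where e: "\<And>b b'. b \<in> E \<Longrightarrow> b' \<in> E \<Longrightarrow> b' \<bullet> e b = (if b' = b then 1 else 0)"
    using dual_basis[OF assms(2)] by blast
  have coord: "(\<Sum>b'\<in>E. of_int (c b') *\<^sub>R b') \<bullet> e b = of_int (c b)" if "b \<in> E" for c b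
    using that assms(1) by (simp add: inner_sum_left e if_distrib[of "\<lambda>x. _ * x"] cong: if_cong)
  have "integrally_separated (e ` E) (zspan E)"
    unfolding integrally_separated_def
  proof (intro conjI ballI impI)
    fix x y assume x: "x \<in> zspan E" and y: "y \<in> zspan E" and eq: "\<forall>b\<in>e ` E. x \<bullet> b = y \<bullet> b"
    obtain c where c: "x = (\<Sum>b\<in>E. of_int (c b) *\<^sub>R b)" using x unfolding zspan_def by blast
    obtain d where d: "y = (\<Sum>b\<in>E. of_int (d b) *\<^sub>R b)" using y unfolding zspan_def by blast
    have "c b = d b" if "b \<in> E" for b using eq coord[OF that] that unfolding c d by (metis imageI of_int_eq_iff)
    then show "x = y" unfolding c d by simp
  next
    fix x b assume "x \<in> zspan E" "b \<in> e ` E"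
    then show "x \<bullet> b \<in> \<int>" unfolding zspan_def using coord by auto
  qed (use assms in auto)
  then show ?thesis by (rule that)
qed

lemma zspan_insert_bij:
  fixes b :: "'a::euclidean_space"
  assumes "finite F" "b \<notin> span F"
  shows "bij_betw (\<lambda>(m::int, x). x + of_int m *\<^sub>R b) (UNIV \<times> zspan F) (zspan (insert b F))"
proof (rule bij_betw_imageI)
  have bF: "b \<notin> F" using assms span_base by blast
  show "inj_on (\<lambda>(m::int, x). x + of_int m *\<^sub>R b) (UNIV \<times> zspan F)"
  proof (rule inj_onI, clarsimp)
    fix m n :: int and x y
    assume x: "x \<in> zspan F" "y \<in> zspan F" and eq: "x + of_int m *\<^sub>R b = y + of_int n *\<^sub>R b"
    have "(of_int m - of_int n) *\<^sub>R b = y - x" using eq by (simp add: algebra_simps)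
    moreover have "y - x \<in> span F" using x zspan_subset_span span_diff by blast
    ultimately have "(of_int m - of_int n) *\<^sub>R b \<in> span F" by simp
    then have "(1 / (of_int m - of_int n)) *\<^sub>R ((of_int m - of_int n) *\<^sub>R b) \<in> span F"
      by (rule span_scale)
    then have "of_int m - of_int n = (0::real)" using assms(2) by (cases "of_int m - of_int n = (0::real)") auto
    then show "m = n \<and> x = y" using eq by simp
  qed
  show "(\<lambda>(m::int, x). x + of_int m *\<^sub>R b) ` (UNIV \<times> zspan F) = zspan (insert b F)"
  proof (intro equalityI subsetI)
    fix w assume "w \<in> (\<lambda>(m::int, x). x + of_int m *\<^sub>R b) ` (UNIV \<times> zspan F)"
    then obtain m c where "w = (\<Sum>b\<in>F. of_int (c b) *\<^sub>R b) + of_int m *\<^sub>R b" unfolding zspan_def by auto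
    then have "w = (\<Sum>b'\<in>insert b F. of_int ((c(b := m)) b') *\<^sub>R b')"
      using assms(1) bF by (simp add: add.commute cong: sum.cong) (rule sum.cong, auto)
    then show "w \<in> zspan (insert b F)" unfolding zspan_def by blast
  next
    fix w assume "w \<in> zspan (insert b F)"
    then obtain c where "w = (\<Sum>b\<in>insert b F. of_int (c b) *\<^sub>R b)" unfolding zspan_def by blast
    then have "w = (\<lambda>(m::int, x). x + of_int m *\<^sub>R b) (c b, \<Sum>b\<in>F. of_int (c b) *\<^sub>R b)"
      using assms(1) bF by (simp add: add.commute)
    moreover have "(\<Sum>b\<in>F. of_int (c b) *\<^sub>R b) \<in> zspan F" unfolding zspan_def by blast
    ultimately show "w \<in> (\<lambda>(m::int, x). x + of_int m *\<^sub>R b) ` (UNIV \<times> zspan F)" by blast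
  qed
qed

lemma span_insert_orthogonal:
  fixes b :: "'a::euclidean_space"
  assumes "w \<in> span (insert b F)" "p \<in> span F" "b = p + q"
  obtains w0 s where "w0 \<in> span F" "w = w0 + s *\<^sub>R q"
proof -
  obtain k where "w - k *\<^sub>R b \<in> span F" using assms(1) span_breakdown_eq by blast
  then have "w - k *\<^sub>R b + k *\<^sub>R p \<in> span F" using assms(2) by (intro span_add span_scale)
  moreover have "w = (w - k *\<^sub>R b + k *\<^sub>R p) + k *\<^sub>R q" using assms(3) by (simp add: algebra_simps)
  ultimately show ?thesis using that by blast
qed

text \<open>
  Dual vectors for \<open>F \<union> {b}\<close> restrict to dual vectors for \<open>F\<close>; the fibre of this restriction is parametrised by
  the integer \<open>k\<close>, the pairing with \<open>b\<close>, which fixes the component along the part \<open>q\<close> of \<open>b\<close> orthogonal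
  to \<open>F\<close>.
\<close>
lemma zdual_insert_bij:
  fixes b :: "'a::euclidean_space"
  assumes F: "finite F" and b: "b = p + q" and p: "p \<in> span F" and q: "\<And>w. w \<in> span F \<Longrightarrow> w \<bullet> q = 0" and q0: "q \<noteq> 0"
  shows "bij_betw (\<lambda>(y, k::int). y + ((of_int k - p \<bullet> y) / (q \<bullet> q)) *\<^sub>R q) (zdual F \<times> UNIV) (zdual (insert b F))"
proof (rule bij_betw_imageI)
  have qq: "q \<bullet> q \<noteq> 0" using q0 by simp
  have qw: "q \<bullet> w = 0" if "w \<in> span F" for w using q[OF that] by (simp add: inner_commute)
  have pq: "p \<bullet> q = 0" using q p by blast
  let ?f = "\<lambda>(y, k::int). y + ((of_int k - p \<bullet> y) / (q \<bullet> q)) *\<^sub>R q"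
  show "inj_on ?f (zdual F \<times> UNIV)"
  proof (rule inj_onI, clarsimp)
    fix y y' and k k' :: int
    assume y: "y \<in> zdual F" "y' \<in> zdual F"
      and eq: "y + ((of_int k - p \<bullet> y) / (q \<bullet> q)) *\<^sub>R q = y' + ((of_int k' - p \<bullet> y') / (q \<bullet> q)) *\<^sub>R q"
    have sp: "y \<in> span F" "y' \<in> span F" using y by (auto simp: zdual_def)
    have "(y + ((of_int k - p \<bullet> y) / (q \<bullet> q)) *\<^sub>R q) \<bullet> q = (y' + ((of_int k' - p \<bullet> y') / (q \<bullet> q)) *\<^sub>R q) \<bullet> q"
      by (simp only: eq)
    then have e: "of_int k - p \<bullet> y = of_int k' - p \<bullet> y'" using qq sp q by (simp add: inner_add_left)
    then have "y = y'" using eq by simp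
    then show "y = y' \<and> k = k'" using e by simp
  qed
  show "?f ` (zdual F \<times> UNIV) = zdual (insert b F)"
  proof (intro equalityI subsetI)
    fix w assume "w \<in> ?f ` (zdual F \<times> UNIV)"
    then obtain y k where y: "y \<in> zdual F" and w: "w = y + ((of_int k - p \<bullet> y) / (q \<bullet> q)) *\<^sub>R q" by auto
    have sy: "y \<in> span F" using y by (simp add: zdual_def)
    have qs: "q \<in> span (insert b F)"
    proof -
      have "q = b - p" using b by simp
      then show ?thesis using p by (metis insertI1 span_base span_diff span_mono subset_insertI subsetD)
    qed
    have "w \<in> span (insert b F)"
      unfolding w using sy qs by (intro span_add span_scale) (auto intro: subsetD[OF span_mono])
    moreover have "b \<bullet> w = of_int k"
      unfolding w b using qq pq qw[OF sy] by (simp add: inner_simps)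
    moreover have "b' \<bullet> w \<in> \<int>" if "b' \<in> F" for b'
      unfolding w using y that q[OF span_base[OF that]] by (simp add: inner_simps zdual_def)
    ultimately show "w \<in> zdual (insert b F)" by (simp add: zdual_def)
  next
    fix w assume w: "w \<in> zdual (insert b F)"
    then obtain y s where y: "y \<in> span F" and ws: "w = y + s *\<^sub>R q"
      using span_insert_orthogonal[OF _ p b, of w] unfolding zdual_def by blast
    obtain k where k: "b \<bullet> w = of_int k" using w unfolding zdual_def by (auto elim: Ints_cases)
    have "b \<bullet> w = p \<bullet> y + s * (q \<bullet> q)" unfolding ws b using pq qw[OF y] by (simp add: inner_simps)
    then have "s = (of_int k - p \<bullet> y) / (q \<bullet> q)" using k qq by (simp add: field_simps)
    moreover have "y \<in> zdual F"
    proof -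
      have "b' \<bullet> y = b' \<bullet> w" if "b' \<in> F" for b' unfolding ws using q[OF span_base[OF that]] by (simp add: inner_simps)
      then show ?thesis using w y by (simp add: zdual_def)
    qed
    ultimately show "w \<in> ?f ` (zdual F \<times> UNIV)" using ws by force
  qed
qed

text \<open>
  Induction on the rank. Write the new basis vector as \<open>b = p + q\<close> with \<open>p\<close> in the span of the old ones and \<open>q\<close>
  orthogonal to it. The Gaussian then splits; the induction hypothesis applies to the sum over the old lattice,
  shifted by a multiple of \<open>p\<close>, and the remaining sum over multiples of \<open>b\<close> is one-dimensional. The constant
  is the inverse of the covolume; its value is not tracked here because it is later determined by applying
  inversion twice.
\<close>
theorem poisson_gaussian_lattice:
  fixes E :: "'a::euclidean_space set"
  assumes "finite E" "independent E"
  shows "\<exists>C>0. \<forall>t>0. \<forall>v\<in>span E. \<forall>z\<in>span E.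
    (\<Sum>\<^sub>\<infinity>x\<in>zspan E. complex_of_real (exp (- pi * t * (norm (x + v))\<^sup>2)) * ee (of_real (x \<bullet> z))) =
    of_real (C * (1 / sqrt t) ^ card E) *
      (\<Sum>\<^sub>\<infinity>y\<in>zdual E. complex_of_real (exp (- pi * (norm (y + z))\<^sup>2 / t)) * ee (- of_real (v \<bullet> (y + z))))"
  using assms
proof (induction E)
  case empty
  have "zspan {} = {0::'a}" "zdual {} = {0::'a}" by (auto simp: zspan_def zdual_def)
  then show ?case by (intro exI[of _ 1]) simp
next
  case (insert b F)
  have indF: "independent F" using insert.prems independent_mono by blast
  obtain C0 where C0: "C0 > 0" and IH: "\<And>t v z. t > 0 \<Longrightarrow> v \<in> span F \<Longrightarrow> z \<in> span F \<Longrightarrow>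
    (\<Sum>\<^sub>\<infinity>x\<in>zspan F. complex_of_real (exp (- pi * t * (norm (x + v))\<^sup>2)) * ee (of_real (x \<bullet> z))) =
    of_real (C0 * (1 / sqrt t) ^ card F) *
      (\<Sum>\<^sub>\<infinity>y\<in>zdual F. complex_of_real (exp (- pi * (norm (y + z))\<^sup>2 / t)) * ee (- of_real (v \<bullet> (y + z))))"
    using insert.IH[OF indF] by blast
  have bF: "b \<notin> span F" using insert.prems insert.hyps(2) independent_insert by metis
  obtain p q where p: "p \<in> span F" and orth: "\<And>w. w \<in> span F \<Longrightarrow> orthogonal q w" and b: "b = p + q"
    using orthogonal_subspace_decomp_exists by blast
  have q: "w \<bullet> q = 0" "q \<bullet> w = 0" if "w \<in> span F" for w
    using orth[OF that] by (simp_all add: orthogonal_def inner_commute[of w])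
  have q0: "q \<noteq> 0" using bF b p by auto
  \<comment> \<open>The Gram determinant is multiplied by \<open>\<beta>\<close> when \<open>b\<close> is added, and the constant by its inverse square root.\<close>
  define \<beta> where "\<beta> = q \<bullet> q"
  have \<beta>: "\<beta> > 0" using q0 by (simp add: \<beta>_def)
  have finE: "finite (insert b F)" using insert.hyps by simp
  obtain E1 where sepE: "integrally_separated E1 (zspan (insert b F))"
    using zspan_separated[OF finE insert.prems] by blast
  have sepE': "integrally_separated (insert b F) (zdual (insert b F))" using zdual_separated[OF finE] .
  have sepF': "integrally_separated F (zdual F)" using zdual_separated[OF insert.hyps(1)] .
  have "(\<Sum>\<^sub>\<infinity>x\<in>zspan (insert b F). complex_of_real (exp (- pi * t * (norm (x + v))\<^sup>2)) * ee (of_real (x \<bullet> z))) =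
    of_real ((C0 / sqrt \<beta>) * (1 / sqrt t) ^ card (insert b F)) *
      (\<Sum>\<^sub>\<infinity>y\<in>zdual (insert b F). complex_of_real (exp (- pi * (norm (y + z))\<^sup>2 / t)) * ee (- of_real (v \<bullet> (y + z))))"
    (is "?lhs = _ * ?rhs")
    if t: "t > 0" and v: "v \<in> span (insert b F)" and z: "z \<in> span (insert b F)" for t v z
  proof -
    obtain v0 \<nu> where v0: "v0 \<in> span F" and v: "v = v0 + \<nu> *\<^sub>R q" using span_insert_orthogonal[OF v p b] .
    obtain z0 \<omega> where z0: "z0 \<in> span F" and z: "z = z0 + \<omega> *\<^sub>R q" using span_insert_orthogonal[OF z p b] .
    define W where "W m = complex_of_real (exp (- pi * (t * \<beta>) * (of_int m + \<nu>)\<^sup>2)) * ee (of_real (of_int m * (p \<bullet> z0 + \<omega> * \<beta>)))" for m :: int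
    define K0 where "K0 = complex_of_real (C0 * (1 / sqrt t) ^ card F)"
    define G where "G x = complex_of_real (exp (- pi * t * (norm (x + v))\<^sup>2)) * ee (of_real (x \<bullet> z))" for x
    have G: "G (x0 + of_int m *\<^sub>R b) = complex_of_real (exp (- pi * t * (norm (x0 + (of_int m *\<^sub>R p + v0)))\<^sup>2)) * ee (of_real (x0 \<bullet> z0)) * W m"
      if "x0 \<in> zspan F" for m :: int and x0
    proof -
      have x0: "x0 \<in> span F" using that zspan_subset_span by blast
      have 1: "(norm (x0 + of_int m *\<^sub>R b + v))\<^sup>2 = (norm (x0 + (of_int m *\<^sub>R p + v0)))\<^sup>2 + \<beta> * (of_int m + \<nu>)\<^sup>2"
        using q[OF x0] q[OF p] q[OF v0] unfolding b v power2_norm_eq_inner \<beta>_def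
        by (simp add: inner_simps algebra_simps power2_eq_square)
      have 2: "(x0 + of_int m *\<^sub>R b) \<bullet> z = x0 \<bullet> z0 + of_int m * (p \<bullet> z0 + \<omega> * \<beta>)"
        using q[OF x0] q[OF p] q[OF z0] unfolding b z \<beta>_def by (simp add: inner_simps algebra_simps)
      have 3: "- pi * t * (norm (x0 + of_int m *\<^sub>R b + v))\<^sup>2 =
          - pi * t * (norm (x0 + (of_int m *\<^sub>R p + v0)))\<^sup>2 + - pi * (t * \<beta>) * (of_int m + \<nu>)\<^sup>2"
        unfolding 1 by (simp add: algebra_simps)
      show ?thesis unfolding G_def W_def 2 3 of_real_add by (simp only: exp_add ee_add of_real_add of_real_mult mult_ac)
    qed
    have Gsum: "G summable_on zspan (insert b F)"
      unfolding G_def using t gaussian_shift_summable[OF sepE, of "pi * t" v] by (intro summable_phase) auto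
    have bij1: "bij_betw (\<lambda>(m::int, x). x + of_int m *\<^sub>R b) (UNIV \<times> zspan F) (zspan (insert b F))"
      using zspan_insert_bij[OF insert.hyps(1) bF] .
    have Gsum': "(\<lambda>(m::int, x). G (x + of_int m *\<^sub>R b)) summable_on (UNIV \<times> zspan F)"
      using Gsum summable_on_reindex_bij_betw[OF bij1, of G] by (simp add: case_prod_unfold)
    define H where "H m y = complex_of_real (exp (- pi * (norm (y + z0))\<^sup>2 / t)) * ee (- of_real ((of_int m *\<^sub>R p + v0) \<bullet> (y + z0))) * W m" for m :: int and y
    have Hsum: "(\<lambda>(m, y). H m y) summable_on (UNIV \<times> zdual F)"
    proof -
      have "(\<lambda>(m::int, y). exp (- (pi * (t * \<beta>)) * (of_int m + \<nu>)\<^sup>2) * exp (- (pi / t) * (norm (y + z0))\<^sup>2)) summable_on (UNIV \<times> zdual F)"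
        using t \<beta> by (intro summable_on_product summable_gaussian_shift_int gaussian_shift_summable[OF sepF']) auto
      moreover have "norm (H m y) = exp (- (pi * (t * \<beta>)) * (of_int m + \<nu>)\<^sup>2) * exp (- (pi / t) * (norm (y + z0))\<^sup>2)" for m y
      proof -
        have 1: "norm (complex_of_real (exp r) * ee (of_real s)) = exp r" "norm (complex_of_real (exp r) * ee (- of_real s)) = exp r" for r s
          by (simp_all add: norm_mult norm_ee)
        have 2: "- pi * (norm (y + z0))\<^sup>2 / t = - (pi / t) * (norm (y + z0))\<^sup>2"
          "- pi * (t * \<beta>) * (of_int m + \<nu>)\<^sup>2 = - (pi * (t * \<beta>)) * (of_int m + \<nu>)\<^sup>2" by simp_all
        show ?thesis
          unfolding H_def W_def norm_mult[of "_ * _" "_ * _"] 1 2 by (rule mult.commute)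
      qed
      ultimately show ?thesis by - (rule abs_summable_summable, simp only: case_prod_unfold)
    qed
    define RT where "RT y = complex_of_real (exp (- pi * (norm (y + z))\<^sup>2 / t)) * ee (- of_real (v \<bullet> (y + z)))" for y
    have bij2: "bij_betw (\<lambda>(y, k::int). y + ((of_int k - p \<bullet> y) / (q \<bullet> q)) *\<^sub>R q) (zdual F \<times> UNIV) (zdual (insert b F))"
      using zdual_insert_bij[OF insert.hyps(1) b p q(1) q0] .
    have RTsum: "RT summable_on zdual (insert b F)"
    proof -
      have "RT = (\<lambda>y. complex_of_real (exp (- (pi / t) * (norm (y + z))\<^sup>2)) * ee (of_real (- (v \<bullet> (y + z)))))"
        by (rule ext) (simp add: RT_def)
      then show ?thesis
        using t gaussian_shift_summable[OF sepE', of "pi / t" z] by (simp only:) (intro summable_phase, auto)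
    qed
    have RTsum': "(\<lambda>(y, k::int). RT (y + ((of_int k - p \<bullet> y) / (q \<bullet> q)) *\<^sub>R q)) summable_on (zdual F \<times> UNIV)"
      using RTsum summable_on_reindex_bij_betw[OF bij2, of RT] by (simp add: case_prod_unfold)
    have RT: "RT (y + ((of_int k - p \<bullet> y) / (q \<bullet> q)) *\<^sub>R q) =
       complex_of_real (exp (- pi * (norm (y + z0))\<^sup>2 / t)) * ee (- of_real (v0 \<bullet> (y + z0))) *
       (complex_of_real (exp (- pi * (of_int k + (\<omega> * \<beta> - p \<bullet> y))\<^sup>2 / (t * \<beta>))) * ee (- of_real (\<nu> * (of_int k + (\<omega> * \<beta> - p \<bullet> y)))))"
      if "y \<in> zdual F" for y and k :: int
    proof -
      have y: "y \<in> span F" using that by (simp add: zdual_def)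
      define s where "s = (of_int k - p \<bullet> y) / (q \<bullet> q)"
      have s: "s * \<beta> + \<omega> * \<beta> = of_int k + (\<omega> * \<beta> - p \<bullet> y)" using \<beta> by (simp add: s_def \<beta>_def)
      have "(norm (y + s *\<^sub>R q + z))\<^sup>2 = (norm (y + z0))\<^sup>2 + (s * \<beta> + \<omega> * \<beta>)\<^sup>2 / \<beta>"
        using q[OF y] q[OF z0] \<beta> unfolding z power2_norm_eq_inner \<beta>_def
        by (simp add: inner_simps algebra_simps power2_eq_square add_divide_distrib)
      then have 1: "- pi * (norm (y + s *\<^sub>R q + z))\<^sup>2 / t = - pi * (norm (y + z0))\<^sup>2 / t + - pi * (of_int k + (\<omega> * \<beta> - p \<bullet> y))\<^sup>2 / (t * \<beta>)"
        unfolding s using t \<beta> by (simp add: field_simps)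
      have "v \<bullet> (y + s *\<^sub>R q + z) = v0 \<bullet> (y + z0) + \<nu> * (s * \<beta> + \<omega> * \<beta>)"
        using q[OF y] q[OF z0] q[OF v0] unfolding z v \<beta>_def by (simp add: inner_simps algebra_simps)
      then have 2: "- complex_of_real (v \<bullet> (y + s *\<^sub>R q + z)) = - of_real (v0 \<bullet> (y + z0)) + - of_real (\<nu> * (of_int k + (\<omega> * \<beta> - p \<bullet> y)))"
        unfolding s by simp
      show ?thesis unfolding s_def[symmetric] RT_def 1 2 by (simp only: exp_add ee_add of_real_mult mult_ac)
    qed
    have "?lhs = infsum G (zspan (insert b F))" by (rule infsum_cong) (simp only: G_def)
    also have "\<dots> = (\<Sum>\<^sub>\<infinity>(m::int, x)\<in>UNIV \<times> zspan F. G (x + of_int m *\<^sub>R b))"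
      using infsum_reindex_bij_betw[OF bij1, of G] by (simp add: case_prod_unfold)
    also have "\<dots> = (\<Sum>\<^sub>\<infinity>m::int. \<Sum>\<^sub>\<infinity>x\<in>zspan F. G (x + of_int m *\<^sub>R b))"
      using infsum_Sigma'_banach[OF Gsum'] by simp
    also have "\<dots> = (\<Sum>\<^sub>\<infinity>m::int. (\<Sum>\<^sub>\<infinity>x\<in>zspan F. complex_of_real (exp (- pi * t * (norm (x + (of_int m *\<^sub>R p + v0)))\<^sup>2)) * ee (of_real (x \<bullet> z0))) * W m)"
      by (subst infsum_cmult_left'[symmetric]) (intro infsum_cong, simp only: G)
    also have "\<dots> = (\<Sum>\<^sub>\<infinity>m::int. K0 * (\<Sum>\<^sub>\<infinity>y\<in>zdual F. H m y))"
    proof (rule infsum_cong)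
      fix m :: int
      have "of_int m *\<^sub>R p + v0 \<in> span F" using v0 p by (intro span_add span_scale)
      note IH[OF t this z0, folded K0_def]
      moreover have "(\<Sum>\<^sub>\<infinity>y\<in>zdual F. H m y) = (\<Sum>\<^sub>\<infinity>y\<in>zdual F. complex_of_real (exp (- pi * (norm (y + z0))\<^sup>2 / t)) * ee (- of_real ((of_int m *\<^sub>R p + v0) \<bullet> (y + z0)))) * W m"
        unfolding H_def by (rule infsum_cmult_left')
      ultimately show "(\<Sum>\<^sub>\<infinity>x\<in>zspan F. complex_of_real (exp (- pi * t * (norm (x + (of_int m *\<^sub>R p + v0)))\<^sup>2)) * ee (of_real (x \<bullet> z0))) * W m
          = K0 * (\<Sum>\<^sub>\<infinity>y\<in>zdual F. H m y)" by (simp only: mult.assoc)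
    qed
    also have "\<dots> = K0 * (\<Sum>\<^sub>\<infinity>m::int. \<Sum>\<^sub>\<infinity>y\<in>zdual F. H m y)" by (rule infsum_cmult_right')
    also have "(\<Sum>\<^sub>\<infinity>m::int. \<Sum>\<^sub>\<infinity>y\<in>zdual F. H m y) = (\<Sum>\<^sub>\<infinity>y\<in>zdual F. \<Sum>\<^sub>\<infinity>m::int. H m y)"
      by (rule infsum_swap_banach[OF Hsum])
    also have "\<dots> = (\<Sum>\<^sub>\<infinity>y\<in>zdual F. of_real (1 / sqrt (t * \<beta>)) * (\<Sum>\<^sub>\<infinity>k::int. RT (y + ((of_int k - p \<bullet> y) / (q \<bullet> q)) *\<^sub>R q)))"
    proof (rule infsum_cong)
      fix y assume y: "y \<in> zdual F"
      define c where "c = complex_of_real (exp (- pi * (norm (y + z0))\<^sup>2 / t)) * ee (- of_real (v0 \<bullet> (y + z0)))"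
      have "H m y = c * (of_real (exp (- pi * (t * \<beta>) * (of_int m + \<nu>)\<^sup>2)) * ee (of_real (of_int m * (\<omega> * \<beta> - p \<bullet> y))))" for m :: int
      proof -
        have "- complex_of_real ((of_int m *\<^sub>R p + v0) \<bullet> (y + z0)) + of_real (of_int m * (p \<bullet> z0 + \<omega> * \<beta>)) =
           - of_real (v0 \<bullet> (y + z0)) + of_real (of_int m * (\<omega> * \<beta> - p \<bullet> y))"
          unfolding of_real_add[symmetric] of_real_minus[symmetric] by (simp add: inner_simps algebra_simps)
        then have "ee (- complex_of_real ((of_int m *\<^sub>R p + v0) \<bullet> (y + z0))) * ee (of_real (of_int m * (p \<bullet> z0 + \<omega> * \<beta>))) =
           ee (- of_real (v0 \<bullet> (y + z0))) * ee (of_real (of_int m * (\<omega> * \<beta> - p \<bullet> y)))"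
          unfolding ee_add[symmetric] by (rule arg_cong)
        moreover have "x * a * (g * b') = x * c * (g * d)" if "a * b' = c * d" for x a g b' c d :: complex
        proof -
          have "x * a * (g * b') = x * g * (a * b')" by (simp add: mult_ac)
          also have "\<dots> = x * c * (g * d)" unfolding that by (simp add: mult_ac)
          finally show ?thesis .
        qed
        ultimately show ?thesis unfolding H_def W_def c_def by blast
      qed
      then have "(\<Sum>\<^sub>\<infinity>m::int. H m y) = c * (\<Sum>\<^sub>\<infinity>m::int. (of_real (exp (- pi * (t * \<beta>) * (of_int m + \<nu>)\<^sup>2)) * ee (of_real (of_int m * (\<omega> * \<beta> - p \<bullet> y)))))"
        by (simp only: infsum_cmult_right')
      also have "\<dots> = c * (of_real (1 / sqrt (t * \<beta>)) * (\<Sum>\<^sub>\<infinity>k::int. of_real (exp (- pi * (of_int k + (\<omega> * \<beta> - p \<bullet> y))\<^sup>2 / (t * \<beta>))) * ee (- of_real (\<nu> * (of_int k + (\<omega> * \<beta> - p \<bullet> y))))))"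
        using t \<beta> by (subst theta_inversion_1d) simp_all
      also have "\<dots> = of_real (1 / sqrt (t * \<beta>)) * (\<Sum>\<^sub>\<infinity>k::int. RT (y + ((of_int k - p \<bullet> y) / (q \<bullet> q)) *\<^sub>R q))"
        unfolding RT[OF y] c_def[symmetric] by (simp only: infsum_cmult_right' mult_ac)
      finally show "(\<Sum>\<^sub>\<infinity>m::int. H m y) = of_real (1 / sqrt (t * \<beta>)) * (\<Sum>\<^sub>\<infinity>k::int. RT (y + ((of_int k - p \<bullet> y) / (q \<bullet> q)) *\<^sub>R q))" .
    qed
    also have "\<dots> = of_real (1 / sqrt (t * \<beta>)) * (\<Sum>\<^sub>\<infinity>y\<in>zdual F. \<Sum>\<^sub>\<infinity>k::int. RT (y + ((of_int k - p \<bullet> y) / (q \<bullet> q)) *\<^sub>R q))"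
      by (rule infsum_cmult_right')
    also have "(\<Sum>\<^sub>\<infinity>y\<in>zdual F. \<Sum>\<^sub>\<infinity>k::int. RT (y + ((of_int k - p \<bullet> y) / (q \<bullet> q)) *\<^sub>R q)) = infsum RT (zdual (insert b F))"
      using infsum_Sigma'_banach[OF RTsum'] infsum_reindex_bij_betw[OF bij2, of RT] by (simp add: case_prod_unfold)
    also have "infsum RT (zdual (insert b F)) = ?rhs" by (rule infsum_cong) (simp only: RT_def)
    also have "K0 * (of_real (1 / sqrt (t * \<beta>)) * ?rhs) = of_real ((C0 / sqrt \<beta>) * (1 / sqrt t) ^ card (insert b F)) * ?rhs"
      using insert.hyps by (simp add: K0_def real_sqrt_mult field_simps)
    finally show ?thesis .
  qed
  moreover have "C0 / sqrt \<beta> > 0" using C0 \<beta> by simp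
  ultimately show ?case by blast
qed

section \<open>Uniqueness of absolutely convergent Fourier expansions\<close>

lemma has_sum_finite_sum:
  fixes f :: "'s \<Rightarrow> 'i \<Rightarrow> 'b::{topological_comm_monoid_add}"
  assumes "finite S" "\<And>s. s \<in> S \<Longrightarrow> (f s has_sum c s) A"
  shows "((\<lambda>i. \<Sum>s\<in>S. f s i) has_sum (\<Sum>s\<in>S. c s)) A"
  using assms by (induction S) (auto intro: has_sum_add)

text \<open>
  The powers of \<open>\<omega>\<close> have bounded partial sums.
\<close>
lemma unimodular_mean_small:
  fixes \<omega> :: complex
  assumes "norm \<omega> = 1" "\<omega> \<noteq> 1" "\<delta> > 0"
  obtains K :: nat where "K > 0" "norm ((\<Sum>s<K. \<omega> ^ s) / of_nat K) \<le> \<delta>"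
proof -
  define c where "c = 2 / norm (\<omega> - 1)"
  have c: "c > 0" using assms by (simp add: c_def)
  obtain K :: nat where K: "c / \<delta> < of_nat K" using reals_Archimedean2 by blast
  have "K > 0" using K c assms(3) by (metis divide_pos_pos gr0I less_asym of_nat_0)
  have "norm (\<Sum>s<K. \<omega> ^ s) = norm (\<omega> ^ K - 1) / norm (\<omega> - 1)"
    using assms by (simp add: geometric_sum norm_divide)
  also have "\<dots> \<le> c" unfolding c_def
    using norm_triangle_ineq4[of "\<omega> ^ K" 1] assms by (intro divide_right_mono) (auto simp: norm_power)
  finally have "norm (\<Sum>s<K. \<omega> ^ s) / real K \<le> c / real K" by (rule divide_right_mono) simp
  also have "c / real K \<le> \<delta>" using K \<open>K > 0\<close> assms(3) by (simp add: field_simps)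
  finally show ?thesis using that[OF \<open>K > 0\<close>] by (simp add: norm_divide)
qed

text \<open>
  The frequencies \<open>l\<close> need not be discrete, so integration over a period is not available. Instead, averaging
  the identity over translates by multiples of a vector \<open>x0\<close>, with phases that fix the frequency \<open>l0\<close>, multiplies
  the coefficient of \<open>l\<close> by a mean of powers of a number of modulus one. Choosing \<open>x0\<close> along \<open>j - l0\<close> makes the
  coefficient of \<open>j\<close> as small as desired, without enlarging any other one. After finitely many such steps all of
  an absolutely convergent series except the term of \<open>l0\<close> is smaller than any given bound.
\<close>
theorem fourier_series_zero:
  fixes S :: "'b::euclidean_space set" and a :: "'b \<Rightarrow> complex"
  assumes G: "subspace G" and SG: "S \<subseteq> G"
    and zero: "\<And>x. x \<in> G \<Longrightarrow> ((\<lambda>l. a l * ee (of_real (l \<bullet> x))) has_sum 0) S"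
    and l0: "l0 \<in> S"
  shows "a l0 = 0"
proof -
  \<comment> \<open>Averaging produces multipliers \<open>m\<close> that keep the coefficient at \<open>l0\<close> and make those in \<open>J\<close> small.\<close>
  have mult: "\<exists>m. m l0 = 1 \<and> (\<forall>l\<in>S. norm (m l) \<le> 1) \<and> (\<forall>j\<in>J. norm (m j) \<le> \<delta>) \<and>
        (\<forall>x\<in>G. ((\<lambda>l. a l * m l * ee (of_real (l \<bullet> x))) has_sum 0) S)"
    if "finite J" "J \<subseteq> S - {l0}" "\<delta> > 0" for J and \<delta> :: real
    using that
  proof (induction J)
    case empty
    show ?case by (rule exI[of _ "\<lambda>_. 1"]) (use zero in auto)
  next
    case (insert j J)
    then obtain m where m: "m l0 = 1" "\<And>l. l \<in> S \<Longrightarrow> norm (m l) \<le> 1" "\<And>j. j \<in> J \<Longrightarrow> norm (m j) \<le> \<delta>"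
      "\<And>x. x \<in> G \<Longrightarrow> ((\<lambda>l. a l * m l * ee (of_real (l \<bullet> x))) has_sum 0) S" by auto
    have j: "j \<in> S" "j \<noteq> l0" using insert.prems by auto
    \<comment> \<open>normalised so that the phase of \<open>j\<close> relative to \<open>l0\<close> is \<open>- 1\<close>\<close>
    define x0 where "x0 = (1 / (2 * (norm (j - l0))\<^sup>2)) *\<^sub>R (j - l0)"
    have x0: "x0 \<in> G" unfolding x0_def using G SG j l0 by (intro subspace_scale subspace_diff) auto
    define \<omega> where "\<omega> l = ee (of_real ((l - l0) \<bullet> x0))" for l
    have "(j - l0) \<bullet> x0 = 1 / 2" using j by (simp add: x0_def power2_norm_eq_inner)
    then have "\<omega> j = ee (of_real (1 / 2))" unfolding \<omega>_def by (simp only:)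
    then have \<omega>j: "\<omega> j \<noteq> 1" using ee_eq_1_imp[of "1 / 2"] by (auto elim!: Ints_cases)
    have n\<omega>: "norm (\<omega> l) = 1" for l by (simp add: \<omega>_def)
    obtain K :: nat where K: "K > 0" "norm ((\<Sum>s<K. \<omega> j ^ s) / of_nat K) \<le> \<delta>"
      using unimodular_mean_small[OF n\<omega> \<omega>j insert.prems(2)] by blast
    define \<mu> where "\<mu> l = (\<Sum>s<K. \<omega> l ^ s) / of_nat K" for l
    have \<mu>1: "norm (\<mu> l) \<le> 1" for l
    proof -
      have "norm (\<Sum>s<K. \<omega> l ^ s) \<le> (\<Sum>s<K. norm (\<omega> l ^ s))" by (rule norm_sum)
      then have "norm (\<Sum>s<K. \<omega> l ^ s) \<le> real K" by (simp add: norm_power n\<omega>)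
      then show ?thesis using K by (simp add: \<mu>_def norm_divide)
    qed
    have "((\<lambda>l. a l * (m l * \<mu> l) * ee (of_real (l \<bullet> x))) has_sum 0) S" if x: "x \<in> G" for x
    proof -
      have s: "((\<lambda>l. a l * m l * ee (of_real (l \<bullet> x)) * \<omega> l ^ s) has_sum 0) S" for s :: nat
      proof -
        have "x + real s *\<^sub>R x0 \<in> G" using G x x0 by (intro subspace_add subspace_scale)
        from has_sum_cmult_right[OF m(4)[OF this], of "ee (- of_real (real s * (l0 \<bullet> x0)))"]
        have "((\<lambda>l. ee (- of_real (real s * (l0 \<bullet> x0))) * (a l * m l * ee (of_real (l \<bullet> (x + real s *\<^sub>R x0))))) has_sum 0) S"
          by simp
        moreover have "ee (- of_real (real s * (l0 \<bullet> x0))) * (a l * m l * ee (of_real (l \<bullet> (x + real s *\<^sub>R x0))))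
           = a l * m l * ee (of_real (l \<bullet> x)) * \<omega> l ^ s" for l
        proof -
          have "\<omega> l ^ s = ee (of_nat s * of_real ((l - l0) \<bullet> x0))" by (simp add: \<omega>_def ee_of_nat_mult)
          then show ?thesis by (simp add: inner_simps ring_distribs ee_add ee_diff ee_minus field_simps)
        qed
        ultimately show ?thesis by (simp only:)
      qed
      have "((\<lambda>l. \<Sum>s<K. a l * m l * ee (of_real (l \<bullet> x)) * \<omega> l ^ s) has_sum (\<Sum>s<K. 0)) S"
        by (rule has_sum_finite_sum) (use s in auto)
      from has_sum_cmult_right[OF this, of "1 / of_nat K"]
      have "((\<lambda>l. 1 / of_nat K * (\<Sum>s<K. a l * m l * ee (of_real (l \<bullet> x)) * \<omega> l ^ s)) has_sum 0) S" by simp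
      moreover have "1 / of_nat K * (\<Sum>s<K. a l * m l * ee (of_real (l \<bullet> x)) * \<omega> l ^ s) = a l * (m l * \<mu> l) * ee (of_real (l \<bullet> x))" for l
        unfolding \<mu>_def sum_distrib_left[symmetric] by (simp add: mult_ac)
      ultimately show ?thesis by (simp only:)
    qed
    moreover have "\<mu> l0 = 1" using K by (simp add: \<mu>_def \<omega>_def)
    moreover have "norm (m l * \<mu> l) \<le> 1" if "l \<in> S" for l
      using m(2)[OF that] \<mu>1[of l] by (simp add: norm_mult mult_le_one)
    moreover have "norm (m i * \<mu> i) \<le> \<delta>" if "i \<in> insert j J" for i
    proof (cases "i = j")
      case True
      have "norm (m j) * norm (\<mu> j) \<le> 1 * \<delta>" using m(2)[OF j(1)] K(2) by (intro mult_mono) (auto simp: \<mu>_def)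
      then show ?thesis using True by (simp add: norm_mult)
    next
      case False
      then have "norm (m i) * norm (\<mu> i) \<le> \<delta> * 1" using m(3)[of i] \<mu>1 that insert.prems by (intro mult_mono) auto
      then show ?thesis by (simp add: norm_mult)
    qed
    ultimately show ?case using m(1) by (intro exI[of _ "\<lambda>l. m l * \<mu> l"]) auto
  qed
  have "(\<lambda>l. a l * ee (of_real (l \<bullet> 0))) summable_on S"
    using zero[OF subspace_0[OF G]] has_sum_imp_summable by blast
  then have "a summable_on S" by simp
  then have sum: "(\<lambda>l. norm (a l)) summable_on S"
    by (simp only: summable_on_iff_abs_summable_on_complex[symmetric])
  define A where "A = infsum (\<lambda>l. norm (a l)) S"
  have A0: "A \<ge> 0" unfolding A_def by (rule infsum_nonneg) auto
  have "norm (a l0) \<le> \<epsilon>" if \<epsilon>: "\<epsilon> > 0" for \<epsilon>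
  proof -
    obtain F where F: "finite F" "F \<subseteq> S" "dist (sum (\<lambda>l. norm (a l)) F) A \<le> \<epsilon> / 2"
      using infsum_finite_approximation[OF sum, of "\<epsilon> / 2"] \<epsilon> unfolding A_def by auto
    define F' where "F' = insert l0 F"
    have F': "finite F'" "F' \<subseteq> S" "sum (\<lambda>l. norm (a l)) F' \<ge> A - \<epsilon> / 2"
    proof -
      have "sum (\<lambda>l. norm (a l)) F \<le> sum (\<lambda>l. norm (a l)) F'"
        using F(1) by (intro sum_mono2) (auto simp: F'_def)
      then show "sum (\<lambda>l. norm (a l)) F' \<ge> A - \<epsilon> / 2" using F(3) unfolding dist_real_def by linarith
    qed (use F l0 in \<open>auto simp: F'_def\<close>)
    define \<delta> where "\<delta> = \<epsilon> / (2 * (1 + A))"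
    have \<delta>: "\<delta> > 0" using \<epsilon> A0 by (simp add: \<delta>_def)
    obtain m where m: "m l0 = 1" "\<And>l. l \<in> S \<Longrightarrow> norm (m l) \<le> 1" "\<And>j. j \<in> F' - {l0} \<Longrightarrow> norm (m j) \<le> \<delta>"
      and m0: "\<And>x. x \<in> G \<Longrightarrow> ((\<lambda>l. a l * m l * ee (of_real (l \<bullet> x))) has_sum 0) S"
    proof -
      have "finite (F' - {l0})" "F' - {l0} \<subseteq> S - {l0}" using F' by auto
      from mult[OF this \<delta>] that show ?thesis by blast
    qed
    have hs: "((\<lambda>l. a l * m l) has_sum 0) S" using m0[OF subspace_0[OF G]] by simp
    have nsum: "(\<lambda>l. norm (a l * m l)) summable_on S"
      using has_sum_imp_summable[OF hs] by (simp only: summable_on_iff_abs_summable_on_complex[symmetric])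
    have split: "S = F' \<union> (S - F')" using F' by auto
    have tail: "(\<lambda>l. a l * m l) summable_on (S - F')"
      using has_sum_imp_summable[OF hs] by (rule summable_on_subset_banach) auto
    have "0 = (\<Sum>l\<in>F'. a l * m l) + infsum (\<lambda>l. a l * m l) (S - F')"
      using infsum_Un_disjoint[of "\<lambda>l. a l * m l" F' "S - F'"] F' tail infsumI[OF hs] split by simp
    also have "(\<Sum>l\<in>F'. a l * m l) = a l0 + (\<Sum>l\<in>F' - {l0}. a l * m l)"
      using F' m(1) by (simp add: F'_def sum.remove[of "insert l0 F" l0])
    finally have "a l0 = - ((\<Sum>l\<in>F' - {l0}. a l * m l) + infsum (\<lambda>l. a l * m l) (S - F'))"
      by (simp add: eq_neg_iff_add_eq_0 add.assoc del: minus_add_distrib)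
    then have n: "norm (a l0) \<le> norm (\<Sum>l\<in>F' - {l0}. a l * m l) + norm (infsum (\<lambda>l. a l * m l) (S - F'))"
      by (simp only: norm_minus_cancel norm_triangle_ineq)
    have "norm (\<Sum>l\<in>F' - {l0}. a l * m l) \<le> (\<Sum>l\<in>F' - {l0}. norm (a l) * \<delta>)"
      by (rule sum_norm_le) (use m(3) in \<open>auto simp: norm_mult intro: mult_left_mono\<close>)
    also have "\<dots> \<le> A * \<delta>"
      unfolding sum_distrib_right[symmetric] A_def
      using F' \<delta> by (intro mult_right_mono finite_sum_le_infsum[OF sum]) auto
    also have "\<dots> \<le> \<epsilon> / 2" using A0 \<epsilon> by (simp add: \<delta>_def field_simps)
    finally have n1: "norm (\<Sum>l\<in>F' - {l0}. a l * m l) \<le> \<epsilon> / 2" .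
    have sumt: "(\<lambda>l. norm (a l)) summable_on (S - F')" using sum by (rule summable_on_subset_banach) auto
    have "norm (infsum (\<lambda>l. a l * m l) (S - F')) \<le> infsum (\<lambda>l. norm (a l)) (S - F')"
      by (rule norm_infsum_le[OF has_sum_infsum[OF tail] has_sum_infsum[OF sumt]])
         (use m(2) in \<open>auto simp: norm_mult mult_left_le\<close>)
    also have "\<dots> \<le> \<epsilon> / 2"
    proof -
      have "A = sum (\<lambda>l. norm (a l)) F' + infsum (\<lambda>l. norm (a l)) (S - F')"
        unfolding A_def using infsum_Un_disjoint[of "\<lambda>l. norm (a l)" F' "S - F'"] F' sumt split by simp
      then show ?thesis using F'(3) by linarith
    qed
    finally show ?thesis using n n1 by linarith
  qed
  then have "norm (a l0) \<le> 0" by (rule field_le_epsilon) simp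
  then show ?thesis by simp
qed

section \<open>The complexified space\<close>

lemma cform_dual: "cform (l, 0) (p, q) = Complex (l \<bullet> p) (l \<bullet> q)"
  by (simp add: cform_def)

lemma cform_dual_add: "cform (l + l', 0) z = cform (l, 0) z + cform (l', 0) z"
  by (cases z) (simp add: cform_dual inner_simps complex_eq_iff)

lemma cform_dual_minus: "cform (- l, 0) z = - cform (l, 0) z"
  by (cases z) (simp add: cform_dual inner_simps complex_eq_iff)

lemma cform_add_right: "cform x (z + w) = cform x z + cform x w"
  by (cases x; cases z; cases w) (simp add: cform_def inner_simps complex_eq_iff)

lemma cform_minus_right: "cform x (- z) = - cform x z"
  by (cases x; cases z) (simp add: cform_def inner_simps complex_eq_iff)

lemma cform_scale_right: "cform x (cscale w z) = w * cform x z"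
  by (cases x; cases z) (simp add: cform_def cscale_def inner_simps complex_eq_iff algebra_simps)

lemma cform_commute: "cform x z = cform z x"
  by (cases x; cases z) (simp add: cform_def inner_simps complex_eq_iff inner_commute algebra_simps)

lemma cform_scale_left: "cform (cscale w x) z = w * cform x z"
  using cform_scale_right cform_commute by metis

lemma cform_real: "cform (l, 0) (y, 0) = of_real (l \<bullet> y)"
  by (simp add: cform_dual complex_eq_iff)

lemma cscale_cscale: "cscale w (cscale v z) = cscale (w * v) z"
  by (cases z) (simp add: cscale_def algebra_simps)

lemma cscale_1 [simp]: "cscale 1 z = z"
  by (cases z) (simp add: cscale_def)

lemma cscale_minus: "cscale (- w) z = - cscale w z"
  by (cases z) (simp add: cscale_def)

lemma cscale_complexify: "z \<in> complexify L \<Longrightarrow> cscale w z \<in> complexify L"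
  by (cases z) (auto simp: complexify_def cscale_def intro!: span_add span_diff span_scale)

lemma complexify_add: "z \<in> complexify L \<Longrightarrow> w \<in> complexify L \<Longrightarrow> z + w \<in> complexify L"
  by (cases z; cases w) (auto simp: complexify_def intro!: span_add)

lemma complexify_minus: "z \<in> complexify L \<Longrightarrow> - z \<in> complexify L"
  by (cases z) (auto simp: complexify_def intro!: span_neg)

lemma complexify_real: "x \<in> span L \<Longrightarrow> (x, 0) \<in> complexify L"
  by (simp add: complexify_def span_zero)

lemma norm_cform_dual_le: "norm (cform (l, 0) z) \<le> norm l * norm z"
proof (cases z)
  case (Pair p q)
  have "(l \<bullet> p)\<^sup>2 + (l \<bullet> q)\<^sup>2 \<le> (norm l)\<^sup>2 * (norm p)\<^sup>2 + (norm l)\<^sup>2 * (norm q)\<^sup>2"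
    by (intro add_mono) (metis abs_le_square_iff Cauchy_Schwarz_ineq2 abs_mult abs_norm_cancel power_mult_distrib)+
  also have "\<dots> = (norm l * norm z)\<^sup>2" by (simp add: Pair norm_Pair power_mult_distrib algebra_simps)
  finally show ?thesis by (simp add: Pair cform_dual cmod_def real_le_lsqrt)
qed

section \<open>Positive definite even lattices and theta functions\<close>

text \<open>
  The theta function with coefficients \<open>g\<close>. For \<open>g\<close> the indicator function of a coset of \<open>L\<close> it is the
  classical theta function of that coset; general periodic \<open>g\<close> are allowed because inversion replaces an
  indicator function by a character.
\<close>
definition theta :: "'a::euclidean_space set \<Rightarrow> ('a \<Rightarrow> complex) \<Rightarrow> complex \<Rightarrow> 'a \<times> 'a \<Rightarrow> complex" where
  "theta L g \<tau> z = (\<Sum>\<^sub>\<infinity>l\<in>dual_lattice (\<bullet>) L. g l * (ee (of_real (l \<bullet> l / 2) * \<tau>) * ee (cform (l, 0) z)))"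

definition periodic :: "'a::euclidean_space set \<Rightarrow> ('a \<Rightarrow> complex) \<Rightarrow> bool" where
  "periodic L g \<longleftrightarrow> (\<forall>l\<in>dual_lattice (\<bullet>) L. \<forall>x\<in>L. g (l + x) = g l)"

definition coset_rep :: "'a::euclidean_space set \<Rightarrow> 'a \<Rightarrow> 'a" where
  "coset_rep L l = (SOME y. y \<in> dual_lattice (\<bullet>) L \<and> y - l \<in> L)"

definition coset_reps :: "'a::euclidean_space set \<Rightarrow> 'a set" where
  "coset_reps L = coset_rep L ` dual_lattice (\<bullet>) L"

text \<open>
  The bound is uniform for \<open>z\<close> in a ball and \<open>\<tau>\<close> in a half-plane away from the real axis, by completing
  the square.
\<close>
lemma theta_term_bound:
  fixes l :: "'a::euclidean_space"
  assumes y: "y > 0" "y \<le> Im \<tau>" and r: "norm z \<le> r"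
  shows "norm (ee (of_real (l \<bullet> l / 2) * \<tau>) * ee (cform (l, 0) z)) \<le> exp (2 * pi * r\<^sup>2 / y) * exp (- (pi * y / 2) * (norm l)\<^sup>2)"
proof -
  have "norm (snd z) \<le> r" using norm_snd_le[of "snd z" "fst z"] r by simp
  then have "- (l \<bullet> snd z) \<le> norm l * r"
    using Cauchy_Schwarz_ineq2[of l "snd z"] mult_left_mono[of "norm (snd z)" r "norm l"] norm_ge_zero[of l] by linarith
  moreover have "norm l * r \<le> y * (norm l)\<^sup>2 / 4 + r\<^sup>2 / y"
  proof -
    have "0 \<le> (y * norm l - 2 * r)\<^sup>2" by simp
    then have "4 * (y * (norm l * r)) \<le> y\<^sup>2 * (norm l)\<^sup>2 + 4 * r\<^sup>2" by (simp add: power2_eq_square algebra_simps)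
    then show ?thesis using y by (simp add: field_simps power2_eq_square)
  qed
  moreover have "y * (norm l)\<^sup>2 \<le> Im \<tau> * (norm l)\<^sup>2" using y by (intro mult_right_mono) auto
  ultimately have "2 * pi * (- (Im \<tau> * (norm l)\<^sup>2 / 2) + - (l \<bullet> snd z)) \<le> 2 * pi * (- (y * (norm l)\<^sup>2 / 2) + (y * (norm l)\<^sup>2 / 4 + r\<^sup>2 / y))"
    by (intro mult_left_mono) (linarith, simp)
  moreover have "norm (ee (of_real (l \<bullet> l / 2) * \<tau>) * ee (cform (l, 0) z)) = exp (2 * pi * (- (Im \<tau> * (norm l)\<^sup>2 / 2) + - (l \<bullet> snd z)))"
    by (cases z) (simp add: norm_mult norm_ee cform_dual power2_norm_eq_inner algebra_simps flip: exp_add)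
  moreover have "2 * pi * (- (y * (norm l)\<^sup>2 / 2) + (y * (norm l)\<^sup>2 / 4 + r\<^sup>2 / y)) = 2 * pi * r\<^sup>2 / y + - (pi * y / 2) * (norm l)\<^sup>2"
    by (simp add: algebra_simps)
  ultimately show ?thesis by (simp only: exp_add[symmetric] exp_le_cancel_iff)
qed

locale even_lattice =
  fixes L :: "'a::euclidean_space set"
  assumes even_lattice: "even_posdef_lattice L"
begin

abbreviation Ld :: "'a set" where "Ld \<equiv> dual_lattice (\<bullet>) L"

lemma basis_exists: obtains E where "finite E" "independent E" "L = zspan E"
proof -
  obtain E where "independent E" "L = zspan E"
    using even_lattice unfolding even_posdef_lattice_def is_lattice_def zspan_def by blast
  then show ?thesis using that independent_imp_finite by blast
qed

lemma L_0 [simp]: "0 \<in> L"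
proof -
  obtain E where "L = zspan E" using basis_exists by blast
  then show ?thesis unfolding zspan_def by (auto intro!: exI[of _ "\<lambda>_. 0"])
qed

lemma L_add: "x \<in> L \<Longrightarrow> y \<in> L \<Longrightarrow> x + y \<in> L"
proof -
  obtain E where E: "L = zspan E" using basis_exists by blast
  assume "x \<in> L" "y \<in> L"
  then obtain c d where "x = (\<Sum>b\<in>E. of_int (c b) *\<^sub>R b)" "y = (\<Sum>b\<in>E. of_int (d b) *\<^sub>R b)"
    unfolding E zspan_def by blast
  then have "x + y = (\<Sum>b\<in>E. of_int (c b + d b) *\<^sub>R b)" by (simp add: sum.distrib scaleR_add_left)
  then show ?thesis unfolding E by (rule zspanI)
qed

lemma L_minus: "x \<in> L \<Longrightarrow> - x \<in> L"
proof -
  obtain E where E: "L = zspan E" using basis_exists by blast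
  assume "x \<in> L"
  then obtain c where "x = (\<Sum>b\<in>E. of_int (c b) *\<^sub>R b)" unfolding E zspan_def by blast
  then have "- x = (\<Sum>b\<in>E. of_int (- c b) *\<^sub>R b)" by (simp add: sum_negf)
  then show ?thesis unfolding E by (rule zspanI)
qed

lemma L_diff: "x \<in> L \<Longrightarrow> y \<in> L \<Longrightarrow> x - y \<in> L"
  using L_add[of x "- y"] L_minus[of y] by simp

lemma L_even: "x \<in> L \<Longrightarrow> x \<bullet> x / 2 \<in> \<int>"
  using even_lattice unfolding even_posdef_lattice_def by fastforce

lemma L_integral: "x \<in> L \<Longrightarrow> y \<in> L \<Longrightarrow> x \<bullet> y \<in> \<int>"
proof -
  assume xy: "x \<in> L" "y \<in> L"
  have "x \<bullet> y = (x + y) \<bullet> (x + y) / 2 - x \<bullet> x / 2 - y \<bullet> y / 2"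
    by (simp add: inner_simps inner_commute field_simps)
  then show ?thesis using L_even L_add xy by simp
qed

lemma L_span: "x \<in> L \<Longrightarrow> x \<in> span L" by (rule span_base)

lemma Ld_span: "l \<in> Ld \<Longrightarrow> l \<in> span L" by (simp add: dual_lattice_def)

lemma Ld_integral: "l \<in> Ld \<Longrightarrow> x \<in> L \<Longrightarrow> l \<bullet> x \<in> \<int>" "l \<in> Ld \<Longrightarrow> x \<in> L \<Longrightarrow> x \<bullet> l \<in> \<int>"
  by (auto simp: dual_lattice_def inner_commute)

lemma L_Ld: "x \<in> L \<Longrightarrow> x \<in> Ld"
  using L_integral L_span by (auto simp: dual_lattice_def)

lemma Ld_0 [simp]: "0 \<in> Ld" using L_Ld by simp

lemma Ld_add: "l \<in> Ld \<Longrightarrow> m \<in> Ld \<Longrightarrow> l + m \<in> Ld"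
  by (auto simp: dual_lattice_def inner_simps span_add)

lemma Ld_minus: "l \<in> Ld \<Longrightarrow> - l \<in> Ld"
  by (auto simp: dual_lattice_def inner_simps span_neg)

lemma Ld_minus_iff [simp]: "- l \<in> Ld \<longleftrightarrow> l \<in> Ld"
  using Ld_minus by fastforce

lemma Ld_diff: "l \<in> Ld \<Longrightarrow> m \<in> Ld \<Longrightarrow> l - m \<in> Ld"
  using Ld_add[of l "- m"] by simp

lemma Ld_quad_shift: "l \<in> Ld \<Longrightarrow> x \<in> L \<Longrightarrow> (l + x) \<bullet> (l + x) / 2 - l \<bullet> l / 2 \<in> \<int>"
proof -
  assume "l \<in> Ld" "x \<in> L"
  moreover have "(l + x) \<bullet> (l + x) / 2 - l \<bullet> l / 2 = l \<bullet> x + x \<bullet> x / 2"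
    by (simp add: inner_simps inner_commute field_simps)
  ultimately show ?thesis using Ld_integral L_even by simp
qed

lemma Ld_separated: obtains E where "integrally_separated E Ld"
  using basis_exists zdual_separated dual_lattice_zspan by metis

lemma Ld_gaussian: "a > 0 \<Longrightarrow> (\<lambda>l. exp (- a * (norm l)\<^sup>2)) summable_on Ld"
  using Ld_separated integrally_separated_gaussian by metis

lemma Ld_bounded_finite: "finite {l \<in> Ld. norm l \<le> r}"
  using Ld_separated integrally_separated_bounded_finite by metis

lemma coset_rep: assumes "l \<in> Ld" shows "coset_rep L l \<in> Ld" "coset_rep L l - l \<in> L"
proof -
  have "\<exists>y. y \<in> Ld \<and> y - l \<in> L" using assms by (intro exI[of _ l]) simp
  from someI_ex[OF this] show "coset_rep L l \<in> Ld" "coset_rep L l - l \<in> L" by (auto simp: coset_rep_def)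
qed

lemma coset_rep_eq: "l - m \<in> L \<Longrightarrow> coset_rep L l = coset_rep L m"
proof -
  assume lm: "l - m \<in> L"
  have "y - l \<in> L \<longleftrightarrow> y - m \<in> L" for y
    using L_add[OF _ lm, of "y - l"] L_diff[OF _ lm, of "y - m"] by auto
  then show ?thesis by (simp add: coset_rep_def)
qed

lemma coset_rep_idem: "r \<in> coset_reps L \<Longrightarrow> coset_rep L r = r"
  unfolding coset_reps_def using coset_rep(2) coset_rep_eq by blast

lemma coset_reps_Ld: "r \<in> coset_reps L \<Longrightarrow> r \<in> Ld"
  unfolding coset_reps_def using coset_rep by auto

lemma coset_rep_in: "l \<in> Ld \<Longrightarrow> coset_rep L l \<in> coset_reps L"
  unfolding coset_reps_def by simp

lemma coset_rep_eq_iff: "r \<in> coset_reps L \<Longrightarrow> l \<in> Ld \<Longrightarrow> coset_rep L l = r \<longleftrightarrow> l - r \<in> L"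
  using coset_rep_eq[of l r] coset_rep_idem[of r] coset_rep(2)[of l] L_minus[of "coset_rep L l - l"] by auto

text \<open>
  Reducing the coordinates with respect to a basis modulo \<open>1\<close> moves every dual vector into a bounded set.
\<close>
lemma finite_coset_reps: "finite (coset_reps L)"
proof -
  obtain E where E: "finite E" "independent E" "L = zspan E" using basis_exists .
  define B where "B = {l \<in> Ld. norm l \<le> (\<Sum>b\<in>E. norm b)}"
  have "coset_reps L \<subseteq> coset_rep L ` B"
    unfolding coset_reps_def
  proof
    fix r assume "r \<in> coset_rep L ` Ld"
    then obtain l where l: "l \<in> Ld" "r = coset_rep L l" by blast
    have "l \<in> span E" using Ld_span[OF l(1)] span_zspan[OF E(1)] E(3) by simp
    then obtain u where u: "l = (\<Sum>b\<in>E. u b *\<^sub>R b)" using span_finite[OF E(1)] by auto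
    define x where "x = (\<Sum>b\<in>E. of_int \<lfloor>u b\<rfloor> *\<^sub>R b)"
    have x: "x \<in> L" unfolding E by (rule zspanI[OF x_def])
    have "l - x = (\<Sum>b\<in>E. frac (u b) *\<^sub>R b)"
      unfolding u x_def by (simp add: frac_def scaleR_diff_left sum_subtractf)
    also have "norm \<dots> \<le> (\<Sum>b\<in>E. norm b)"
    proof (rule sum_norm_le)
      fix b assume "b \<in> E"
      have "\<bar>frac (u b)\<bar> \<le> 1" using frac_ge_0[of "u b"] frac_lt_1[of "u b"] by linarith
      then show "norm (frac (u b) *\<^sub>R b) \<le> norm b" by (simp add: mult_left_le_one_le)
    qed
    finally have "l - x \<in> B" using l x L_Ld Ld_diff by (simp add: B_def)
    moreover have "coset_rep L (l - x) = r" unfolding l(2) by (rule coset_rep_eq) (use x L_minus in simp)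
    ultimately show "r \<in> coset_rep L ` B" by blast
  qed
  then show ?thesis using Ld_bounded_finite finite_subset B_def by blast
qed

lemma coset_reps_nonempty: "coset_reps L \<noteq> {}"
  using coset_rep_in[OF Ld_0] by auto

lemma periodicD: "periodic L g \<Longrightarrow> l \<in> Ld \<Longrightarrow> x \<in> L \<Longrightarrow> g (l + x) = g l"
  by (simp add: periodic_def)

lemma periodic_coset_rep: "periodic L g \<Longrightarrow> l \<in> Ld \<Longrightarrow> g (coset_rep L l) = g l"
  using periodicD[of g l "coset_rep L l - l"] coset_rep[of l] by simp

lemma periodic_bounded:
  assumes "periodic L g" obtains K where "K > 0" "\<And>l. l \<in> Ld \<Longrightarrow> norm (g l) \<le> K"
proof -
  define K where "K = 1 + (\<Sum>r\<in>coset_reps L. norm (g r))"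
  have "K > 0" unfolding K_def by (smt (verit) norm_ge_zero sum_nonneg)
  moreover have "norm (g l) \<le> K" if "l \<in> Ld" for l
    using member_le_sum[of "coset_rep L l" "coset_reps L" "\<lambda>r. norm (g r)"] finite_coset_reps
      coset_rep_in[OF that] periodic_coset_rep[OF assms that] by (simp add: K_def)
  ultimately show ?thesis using that by blast
qed

lemma theta_abs_summable:
  assumes "periodic L g" "\<tau> \<in> UHP"
  shows "(\<lambda>l. norm (g l * (ee (of_real (l \<bullet> l / 2) * \<tau>) * ee (cform (l, 0) z)))) summable_on Ld"
proof -
  obtain K where K: "K > 0" "\<And>l. l \<in> Ld \<Longrightarrow> norm (g l) \<le> K" using periodic_bounded[OF assms(1)] by blast
  have y: "Im \<tau> > 0" using assms by (simp add: UHP_def)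
  show ?thesis
  proof (rule summable_on_comparison_test)
    show "(\<lambda>l. K * (exp (2 * pi * (norm z)\<^sup>2 / Im \<tau>) * exp (- (pi * Im \<tau> / 2) * (norm l)\<^sup>2))) summable_on Ld"
      using y by (intro summable_on_cmult_right Ld_gaussian) auto
    fix l assume l: "l \<in> Ld"
    show "norm (g l * (ee (of_real (l \<bullet> l / 2) * \<tau>) * ee (cform (l, 0) z))) \<le>
        K * (exp (2 * pi * (norm z)\<^sup>2 / Im \<tau>) * exp (- (pi * Im \<tau> / 2) * (norm l)\<^sup>2))"
      unfolding norm_mult[of "g l"] using K(1)
      by (intro mult_mono K(2)[OF l] theta_term_bound[OF y order_refl order_refl]) auto
  qed auto
qed

lemma theta_has_sum:
  assumes "periodic L g" "\<tau> \<in> UHP"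
  shows "((\<lambda>l. g l * (ee (of_real (l \<bullet> l / 2) * \<tau>) * ee (cform (l, 0) z))) has_sum theta L g \<tau> z) Ld"
  unfolding theta_def by (rule has_sum_infsum) (rule abs_summable_summable[OF theta_abs_summable[OF assms]])

lemma theta_cong: "(\<And>l. l \<in> Ld \<Longrightarrow> g l = h l) \<Longrightarrow> theta L g \<tau> z = theta L h \<tau> z"
  unfolding theta_def by (rule infsum_cong) simp

text \<open>
  For real \<open>z\<close> a theta function is a Fourier series, whose coefficients are those of \<open>g\<close> times nonzero Gaussians.
\<close>
lemma theta_unique:
  assumes "periodic L g" "periodic L h" "\<tau> \<in> UHP" "\<And>z. z \<in> complexify L \<Longrightarrow> theta L g \<tau> z = theta L h \<tau> z"
    and l: "l \<in> Ld"
  shows "g l = h l"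
proof -
  have "(g l - h l) * ee (of_real (l \<bullet> l / 2) * \<tau>) = 0"
  proof (rule fourier_series_zero[of "span L" Ld _ l])
    fix x assume "x \<in> span L"
    then have z: "(x, 0) \<in> complexify L" by (rule complexify_real)
    from has_sum_add[OF theta_has_sum[OF assms(1,3), of "(x, 0)"] has_sum_uminusI[OF theta_has_sum[OF assms(2,3), of "(x, 0)"]]]
    show "((\<lambda>l. (g l - h l) * ee (of_real (l \<bullet> l / 2) * \<tau>) * ee (of_real (l \<bullet> x))) has_sum 0) Ld"
      using assms(4)[OF z] by (simp add: cform_real algebra_simps)
  qed (use l Ld_span in auto)
  then show ?thesis by simp
qed

text \<open>
  Substitute \<open>l + x\<close> for \<open>l\<close> in the sum and complete the square.
\<close>
lemma theta_elliptic:
  assumes g: "periodic L g" and x: "x \<in> L" and y: "y \<in> L"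
  shows "theta L g \<tau> (z + cscale \<tau> (x, 0) + (y, 0)) =
     ee (- (of_real (x \<bullet> x / 2) * \<tau> + cform (x, 0) z)) * theta L g \<tau> z"
proof -
  have bij: "bij_betw (\<lambda>l. l + x) Ld Ld"
    by (rule bij_betwI[of _ _ _ "\<lambda>l. l - x"]) (use x L_Ld Ld_add Ld_diff in auto)
  have "theta L g \<tau> z = (\<Sum>\<^sub>\<infinity>l\<in>Ld. g (l + x) * (ee (of_real ((l + x) \<bullet> (l + x) / 2) * \<tau>) * ee (cform (l + x, 0) z)))"
    unfolding theta_def by (rule infsum_reindex_bij_betw[OF bij, symmetric])
  then have "ee (- (of_real (x \<bullet> x / 2) * \<tau> + cform (x, 0) z)) * theta L g \<tau> z =
      (\<Sum>\<^sub>\<infinity>l\<in>Ld. ee (- (of_real (x \<bullet> x / 2) * \<tau> + cform (x, 0) z)) *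
         (g (l + x) * (ee (of_real ((l + x) \<bullet> (l + x) / 2) * \<tau>) * ee (cform (l + x, 0) z))))"
    by (simp add: infsum_cmult_right')
  also have "\<dots> = theta L g \<tau> (z + cscale \<tau> (x, 0) + (y, 0))"
    unfolding theta_def
  proof (rule infsum_cong)
    fix l assume l: "l \<in> Ld"
    have 1: "cform (l, 0) (z + cscale \<tau> (x, 0) + (y, 0)) = cform (l, 0) z + of_real (l \<bullet> x) * \<tau> + of_real (l \<bullet> y)"
      by (simp add: cform_add_right cform_scale_right cform_real)
    have 2: "ee (of_real (l \<bullet> y)) = 1" by (rule ee_of_real_Ints) (use l y Ld_integral in auto)
    have 3: "(l + x) \<bullet> (l + x) / 2 = l \<bullet> l / 2 + l \<bullet> x + x \<bullet> x / 2" by (simp add: inner_simps inner_commute field_simps)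
    have 4: "- (of_real (x \<bullet> x / 2) * \<tau> + cform (x, 0) z) + (of_real (l \<bullet> l / 2 + l \<bullet> x + x \<bullet> x / 2) * \<tau> + cform (l + x, 0) z)
        = of_real (l \<bullet> l / 2) * \<tau> + (cform (l, 0) z + of_real (l \<bullet> x) * \<tau>)"
      by (simp add: cform_dual_add algebra_simps)
    show "ee (- (of_real (x \<bullet> x / 2) * \<tau> + cform (x, 0) z)) *
         (g (l + x) * (ee (of_real ((l + x) \<bullet> (l + x) / 2) * \<tau>) * ee (cform (l + x, 0) z))) =
         g l * (ee (of_real (l \<bullet> l / 2) * \<tau>) * ee (cform (l, 0) (z + cscale \<tau> (x, 0) + (y, 0))))"
      unfolding 1 3 periodicD[OF g l x] ee_add[of _ "of_real (l \<bullet> y)"] 2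
      using arg_cong[OF 4, of ee] by (simp only: ee_add mult_ac mult_1_right mult_1_left)
  qed
  finally show ?thesis by simp
qed

lemma theta_T:
  "theta L g (\<tau> + 1) z = theta L (\<lambda>l. g l * ee (of_real (l \<bullet> l / 2))) \<tau> z"
  unfolding theta_def by (rule infsum_cong) (simp only: ring_distribs ee_add mult_ac mult_1_right mult_1_left)

lemma theta_uminus: "theta L g \<tau> (- z) = theta L (\<lambda>l. g (- l)) \<tau> z"
proof -
  have bij: "bij_betw uminus Ld Ld" by (rule bij_betwI[of _ _ _ uminus]) auto
  show ?thesis
    unfolding theta_def
    by (subst infsum_reindex_bij_betw[OF bij, symmetric]) (simp add: cform_dual_minus cform_minus_right)
qed

lemma periodic_indicator: "periodic L (\<lambda>l. if l - r \<in> L then 1 else 0)"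
  unfolding periodic_def
proof (intro ballI)
  fix l x assume x: "x \<in> L"
  have "l + x - r \<in> L \<longleftrightarrow> l - r \<in> L"
    using L_add[OF _ x, of "l - r"] L_diff[OF _ x, of "l + x - r"] by (auto simp: algebra_simps)
  then show "(if l + x - r \<in> L then 1 else 0) = (if l - r \<in> L then 1 else 0)" by simp
qed

lemma theta_decompose:
  assumes g: "periodic L g" and \<tau>: "\<tau> \<in> UHP"
  shows "theta L g \<tau> z = (\<Sum>r\<in>coset_reps L. g r * theta L (\<lambda>l. if l - r \<in> L then 1 else 0) \<tau> z)"
proof -
  have "((\<lambda>l. \<Sum>r\<in>coset_reps L. g r * ((if l - r \<in> L then 1 else 0) * (ee (of_real (l \<bullet> l / 2) * \<tau>) * ee (cform (l, 0) z))))
     has_sum (\<Sum>r\<in>coset_reps L. g r * theta L (\<lambda>l. if l - r \<in> L then 1 else 0) \<tau> z)) Ld"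
    by (intro has_sum_finite_sum finite_coset_reps has_sum_cmult_right theta_has_sum periodic_indicator \<tau>)
  moreover have "(\<Sum>r\<in>coset_reps L. g r * ((if l - r \<in> L then 1 else 0) * c)) = g l * c" if l: "l \<in> Ld" for l c
  proof -
    have "(\<Sum>r\<in>coset_reps L. g r * ((if l - r \<in> L then 1 else 0) * c)) = (\<Sum>r\<in>coset_reps L. if r = coset_rep L l then g r * c else 0)"
      using coset_rep_eq_iff[OF _ l] by (intro sum.cong) auto
    then show ?thesis using finite_coset_reps coset_rep_in[OF l] periodic_coset_rep[OF g l] by simp
  qed
  ultimately have "((\<lambda>l. g l * (ee (of_real (l \<bullet> l / 2) * \<tau>) * ee (cform (l, 0) z)))
     has_sum (\<Sum>r\<in>coset_reps L. g r * theta L (\<lambda>l. if l - r \<in> L then 1 else 0) \<tau> z)) Ld"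
    by (subst (asm) has_sum_cong) auto
  with theta_has_sum[OF g \<tau>] show ?thesis using has_sum_unique by blast
qed

end

section \<open>Holomorphy of theta functions\<close>

lemma open_UHP: "open UHP"
  unfolding UHP_def by (simp add: open_halfspace_Im_gt)

lemma convex_UHP: "convex UHP"
  unfolding UHP_def by (simp add: convex_halfspace_Im_gt)

lemma minus_inverse_UHP: "\<tau> \<in> UHP \<Longrightarrow> - 1 / \<tau> \<in> UHP"
  unfolding UHP_def by (auto simp: Im_divide power2_eq_square intro!: divide_pos_pos add_nonneg_pos mult_pos_pos)

lemma UHP_nonzero: "\<tau> \<in> UHP \<Longrightarrow> \<tau> \<noteq> 0"
  unfolding UHP_def by auto

lemma convex_complexify: "convex (complexify L)"
  unfolding complexify_def by (intro convex_Times subspace_imp_convex subspace_span)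

lemma bounded_linear_cform: "bounded_linear (cform x)"
proof (intro bounded_linear_intro[where K="norm (fst x) + norm (snd x)"])
  fix z w show "cform x (z + w) = cform x z + cform x w" by (rule cform_add_right)
next
  fix r z show "cform x (r *\<^sub>R z) = r *\<^sub>R cform x z"
    by (cases x; cases z) (simp add: cform_def complex_eq_iff algebra_simps)
next
  fix z
  obtain u v where x: "x = (u, v)" by (cases x)
  have "x = (u, 0) + cscale \<i> (v, 0)" by (simp add: x cscale_def)
  then have "cform x z = cform (u, 0) z + \<i> * cform (v, 0) z"
    by (metis cform_commute cform_add_right cform_scale_right)
  then have "norm (cform x z) \<le> norm (cform (u, 0) z) + norm (cform (v, 0) z)"
    using norm_triangle_ineq[of "cform (u, 0) z" "\<i> * cform (v, 0) z"] by (simp add: norm_mult)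
  also have "\<dots> \<le> norm u * norm z + norm v * norm z" by (intro add_mono norm_cform_dual_le)
  finally show "norm (cform x z) \<le> norm z * (norm (fst x) + norm (snd x))" by (simp add: x algebra_simps)
qed

lemma bounded_linear_cscale_left: "bounded_linear (\<lambda>w. cscale w z)"
proof (intro bounded_linear_intro[where K="norm (fst z) + norm (snd z) + (norm (fst z) + norm (snd z))"])
  fix w :: complex
  obtain u v where z: "z = (u, v)" by (cases z)
  have "norm (cscale w z) \<le> norm (Re w *\<^sub>R u - Im w *\<^sub>R v) + norm (Re w *\<^sub>R v + Im w *\<^sub>R u)"
    by (simp add: z cscale_def norm_Pair_le)
  also have "\<dots> \<le> (norm (Re w *\<^sub>R u) + norm (Im w *\<^sub>R v)) + (norm (Re w *\<^sub>R v) + norm (Im w *\<^sub>R u))"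
    by (intro add_mono norm_triangle_ineq norm_triangle_ineq4)
  also have "\<dots> \<le> (norm w * norm u + norm w * norm v) + (norm w * norm v + norm w * norm u)"
    by (simp only: norm_scaleR) (intro add_mono mult_right_mono, auto simp: abs_Re_le_cmod abs_Im_le_cmod)
  finally show "norm (cscale w z) \<le> norm w * (norm (fst z) + norm (snd z) + (norm (fst z) + norm (snd z)))"
    by (simp add: z algebra_simps)
qed (cases z; simp add: cscale_def algebra_simps)+

text \<open>
  Restricting a function of \<open>(\<tau>, z)\<close> to a complex curve reduces identities between such functions to analytic
  continuation in one variable.
\<close>
lemma jointly_holomorphic_compose:
  assumes \<phi>: "jointly_holomorphic L \<phi>" and z: "z \<in> complexify L"
    and \<alpha>: "\<alpha> holomorphic_on UHP" "\<And>\<tau>. \<tau> \<in> UHP \<Longrightarrow> \<alpha> \<tau> \<in> UHP" and \<beta>: "\<beta> holomorphic_on UHP"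
  shows "(\<lambda>\<tau>. \<phi> (\<alpha> \<tau>) (cscale (\<beta> \<tau>) z)) holomorphic_on UHP"
  unfolding holomorphic_on_def
proof
  fix \<tau> assume \<tau>: "\<tau> \<in> UHP"
  obtain a where a: "(\<alpha> has_field_derivative a) (at \<tau>)"
    using \<alpha>(1) \<tau> open_UHP holomorphic_on_imp_differentiable_at field_differentiable_def by metis
  obtain b where b: "(\<beta> has_field_derivative b) (at \<tau>)"
    using \<beta>(1) \<tau> open_UHP holomorphic_on_imp_differentiable_at field_differentiable_def by metis
  obtain D where D: "((\<lambda>(\<tau>, z). \<phi> \<tau> z) has_derivative D) (at (\<alpha> \<tau>, cscale (\<beta> \<tau>) z) within UHP \<times> complexify L)"
    and lin: "\<And>w s y. y \<in> complexify L \<Longrightarrow> D (w * s, cscale w y) = w * D (s, y)"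
    using \<phi> \<alpha>(2)[OF \<tau>] cscale_complexify[OF z] unfolding jointly_holomorphic_def by blast
  have "((\<lambda>\<tau>. cscale (\<beta> \<tau>) z) has_derivative (\<lambda>h. cscale (b * h) z)) (at \<tau> within UHP)"
    using bounded_linear.has_derivative[OF bounded_linear_cscale_left has_field_derivative_imp_has_derivative[OF b]]
      has_derivative_at_withinI by blast
  moreover have "(\<alpha> has_derivative (\<lambda>h. a * h)) (at \<tau> within UHP)"
    using has_field_derivative_imp_has_derivative[OF a] has_derivative_at_withinI by blast
  ultimately have g: "((\<lambda>\<tau>. (\<alpha> \<tau>, cscale (\<beta> \<tau>) z)) has_derivative (\<lambda>h. (a * h, cscale (b * h) z))) (at \<tau> within UHP)"
    by (rule has_derivative_Pair[rotated])
  have "((\<lambda>x. (\<lambda>(\<tau>, z). \<phi> \<tau> z) (\<alpha> x, cscale (\<beta> x) z)) has_derivative (\<lambda>h. D (a * h, cscale (b * h) z))) (at \<tau> within UHP)"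
  proof (rule has_derivative_in_compose[OF g])
    show "((\<lambda>(\<tau>, z). \<phi> \<tau> z) has_derivative D) (at (\<alpha> \<tau>, cscale (\<beta> \<tau>) z) within (\<lambda>\<tau>. (\<alpha> \<tau>, cscale (\<beta> \<tau>) z)) ` UHP)"
      by (rule has_derivative_subset[OF D]) (use \<alpha>(2) cscale_complexify[OF z] in auto)
  qed
  moreover have "D (a * h, cscale (b * h) z) = D (a, cscale b z) * h" for h
    using lin[OF cscale_complexify[OF z, of b], of h a] by (simp add: cscale_cscale mult.commute)
  ultimately have "((\<lambda>\<tau>. \<phi> (\<alpha> \<tau>) (cscale (\<beta> \<tau>) z)) has_derivative (\<lambda>h. D (a, cscale b z) * h)) (at \<tau> within UHP)"
    by simp
  then show "(\<lambda>\<tau>. \<phi> (\<alpha> \<tau>) (cscale (\<beta> \<tau>) z)) field_differentiable at \<tau> within UHP"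
    unfolding field_differentiable_def has_field_derivative_def by blast
qed

context even_lattice
begin

lemma theta_term_derivative:
  "((\<lambda>(\<tau>, z). ee (of_real q * \<tau>) * ee (cform x z)) has_derivative
     (\<lambda>(s, w). ee (of_real q * \<tau>) * ee (cform x z) * (2 * of_real pi * \<i> * (of_real q * s + cform x w)))) (at (\<tau>, z) within S)"
proof -
  have lin: "bounded_linear (\<lambda>p. 2 * of_real pi * \<i> * (of_real q * fst p + cform x (snd p)))"
    by (intro bounded_linear_const_mult bounded_linear_add bounded_linear_fst
        bounded_linear_compose[OF bounded_linear_cform bounded_linear_snd])
  have "((\<lambda>p. exp (2 * of_real pi * \<i> * (of_real q * fst p + cform x (snd p)))) has_derivative
      (\<lambda>p. exp (2 * of_real pi * \<i> * (of_real q * \<tau> + cform x z)) * (2 * of_real pi * \<i> * (of_real q * fst p + cform x (snd p))))) (at (\<tau>, z) within S)"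
    using has_derivative_compose[OF bounded_linear_imp_has_derivative[OF lin], of exp "(*) (exp (2 * of_real pi * \<i> * (of_real q * \<tau> + cform x z)))" "(\<tau>, z)" S]
      DERIV_exp[of "2 * of_real pi * \<i> * (of_real q * \<tau> + cform x z)"]
    by (simp add: has_field_derivative_def)
  then show ?thesis
    by (simp add: case_prod_unfold ee_add[symmetric]) (simp add: ee_def)
qed

text \<open>
  Differentiation term by term. Near a given point the derivatives of the terms are dominated by a Gaussian in
  \<open>l\<close> times the norm of the direction, so that the partial sums over balls have uniformly convergent derivatives.
\<close>
lemma theta_jointly_holomorphic:
  assumes g: "periodic L g"
  shows "jointly_holomorphic L (theta L g)"
  unfolding jointly_holomorphic_def
proof (intro ballI)
  fix \<tau>0 z0 assume \<tau>0: "\<tau>0 \<in> UHP" and z0: "z0 \<in> complexify L"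
  define y where "y = Im \<tau>0 / 2"
  define r where "r = norm z0 + 1"
  have y: "y > 0" using \<tau>0 by (simp add: y_def UHP_def)
  define S where "S = {\<tau>. y < Im \<tau>} \<times> (complexify L \<inter> ball 0 r)"
  have convS: "convex S"
    unfolding S_def by (intro convex_Times convex_Int convex_complexify convex_ball convex_halfspace_Im_gt)
  have inS: "(\<tau>0, z0) \<in> S" using y z0 by (simp add: S_def y_def r_def)
  have SU: "\<tau> \<in> UHP" "z \<in> complexify L" "norm z \<le> r" "y \<le> Im \<tau>" if "(\<tau>, z) \<in> S" for \<tau> z
    using that y by (auto simp: S_def UHP_def)
  obtain K where K: "K > 0" "\<And>l. l \<in> Ld \<Longrightarrow> norm (g l) \<le> K" using periodic_bounded[OF g] by blast
  define A where "A n = {l \<in> Ld. norm l \<le> real n}" for n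
  have finA: "finite (A n)" for n unfolding A_def by (rule Ld_bounded_finite)
  have limA: "filterlim A (finite_subsets_at_top Ld) sequentially"
    unfolding filterlim_finite_subsets_at_top
  proof (intro allI impI)
    fix X assume X: "finite X \<and> X \<subseteq> Ld"
    obtain N where N: "\<And>x. x \<in> X \<Longrightarrow> norm x \<le> real N"
    proof -
      obtain N where "Max (insert 0 (norm ` X)) \<le> real N" using real_arch_simple by blast
      then show ?thesis using that[of N] X by (simp add: Max_le_iff)
    qed
    show "\<forall>\<^sub>F n in sequentially. finite (A n) \<and> X \<subseteq> A n \<and> A n \<subseteq> Ld"
      by (rule eventually_sequentiallyI[of N]) (use N X finA in \<open>force simp: A_def\<close>)
  qed
  define T where "T l \<tau> z = ee (of_real (l \<bullet> l / 2) * \<tau>) * ee (cform (l, 0) z)" for l :: 'a and \<tau> z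
  define T' where "T' l \<tau> z s w = g l * (T l \<tau> z * (2 * of_real pi * \<i> * (of_real (l \<bullet> l / 2) * s + cform (l, 0) w)))" for l \<tau> z s w
  define g' where "g' \<tau> z s w = (\<Sum>\<^sub>\<infinity>l\<in>Ld. T' l \<tau> z s w)" for \<tau> z s w
  define c where "c = pi * y / 2"
  have c: "c > 0" using y by (simp add: c_def)
  define B where "B l = K * (exp (2 * pi * r\<^sup>2 / y) * exp (- c * (norm l)\<^sup>2) * (2 * pi * ((norm l)\<^sup>2 / 2 + norm l)))" for l :: 'a
  have B0: "B l \<ge> 0" for l using K by (simp add: B_def)
  have Bsum: "B summable_on Ld"
  proof (rule summable_on_comparison_test)
    \<comment> \<open>half of the rate of decay \<open>c\<close> is spent on the polynomial factor in \<open>l\<close>\<close>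
    define M where "M = K * (exp (2 * pi * r\<^sup>2 / y) * (2 * pi * (2 / c + 1)))"
    show "(\<lambda>l. M * exp (- (c / 2) * (norm l)\<^sup>2)) summable_on Ld"
      using c by (intro summable_on_cmult_right Ld_gaussian) auto
    fix l :: 'a
    have "(norm l)\<^sup>2 / 2 + norm l \<le> (norm l)\<^sup>2 + 1 / 2"
      using zero_le_power2[of "norm l - 1"] by (simp add: power2_eq_square algebra_simps)
    also have "\<dots> \<le> (2 / c + 1) * (1 + c / 2 * (norm l)\<^sup>2)" using c by (simp add: field_simps)
    also have "\<dots> \<le> (2 / c + 1) * exp (c / 2 * (norm l)\<^sup>2)"
      using c by (intro mult_left_mono exp_ge_add_one_self) auto
    finally have "exp (- c * (norm l)\<^sup>2) * ((norm l)\<^sup>2 / 2 + norm l) \<le> exp (- c * (norm l)\<^sup>2) * ((2 / c + 1) * exp (c / 2 * (norm l)\<^sup>2))"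
      by (rule mult_left_mono) simp
    also have "\<dots> = (2 / c + 1) * exp (- (c / 2) * (norm l)\<^sup>2)" by (simp flip: exp_add)
    finally have "(K * exp (2 * pi * r\<^sup>2 / y) * (2 * pi)) * (exp (- c * (norm l)\<^sup>2) * ((norm l)\<^sup>2 / 2 + norm l)) \<le>
       (K * exp (2 * pi * r\<^sup>2 / y) * (2 * pi)) * ((2 / c + 1) * exp (- (c / 2) * (norm l)\<^sup>2))"
      using K by (intro mult_left_mono) auto
    then show "B l \<le> M * exp (- (c / 2) * (norm l)\<^sup>2)" by (simp only: B_def M_def mult_ac)
  qed (rule B0)
  have T'B: "norm (T' l \<tau> z s w) \<le> B l * norm (s, w)" if S: "(\<tau>, z) \<in> S" and l: "l \<in> Ld" for l \<tau> z s w
  proof -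
    have "norm (of_real (l \<bullet> l / 2) * s + cform (l, 0) w) \<le> (norm l)\<^sup>2 / 2 * norm (s, w) + norm l * norm (s, w)"
    proof (rule order_trans[OF norm_triangle_ineq add_mono])
      show "norm (complex_of_real (l \<bullet> l / 2) * s) \<le> (norm l)\<^sup>2 / 2 * norm (s, w)"
        unfolding norm_mult norm_of_real using norm_fst_le[of s w] by (intro mult_mono) (auto simp: power2_norm_eq_inner)
      show "norm (cform (l, 0) w) \<le> norm l * norm (s, w)"
        using norm_cform_dual_le[of l w] norm_snd_le[of w s] mult_left_mono[of "norm w" "norm (s, w)" "norm l"] by fastforce
    qed
    also have "\<dots> = ((norm l)\<^sup>2 / 2 + norm l) * norm (s, w)" by (simp add: algebra_simps)
    finally have 1: "norm (of_real (l \<bullet> l / 2) * s + cform (l, 0) w) \<le> ((norm l)\<^sup>2 / 2 + norm l) * norm (s, w)" .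
    have 2: "norm (T l \<tau> z) \<le> exp (2 * pi * r\<^sup>2 / y) * exp (- c * (norm l)\<^sup>2)"
      unfolding T_def c_def using SU[OF S] y by (intro theta_term_bound) auto
    have "norm (T' l \<tau> z s w) = norm (g l) * (norm (T l \<tau> z) * (2 * pi * norm (of_real (l \<bullet> l / 2) * s + cform (l, 0) w)))"
      by (simp only: T'_def norm_mult) simp
    also have "\<dots> \<le> K * (exp (2 * pi * r\<^sup>2 / y) * exp (- c * (norm l)\<^sup>2) * (2 * pi * (((norm l)\<^sup>2 / 2 + norm l) * norm (s, w))))"
      using K(1) by (intro mult_mono K(2)[OF l] 1 2) auto
    also have "\<dots> = B l * norm (s, w)" by (simp add: B_def)
    finally show ?thesis .
  qed
  have T'sum: "(\<lambda>l. T' l \<tau> z s w) summable_on Ld" if S: "(\<tau>, z) \<in> S" for \<tau> z s w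
    by (rule abs_summable_summable, rule summable_on_comparison_test[OF summable_on_cmult_left[OF Bsum, of "norm (s, w)"]])
       (use T'B[OF S] in auto)
  define f where "f n p = (\<Sum>l\<in>A n. g l * T l (fst p) (snd p))" for n p
  have "\<exists>h. \<forall>p\<in>S. (\<lambda>n. f n p) \<longlonglongrightarrow> h p \<and> (h has_derivative (\<lambda>(s, w). g' (fst p) (snd p) s w)) (at p within S)"
  proof (rule has_derivative_sequence[OF convS])
    fix n p assume "p \<in> S"
    show "(f n has_derivative (\<lambda>(s, w). \<Sum>l\<in>A n. T' l (fst p) (snd p) s w)) (at p within S)"
    proof -
      have "((\<lambda>p. g l * T l (fst p) (snd p)) has_derivative (\<lambda>q. T' l (fst p) (snd p) (fst q) (snd q))) (at p within S)" for l
        unfolding T'_def T_def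
        using has_derivative_mult_right[OF theta_term_derivative[of "l \<bullet> l / 2" "(l, 0)" "fst p" "snd p" S], of "g l"]
        by (simp add: case_prod_unfold)
      then have "((\<lambda>p. \<Sum>l\<in>A n. g l * T l (fst p) (snd p)) has_derivative (\<lambda>q. \<Sum>l\<in>A n. T' l (fst p) (snd p) (fst q) (snd q))) (at p within S)"
        by (intro has_derivative_sum)
      then show ?thesis by (simp only: f_def[abs_def] case_prod_unfold)
    qed
  next
    fix e :: real assume e: "e > 0"
    obtain F where F: "finite F" "F \<subseteq> Ld" "dist (sum B F) (infsum B Ld) \<le> e"
      using infsum_finite_approximation[OF Bsum e] by blast
    have ev: "\<forall>\<^sub>F n in sequentially. F \<subseteq> A n"
    proof -
      have "\<forall>\<^sub>F n in sequentially. finite (A n) \<and> F \<subseteq> A n \<and> A n \<subseteq> Ld"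
        using limA F(1,2) unfolding filterlim_finite_subsets_at_top by blast
      then show ?thesis by eventually_elim blast
    qed
    show "\<forall>\<^sub>F n in sequentially. \<forall>p\<in>S. \<forall>h. norm ((case h of (s, w) \<Rightarrow> \<Sum>l\<in>A n. T' l (fst p) (snd p) s w) - (case h of (s, w) \<Rightarrow> g' (fst p) (snd p) s w)) \<le> e * norm h"
      using ev
    proof eventually_elim
      case (elim n)
      have Bs: "B summable_on (Ld - A n)" using Bsum by (rule summable_on_subset_banach) auto
      have AL: "A n \<subseteq> Ld" by (auto simp: A_def)
      have un: "A n \<union> (Ld - A n) = Ld" using AL by auto
      have "infsum B Ld = sum B (A n) + infsum B (Ld - A n)"
        using infsum_Un_disjoint[of B "A n" "Ld - A n"] finA[of n] Bs un by simp
      moreover have "sum B F \<le> sum B (A n)" using elim finA B0 by (intro sum_mono2) auto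
      ultimately have tail: "infsum B (Ld - A n) \<le> e" using F(3) unfolding dist_real_def by linarith
      show ?case
      proof (intro ballI allI)
        fix p and h :: "complex \<times> 'a \<times> 'a" assume p: "p \<in> S"
        obtain \<tau> z where pz: "p = (\<tau>, z)" by (cases p)
        obtain s w where h: "h = (s, w)" by (cases h)
        have S: "(\<tau>, z) \<in> S" using p pz by simp
        have ts: "(\<lambda>l. T' l \<tau> z s w) summable_on (Ld - A n)" using T'sum[OF S] by (rule summable_on_subset_banach) auto
        have "g' \<tau> z s w = (\<Sum>l\<in>A n. T' l \<tau> z s w) + infsum (\<lambda>l. T' l \<tau> z s w) (Ld - A n)"
          unfolding g'_def using infsum_Un_disjoint[of "\<lambda>l. T' l \<tau> z s w" "A n" "Ld - A n"] finA[of n] ts un by simp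
        then have "norm ((\<Sum>l\<in>A n. T' l \<tau> z s w) - g' \<tau> z s w) = norm (infsum (\<lambda>l. T' l \<tau> z s w) (Ld - A n))" by simp
        also have "\<dots> \<le> infsum B (Ld - A n) * norm (s, w)"
          by (rule norm_infsum_le[OF has_sum_infsum[OF ts] has_sum_cmult_left[OF has_sum_infsum[OF Bs]]])
             (use T'B[OF S] in auto)
        also have "\<dots> \<le> e * norm (s, w)" using tail by (rule mult_right_mono) simp
        finally show "norm ((case h of (s, w) \<Rightarrow> \<Sum>l\<in>A n. T' l (fst p) (snd p) s w) - (case h of (s, w) \<Rightarrow> g' (fst p) (snd p) s w)) \<le> e * norm h"
          by (simp add: pz h)
      qed
    qed
  next
    show "(\<tau>0, z0) \<in> S" by (rule inS)
    show "(\<lambda>n. f n (\<tau>0, z0)) \<longlonglongrightarrow> theta L g \<tau>0 z0"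
      using filterlim_compose[OF theta_has_sum[OF g \<tau>0, of z0, unfolded has_sum_def] limA] by (simp add: f_def T_def)
  qed
  then obtain h where h: "\<And>p. p \<in> S \<Longrightarrow> (\<lambda>n. f n p) \<longlonglongrightarrow> h p"
    "\<And>p. p \<in> S \<Longrightarrow> (h has_derivative (\<lambda>(s, w). g' (fst p) (snd p) s w)) (at p within S)" by blast
  have htheta: "(\<lambda>(\<tau>, z). theta L g \<tau> z) p = h p" if p: "p \<in> S" for p
  proof -
    obtain \<tau> z where pz: "p = (\<tau>, z)" by (cases p)
    have "\<tau> \<in> UHP" using p pz SU by auto
    then have "(\<lambda>n. f n p) \<longlonglongrightarrow> theta L g \<tau> z"
      using filterlim_compose[OF theta_has_sum[OF g, of \<tau> z, unfolded has_sum_def] limA] by (simp add: f_def T_def pz)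
    then show ?thesis using h(1)[OF p] LIMSEQ_unique pz by auto
  qed
  have "((\<lambda>(\<tau>, z). theta L g \<tau> z) has_derivative (\<lambda>(s, w). g' \<tau>0 z0 s w)) (at (\<tau>0, z0) within S)"
    using has_derivative_transform[OF inS htheta h(2)[OF inS]] by simp
  moreover have "at (\<tau>0, z0) within S = at (\<tau>0, z0) within UHP \<times> complexify L"
  proof (rule at_within_nhd[where S="{\<tau>. y < Im \<tau>} \<times> ball 0 r"])
    show "(\<tau>0, z0) \<in> {\<tau>. y < Im \<tau>} \<times> ball 0 r" using inS by (simp add: S_def)
    show "open ({\<tau>. y < Im \<tau>} \<times> ball (0::'a \<times> 'a) r)" by (intro open_Times open_halfspace_Im_gt open_ball)
    show "S \<inter> ({\<tau>. y < Im \<tau>} \<times> ball 0 r) - {(\<tau>0, z0)} = UHP \<times> complexify L \<inter> ({\<tau>. y < Im \<tau>} \<times> ball 0 r) - {(\<tau>0, z0)}"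
      using y by (auto simp: S_def UHP_def)
  qed
  moreover have "(\<lambda>(s, w). g' \<tau>0 z0 s w) (w * s, cscale w v) = w * (\<lambda>(s, w). g' \<tau>0 z0 s w) (s, v)" for w s v
    unfolding g'_def case_prod_conv by (subst infsum_cmult_right'[symmetric]) (simp add: T'_def cform_scale_right algebra_simps)
  ultimately show "\<exists>D. ((\<lambda>(\<tau>, z). theta L g \<tau> z) has_derivative D) (at (\<tau>0, z0) within UHP \<times> complexify L) \<and>
          (\<forall>w s. \<forall>y\<in>complexify L. D (w * s, cscale w y) = w * D (s, y))"
    by (intro exI[of _ "\<lambda>(s, w). g' \<tau>0 z0 s w"]) auto
qed

end

section \<open>Theta inversion\<close>

lemma ee_quarter: "ee (1 / 4) = \<i>"
proof -
  have "2 * complex_of_real pi * \<i> * (1 / 4) = \<i> * of_real (pi / 2)" by simp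
  then show ?thesis unfolding ee_def by (simp only: cis_conv_exp[symmetric]) simp
qed

lemma csqrt_imaginary:
  assumes "s > 0" shows "csqrt (\<i> * of_real s) = of_real (sqrt s) * ee (1 / 8)"
proof (rule csqrt_unique)
  have "(ee (1 / 8))\<^sup>2 = \<i>" unfolding power2_eq_square ee_add[symmetric] by (simp add: ee_quarter)
  then show "(of_real (sqrt s) * ee (1 / 8))\<^sup>2 = \<i> * of_real s"
    using assms by (simp add: power_mult_distrib flip: of_real_power)
  have "2 * complex_of_real pi * \<i> * (1 / 8) = \<i> * of_real (pi / 4)" by simp
  then have "Re (ee (1 / 8)) = cos (pi / 4)"
    unfolding ee_def by (simp only: cis_conv_exp[symmetric]) simp
  then have "0 < Re (ee (1 / 8))" by (simp only: cos_45) simp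
  then show "0 < Re (of_real (sqrt s) * ee (1 / 8)) \<or> Re (of_real (sqrt s) * ee (1 / 8)) = 0 \<and> 0 \<le> Im (of_real (sqrt s) * ee (1 / 8))"
    using assms by simp
qed

lemma csqrt_normalised_imaginary:
  assumes "s > 0" shows "csqrt (\<i> * of_real s) * ee (- 1 / 8) = of_real (sqrt s)"
  using ee_minus_mult(2)[of "1 / 8"] unfolding csqrt_imaginary[OF assms] by (simp add: mult.assoc)

lemma csqrt_holomorphic_UHP: "csqrt holomorphic_on UHP"
  by (rule holomorphic_on_subset[OF holomorphic_on_csqrt]) (auto simp: UHP_def complex_nonpos_Reals_iff)

context even_lattice
begin

lemma theta_coset:
  assumes r: "r \<in> Ld"
  shows "theta L (\<lambda>l. if l - r \<in> L then 1 else 0) \<tau> z =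
    (\<Sum>\<^sub>\<infinity>x\<in>L. ee (of_real ((x + r) \<bullet> (x + r) / 2) * \<tau>) * ee (cform (x + r, 0) z))"
proof -
  let ?T = "\<lambda>l. ee (of_real (l \<bullet> l / 2) * \<tau>) * ee (cform (l, 0) z)"
  have "theta L (\<lambda>l. if l - r \<in> L then 1 else 0) \<tau> z = infsum ?T ((\<lambda>x. x + r) ` L)"
    unfolding theta_def
  proof (rule infsum_cong_neutral)
    fix l assume "l \<in> Ld - (\<lambda>x. x + r) ` L"
    then have "l - r \<notin> L" by (metis Diff_iff diff_add_cancel image_eqI)
    then show "(if l - r \<in> L then 1 else 0) * ?T l = 0" by simp
  next
    fix l assume "l \<in> (\<lambda>x. x + r) ` L - Ld"
    then show "?T l = 0" using r L_Ld Ld_add by auto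
  next
    fix l assume "l \<in> Ld \<inter> (\<lambda>x. x + r) ` L"
    then show "(if l - r \<in> L then 1 else 0) * ?T l = ?T l" by auto
  qed
  then show ?thesis by (subst (asm) infsum_reindex) (auto simp: inj_on_def o_def)
qed

lemma periodic_character: "r \<in> Ld \<Longrightarrow> periodic L (\<lambda>y. ee (- of_real (r \<bullet> y)))"
  unfolding periodic_def using ee_of_real_Ints[OF Ld_integral(1)]
  by (auto simp: inner_simps ee_add ee_minus ee_diff)

lemma periodic_const: "periodic L (\<lambda>y. c)"
  by (simp add: periodic_def)

lemma periodic_sum: "(\<And>s. s \<in> S \<Longrightarrow> periodic L (h s)) \<Longrightarrow> periodic L (\<lambda>y. \<Sum>s\<in>S. c s * h s y)"
  unfolding periodic_def by (auto intro!: sum.cong)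

lemma theta_sum:
  assumes "finite S" "\<And>s. s \<in> S \<Longrightarrow> periodic L (h s)" "\<tau> \<in> UHP"
  shows "theta L (\<lambda>y. \<Sum>s\<in>S. c s * h s y) \<tau> z = (\<Sum>s\<in>S. c s * theta L (h s) \<tau> z)"
proof -
  have "((\<lambda>l. \<Sum>s\<in>S. c s * (h s l * (ee (of_real (l \<bullet> l / 2) * \<tau>) * ee (cform (l, 0) z)))) has_sum (\<Sum>s\<in>S. c s * theta L (h s) \<tau> z)) Ld"
    using assms by (intro has_sum_finite_sum has_sum_cmult_right theta_has_sum) auto
  then have "((\<lambda>l. (\<Sum>s\<in>S. c s * h s l) * (ee (of_real (l \<bullet> l / 2) * \<tau>) * ee (cform (l, 0) z))) has_sum (\<Sum>s\<in>S. c s * theta L (h s) \<tau> z)) Ld"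
    by (simp only: sum_distrib_right mult.assoc)
  then show ?thesis
    unfolding theta_def by (rule infsumI)
qed

lemma theta_scale: "theta L (\<lambda>y. c * h y) \<tau> z = c * theta L h \<tau> z"
  unfolding theta_def by (simp add: infsum_cmult_right' mult.assoc)

text \<open>
  For \<open>\<tau> = i s\<close> this is Poisson summation for a Gaussian on the coset of \<open>r\<close>, shifted by the real part of \<open>z\<close> and
  with a phase given by its imaginary part.
\<close>
lemma theta_inversion_imaginary:
  "\<exists>C>0. \<forall>s>0. \<forall>r\<in>Ld. \<forall>z\<in>complexify L.
     theta L (\<lambda>l. if l - r \<in> L then 1 else 0) (\<i> / of_real s) (cscale (- \<i> / of_real s) z) =
     of_real C * of_real (sqrt s) ^ dim L * ee (cform z z / (2 * (\<i> * of_real s))) * theta L (\<lambda>y. ee (- of_real (r \<bullet> y))) (\<i> * of_real s) z"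
proof -
  obtain E where E: "finite E" "independent E" "L = zspan E" using basis_exists .
  have sp: "span L = span E" using span_zspan[OF E(1)] E(3) by simp
  have n: "dim L = card E" using dim_span[of L] dim_span[of E] dim_eq_card_independent[OF E(2)] sp by simp
  have Ld: "Ld = zdual E" using dual_lattice_zspan[OF E(1)] E(3) by simp
  obtain C where C: "C > 0" and P: "\<And>t v z. t > 0 \<Longrightarrow> v \<in> span E \<Longrightarrow> z \<in> span E \<Longrightarrow>
    (\<Sum>\<^sub>\<infinity>x\<in>zspan E. complex_of_real (exp (- pi * t * (norm (x + v))\<^sup>2)) * ee (of_real (x \<bullet> z))) =
    of_real (C * (1 / sqrt t) ^ card E) *
      (\<Sum>\<^sub>\<infinity>y\<in>zdual E. complex_of_real (exp (- pi * (norm (y + z))\<^sup>2 / t)) * ee (- of_real (v \<bullet> (y + z))))"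
    using poisson_gaussian_lattice[OF E(1,2)] by blast
  have "theta L (\<lambda>l. if l - r \<in> L then 1 else 0) (\<i> / of_real s) (cscale (- \<i> / of_real s) z) =
     of_real C * of_real (sqrt s) ^ dim L * ee (cform z z / (2 * (\<i> * of_real s))) * theta L (\<lambda>y. ee (- of_real (r \<bullet> y))) (\<i> * of_real s) z"
    if s: "s > 0" and r: "r \<in> Ld" and z: "z \<in> complexify L" for s r z
  proof -
    obtain p q where pq: "z = (p, q)" by (cases z)
    have pqs: "p \<in> span E" "q \<in> span E" using z by (auto simp: pq complexify_def sp)
    have rs: "r \<in> span E" using Ld_span[OF r] sp by simp
    define c where "c = complex_of_real (exp (pi * (norm p)\<^sup>2 / s)) * ee (of_real (r \<bullet> q / s))"
    have cs: "cscale (- \<i> / of_real s) (p, q) = ((1 / s) *\<^sub>R q, - (1 / s) *\<^sub>R p)"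
      by (simp add: cscale_def Re_divide Im_divide power2_eq_square)
    have 1: "ee (of_real ((x + r) \<bullet> (x + r) / 2) * (\<i> / of_real s)) * ee (cform (x + r, 0) (cscale (- \<i> / of_real s) z))
       = c * (complex_of_real (exp (- pi * (1 / s) * (norm (x + (r - p)))\<^sup>2)) * ee (of_real (x \<bullet> ((1 / s) *\<^sub>R q))))" for x
    proof -
      have n1: "(norm (x + (r - p)))\<^sup>2 = (x + r) \<bullet> (x + r) - 2 * ((x + r) \<bullet> p) + p \<bullet> p"
        by (simp add: power2_norm_eq_inner inner_simps inner_commute)
      show ?thesis
        using s unfolding c_def ee_def exp_of_real[symmetric] exp_add[symmetric] n1 pq cs cform_dual power2_norm_eq_inner[of p]
        by (intro arg_cong[of _ _ exp]) (simp add: complex_eq_iff inner_simps inner_commute[of r x] field_simps)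
    qed
    have 2: "c * (complex_of_real (exp (- pi * (norm (y + (1 / s) *\<^sub>R q))\<^sup>2 / (1 / s))) * ee (- of_real ((r - p) \<bullet> (y + (1 / s) *\<^sub>R q))))
       = ee (cform z z / (2 * (\<i> * of_real s))) * (ee (- of_real (r \<bullet> y)) * (ee (of_real (y \<bullet> y / 2) * (\<i> * of_real s)) * ee (cform (y, 0) z)))" for y
    proof -
      have n2: "(norm (y + (1 / s) *\<^sub>R q))\<^sup>2 = y \<bullet> y + 2 * (y \<bullet> q) / s + q \<bullet> q / (s * s)"
        using s by (simp add: power2_norm_eq_inner inner_simps inner_commute field_simps)
      have cz: "cform z z / (2 * (\<i> * of_real s)) = Complex ((p \<bullet> q) / s) (- (p \<bullet> p - q \<bullet> q) / (2 * s))"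
        using s by (simp add: pq cform_def complex_eq_iff Re_divide Im_divide power2_eq_square inner_commute field_simps)
      show ?thesis
        using s unfolding c_def ee_def exp_of_real[symmetric] exp_add[symmetric] n2 cz power2_norm_eq_inner[of p]
        by (intro arg_cong[of _ _ exp]) (simp add: pq cform_dual complex_eq_iff inner_simps inner_commute field_simps)
    qed
    have "theta L (\<lambda>l. if l - r \<in> L then 1 else 0) (\<i> / of_real s) (cscale (- \<i> / of_real s) z) =
      c * (\<Sum>\<^sub>\<infinity>x\<in>zspan E. complex_of_real (exp (- pi * (1 / s) * (norm (x + (r - p)))\<^sup>2)) * ee (of_real (x \<bullet> ((1 / s) *\<^sub>R q))))"
      unfolding theta_coset[OF r] 1 E(3)[symmetric] by (rule infsum_cmult_right')
    also have "\<dots> = c * (of_real (C * (1 / sqrt (1 / s)) ^ card E) *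
      (\<Sum>\<^sub>\<infinity>y\<in>zdual E. complex_of_real (exp (- pi * (norm (y + (1 / s) *\<^sub>R q))\<^sup>2 / (1 / s))) * ee (- of_real ((r - p) \<bullet> (y + (1 / s) *\<^sub>R q)))))"
      using s pqs rs by (subst P) (auto intro: span_diff span_scale)
    also have "\<dots> = of_real (C * (1 / sqrt (1 / s)) ^ card E) *
       (\<Sum>\<^sub>\<infinity>y\<in>zdual E. c * (complex_of_real (exp (- pi * (norm (y + (1 / s) *\<^sub>R q))\<^sup>2 / (1 / s))) * ee (- of_real ((r - p) \<bullet> (y + (1 / s) *\<^sub>R q)))))"
      unfolding infsum_cmult_right' by (simp only: mult_ac)
    also have "\<dots> = of_real (C * (1 / sqrt (1 / s)) ^ card E) * (ee (cform z z / (2 * (\<i> * of_real s))) * theta L (\<lambda>y. ee (- of_real (r \<bullet> y))) (\<i> * of_real s) z)"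
      unfolding 2 infsum_cmult_right' theta_def Ld ..
    finally show ?thesis using s by (simp add: n real_sqrt_divide)
  qed
  then show ?thesis using C by blast
qed

text \<open>
  For fixed \<open>z\<close> and a coset of \<open>L\<close> both sides are holomorphic in \<open>\<tau>\<close> and agree on the imaginary axis, hence
  everywhere. General \<open>g\<close> are linear combinations of indicator functions of cosets.
\<close>
lemma theta_inversion_const:
  "\<exists>C>0. \<forall>g. periodic L g \<longrightarrow> (\<forall>\<tau>\<in>UHP. \<forall>z\<in>complexify L.
     theta L g (- 1 / \<tau>) (cscale (1 / \<tau>) z) =
     of_real C * (csqrt \<tau> * ee (- 1 / 8)) ^ dim L * ee (cform z z / (2 * \<tau>)) *
       theta L (\<lambda>y. \<Sum>r\<in>coset_reps L. g r * ee (- of_real (r \<bullet> y))) \<tau> z)"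
proof -
  obtain C where C: "C > 0" and I: "\<And>s r z. s > 0 \<Longrightarrow> r \<in> Ld \<Longrightarrow> z \<in> complexify L \<Longrightarrow>
     theta L (\<lambda>l. if l - r \<in> L then 1 else 0) (\<i> / of_real s) (cscale (- \<i> / of_real s) z) =
     of_real C * of_real (sqrt s) ^ dim L * ee (cform z z / (2 * (\<i> * of_real s))) * theta L (\<lambda>y. ee (- of_real (r \<bullet> y))) (\<i> * of_real s) z"
    using theta_inversion_imaginary by blast
  have coset: "theta L (\<lambda>l. if l - r \<in> L then 1 else 0) (- 1 / \<tau>) (cscale (1 / \<tau>) z) =
     of_real C * (csqrt \<tau> * ee (- 1 / 8)) ^ dim L * ee (cform z z / (2 * \<tau>)) * theta L (\<lambda>y. ee (- of_real (r \<bullet> y))) \<tau> z"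
    if r: "r \<in> Ld" and \<tau>: "\<tau> \<in> UHP" and z: "z \<in> complexify L" for r \<tau> z
  proof -
    define f where "f \<tau> = theta L (\<lambda>l. if l - r \<in> L then 1 else 0) (- 1 / \<tau>) (cscale (1 / \<tau>) z) -
      of_real C * (csqrt \<tau> * ee (- 1 / 8)) ^ dim L * ee (cform z z / (2 * \<tau>)) * theta L (\<lambda>y. ee (- of_real (r \<bullet> y))) \<tau> (cscale 1 z)" for \<tau>
    have hol: "f holomorphic_on UHP"
      unfolding f_def
      by (intro holomorphic_intros csqrt_holomorphic_UHP jointly_holomorphic_compose[OF theta_jointly_holomorphic z]
          periodic_indicator periodic_character r minus_inverse_UHP) (auto dest: UHP_nonzero)
    have lim: "\<i> islimpt {\<i> * of_real s |s. s > 0}"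
      unfolding islimpt_approachable
    proof (intro allI impI)
      fix e :: real assume e: "e > 0"
      have "\<i> * of_real (1 + e / 2) \<in> {\<i> * of_real s |s. s > 0}" using e by (intro CollectI exI[of _ "1 + e / 2"]) auto
      moreover have d: "\<i> * of_real (1 + e / 2) - \<i> = \<i> * of_real (e / 2)" by (simp add: algebra_simps)
      have "dist (\<i> * of_real (1 + e / 2)) \<i> = e / 2" unfolding dist_norm d norm_mult norm_of_real using e by simp
      moreover have "\<i> * of_real (1 + e / 2) \<noteq> \<i>" using e by (simp add: complex_eq_iff)
      ultimately show "\<exists>x'\<in>{\<i> * of_real s |s. s > 0}. x' \<noteq> \<i> \<and> dist x' \<i> < e" using e by (intro bexI[of _ "\<i> * of_real (1 + e / 2)"]) simp_all
    qed
    have zero: "f w = 0" if w_in: "w \<in> {\<i> * of_real s |s. s > 0}" for w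
    proof -
      obtain s where w: "w = \<i> * of_real s" and s: "s > 0" using w_in by blast
      have "- 1 / w = \<i> / of_real s" "1 / w = - \<i> / of_real s" using s by (simp_all add: w field_simps)
      then show ?thesis unfolding f_def using I[OF s r z] csqrt_normalised_imaginary[OF s] by (simp add: w)
    qed
    have "f \<tau> = 0"
      by (rule analytic_continuation[OF hol open_UHP convex_connected[OF convex_UHP] _ _ lim zero \<tau>]) (auto simp: UHP_def)
    then show ?thesis by (simp add: f_def)
  qed
  have "theta L g (- 1 / \<tau>) (cscale (1 / \<tau>) z) =
     of_real C * (csqrt \<tau> * ee (- 1 / 8)) ^ dim L * ee (cform z z / (2 * \<tau>)) *
       theta L (\<lambda>y. \<Sum>r\<in>coset_reps L. g r * ee (- of_real (r \<bullet> y))) \<tau> z"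
    if g: "periodic L g" and \<tau>: "\<tau> \<in> UHP" and z: "z \<in> complexify L" for g \<tau> z
  proof -
    have "theta L g (- 1 / \<tau>) (cscale (1 / \<tau>) z) =
       (\<Sum>r\<in>coset_reps L. g r * (of_real C * (csqrt \<tau> * ee (- 1 / 8)) ^ dim L * ee (cform z z / (2 * \<tau>)) * theta L (\<lambda>y. ee (- of_real (r \<bullet> y))) \<tau> z))"
      unfolding theta_decompose[OF g minus_inverse_UHP[OF \<tau>]]
      by (rule sum.cong[OF refl]) (simp only: coset[OF coset_reps_Ld \<tau> z])
    also have "\<dots> = of_real C * (csqrt \<tau> * ee (- 1 / 8)) ^ dim L * ee (cform z z / (2 * \<tau>)) * (\<Sum>r\<in>coset_reps L. g r * theta L (\<lambda>y. ee (- of_real (r \<bullet> y))) \<tau> z)"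
      unfolding sum_distrib_left by (simp only: mult_ac)
    also have "(\<Sum>r\<in>coset_reps L. g r * theta L (\<lambda>y. ee (- of_real (r \<bullet> y))) \<tau> z) = theta L (\<lambda>y. \<Sum>r\<in>coset_reps L. g r * ee (- of_real (r \<bullet> y))) \<tau> z"
      by (rule theta_sum[symmetric]) (use \<tau> finite_coset_reps periodic_character coset_reps_Ld in auto)
    finally show ?thesis .
  qed
  then show ?thesis using C by blast
qed

lemma periodic_character_sum: "periodic L (\<lambda>y. \<Sum>r\<in>coset_reps L. c r * ee (- of_real (r \<bullet> y)))"
  by (rule periodic_sum) (use periodic_character coset_reps_Ld in auto)

text \<open>
  Inversion applied twice at \<open>\<tau> = i\<close> is the substitution of \<open>- z\<close> for \<open>z\<close>. Applied to the indicator function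
  of \<open>L\<close>, it expresses this indicator function as a multiple of a sum of characters.
\<close>
lemma inversion_constant:
  assumes C: "C > 0" and inv: "\<And>g \<tau> z. periodic L g \<Longrightarrow> \<tau> \<in> UHP \<Longrightarrow> z \<in> complexify L \<Longrightarrow>
     theta L g (- 1 / \<tau>) (cscale (1 / \<tau>) z) =
     of_real C * (csqrt \<tau> * ee (- 1 / 8)) ^ dim L * ee (cform z z / (2 * \<tau>)) *
       theta L (\<lambda>y. \<Sum>r\<in>coset_reps L. g r * ee (- of_real (r \<bullet> y))) \<tau> z" and y: "y \<in> Ld"
  shows "(if y \<in> L then 1 else 0) = of_real (C\<^sup>2) * (\<Sum>r\<in>coset_reps L. ee (- of_real (r \<bullet> y)))"
proof -
  have i: "\<i> \<in> UHP" by (simp add: UHP_def)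
  have w1: "csqrt \<i> * ee (- 1 / 8) = 1" using csqrt_normalised_imaginary[of 1] by simp
  have i1: "- 1 / \<i> = \<i>" "1 / \<i> = - \<i>" by (simp_all add: field_simps)
  have ind: "periodic L (\<lambda>l. if l \<in> L then 1 else 0 :: complex)" using periodic_indicator[of 0] by simp
  have inv_i: "theta L g \<i> (cscale (- \<i>) z) = of_real C * ee (cform z z / (2 * \<i>)) *
     theta L (\<lambda>y. \<Sum>r\<in>coset_reps L. g r * ee (- of_real (r \<bullet> y))) \<i> z"
    if "periodic L g" "z \<in> complexify L" for g z
    using inv[OF that(1) i that(2)] unfolding w1 i1 by simp
  have hat: "(\<Sum>r\<in>coset_reps L. (if r \<in> L then 1 else 0) * ee (- of_real (r \<bullet> y))) = 1" if y: "y \<in> Ld" for y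
  proof -
    have "(\<Sum>r\<in>coset_reps L. (if r \<in> L then 1 else 0) * ee (- of_real (r \<bullet> y))) = (\<Sum>r\<in>coset_reps L. if r = coset_rep L 0 then 1 else 0)"
    proof (rule sum.cong[OF refl])
      fix r assume r: "r \<in> coset_reps L"
      have "r \<in> L \<longleftrightarrow> r = coset_rep L 0" using coset_rep_eq_iff[OF r Ld_0] L_minus[of r] L_minus[of "- r"] by auto
      moreover have "ee (- of_real (r \<bullet> y)) = 1" if "r \<in> L" using ee_of_real_Ints[OF Ld_integral(2)[OF y that]] by (simp add: ee_minus)
      ultimately show "(if r \<in> L then 1 else 0) * ee (- of_real (r \<bullet> y)) = (if r = coset_rep L 0 then 1 else 0)" by simp
    qed
    then show ?thesis using finite_coset_reps coset_rep_in[OF Ld_0] by simp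
  qed
  define \<iota> where "\<iota> l = (if l \<in> L then 1 else 0 :: complex)" for l
  define K where "K y = (\<Sum>r\<in>coset_reps L. 1 * ee (- of_real (r \<bullet> y)))" for y
  have perK: "periodic L K" unfolding K_def by (rule periodic_character_sum)
  have "theta L \<iota> \<i> z = theta L (\<lambda>y. of_real (C\<^sup>2) * K y) \<i> z" if z: "z \<in> complexify L" for z
  proof -
    have z': "cscale (- \<i>) z \<in> complexify L" "- z \<in> complexify L" by (rule cscale_complexify[OF z], rule complexify_minus[OF z])
    have m: "cscale (- \<i>) (cscale (- \<i>) z) = - z" using cscale_minus[of 1 z] by (simp add: cscale_cscale)
    have "theta L \<iota> \<i> z = theta L \<iota> \<i> (- z)"
      unfolding theta_uminus by (rule theta_cong) (use L_minus[of "- _"] L_minus in \<open>auto simp: \<iota>_def\<close>)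
    also have "\<dots> = theta L \<iota> \<i> (cscale (- \<i>) (cscale (- \<i>) z))" by (simp only: m)
    also have "\<dots> = of_real C * ee (cform (cscale (- \<i>) z) (cscale (- \<i>) z) / (2 * \<i>)) *
        theta L (\<lambda>y. \<Sum>r\<in>coset_reps L. \<iota> r * ee (- of_real (r \<bullet> y))) \<i> (cscale (- \<i>) z)"
      by (rule inv_i[OF _ z'(1)]) (use ind in \<open>simp add: \<iota>_def[abs_def]\<close>)
    also have "theta L (\<lambda>y. \<Sum>r\<in>coset_reps L. \<iota> r * ee (- of_real (r \<bullet> y))) \<i> (cscale (- \<i>) z) = theta L (\<lambda>y. 1) \<i> (cscale (- \<i>) z)"
      by (rule theta_cong) (use hat in \<open>simp add: \<iota>_def\<close>)
    also have "theta L (\<lambda>y. 1) \<i> (cscale (- \<i>) z) = of_real C * ee (cform z z / (2 * \<i>)) * theta L K \<i> z"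
      unfolding K_def by (rule inv_i[OF periodic_const z])
    also have "cform (cscale (- \<i>) z) (cscale (- \<i>) z) = - cform z z" by (simp add: cform_scale_left cform_scale_right)
    finally have "theta L \<iota> \<i> z = of_real (C\<^sup>2) * (ee (- cform z z / (2 * \<i>)) * ee (cform z z / (2 * \<i>))) * theta L K \<i> z"
      by (simp add: power2_eq_square mult_ac)
    also have "ee (- cform z z / (2 * \<i>)) * ee (cform z z / (2 * \<i>)) = 1" by (simp flip: ee_add)
    finally show ?thesis by (simp add: theta_scale)
  qed
  from theta_unique[OF _ _ i this y] have "\<iota> y = of_real (C\<^sup>2) * K y"
    using ind perK by (simp add: \<iota>_def[abs_def] periodic_def)
  then show ?thesis by (simp add: \<iota>_def K_def)
qed

abbreviation disc :: nat where "disc \<equiv> card (coset_reps L)"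

lemma disc_pos: "disc > 0"
  using finite_coset_reps coset_reps_nonempty by (simp add: card_gt_0_iff)

text \<open>
  At \<open>y = 0\<close> the previous lemma determines the positive constant, and for general \<open>y\<close> it becomes the orthogonality
  of characters of \<open>L'/L\<close>.
\<close>
lemma
  shows theta_inversion: "periodic L g \<Longrightarrow> \<tau> \<in> UHP \<Longrightarrow> z \<in> complexify L \<Longrightarrow>
     theta L g (- 1 / \<tau>) (cscale (1 / \<tau>) z) =
     of_real (1 / sqrt disc) * (csqrt \<tau> * ee (- 1 / 8)) ^ dim L * ee (cform z z / (2 * \<tau>)) *
       theta L (\<lambda>y. \<Sum>r\<in>coset_reps L. g r * ee (- of_real (r \<bullet> y))) \<tau> z"
  and dual_orthogonality: "y \<in> Ld \<Longrightarrow> (\<Sum>r\<in>coset_reps L. ee (of_real (r \<bullet> y))) = (if y \<in> L then of_nat disc else 0)"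
proof -
  obtain C where C: "C > 0" and inv: "\<And>g \<tau> z. periodic L g \<Longrightarrow> \<tau> \<in> UHP \<Longrightarrow> z \<in> complexify L \<Longrightarrow>
     theta L g (- 1 / \<tau>) (cscale (1 / \<tau>) z) =
     of_real C * (csqrt \<tau> * ee (- 1 / 8)) ^ dim L * ee (cform z z / (2 * \<tau>)) *
       theta L (\<lambda>y. \<Sum>r\<in>coset_reps L. g r * ee (- of_real (r \<bullet> y))) \<tau> z"
    using theta_inversion_const by blast
  have *: "(if y \<in> L then 1 else 0) = of_real (C\<^sup>2) * (\<Sum>r\<in>coset_reps L. ee (- of_real (r \<bullet> y)))" if "y \<in> Ld" for y
    by (rule inversion_constant[OF C _ that]) (rule inv)
  have "complex_of_real (C\<^sup>2 * real disc) = 1" using *[OF Ld_0] by simp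
  then have C1: "C\<^sup>2 * real disc = 1" using of_real_eq_1_iff by blast
  have "C * sqrt disc = sqrt (C\<^sup>2 * real disc)" using C by (simp add: real_sqrt_mult)
  then have Cs: "C = 1 / sqrt disc" using C1 disc_pos by (simp add: field_simps)
  show "periodic L g \<Longrightarrow> \<tau> \<in> UHP \<Longrightarrow> z \<in> complexify L \<Longrightarrow>
     theta L g (- 1 / \<tau>) (cscale (1 / \<tau>) z) =
     of_real (1 / sqrt disc) * (csqrt \<tau> * ee (- 1 / 8)) ^ dim L * ee (cform z z / (2 * \<tau>)) *
       theta L (\<lambda>y. \<Sum>r\<in>coset_reps L. g r * ee (- of_real (r \<bullet> y))) \<tau> z"
    using inv unfolding Cs by blast
  show "y \<in> Ld \<Longrightarrow> (\<Sum>r\<in>coset_reps L. ee (of_real (r \<bullet> y))) = (if y \<in> L then of_nat disc else 0)"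
  proof -
    assume y: "y \<in> Ld"
    have "- y \<in> L \<longleftrightarrow> y \<in> L" using L_minus[of y] L_minus[of "- y"] by auto
    then have "(if y \<in> L then 1 else 0) = complex_of_real (C\<^sup>2) * (\<Sum>r\<in>coset_reps L. ee (of_real (r \<bullet> y)))"
      using *[OF Ld_minus[OF y]] by simp
    then have "complex_of_real (real disc) * (if y \<in> L then 1 else 0) = of_real (C\<^sup>2 * real disc) * (\<Sum>r\<in>coset_reps L. ee (of_real (r \<bullet> y)))"
      by simp
    then show ?thesis unfolding C1 by (auto split: if_splits)
  qed
qed

end

section \<open>The modular group acting on the upper half-plane\<close>

(* With the meaning for power series also in force, terms with many matrix entries are highly ambiguous. *)
no_notation fps_nth (infixl "$" 75)

text \<open>
  Integral matrices given by their rows, so that identities between them can be checked entry by entry.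
\<close>
definition mat2 :: "int \<Rightarrow> int \<Rightarrow> int \<Rightarrow> int \<Rightarrow> int^2^2" where
  "mat2 a b c d = vector [vector [a, b], vector [c, d]]"

lemma mat2_simps [simp]:
  "mat2 a b c d $ 1 $ 1 = a" "mat2 a b c d $ 1 $ 2 = b" "mat2 a b c d $ 2 $ 1 = c" "mat2 a b c d $ 2 $ 2 = d"
  by (simp_all add: mat2_def)

lemma mat2_eq_iff:
  fixes A B :: "int^2^2"
  shows "A = B \<longleftrightarrow> A$1$1 = B$1$1 \<and> A$1$2 = B$1$2 \<and> A$2$1 = B$2$1 \<and> A$2$2 = B$2$2"
  unfolding vec_eq_iff forall_2 by blast

lemma matrix_mult_2 [simp]:
  fixes A B :: "int^2^2"
  shows "(A ** B) $ i $ j = A$i$1 * B$1$j + A$i$2 * B$2$j"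
  by (simp add: matrix_matrix_mult_def sum_2)

lemma mat_1_simps [simp]:
  "(mat 1 :: int^2^2) $ 1 $ 1 = 1" "(mat 1 :: int^2^2) $ 1 $ 2 = 0" "(mat 1 :: int^2^2) $ 2 $ 1 = 0" "(mat 1 :: int^2^2) $ 2 $ 2 = 1"
  by (simp_all add: mat_def)

lemma SL2Z_iff: "A \<in> SL2Z \<longleftrightarrow> A$1$1 * A$2$2 - A$1$2 * A$2$1 = 1"
  by (simp add: SL2Z_def det_2)

lemma SL2Z_mult: "A \<in> SL2Z \<Longrightarrow> B \<in> SL2Z \<Longrightarrow> A ** B \<in> SL2Z"
  by (simp add: SL2Z_def det_mul)

lemma SL2Z_one [simp]: "mat 1 \<in> SL2Z"
  by (simp add: SL2Z_def)

text \<open>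
  The inverse of a matrix of determinant \<open>1\<close>.
\<close>
definition adj2 :: "int^2^2 \<Rightarrow> int^2^2" where
  "adj2 A = mat2 (A$2$2) (- A$1$2) (- A$2$1) (A$1$1)"

lemma adj2_SL2Z: "A \<in> SL2Z \<Longrightarrow> adj2 A \<in> SL2Z"
  by (simp add: SL2Z_iff adj2_def algebra_simps)

lemma adj2_mult: "A \<in> SL2Z \<Longrightarrow> adj2 A ** A = mat 1" "A \<in> SL2Z \<Longrightarrow> A ** adj2 A = mat 1"
  by (auto simp: SL2Z_iff adj2_def mat2_eq_iff algebra_simps)

lemma aut_factor_nonzero:
  assumes "A \<in> SL2Z" "\<tau> \<in> UHP" shows "aut_factor A \<tau> \<noteq> 0"
proof
  assume 0: "aut_factor A \<tau> = 0"
  have "Im (aut_factor A \<tau>) = of_int (A$2$1) * Im \<tau>" by (simp add: aut_factor_def)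
  then have "A$2$1 = 0" using 0 assms by (auto simp: UHP_def)
  moreover have "A$2$2 = 0" using 0 \<open>A$2$1 = 0\<close> by (simp add: aut_factor_def)
  ultimately show False using assms by (simp add: SL2Z_iff)
qed

lemma moebius_act_UHP:
  assumes A: "A \<in> SL2Z" and \<tau>: "\<tau> \<in> UHP" shows "moebius_act A \<tau> \<in> UHP"
proof -
  let ?j = "aut_factor A \<tau>"
  have "Im (moebius_act A \<tau>) = Im ((of_int (A$1$1) * \<tau> + of_int (A$1$2)) * cnj ?j) / (cmod ?j)\<^sup>2"
    unfolding moebius_act_def by (subst complex_div_cnj) (simp only: Im_divide_of_real of_real_power[symmetric])
  also have "Im ((of_int (A$1$1) * \<tau> + of_int (A$1$2)) * cnj ?j) = of_int (A$1$1 * A$2$2 - A$1$2 * A$2$1) * Im \<tau>"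
    by (simp add: aut_factor_def algebra_simps)
  also have "A$1$1 * A$2$2 - A$1$2 * A$2$1 = 1" using A by (simp add: SL2Z_iff)
  finally show ?thesis using \<tau> aut_factor_nonzero[OF A \<tau>] by (simp add: UHP_def)
qed

lemma aut_factor_mult:
  assumes "B \<in> SL2Z" "\<tau> \<in> UHP"
  shows "aut_factor (A ** B) \<tau> = aut_factor A (moebius_act B \<tau>) * aut_factor B \<tau>"
  using aut_factor_nonzero[OF assms] by (simp add: aut_factor_def moebius_act_def field_simps)

lemma moebius_act_mult:
  assumes "A \<in> SL2Z" "B \<in> SL2Z" "\<tau> \<in> UHP"
  shows "moebius_act (A ** B) \<tau> = moebius_act A (moebius_act B \<tau>)"
proof -
  have B: "aut_factor B \<tau> \<noteq> 0" using aut_factor_nonzero assms by blast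
  have A: "aut_factor A (moebius_act B \<tau>) \<noteq> 0" using aut_factor_nonzero moebius_act_UHP assms by blast
  have "(of_int ((A ** B)$1$1) * \<tau> + of_int ((A ** B)$1$2)) = (of_int (A$1$1) * moebius_act B \<tau> + of_int (A$1$2)) * aut_factor B \<tau>"
    using B by (simp add: moebius_act_def field_simps) (simp add: aut_factor_def algebra_simps)
  then show ?thesis using A B unfolding moebius_act_def[of "A ** B"] moebius_act_def[of A] aut_factor_mult[OF assms(2,3)] by simp
qed

lemma moebius_act_one [simp]: "moebius_act (mat 1) \<tau> = \<tau>" and aut_factor_one [simp]: "aut_factor (mat 1) \<tau> = 1"
  by (simp_all add: moebius_act_def aut_factor_def)

lemma aut_factor_holomorphic: "aut_factor A holomorphic_on S"
  unfolding aut_factor_def by (intro holomorphic_intros)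

lemma moebius_act_holomorphic: "A \<in> SL2Z \<Longrightarrow> moebius_act A holomorphic_on UHP"
  unfolding moebius_act_def by (intro holomorphic_intros aut_factor_holomorphic) (use aut_factor_nonzero in auto)

section \<open>The Jacobi slash operator\<close>

text \<open>
  The part of the slash operator that depends on \<open>z\<close>. It is a cocycle, and it is common to all weights.
\<close>
definition index_factor :: "int^2^2 \<Rightarrow> complex \<Rightarrow> 'a::euclidean_space \<times> 'a \<Rightarrow> complex" where
  "index_factor A \<tau> z = exp (- \<i> * of_real pi * (of_int (A$2$1) * cform z z / aut_factor A \<tau>))"

lemma index_factor_nonzero [simp]: "index_factor A \<tau> z \<noteq> 0"
  by (simp add: index_factor_def)

lemma index_factor_one [simp]: "index_factor (mat 1) \<tau> z = 1"
  by (simp add: index_factor_def)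

lemma jslash_index_factor:
  "jslash k A \<phi> \<tau> z = aut_factor A \<tau> powi (- k) * index_factor A \<tau> z * \<phi> (moebius_act A \<tau>) (cscale (1 / aut_factor A \<tau>) z)"
  by (simp add: jslash_def index_factor_def)

lemma index_factor_mult:
  assumes "A \<in> SL2Z" "B \<in> SL2Z" "\<tau> \<in> UHP"
  shows "index_factor (A ** B) \<tau> z = index_factor A (moebius_act B \<tau>) (cscale (1 / aut_factor B \<tau>) z) * index_factor B \<tau> z"
proof -
  define jB where "jB = aut_factor B \<tau>"
  define jA where "jA = aut_factor A (moebius_act B \<tau>)"
  have B0: "jB \<noteq> 0" using aut_factor_nonzero assms by (simp add: jB_def)
  have A0: "jA \<noteq> 0" using aut_factor_nonzero moebius_act_UHP assms by (simp add: jA_def)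
  have det: "of_int (B$1$1) * of_int (B$2$2) - of_int (B$1$2) * of_int (B$2$1) = (1::complex)"
    using assms(2) unfolding SL2Z_iff by (metis of_int_1 of_int_diff of_int_mult)
  have jA: "jA * jB = of_int (A$2$1) * (of_int (B$1$1) * \<tau> + of_int (B$1$2)) + of_int (A$2$2) * jB"
    using B0 by (simp add: jA_def aut_factor_def[of A] moebius_act_def jB_def[symmetric] field_simps)
  have "of_int ((A ** B)$2$1) * jB = of_int (A$2$1) + of_int (B$2$1) * (jA * jB)"
  proof -
    have "of_int (A$2$1) + of_int (B$2$1) * (jA * jB) = of_int (A$2$1) * (of_int (B$1$1) * of_int (B$2$2) - of_int (B$1$2) * of_int (B$2$1)) + of_int (B$2$1) * (jA * jB)"
      unfolding det by simp
    also have "\<dots> = of_int ((A ** B)$2$1) * jB"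
      unfolding jA unfolding jB_def aut_factor_def by (simp add: algebra_simps)
    finally show ?thesis by simp
  qed
  then have c: "of_int ((A ** B)$2$1) = (of_int (A$2$1) + of_int (B$2$1) * (jA * jB)) / jB"
    using B0 by (simp add: eq_divide_eq del: matrix_mult_2)
  have "of_int ((A ** B)$2$1) * cform z z / (jA * jB) = of_int (A$2$1) * cform z z / (jB * jB * jA) + of_int (B$2$1) * cform z z / jB"
    unfolding c using A0 B0 by (simp add: field_simps)
  moreover have "cform (cscale (1 / jB) z) (cscale (1 / jB) z) = cform z z / (jB * jB)"
    by (simp add: cform_scale_left cform_scale_right)
  ultimately show ?thesis
    unfolding index_factor_def aut_factor_mult[OF assms(2,3)] jA_def[symmetric] jB_def[symmetric] exp_add[symmetric]
    by (intro arg_cong[of _ _ exp]) (simp add: algebra_simps)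
qed

lemma jslash_mult:
  assumes "A \<in> SL2Z" "B \<in> SL2Z" "\<tau> \<in> UHP"
  shows "jslash k B (jslash k A \<phi>) \<tau> z = jslash k (A ** B) \<phi> \<tau> z"
  unfolding jslash_index_factor index_factor_mult[OF assms] aut_factor_mult[OF assms(2,3)] moebius_act_mult[OF assms]
  by (simp add: power_int_mult_distrib cscale_cscale)

lemma jslash_one [simp]: "jslash k (mat 1) \<phi> \<tau> z = \<phi> \<tau> z"
  by (simp add: jslash_index_factor)

section \<open>Generators of the metaplectic group\<close>

definition mp_Tinv :: "(int^2^2) \<times> (complex \<Rightarrow> complex)" where
  "mp_Tinv = (mat2 1 (-1) 0 1, \<lambda>\<tau>. if \<tau> \<in> UHP then 1 else 0)"

lemma csqrt_nonzero_UHP: "\<tau> \<in> UHP \<Longrightarrow> csqrt \<tau> \<noteq> 0"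
  using UHP_nonzero by auto

lemma Mp2Z_iff: "(A, \<phi>) \<in> Mp2Z \<longleftrightarrow> A \<in> SL2Z \<and> \<phi> holomorphic_on UHP \<and>
    (\<forall>\<tau>\<in>UHP. (\<phi> \<tau>)\<^sup>2 = aut_factor A \<tau>) \<and> (\<forall>\<tau>. \<tau> \<notin> UHP \<longrightarrow> \<phi> \<tau> = 0)"
  by (simp add: Mp2Z_def)

lemma Mp2Z_nonzero: "(A, \<phi>) \<in> Mp2Z \<Longrightarrow> \<tau> \<in> UHP \<Longrightarrow> \<phi> \<tau> \<noteq> 0"
  using aut_factor_nonzero by (fastforce simp: Mp2Z_iff)

lemma holomorphic_on_if_UHP: "(\<lambda>\<tau>. if \<tau> \<in> UHP then f \<tau> else 0) holomorphic_on UHP \<longleftrightarrow> f holomorphic_on UHP"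
  by (rule holomorphic_cong) auto

lemma mp_one_Mp2Z: "mp_one \<in> Mp2Z"
  by (simp add: mp_one_def Mp2Z_iff holomorphic_on_if_UHP)

lemma mp_T_eq: "mp_T = (mat2 1 1 0 1, \<lambda>\<tau>. if \<tau> \<in> UHP then 1 else 0)"
  by (simp add: mp_T_def mat2_def)

lemma mp_S_eq: "mp_S = (mat2 0 (-1) 1 0, \<lambda>\<tau>. if \<tau> \<in> UHP then csqrt \<tau> else 0)"
  by (simp add: mp_S_def mat2_def)

lemma mp_T_Mp2Z: "mp_T \<in> Mp2Z"
  by (simp add: mp_T_eq Mp2Z_iff holomorphic_on_if_UHP SL2Z_iff aut_factor_def)

lemma mp_Tinv_Mp2Z: "mp_Tinv \<in> Mp2Z"
  by (simp add: mp_Tinv_def Mp2Z_iff holomorphic_on_if_UHP SL2Z_iff aut_factor_def)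

lemma mp_S_Mp2Z: "mp_S \<in> Mp2Z"
  by (simp add: mp_S_eq Mp2Z_iff holomorphic_on_if_UHP SL2Z_iff aut_factor_def csqrt_holomorphic_UHP)

lemma mp_mult_Mp2Z:
  assumes g: "g \<in> Mp2Z" and h: "h \<in> Mp2Z"
  shows "mp_mult g h \<in> Mp2Z"
proof -
  obtain A \<phi> where g_eq: "g = (A, \<phi>)" by (cases g)
  obtain B \<psi> where h_eq: "h = (B, \<psi>)" by (cases h)
  have A: "A \<in> SL2Z" "\<phi> holomorphic_on UHP" "\<And>\<tau>. \<tau> \<in> UHP \<Longrightarrow> (\<phi> \<tau>)\<^sup>2 = aut_factor A \<tau>"
    using g by (auto simp: g_eq Mp2Z_iff)
  have B: "B \<in> SL2Z" "\<psi> holomorphic_on UHP" "\<And>\<tau>. \<tau> \<in> UHP \<Longrightarrow> (\<psi> \<tau>)\<^sup>2 = aut_factor B \<tau>"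
    using h by (auto simp: h_eq Mp2Z_iff)
  have "(\<lambda>\<tau>. \<phi> (moebius_act B \<tau>)) holomorphic_on UHP"
    using holomorphic_on_compose_gen[OF moebius_act_holomorphic[OF B(1)] A(2)] moebius_act_UHP[OF B(1)]
    by (auto simp: o_def)
  then have "(\<lambda>\<tau>. \<phi> (moebius_act B \<tau>) * \<psi> \<tau>) holomorphic_on UHP" by (intro holomorphic_intros B)
  then show ?thesis
    using A B moebius_act_UHP[OF B(1)]
    by (simp add: g_eq h_eq mp_mult_def Mp2Z_iff SL2Z_mult holomorphic_on_if_UHP power_mult_distrib aut_factor_mult)
qed

lemma mp_mult_translation:
  assumes "(A, \<phi>) \<in> Mp2Z"
  shows "mp_mult (M, \<lambda>\<tau>. if \<tau> \<in> UHP then 1 else 0) (A, \<phi>) = (M ** A, \<phi>)"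
  using assms moebius_act_UHP by (auto simp: mp_mult_def Mp2Z_iff fun_eq_iff)

lemma mp_mult_S:
  assumes "(A, \<phi>) \<in> Mp2Z"
  shows "mp_mult mp_S (A, \<phi>) = (mat2 0 (-1) 1 0 ** A, \<lambda>\<tau>. if \<tau> \<in> UHP then csqrt (moebius_act A \<tau>) * \<phi> \<tau> else 0)"
  using assms moebius_act_UHP by (auto simp: mp_mult_def mp_S_eq Mp2Z_iff fun_eq_iff)

text \<open>
  Consequently each matrix has exactly two lifts to the metaplectic group, which differ by a sign.
\<close>
lemma square_one_constant_UHP:
  assumes "f holomorphic_on UHP" "\<And>\<tau>. \<tau> \<in> UHP \<Longrightarrow> (f \<tau>)\<^sup>2 = 1"
  shows "(\<forall>\<tau>\<in>UHP. f \<tau> = 1) \<or> (\<forall>\<tau>\<in>UHP. f \<tau> = -1)"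
proof -
  have sub: "f ` UHP \<subseteq> {1, -1}" using assms(2) by (auto simp: power2_eq_1_iff)
  then have "finite (f ` UHP)" by (rule finite_subset) simp
  then have "f constant_on UHP"
    using continuous_finite_range_constant[OF convex_connected[OF convex_UHP]] holomorphic_on_imp_continuous_on[OF assms(1)] by blast
  then obtain c where c: "\<And>\<tau>. \<tau> \<in> UHP \<Longrightarrow> f \<tau> = c" unfolding constant_on_def by blast
  have "\<i> \<in> UHP" by (simp add: UHP_def)
  then have "c = 1 \<or> c = -1" using sub c by blast
  then show ?thesis using c by auto
qed

text \<open>
  The metaplectic group is generated by \<open>S\<close>, \<open>T\<close> and the inverse of \<open>T\<close>. The Euclidean algorithm on the lower left
  entry of the matrix reduces every element to a product of generators and an element with matrix \<open>1\<close> or \<open>- 1\<close>. There are four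
  of the latter, and they are the powers of \<open>S\<^sup>2\<close>.
\<close>
theorem Mp2Z_induct [consumes 1, case_names one S T Tinv]:
  assumes g: "g \<in> Mp2Z" and one: "P mp_one"
    and S: "\<And>g. g \<in> Mp2Z \<Longrightarrow> P g \<Longrightarrow> P (mp_mult mp_S g)"
    and T: "\<And>g. g \<in> Mp2Z \<Longrightarrow> P g \<Longrightarrow> P (mp_mult mp_T g)"
    and Ti: "\<And>g. g \<in> Mp2Z \<Longrightarrow> P g \<Longrightarrow> P (mp_mult mp_Tinv g)"
  shows "P g"
proof -
  have Tn: "(mat2 1 n 0 1 ** A, \<phi>) \<in> Mp2Z \<and> P (mat2 1 n 0 1 ** A, \<phi>)" if A: "(A, \<phi>) \<in> Mp2Z" "P (A, \<phi>)" for A \<phi> n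
  proof (induction n rule: int_induct[where k=0])
    case base
    have "mat2 1 0 0 1 ** A = A" by (simp add: mat2_eq_iff)
    then show ?case using A by simp
  next
    case (step1 i)
    have "mat2 1 1 0 1 ** (mat2 1 i 0 1 ** A) = mat2 1 (i + 1) 0 1 ** A" by (simp add: mat2_eq_iff algebra_simps)
    then have "mp_mult mp_T (mat2 1 i 0 1 ** A, \<phi>) = (mat2 1 (i + 1) 0 1 ** A, \<phi>)"
      using step1 mp_mult_translation[of "mat2 1 i 0 1 ** A" \<phi> "mat2 1 1 0 1"] by (simp add: mp_T_eq)
    then show ?case using step1 T mp_mult_Mp2Z[OF mp_T_Mp2Z] by metis
  next
    case (step2 i)
    have "mat2 1 (-1) 0 1 ** (mat2 1 i 0 1 ** A) = mat2 1 (i - 1) 0 1 ** A" by (simp add: mat2_eq_iff algebra_simps)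
    then have "mp_mult mp_Tinv (mat2 1 i 0 1 ** A, \<phi>) = (mat2 1 (i - 1) 0 1 ** A, \<phi>)"
      using step2 mp_mult_translation[of "mat2 1 i 0 1 ** A" \<phi> "mat2 1 (-1) 0 1"] by (simp add: mp_Tinv_def)
    then show ?case using step2 Ti mp_mult_Mp2Z[OF mp_Tinv_Mp2Z] by metis
  qed
  \<comment> \<open>the second component of \<open>S\<^sup>2\<close>, a square root of \<open>- 1\<close>\<close>
  define j where "j \<tau> = csqrt (- 1 / \<tau>) * csqrt \<tau>" for \<tau>
  have j2: "(j \<tau>)\<^sup>2 = -1" if "\<tau> \<in> UHP" for \<tau>
    using UHP_nonzero[OF that] by (simp add: j_def power_mult_distrib)
  have j0: "j \<tau> \<noteq> 0" if "\<tau> \<in> UHP" for \<tau> using j2[OF that] by auto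
  have jhol: "j holomorphic_on UHP"
  proof -
    have "(\<lambda>\<tau>. csqrt (- 1 / \<tau>)) holomorphic_on UHP"
    proof -
      have "(\<lambda>\<tau>. - 1 / \<tau>) holomorphic_on UHP" by (intro holomorphic_intros) (auto dest: UHP_nonzero)
      then have "(csqrt \<circ> (\<lambda>\<tau>. - 1 / \<tau>)) holomorphic_on UHP"
        by (rule holomorphic_on_compose_gen[OF _ csqrt_holomorphic_UHP]) (use minus_inverse_UHP in auto)
      then show ?thesis by (simp add: o_def)
    qed
    then show ?thesis unfolding j_def by (rule holomorphic_on_mult[OF _ csqrt_holomorphic_UHP])
  qed
  let ?I = "mat 1 :: int^2^2" and ?M = "mat2 (-1) 0 0 (-1)"
  have SS: "P (mat2 (-s) 0 0 (-s), \<lambda>\<tau>. if \<tau> \<in> UHP then j \<tau> * f \<tau> else 0)"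
    if A: "(mat2 s 0 0 s, \<lambda>\<tau>. if \<tau> \<in> UHP then f \<tau> else 0) \<in> Mp2Z" "P (mat2 s 0 0 s, \<lambda>\<tau>. if \<tau> \<in> UHP then f \<tau> else 0)" and s: "s = 1 \<or> s = -1" for s f
  proof -
    have act: "moebius_act (mat2 s 0 0 s) \<tau> = \<tau>" for \<tau> using s by (auto simp: moebius_act_def aut_factor_def)
    have act2: "moebius_act (mat2 0 (-1) 1 0 ** mat2 s 0 0 s) \<tau> = - 1 / \<tau>" for \<tau>
      using s by (auto simp: moebius_act_def aut_factor_def)
    have 1: "mp_mult mp_S (mat2 s 0 0 s, \<lambda>\<tau>. if \<tau> \<in> UHP then f \<tau> else 0) = (mat2 0 (-1) 1 0 ** mat2 s 0 0 s, \<lambda>\<tau>. if \<tau> \<in> UHP then csqrt \<tau> * f \<tau> else 0)"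
      unfolding mp_mult_S[OF A(1)] act by (auto simp: fun_eq_iff)
    have m1: "(mat2 0 (-1) 1 0 ** mat2 s 0 0 s, \<lambda>\<tau>. if \<tau> \<in> UHP then csqrt \<tau> * f \<tau> else 0) \<in> Mp2Z"
      using mp_mult_Mp2Z[OF mp_S_Mp2Z A(1)] 1 by simp
    have mm: "mat2 0 (-1) 1 0 ** (mat2 0 (-1) 1 0 ** mat2 s 0 0 s) = mat2 (-s) 0 0 (-s)" by (simp add: mat2_eq_iff)
    have 2: "mp_mult mp_S (mat2 0 (-1) 1 0 ** mat2 s 0 0 s, \<lambda>\<tau>. if \<tau> \<in> UHP then csqrt \<tau> * f \<tau> else 0) = (mat2 (-s) 0 0 (-s), \<lambda>\<tau>. if \<tau> \<in> UHP then j \<tau> * f \<tau> else 0)"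
      unfolding mp_mult_S[OF m1] act2 mm by (auto simp: fun_eq_iff j_def)
    have "P (mat2 0 (-1) 1 0 ** mat2 s 0 0 s, \<lambda>\<tau>. if \<tau> \<in> UHP then csqrt \<tau> * f \<tau> else 0)"
      using S[OF A] 1 by simp
    from S[OF m1 this] 2 show ?thesis by simp
  qed
  have I_eq: "mat2 1 0 0 1 = ?I" by (simp add: mat2_eq_iff)
  have mem: "(mat2 s 0 0 s, \<lambda>\<tau>. if \<tau> \<in> UHP then f \<tau> else 0) \<in> Mp2Z"
    if "f holomorphic_on UHP" "\<And>\<tau>. \<tau> \<in> UHP \<Longrightarrow> (f \<tau>)\<^sup>2 = of_int s" "s = 1 \<or> s = -1" for s f
    using that by (auto simp: Mp2Z_iff SL2Z_iff holomorphic_on_if_UHP aut_factor_def)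
  have P1: "P (mat2 1 0 0 1, \<lambda>\<tau>. if \<tau> \<in> UHP then 1 else 0)" using one by (simp add: mp_one_def I_eq)
  have P2: "P (mat2 (-1) 0 0 (-1), \<lambda>\<tau>. if \<tau> \<in> UHP then j \<tau> * 1 else 0)"
    by (rule SS[OF mem P1]) auto
  have P3: "P (mat2 1 0 0 1, \<lambda>\<tau>. if \<tau> \<in> UHP then j \<tau> * (j \<tau> * 1) else 0)"
    using SS[OF mem P2] jhol j2 by simp
  have P4: "P (mat2 (-1) 0 0 (-1), \<lambda>\<tau>. if \<tau> \<in> UHP then j \<tau> * (j \<tau> * (j \<tau> * 1)) else 0)"
    by (rule SS[OF mem P3]) (use jhol j2 in \<open>auto intro!: holomorphic_intros simp: power2_eq_square\<close>)
  have jj: "(\<lambda>\<tau>. if \<tau> \<in> UHP then j \<tau> * (j \<tau> * f \<tau>) else 0) = (\<lambda>\<tau>. if \<tau> \<in> UHP then - f \<tau> else 0)" for f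
    using j2 by (auto simp: fun_eq_iff power2_eq_square mult.assoc[symmetric])
  have base1: "P (mat2 1 0 0 1, \<phi>)" if "(mat2 1 0 0 1, \<phi>) \<in> Mp2Z" for \<phi>
  proof -
    have \<phi>: "\<phi> holomorphic_on UHP" "\<And>\<tau>. \<tau> \<in> UHP \<Longrightarrow> (\<phi> \<tau>)\<^sup>2 = 1" "\<And>\<tau>. \<tau> \<notin> UHP \<Longrightarrow> \<phi> \<tau> = 0"
      using that by (auto simp: Mp2Z_iff aut_factor_def)
    from square_one_constant_UHP[OF \<phi>(1,2)] show ?thesis
    proof
      assume "\<forall>\<tau>\<in>UHP. \<phi> \<tau> = 1"
      then have "\<phi> = (\<lambda>\<tau>. if \<tau> \<in> UHP then 1 else 0)" using \<phi>(3) by auto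
      then show ?thesis using P1 by simp
    next
      assume "\<forall>\<tau>\<in>UHP. \<phi> \<tau> = -1"
      then have "\<phi> = (\<lambda>\<tau>. if \<tau> \<in> UHP then - 1 else 0)" using \<phi>(3) by auto
      then show ?thesis using P3 jj[of "\<lambda>_. 1"] by simp
    qed
  qed
  have base2: "P (?M, \<phi>)" if "(?M, \<phi>) \<in> Mp2Z" for \<phi>
  proof -
    have \<phi>: "\<phi> holomorphic_on UHP" "\<And>\<tau>. \<tau> \<in> UHP \<Longrightarrow> (\<phi> \<tau>)\<^sup>2 = -1" "\<And>\<tau>. \<tau> \<notin> UHP \<Longrightarrow> \<phi> \<tau> = 0"
      using that by (auto simp: Mp2Z_iff aut_factor_def)
    have "(\<lambda>\<tau>. \<phi> \<tau> / j \<tau>) holomorphic_on UHP" by (intro holomorphic_intros \<phi> jhol j0)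
    moreover have "(\<phi> \<tau> / j \<tau>)\<^sup>2 = 1" if "\<tau> \<in> UHP" for \<tau> using \<phi>(2)[OF that] j2[OF that] by (simp add: power_divide)
    ultimately have "(\<forall>\<tau>\<in>UHP. \<phi> \<tau> / j \<tau> = 1) \<or> (\<forall>\<tau>\<in>UHP. \<phi> \<tau> / j \<tau> = -1)" by (rule square_one_constant_UHP)
    then show ?thesis
    proof
      assume "\<forall>\<tau>\<in>UHP. \<phi> \<tau> / j \<tau> = 1"
      then have "\<phi> = (\<lambda>\<tau>. if \<tau> \<in> UHP then j \<tau> * 1 else 0)" using \<phi>(3) j0 by (auto simp: fun_eq_iff field_simps)
      then show ?thesis using P2 by simp
    next
      assume "\<forall>\<tau>\<in>UHP. \<phi> \<tau> / j \<tau> = -1"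
      then have "\<phi> = (\<lambda>\<tau>. if \<tau> \<in> UHP then - (j \<tau> * 1) else 0)" using \<phi>(3) j0 by (auto simp: fun_eq_iff field_simps)
      then show ?thesis using P4 jj[of "\<lambda>\<tau>. j \<tau> * 1"] by simp
    qed
  qed
  have "(A, \<phi>) \<in> Mp2Z \<Longrightarrow> m = nat \<bar>A$2$1\<bar> \<Longrightarrow> P (A, \<phi>)" for m A \<phi>
  proof (induction m arbitrary: A \<phi> rule: less_induct)
    case (less m)
    define a b c d where "a = A$1$1" and "b = A$1$2" and "c = A$2$1" and "d = A$2$2"
    have det: "a * d - b * c = 1" using less.prems by (simp add: Mp2Z_iff SL2Z_iff a_def b_def c_def d_def)
    have \<phi>: "\<phi> holomorphic_on UHP" "\<And>\<tau>. \<tau> \<in> UHP \<Longrightarrow> (\<phi> \<tau>)\<^sup>2 = aut_factor A \<tau>" "\<And>\<tau>. \<tau> \<notin> UHP \<Longrightarrow> \<phi> \<tau> = 0"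
      using less.prems by (auto simp: Mp2Z_iff)
    show ?case
    proof (cases "c = 0")
      case True
      then have "a * d = 1" using det by simp
      then have ad: "a = 1 \<and> d = 1 \<or> a = -1 \<and> d = -1" by (metis zmult_eq_1_iff)
      then show ?thesis
      proof
        assume ad: "a = 1 \<and> d = 1"
        have "mat2 1 b 0 1 ** mat2 1 0 0 1 = A" using ad True by (simp add: mat2_eq_iff a_def b_def c_def d_def)
        moreover have "(mat2 1 0 0 1, \<phi>) \<in> Mp2Z"
          using \<phi> ad True by (simp add: Mp2Z_iff SL2Z_iff aut_factor_def a_def b_def c_def d_def)
        ultimately show ?thesis using Tn[OF _ base1, of \<phi> b] by simp
      next
        assume ad: "a = -1 \<and> d = -1"
        have "mat2 1 (-b) 0 1 ** ?M = A" using ad True by (simp add: mat2_eq_iff a_def b_def c_def d_def)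
        moreover have "(?M, \<phi>) \<in> Mp2Z"
          using \<phi> ad True by (simp add: Mp2Z_iff SL2Z_iff aut_factor_def a_def b_def c_def d_def)
        ultimately show ?thesis using Tn[OF _ base2, of \<phi> "-b"] by simp
      qed
    next
      case False
      \<comment> \<open>one step of the Euclidean algorithm: \<open>S\<close> and \<open>T\<^sup>n\<close> replace the lower left entry \<open>c\<close> by \<open>a mod c\<close> up to sign\<close>
      define n where "n = a div c"
      define A' where "A' = mat2 c d (- (a - n * c)) (- (b - n * d))"
      have A': "A' \<in> SL2Z" using det by (simp add: A'_def SL2Z_iff algebra_simps)
      define \<phi>' where "\<phi>' \<tau> = (if \<tau> \<in> UHP then \<phi> \<tau> / csqrt (moebius_act A' \<tau>) else 0)" for \<tau>
      have act: "moebius_act A' \<tau> = aut_factor A \<tau> / aut_factor A' \<tau>" for \<tau>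
        by (simp add: moebius_act_def A'_def aut_factor_def c_def d_def)
      have s0: "csqrt (moebius_act A' \<tau>) \<noteq> 0" if "\<tau> \<in> UHP" for \<tau>
        using csqrt_nonzero_UHP[OF moebius_act_UHP[OF A' that]] .
      have mem': "(A', \<phi>') \<in> Mp2Z"
        unfolding Mp2Z_iff
      proof (intro conjI ballI allI impI)
        have "(\<lambda>\<tau>. csqrt (moebius_act A' \<tau>)) holomorphic_on UHP"
          using holomorphic_on_compose_gen[OF moebius_act_holomorphic[OF A'] csqrt_holomorphic_UHP] moebius_act_UHP[OF A']
          by (auto simp: o_def)
        then show "\<phi>' holomorphic_on UHP"
          unfolding \<phi>'_def[abs_def] holomorphic_on_if_UHP by (rule holomorphic_on_divide[OF \<phi>(1) _ s0])
        fix \<tau> assume \<tau>: "\<tau> \<in> UHP"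
        have A0: "aut_factor A \<tau> \<noteq> 0" "aut_factor A' \<tau> \<noteq> 0"
          using aut_factor_nonzero[OF _ \<tau>] A' less.prems by (auto simp: Mp2Z_iff)
        show "(\<phi>' \<tau>)\<^sup>2 = aut_factor A' \<tau>"
          using \<tau> \<phi>(2)[OF \<tau>] A0 by (simp add: \<phi>'_def power_divide act)
      qed (auto simp: A' \<phi>'_def)
      have lt: "nat \<bar>A'$2$1\<bar> < m"
      proof -
        have "\<bar>a mod c\<bar> < \<bar>c\<bar>" using False by (rule abs_mod_less)
        moreover have "a - n * c = a mod c" by (simp add: n_def minus_div_mult_eq_mod)
        ultimately show ?thesis using less.prems(2) False by (simp add: A'_def c_def)
      qed
      have P': "P (A', \<phi>')" using less.IH[OF lt mem' refl] .
      have Seq: "mp_mult mp_S (A', \<phi>') = (mat2 (a - n * c) (b - n * d) c d, \<phi>)"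
        unfolding mp_mult_S[OF mem'] using \<phi>(3) s0
        by (auto simp: mat2_eq_iff A'_def \<phi>'_def fun_eq_iff)
      have mem2: "(mat2 (a - n * c) (b - n * d) c d, \<phi>) \<in> Mp2Z" using mp_mult_Mp2Z[OF mp_S_Mp2Z mem'] Seq by simp
      have "mat2 1 n 0 1 ** mat2 (a - n * c) (b - n * d) c d = A" by (simp add: mat2_eq_iff a_def b_def c_def d_def)
      then show ?thesis using Tn[OF mem2, of n] S[OF mem' P'] Seq by simp
    qed
  qed
  then show ?thesis using g by (cases g) auto
qed

section \<open>The discriminant group of U(N) + L\<close>

locale UN_lattice = even_lattice L for L :: "'a::euclidean_space set" +
  fixes N :: nat
  assumes N_pos: "N > 0"
begin

abbreviation M :: "(real \<times> real \<times> 'a) set" where "M \<equiv> UN_plus L"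
abbreviation X :: "(real \<times> real \<times> 'a) set set" where "X \<equiv> disc_group (UN_plus_form N) (UN_plus L)"

text \<open>
  The class of \<open>(a/N, b/N, l)\<close>. The parameters \<open>a\<close>, \<open>b\<close> are integers rather than residues because negatives of
  indices and products with matrix entries occur below.
\<close>
definition cls :: "int \<Rightarrow> int \<Rightarrow> 'a \<Rightarrow> (real \<times> real \<times> 'a) set" where
  "cls a b l = (of_int a / real N, of_int b / real N, l) +o M"

lemma UN_class_cls: "UN_class N L a b l = cls (int a) (int b) l"
  by (simp add: UN_class_def cls_def)

lemma UN_plus_mem: "(s, t, x) \<in> M \<longleftrightarrow> s \<in> \<int> \<and> t \<in> \<int> \<and> x \<in> L"
  by (simp add: UN_plus_def)

lemma cls_mem: "(s, t, x) \<in> cls a b l \<longleftrightarrow> s - of_int a / real N \<in> \<int> \<and> t - of_int b / real N \<in> \<int> \<and> x - l \<in> L"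
proof
  assume "(s, t, x) \<in> cls a b l"
  then show "s - of_int a / real N \<in> \<int> \<and> t - of_int b / real N \<in> \<int> \<and> x - l \<in> L"
    unfolding cls_def elt_set_plus_def by (auto simp: UN_plus_mem)
next
  assume "s - of_int a / real N \<in> \<int> \<and> t - of_int b / real N \<in> \<int> \<and> x - l \<in> L"
  then have "(s - of_int a / real N, t - of_int b / real N, x - l) \<in> M" by (simp add: UN_plus_mem)
  then show "(s, t, x) \<in> cls a b l"
    unfolding cls_def elt_set_plus_def by (intro CollectI bexI[of _ "(s - of_int a / real N, t - of_int b / real N, x - l)"]) simp_all
qed

lemma int_div_N_Ints: "(of_int a - of_int a') / real N \<in> \<int> \<longleftrightarrow> int N dvd a - a'"
proof
  assume "(of_int a - of_int a') / real N \<in> \<int>"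
  then obtain k where "(of_int a - of_int a') / real N = of_int k" by (auto elim: Ints_cases)
  then have "real_of_int (a - a') = of_int (k * int N)" using N_pos by (simp add: field_simps)
  then have "a - a' = k * int N" by (simp only: of_int_eq_iff)
  then show "int N dvd a - a'" by simp
next
  assume "int N dvd a - a'"
  then obtain k where "a - a' = int N * k" by (auto elim: dvdE)
  then have "real_of_int a - of_int a' = real N * of_int k" by (metis of_int_diff of_int_mult of_int_of_nat_eq)
  then show "(of_int a - of_int a') / real N \<in> \<int>" using N_pos by simp
qed

lemma cls_eq_iff: "cls a b l = cls a' b' l' \<longleftrightarrow> int N dvd a - a' \<and> int N dvd b - b' \<and> l - l' \<in> L"
proof
  assume eq: "cls a b l = cls a' b' l'"
  have "(of_int a / real N, of_int b / real N, l) \<in> cls a' b' l'" unfolding eq[symmetric] by (simp add: cls_mem)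
  then show "int N dvd a - a' \<and> int N dvd b - b' \<and> l - l' \<in> L"
    by (simp add: cls_mem int_div_N_Ints flip: diff_divide_distrib)
next
  assume h: "int N dvd a - a' \<and> int N dvd b - b' \<and> l - l' \<in> L"
  have A: "s - of_int a / real N \<in> \<int> \<longleftrightarrow> s - of_int a' / real N \<in> \<int>" if "int N dvd a - a'" for s a a'
  proof -
    have i: "(of_int a - of_int a') / real N \<in> \<int>" using that int_div_N_Ints by blast
    have "s - of_int a' / real N = (s - of_int a / real N) + (of_int a - of_int a') / real N" by (simp add: diff_divide_distrib)
    then show ?thesis using i Ints_add Ints_diff by (metis add_diff_cancel_right')
  qed
  have "x - l \<in> L \<longleftrightarrow> x - l' \<in> L" for x
    using h L_add[of "x - l" "l - l'"] L_diff[of "x - l'" "l - l'"] by auto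
  then have "(s, t, x) \<in> cls a b l \<longleftrightarrow> (s, t, x) \<in> cls a' b' l'" for s t x
    unfolding cls_mem using A[of a a' s] A[of b b' t] h by blast
  then show "cls a b l = cls a' b' l'" by auto
qed

lemma cls_mod: "cls (a mod int N) b l = cls a b l" "cls a (b mod int N) l = cls a b l"
  by (simp_all add: cls_eq_iff mod_eq_dvd_iff flip: mod_eq_dvd_iff)

lemma cls_coset_rep: "l \<in> Ld \<Longrightarrow> cls a b (coset_rep L l) = cls a b l"
  using coset_rep by (simp add: cls_eq_iff)

lemma span_UN_plus: "span M = UNIV \<times> UNIV \<times> span L"
proof (intro equalityI span_minimal)
  show "M \<subseteq> UNIV \<times> UNIV \<times> span L" by (auto simp: UN_plus_def span_base)
  show "subspace (UNIV \<times> UNIV \<times> span L :: (real \<times> real \<times> 'a) set)"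
    by (intro subspace_Times subspace_UNIV subspace_span)
  show "UNIV \<times> UNIV \<times> span L \<subseteq> span M"
  proof clarify
    fix s t :: real and x assume x: "x \<in> span L"
    have lin: "linear (\<lambda>x::'a. (0::real, 0::real, x))" by (rule linearI) auto
    have "(0, 0, x) \<in> (\<lambda>x. (0::real, 0::real, x)) ` span L" using x by auto
    then have "(0, 0, x) \<in> span ((\<lambda>x. (0::real, 0::real, x)) ` L)" using linear_span_image[OF lin, of L] by simp
    moreover have "(\<lambda>x. (0::real, 0::real, x)) ` L \<subseteq> M" by (auto simp: UN_plus_def)
    ultimately have 1: "(0, 0, x) \<in> span M" using span_mono by blast
    have "(1, 0, 0) \<in> span M" "(0, 1, 0) \<in> span M" by (rule span_base, simp add: UN_plus_def)+
    then have "s *\<^sub>R (1, 0, 0) + (t *\<^sub>R (0, 1, 0) + (0, 0, x)) \<in> span M" using 1 by (intro span_add span_scale)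
    then show "(s, t, x) \<in> span M" by simp
  qed
qed

text \<open>
  Pairing with the two isotropic basis vectors of \<open>U(N)\<close> gives \<open>N\<close> times the other coordinate.
\<close>
lemma dual_UN_plus: "(s, t, x) \<in> dual_lattice (UN_plus_form N) M \<longleftrightarrow> real N * s \<in> \<int> \<and> real N * t \<in> \<int> \<and> x \<in> Ld"
proof
  assume "(s, t, x) \<in> dual_lattice (UN_plus_form N) M"
  then have x: "x \<in> span L" and h: "\<And>m. m \<in> M \<Longrightarrow> UN_plus_form N m (s, t, x) \<in> \<int>"
    unfolding dual_lattice_def span_UN_plus by auto
  have "real N * s \<in> \<int>" using h[of "(0, 1, 0)"] by (simp add: UN_plus_mem UN_plus_form_def)
  moreover have "real N * t \<in> \<int>" using h[of "(1, 0, 0)"] by (simp add: UN_plus_mem UN_plus_form_def)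
  moreover have "x \<in> Ld" unfolding dual_lattice_def using x h[of "(0, 0, _)"] by (simp add: UN_plus_mem UN_plus_form_def)
  ultimately show "real N * s \<in> \<int> \<and> real N * t \<in> \<int> \<and> x \<in> Ld" by blast
next
  assume h: "real N * s \<in> \<int> \<and> real N * t \<in> \<int> \<and> x \<in> Ld"
  show "(s, t, x) \<in> dual_lattice (UN_plus_form N) M"
    unfolding dual_lattice_def span_UN_plus
  proof (intro CollectI conjI ballI)
    fix m assume "m \<in> M"
    then obtain i j y where m: "m = (i, j, y)" "i \<in> \<int>" "j \<in> \<int>" "y \<in> L" by (cases m) (auto simp: UN_plus_mem)
    have "UN_plus_form N m (s, t, x) = i * (real N * t) + j * (real N * s) + y \<bullet> x"
      by (simp add: UN_plus_form_def m algebra_simps)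
    then show "UN_plus_form N m (s, t, x) \<in> \<int>" using h m Ld_integral(2)[of x y] by simp
  qed (use h Ld_span in auto)
qed

lemma X_eq: "X = {cls a b l | a b l. l \<in> Ld}"
proof (intro equalityI subsetI)
  fix x assume "x \<in> X"
  then obtain s t l where x: "x = (s, t, l) +o M" and d: "(s, t, l) \<in> dual_lattice (UN_plus_form N) M"
    unfolding disc_group_def by auto
  obtain a b where "real N * s = of_int a" "real N * t = of_int b" "l \<in> Ld"
    using d unfolding dual_UN_plus by (auto elim!: Ints_cases)
  moreover from this have "s = of_int a / real N" "t = of_int b / real N" using N_pos by (simp_all add: field_simps)
  ultimately show "x \<in> {cls a b l | a b l. l \<in> Ld}" unfolding x cls_def by blast
next
  fix x assume "x \<in> {cls a b l | a b l. l \<in> Ld}"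
  then obtain a b l where x: "x = cls a b l" "l \<in> Ld" by blast
  then have "(of_int a / real N, of_int b / real N, l) \<in> dual_lattice (UN_plus_form N) M"
    using N_pos by (simp add: dual_UN_plus)
  then show "x \<in> X" unfolding disc_group_def x cls_def by blast
qed

lemma cls_X: "l \<in> Ld \<Longrightarrow> cls a b l \<in> X"
  unfolding X_eq by blast

lemma bij_cls: "bij_betw (\<lambda>(a, b, r). cls (int a) (int b) r) ({..<N} \<times> {..<N} \<times> coset_reps L) X"
proof (rule bij_betw_imageI)
  have small: "a = b" if "a < N" "b < N" "int N dvd int a - int b" for a b :: nat
  proof -
    have "int a mod int N = int b mod int N" using that(3) by (simp add: mod_eq_dvd_iff)
    then show ?thesis using that by simp
  qed
  show "inj_on (\<lambda>(a, b, r). cls (int a) (int b) r) ({..<N} \<times> {..<N} \<times> coset_reps L)"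
  proof (rule inj_onI, clarsimp simp: cls_eq_iff)
    fix a b r a' b' r' assume h: "a < N" "b < N" "r \<in> coset_reps L" "a' < N" "b' < N" "r' \<in> coset_reps L"
      "int N dvd int a - int a'" "int N dvd int b - int b'" "r - r' \<in> L"
    have "r = r'" using coset_rep_eq[OF h(9)] coset_rep_idem h by simp
    then show "a = a' \<and> b = b' \<and> r = r'" using small h by blast
  qed
  show "(\<lambda>(a, b, r). cls (int a) (int b) r) ` ({..<N} \<times> {..<N} \<times> coset_reps L) = X"
  proof (intro equalityI subsetI)
    fix x assume "x \<in> (\<lambda>(a, b, r). cls (int a) (int b) r) ` ({..<N} \<times> {..<N} \<times> coset_reps L)"
    then show "x \<in> X" using cls_X coset_reps_Ld by auto
  next
    fix x assume "x \<in> X"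
    then obtain a b l where x: "x = cls a b l" "l \<in> Ld" unfolding X_eq by blast
    have "x = cls (int (nat (a mod int N))) (int (nat (b mod int N))) (coset_rep L l)"
      using N_pos x by (simp add: cls_mod cls_coset_rep)
    moreover have "nat (a mod int N) < N" "nat (b mod int N) < N" using N_pos by (simp_all add: nat_less_iff)
    ultimately show "x \<in> (\<lambda>(a, b, r). cls (int a) (int b) r) ` ({..<N} \<times> {..<N} \<times> coset_reps L)"
      using coset_rep_in[OF x(2)] by force
  qed
qed

lemma finite_X: "finite X"
  using bij_betw_finite[OF bij_cls] finite_coset_reps by simp

lemma card_X: "card X = N * N * disc"
  using bij_betw_same_card[OF bij_cls] by (simp add: card_cartesian_product)

lemma sum_X: "sum f X = (\<Sum>a<N. \<Sum>b<N. \<Sum>r\<in>coset_reps L. f (cls (int a) (int b) r))"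
  by (subst sum.reindex_bij_betw[OF bij_cls, symmetric]) (simp add: sum.cartesian_product case_prod_unfold)

text \<open>
  The representative of a class is an unspecified element, so values of the discriminant form are
  determined only up to integers.
\<close>
lemma class_rep_cls:
  obtains i j :: int and x where "x \<in> L"
    "class_rep (cls a b l) = (of_int a / real N + of_int i, of_int b / real N + of_int j, l + x)"
proof -
  have "(of_int a / real N, of_int b / real N, l) \<in> cls a b l" by (simp add: cls_mem)
  then have mem: "class_rep (cls a b l) \<in> cls a b l" unfolding class_rep_def by (rule someI)
  obtain s t y where c: "class_rep (cls a b l) = (s, t, y)" by (cases "class_rep (cls a b l)")
  obtain i j where "s - of_int a / real N = of_int i" "t - of_int b / real N = of_int j" "y - l \<in> L"
    using mem unfolding c cls_mem by (auto elim!: Ints_cases)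
  then have "s = of_int a / real N + of_int i" "t = of_int b / real N + of_int j" "y = l + (y - l)" by auto
  then show ?thesis using that[OF \<open>y - l \<in> L\<close>, of i j] c by simp
qed

lemma disc_quad_cls:
  assumes "l \<in> Ld"
  shows "disc_quad (UN_plus_form N) (cls a b l) - (of_int (a * b) / real N + l \<bullet> l / 2) \<in> \<int>"
proof -
  obtain i j x where x: "x \<in> L" and c: "class_rep (cls a b l) = (of_int a / real N + of_int i, of_int b / real N + of_int j, l + x)"
    by (rule class_rep_cls)
  have "disc_quad (UN_plus_form N) (cls a b l) = real N * ((of_int a / real N + of_int i) * (of_int b / real N + of_int j)) + (l + x) \<bullet> (l + x) / 2"
    unfolding disc_quad_def c by (simp add: UN_plus_form_def field_simps)
  also have "real N * ((of_int a / real N + of_int i) * (of_int b / real N + of_int j)) = of_int (a * b) / real N + of_int (a * j + i * b + int N * i * j)"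
    using N_pos by (simp add: field_simps)
  finally have "disc_quad (UN_plus_form N) (cls a b l) - (of_int (a * b) / real N + l \<bullet> l / 2) =
     of_int (a * j + i * b + int N * i * j) + ((l + x) \<bullet> (l + x) / 2 - l \<bullet> l / 2)" by simp
  then show ?thesis using Ld_quad_shift[OF assms x] by (metis Ints_add Ints_of_int)
qed

lemma disc_bilin_cls:
  assumes "l \<in> Ld" "l' \<in> Ld"
  shows "disc_bilin (UN_plus_form N) (cls a b l) (cls a' b' l') - (of_int (a * b' + a' * b) / real N + l \<bullet> l') \<in> \<int>"
proof -
  obtain i j x where x: "x \<in> L" and c: "class_rep (cls a b l) = (of_int a / real N + of_int i, of_int b / real N + of_int j, l + x)"
    by (rule class_rep_cls)
  obtain i' j' x' where x': "x' \<in> L" and c': "class_rep (cls a' b' l') = (of_int a' / real N + of_int i', of_int b' / real N + of_int j', l' + x')"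
    by (rule class_rep_cls)
  have "disc_bilin (UN_plus_form N) (cls a b l) (cls a' b' l') = real N * ((of_int a / real N + of_int i) * (of_int b' / real N + of_int j') + (of_int b / real N + of_int j) * (of_int a' / real N + of_int i')) + (l + x) \<bullet> (l' + x')"
    unfolding disc_bilin_def c c' by (simp add: UN_plus_form_def)
  also have "real N * ((of_int a / real N + of_int i) * (of_int b' / real N + of_int j') + (of_int b / real N + of_int j) * (of_int a' / real N + of_int i')) =
     of_int (a * b' + a' * b) / real N + of_int (a * j' + i * b' + int N * i * j' + b * i' + j * a' + int N * j * i')"
    using N_pos by (simp add: field_simps)
  finally have "disc_bilin (UN_plus_form N) (cls a b l) (cls a' b' l') - (of_int (a * b' + a' * b) / real N + l \<bullet> l') =
     of_int (a * j' + i * b' + int N * i * j' + b * i' + j * a' + int N * j * i') + (l \<bullet> x' + x \<bullet> l' + x \<bullet> x')"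
    by (simp add: inner_simps)
  then show ?thesis using Ld_integral[OF assms(1) x'] Ld_integral[OF assms(2) x] L_integral[OF x x'] by (metis Ints_add Ints_of_int)
qed

lemma ee_congruent: "x - y \<in> \<int> \<Longrightarrow> ee (of_real x) = ee (of_real y)"
proof -
  assume "x - y \<in> \<int>"
  then have "ee (of_real (x - y)) = 1" by (rule ee_of_real_Ints)
  then show ?thesis by (simp add: ee_diff)
qed

lemma ee_disc_quad: "l \<in> Ld \<Longrightarrow> ee (of_real (disc_quad (UN_plus_form N) (cls a b l))) = ee (of_int (a * b) / of_nat N) * ee (of_real (l \<bullet> l / 2))"
  using ee_congruent[OF disc_quad_cls] by (simp flip: ee_add)

lemma ee_disc_bilin: "l \<in> Ld \<Longrightarrow> l' \<in> Ld \<Longrightarrow> ee (of_real (disc_bilin (UN_plus_form N) (cls a b l) (cls a' b' l'))) = ee (of_int (a * b' + a' * b) / of_nat N) * ee (of_real (l \<bullet> l'))"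
  using ee_congruent[OF disc_bilin_cls] by (simp flip: ee_add)

section \<open>The signature\<close>

text \<open>
  A positive definite subspace meets a negative semidefinite one only in \<open>0\<close>, so complementary dimensions
  certify that the first one is maximal.
\<close>
lemma pos_index_eqI:
  fixes B :: "'v::euclidean_space \<Rightarrow> 'v \<Rightarrow> real"
  assumes P: "subspace P" "P \<subseteq> span K" "\<And>x. x \<in> P \<Longrightarrow> x \<noteq> 0 \<Longrightarrow> B x x > 0"
    and W: "subspace W" "W \<subseteq> span K" "\<And>x. x \<in> W \<Longrightarrow> B x x \<le> 0"
    and dim: "dim P + dim W = dim (span K)"
  shows "pos_index B K = dim P"
  unfolding pos_index_def
proof (rule Max_eqI)
  show "finite {dim S |S. subspace S \<and> S \<subseteq> span K \<and> (\<forall>x\<in>S. x \<noteq> 0 \<longrightarrow> B x x > 0)}"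
    by (rule finite_subset[of _ "{..DIM('v)}"]) (auto simp: dim_subset_UNIV)
  show "dim P \<in> {dim S |S. subspace S \<and> S \<subseteq> span K \<and> (\<forall>x\<in>S. x \<noteq> 0 \<longrightarrow> B x x > 0)}" using P by auto
  fix n assume "n \<in> {dim S |S. subspace S \<and> S \<subseteq> span K \<and> (\<forall>x\<in>S. x \<noteq> 0 \<longrightarrow> B x x > 0)}"
  then obtain S where S: "subspace S" "S \<subseteq> span K" "\<And>x. x \<in> S \<Longrightarrow> x \<noteq> 0 \<Longrightarrow> B x x > 0" "n = dim S" by auto
  have "S \<inter> W = {0}" using S(3) W(3) subspace_0[OF S(1)] subspace_0[OF W(1)] by (auto simp: not_less[symmetric])
  then have "dim (S \<inter> W) = 0" by simp
  moreover have "{x + y |x y. x \<in> S \<and> y \<in> W} \<subseteq> span K" using S(2) W(2) by (auto intro!: span_add)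
  then have "dim {x + y |x y. x \<in> S \<and> y \<in> W} \<le> dim (span K)" by (rule dim_subset)
  ultimately have "dim S + dim W \<le> dim (span K)" using dim_sums_Int[OF S(1) W(1)] by linarith
  then show "n \<le> dim P" using dim S(4) by simp
qed

lemma dim_UN: "dim (UNIV \<times> UNIV \<times> span L :: (real \<times> real \<times> 'a) set) = dim L + 2"
proof -
  have 1: "dim (UNIV \<times> span L :: (real \<times> 'a) set) = 1 + dim L"
    by (subst dim_Times) (simp_all add: subspace_span)
  show ?thesis
    by (subst dim_Times) (simp_all add: subspace_span subspace_Times 1)
qed

text \<open>
  The vectors \<open>(s, s, x)\<close> form a positive definite subspace and the vectors \<open>(s, - s, 0)\<close> a negative definite
  one of complementary dimension; the hyperbolic plane contributes nothing to the difference.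
\<close>
lemma signature_diff_UN: "signature_diff (UN_plus_form N) M = int (dim L)"
proof -
  define P :: "(real \<times> real \<times> 'a) set" where "P = (\<lambda>(s, x). (s, s, x)) ` (UNIV \<times> span L)"
  define P' :: "(real \<times> real \<times> 'a) set" where "P' = (\<lambda>s. (s, - s, 0)) ` UNIV"
  have linP: "linear (\<lambda>(s::real, x::'a). (s, s, x))" and linP': "linear (\<lambda>s::real. (s, - s, 0::'a))"
    by (rule linearI; auto)+
  have sub: "subspace P" "subspace P'"
    unfolding P_def P'_def by (intro linear_subspace_image linP linP' subspace_Times subspace_UNIV subspace_span)+
  have inc: "P \<subseteq> span M" "P' \<subseteq> span M"
    unfolding span_UN_plus P_def P'_def using span_zero by auto
  have dimP: "dim P = dim L + 1"
    unfolding P_def by (subst dim_image_eq[OF linP]) (auto simp: inj_on_def, subst dim_Times, simp_all add: subspace_span)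
  have dimP': "dim P' = 1"
    unfolding P'_def by (subst dim_image_eq[OF linP']) (auto simp: inj_on_def)
  have pos: "UN_plus_form N x x > 0" if x: "x \<in> P" "x \<noteq> 0" for x
  proof -
    obtain s y where xs: "x = (s, s, y)" using x by (auto simp: P_def)
    have "s * s > 0" if "s \<noteq> 0" using that not_real_square_gt_zero by blast
    moreover have "y \<bullet> y > 0" if "y \<noteq> 0" using that by simp
    moreover have "s \<noteq> 0 \<or> y \<noteq> 0" using x xs by (auto simp: zero_prod_def)
    ultimately have "s * s + y \<bullet> y > 0" using zero_le_square[of s] inner_ge_zero[of y] by linarith
    moreover have "1 * (s * s) \<le> real N * (s * s)" using N_pos by (intro mult_right_mono) auto
    moreover have "UN_plus_form N x x = 2 * (real N * (s * s)) + y \<bullet> y"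
      by (simp add: UN_plus_form_def xs algebra_simps)
    ultimately show ?thesis using zero_le_square[of s] by linarith
  qed
  have neg: "UN_plus_form N x x < 0" if x: "x \<in> P'" "x \<noteq> 0" for x
  proof -
    obtain s where "x = (s, - s, 0)" using x by (auto simp: P'_def)
    moreover from this have "s \<noteq> 0" using x by (auto simp: zero_prod_def)
    ultimately show ?thesis using N_pos by (auto simp: UN_plus_form_def mult_less_0_iff zero_less_mult_iff not_less linorder_neq_iff)
  qed
  have zero: "UN_plus_form N 0 (0 :: real \<times> real \<times> 'a) = 0" by (simp add: UN_plus_form_def zero_prod_def)
  have d: "dim P + dim P' = dim (span M)" unfolding span_UN_plus dim_UN dimP dimP' by simp
  have "pos_index (UN_plus_form N) M = dim P"
    by (rule pos_index_eqI[OF sub(1) inc(1) pos sub(2) inc(2)]) (use neg zero d in \<open>force+\<close>)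
  moreover have "pos_index (\<lambda>x y. - UN_plus_form N x y) M = dim P'"
    by (rule pos_index_eqI[OF sub(2) inc(2) _ sub(1) inc(1)]) (use pos neg zero d in \<open>force+\<close>)
  ultimately show ?thesis by (simp add: signature_diff_def dimP dimP')
qed

section \<open>Finite Fourier analysis and the partial Fourier transform\<close>

lemma finite_orthogonality:
  "(\<Sum>a<N. ee (of_int (int a * k) / of_nat N)) = (if int N dvd k then of_nat N else 0)"
proof -
  define \<omega> where "\<omega> = ee (of_int k / of_nat N)"
  have t: "ee (of_int (int a * k) / of_nat N) = \<omega> ^ a" for a
    unfolding \<omega>_def ee_of_nat_mult[symmetric] by simp
  show ?thesis
  proof (cases "int N dvd k")
    case True
    then obtain m where "k = int N * m" by (auto elim: dvdE)
    then have "\<omega> = 1" using N_pos ee_of_int[of m] by (simp add: \<omega>_def)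
    then show ?thesis using True unfolding t by simp
  next
    case False
    have "\<omega> \<noteq> 1"
    proof
      assume "\<omega> = 1"
      then have "ee (of_real (of_int k / real N)) = 1" by (simp add: \<omega>_def)
      then have "(of_int k - of_int 0) / real N \<in> \<int>" using ee_eq_1_imp by simp
      then show False using False unfolding int_div_N_Ints by simp
    qed
    moreover have "\<omega> ^ N = 1" using N_pos ee_of_int[of k] by (simp add: \<omega>_def flip: ee_of_nat_mult)
    ultimately show ?thesis using False unfolding t by (simp add: geometric_sum)
  qed
qed

lemma sum_residue:
  fixes f :: "int \<Rightarrow> complex"
  assumes "\<And>a a'. int N dvd a - a' \<Longrightarrow> f a = f a'"
  shows "(\<Sum>a<N. if int N dvd int a - k then f (int a) else 0) = f k"
proof -
  define a0 where "a0 = nat (k mod int N)"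
  have a0: "a0 < N" "int a0 = k mod int N" using N_pos by (simp_all add: a0_def nat_less_iff)
  have "int N dvd int a - k \<longleftrightarrow> a = a0" if "a < N" for a
  proof -
    have "int N dvd int a - k \<longleftrightarrow> int a mod int N = k mod int N" by (simp add: mod_eq_dvd_iff)
    also have "\<dots> \<longleftrightarrow> int a = int a0" unfolding a0(2) using that by simp
    finally show ?thesis by simp
  qed
  then have "(\<Sum>a<N. if int N dvd int a - k then f (int a) else 0) = (\<Sum>a<N. if a = a0 then f (int a0) else 0)"
    by (intro sum.cong) auto
  also have "\<dots> = f (int a0)" using a0 by simp
  also have "\<dots> = f k" by (rule assms) (simp add: a0(2) mod_eq_dvd_iff[symmetric])
  finally show ?thesis .
qed

end

context UN_lattice
begin

abbreviation V :: "((real \<times> real \<times> 'a) set \<Rightarrow> complex) set" where "V \<equiv> group_ring X"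

lemma ee_N_cong: "int N dvd x - y \<Longrightarrow> ee (of_int x / of_nat N) = ee (of_int y / of_nat N)"
  using ee_congruent[of "of_int x / real N" "of_int y / real N"] int_div_N_Ints[of x y] by (simp add: diff_divide_distrib)

text \<open>
  The partial Fourier transform: discrete Fourier transform in the first isotropic coordinate of \<open>U(N)\<close>, with
  the sign of the second coordinate reversed. With this sign the transform of a vector behaves under the Weil
  representation like a function of the row vector \<open>(u, w)\<close>, on which matrices act from the right.
\<close>
definition fcoef :: "((real \<times> real \<times> 'a) set \<Rightarrow> complex) \<Rightarrow> int \<Rightarrow> int \<Rightarrow> 'a \<Rightarrow> complex" where
  "fcoef v u w l = (\<Sum>a<N. ee (of_int (int a * w) / of_nat N) * v (cls (int a) (- u) l))"

lemma cls_periodic: "x \<in> L \<Longrightarrow> cls a b (l + x) = cls a b l"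
  by (simp add: cls_eq_iff)

lemma fcoef_periodic: "periodic L (fcoef v u w)"
  unfolding periodic_def fcoef_def by (simp add: cls_periodic)

lemma fcoef_cong:
  assumes "int N dvd u - u'" "int N dvd w - w'"
  shows "fcoef v u w l = fcoef v u' w' l"
  unfolding fcoef_def
proof (rule sum.cong[OF refl])
  fix a
  have "int N dvd int a * w - int a * w'" using assms(2) by (simp add: dvd_mult flip: right_diff_distrib)
  then have 1: "ee (of_int (int a * w) / of_nat N) = ee (of_int (int a * w') / of_nat N)" by (rule ee_N_cong)
  have "cls (int a) (- u) l = cls (int a) (- u') l"
    using assms(1) by (simp add: cls_eq_iff dvd_diff_commute)
  then show "ee (of_int (int a * w) / of_nat N) * v (cls (int a) (- u) l) = ee (of_int (int a * w') / of_nat N) * v (cls (int a) (- u') l)"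
    by (simp only: 1)
qed

lemma fcoef_add: "fcoef (\<lambda>x. \<alpha> * v x + \<beta> * v' x) u w l = \<alpha> * fcoef v u w l + \<beta> * fcoef v' u w l"
  unfolding fcoef_def by (simp add: sum_distrib_left sum.distrib[symmetric] algebra_simps)

lemma fcoef_inversion:
  "v (cls a b l) = (1 / of_nat N) * (\<Sum>w<N. ee (- (of_int (a * int w) / of_nat N)) * fcoef v (- b) (int w) l)"
proof -
  have "(\<Sum>w<N. ee (- (of_int (a * int w) / of_nat N)) * fcoef v (- b) (int w) l)
     = (\<Sum>w<N. \<Sum>a'<N. ee (of_int (int w * (int a' - a)) / of_nat N) * v (cls (int a') b l))"
    unfolding fcoef_def sum_distrib_left
  proof (intro sum.cong refl)
    fix w a'
    have "- (of_int (a * int w) / of_nat N) + of_int (int a' * int w) / of_nat N = (of_int (int w * (int a' - a)) / of_nat N :: complex)"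
      by (simp add: algebra_simps diff_divide_distrib)
    then show "ee (- (of_int (a * int w) / of_nat N)) * (ee (of_int (int a' * int w) / of_nat N) * v (cls (int a') (- (- b)) l)) =
       ee (of_int (int w * (int a' - a)) / of_nat N) * v (cls (int a') b l)"
      by (simp only: mult.assoc[symmetric] ee_add[symmetric] minus_minus)
  qed
  also have "\<dots> = (\<Sum>a'<N. (\<Sum>w<N. ee (of_int (int w * (int a' - a)) / of_nat N)) * v (cls (int a') b l))"
    unfolding sum_distrib_right by (rule sum.swap)
  also have "\<dots> = (\<Sum>a'<N. if int N dvd int a' - a then of_nat N * v (cls (int a') b l) else 0)"
    unfolding finite_orthogonality by (rule sum.cong) auto
  also have "\<dots> = of_nat N * v (cls a b l)"
  proof (rule sum_residue)
    fix a a' assume "int N dvd a - a'"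
    then have "cls a b l = cls a' b l" by (simp add: cls_eq_iff)
    then show "of_nat N * v (cls a b l) = of_nat N * v (cls a' b l)" by simp
  qed
  finally show ?thesis using N_pos by simp
qed

lemma group_ring_eqI: "v \<in> V \<Longrightarrow> v' \<in> V \<Longrightarrow> (\<And>a b l. l \<in> Ld \<Longrightarrow> v (cls a b l) = v' (cls a b l)) \<Longrightarrow> v = v'"
proof (rule ext)
  fix x assume v: "v \<in> V" "v' \<in> V" and eq: "\<And>a b l. l \<in> Ld \<Longrightarrow> v (cls a b l) = v' (cls a b l)"
  show "v x = v' x"
  proof (cases "x \<in> X")
    case True
    then show ?thesis using eq unfolding X_eq by blast
  next
    case False
    then show ?thesis using v unfolding group_ring_def by simp
  qed
qed

lemma fcoef_inj:
  assumes "v \<in> V" "v' \<in> V" "\<And>u w l. l \<in> Ld \<Longrightarrow> fcoef v u w l = fcoef v' u w l"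
  shows "v = v'"
  using assms(1,2)
proof (rule group_ring_eqI)
  fix a b l assume "l \<in> Ld"
  then show "v (cls a b l) = v' (cls a b l)"
    unfolding fcoef_inversion[of v] fcoef_inversion[of v'] using assms(3) by simp
qed

text \<open>
  The function on classes induced by a function of representatives \<open>(a, b, l)\<close>.
\<close>
definition lift :: "(int \<Rightarrow> int \<Rightarrow> 'a \<Rightarrow> complex) \<Rightarrow> (real \<times> real \<times> 'a) set \<Rightarrow> complex" where
  "lift f x = (if x \<in> X then (let p = (SOME p. x = cls (fst p) (fst (snd p)) (snd (snd p)) \<and> snd (snd p) \<in> Ld)
     in f (fst p) (fst (snd p)) (snd (snd p))) else 0)"

lemma lift_cls:
  assumes inv: "\<And>a b l a' b' l'. l \<in> Ld \<Longrightarrow> l' \<in> Ld \<Longrightarrow> cls a b l = cls a' b' l' \<Longrightarrow> f a b l = f a' b' l'"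
    and l: "l \<in> Ld"
  shows "lift f (cls a b l) = f a b l"
proof -
  define p where "p = (SOME p. cls a b l = cls (fst p) (fst (snd p)) (snd (snd p)) \<and> snd (snd p) \<in> Ld)"
  have "\<exists>p. cls a b l = cls (fst p) (fst (snd p)) (snd (snd p)) \<and> snd (snd p) \<in> Ld"
    by (rule exI[of _ "(a, b, l)"]) (simp add: l)
  from someI_ex[OF this, folded p_def] have "f a b l = f (fst p) (fst (snd p)) (snd (snd p))"
    using inv l by blast
  then show ?thesis using cls_X[OF l] by (simp add: lift_def p_def[symmetric] Let_def)
qed

lemma lift_V: "lift f \<in> V"
  by (simp add: group_ring_def lift_def)

text \<open>
  The inverse of the partial Fourier transform.
\<close>
definition unfcoef :: "(int \<Rightarrow> int \<Rightarrow> 'a \<Rightarrow> complex) \<Rightarrow> (real \<times> real \<times> 'a) set \<Rightarrow> complex" where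
  "unfcoef h = lift (\<lambda>a b l. (1 / of_nat N) * (\<Sum>w<N. ee (- (of_int (a * int w) / of_nat N)) * h (- b) (int w) l))"

lemma unfcoef_V: "unfcoef h \<in> V"
  unfolding unfcoef_def by (rule lift_V)

lemma unfcoef_cls:
  assumes h: "\<And>u u' w w' l x. int N dvd u - u' \<Longrightarrow> int N dvd w - w' \<Longrightarrow> l \<in> Ld \<Longrightarrow> x \<in> L \<Longrightarrow> h u w (l + x) = h u' w' l"
    and l: "l \<in> Ld"
  shows "unfcoef h (cls a b l) = (1 / of_nat N) * (\<Sum>w<N. ee (- (of_int (a * int w) / of_nat N)) * h (- b) (int w) l)"
  unfolding unfcoef_def
proof (rule lift_cls[OF _ l])
  fix a b l a' b' l' assume l: "l \<in> Ld" "l' \<in> Ld" and eq: "cls a b l = cls a' b' l'"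
  have d: "int N dvd a - a'" "int N dvd b - b'" "l - l' \<in> L" using eq by (auto simp: cls_eq_iff)
  have "ee (- (of_int (a * int w) / of_nat N)) = ee (- (of_int (a' * int w) / of_nat N))" for w
  proof -
    have "int N dvd - (a * int w) - - (a' * int w)" using d(1) by (simp add: dvd_diff_commute flip: left_diff_distrib)
    from ee_N_cong[OF this] show ?thesis by simp
  qed
  moreover have "h (- b) (int w) l = h (- b') (int w) l'" for w
  proof -
    have "int N dvd - b - - b'" using d(2) by (simp add: dvd_diff_commute)
    from h[OF this _ l(2) d(3), of "int w" "int w"] show ?thesis by simp
  qed
  ultimately show "(1 / of_nat N) * (\<Sum>w<N. ee (- (of_int (a * int w) / of_nat N)) * h (- b) (int w) l) =
     (1 / of_nat N) * (\<Sum>w<N. ee (- (of_int (a' * int w) / of_nat N)) * h (- b') (int w) l')" by simp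
qed

lemma fcoef_unfcoef:
  assumes h: "\<And>u u' w w' l x. int N dvd u - u' \<Longrightarrow> int N dvd w - w' \<Longrightarrow> l \<in> Ld \<Longrightarrow> x \<in> L \<Longrightarrow> h u w (l + x) = h u' w' l"
    and l: "l \<in> Ld"
  shows "fcoef (unfcoef h) u w l = h u w l"
proof -
  have U: "unfcoef h (cls a b l) = (1 / of_nat N) * (\<Sum>w<N. ee (- (of_int (a * int w) / of_nat N)) * h (- b) (int w) l)" for a b
    by (rule unfcoef_cls[OF _ l]) (rule h)
  have "fcoef (unfcoef h) u w l = (\<Sum>a<N. \<Sum>w'<N. (1 / of_nat N) * (ee (of_int (int a * (w - int w')) / of_nat N) * h u (int w') l))"
    unfolding fcoef_def U sum_distrib_left
  proof (intro sum.cong refl)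
    fix a w' :: nat
    have e: "of_int (int a * w) / of_nat N + - (of_int (int a * int w') / of_nat N) = (of_int (int a * (w - int w')) / of_nat N :: complex)"
      by (simp add: algebra_simps diff_divide_distrib)
    show "ee (of_int (int a * w) / of_nat N) * (1 / of_nat N * (ee (- (of_int (int a * int w') / of_nat N)) * h (- (- u)) (int w') l)) =
      (1 / of_nat N) * (ee (of_int (int a * (w - int w')) / of_nat N) * h u (int w') l)"
      unfolding e[symmetric] ee_add by (simp only: minus_minus mult_ac)
  qed
  also have "\<dots> = (\<Sum>w'<N. \<Sum>a<N. (1 / of_nat N) * (ee (of_int (int a * (w - int w')) / of_nat N) * h u (int w') l))"
    by (rule sum.swap)
  also have "\<dots> = (\<Sum>w'<N. if int N dvd int w' - w then h u (int w') l else 0)"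
  proof (rule sum.cong[OF refl])
    fix w' :: nat
    have "(\<Sum>a<N. (1 / of_nat N) * (ee (of_int (int a * (w - int w')) / of_nat N) * h u (int w') l)) =
       (1 / of_nat N) * ((\<Sum>a<N. ee (of_int (int a * (w - int w')) / of_nat N)) * h u (int w') l)"
      by (simp only: sum_distrib_left sum_distrib_right)
    then show "(\<Sum>a<N. (1 / of_nat N) * (ee (of_int (int a * (w - int w')) / of_nat N) * h u (int w') l)) =
        (if int N dvd int w' - w then h u (int w') l else 0)"
      unfolding finite_orthogonality using N_pos by (simp add: dvd_diff_commute)
  qed
  also have "\<dots> = h u w l"
  proof (rule sum_residue)
    fix a a' assume "int N dvd a - a'"
    from h[OF _ this l L_0, of u u] show "h u a l = h u a' l" by simp
  qed
  finally show ?thesis .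
qed

section \<open>The Weil representation\<close>

text \<open>
  The function \<open>\<Phi>(u, w)\<close> of the introduction, for a constant vector \<open>v\<close>.
\<close>
definition jtheta :: "((real \<times> real \<times> 'a) set \<Rightarrow> complex) \<Rightarrow> complex \<Rightarrow> 'a \<times> 'a \<Rightarrow> int \<Rightarrow> int \<Rightarrow> complex" where
  "jtheta v \<tau> z u w = theta L (fcoef v u w) \<tau> z"

lemma jtheta_cong: "int N dvd u - u' \<Longrightarrow> int N dvd w - w' \<Longrightarrow> jtheta v \<tau> z u w = jtheta v \<tau> z u' w'"
  unfolding jtheta_def using fcoef_cong by (intro theta_cong) blast

lemma jtheta_add:
  assumes "\<tau> \<in> UHP"
  shows "jtheta (\<lambda>x. \<alpha> * v x + \<beta> * v' x) \<tau> z u w = \<alpha> * jtheta v \<tau> z u w + \<beta> * jtheta v' \<tau> z u w"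
proof -
  have "((\<lambda>l. \<alpha> * (fcoef v u w l * (ee (of_real (l \<bullet> l / 2) * \<tau>) * ee (cform (l, 0) z))) + \<beta> * (fcoef v' u w l * (ee (of_real (l \<bullet> l / 2) * \<tau>) * ee (cform (l, 0) z))))
     has_sum \<alpha> * jtheta v \<tau> z u w + \<beta> * jtheta v' \<tau> z u w) Ld"
    unfolding jtheta_def by (intro has_sum_add has_sum_cmult_right theta_has_sum fcoef_periodic assms)
  then show ?thesis
    unfolding jtheta_def theta_def fcoef_add by (intro infsumI) (simp add: algebra_simps)
qed

lemma jtheta_inj:
  assumes "v \<in> V" "v' \<in> V" "\<tau> \<in> UHP" "\<And>z u w. z \<in> complexify L \<Longrightarrow> jtheta v \<tau> z u w = jtheta v' \<tau> z u w"
  shows "v = v'"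
  using assms(1,2)
proof (rule fcoef_inj)
  fix u w l assume l: "l \<in> Ld"
  show "fcoef v u w l = fcoef v' u w l"
    by (rule theta_unique[OF fcoef_periodic fcoef_periodic assms(3) _ l]) (use assms(4) in \<open>simp add: jtheta_def\<close>)
qed

text \<open>
  The relation \<open>v' = \<rho>(g) v\<close> expressed by theta functions: acting by \<open>g\<close> on \<open>(\<tau>, z)\<close> permutes the indices
  \<open>(u, w)\<close> by right multiplication. Taking this as the definition makes multiplicativity in \<open>g\<close> evident, so that
  only the generators need a computation; the usual construction would require checking the relations of the
  metaplectic group.
\<close>
definition weil_rel :: "(int^2^2) \<times> (complex \<Rightarrow> complex) \<Rightarrow> ((real \<times> real \<times> 'a) set \<Rightarrow> complex) \<Rightarrow> ((real \<times> real \<times> 'a) set \<Rightarrow> complex) \<Rightarrow> bool" where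
  "weil_rel g v v' \<longleftrightarrow> v \<in> V \<and> v' \<in> V \<and> (\<forall>\<tau>\<in>UHP. \<forall>z\<in>complexify L. \<forall>u w.
     snd g \<tau> powi (- int (dim L)) * index_factor (fst g) \<tau> z * jtheta v' (moebius_act (fst g) \<tau>) (cscale (1 / aut_factor (fst g) \<tau>) z) u w =
     jtheta v \<tau> z (u * fst g $ 1 $ 1 + w * fst g $ 2 $ 1) (u * fst g $ 1 $ 2 + w * fst g $ 2 $ 2))"

lemma weil_relD:
  assumes "weil_rel (A, \<phi>) v v'" "\<tau> \<in> UHP" "z \<in> complexify L"
  shows "\<phi> \<tau> powi (- int (dim L)) * index_factor A \<tau> z * jtheta v' (moebius_act A \<tau>) (cscale (1 / aut_factor A \<tau>) z) u w =
     jtheta v \<tau> z (u * A $ 1 $ 1 + w * A $ 2 $ 1) (u * A $ 1 $ 2 + w * A $ 2 $ 2)"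
  using assms unfolding weil_rel_def by simp

lemma weil_rel_V: "weil_rel g v v' \<Longrightarrow> v \<in> V" "weil_rel g v v' \<Longrightarrow> v' \<in> V"
  by (simp_all add: weil_rel_def)

lemma jtheta_transform_inj:
  assumes A: "A \<in> SL2Z" and \<tau>: "\<tau> \<in> UHP" and v: "v1 \<in> V" "v2 \<in> V" and c: "c \<noteq> 0"
    and eq: "\<And>z u w. z \<in> complexify L \<Longrightarrow>
      c * index_factor A \<tau> z * jtheta v1 (moebius_act A \<tau>) (cscale (1 / aut_factor A \<tau>) z) u w =
      c * index_factor A \<tau> z * jtheta v2 (moebius_act A \<tau>) (cscale (1 / aut_factor A \<tau>) z) u w"
  shows "v1 = v2"
proof (rule jtheta_inj[OF v moebius_act_UHP[OF A \<tau>]])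
  fix z u w assume z: "z \<in> complexify L"
  have "cscale (1 / aut_factor A \<tau>) (cscale (aut_factor A \<tau>) z) = z"
    using aut_factor_nonzero[OF A \<tau>] by (simp add: cscale_cscale)
  then show "jtheta v1 (moebius_act A \<tau>) z u w = jtheta v2 (moebius_act A \<tau>) z u w"
    using eq[OF cscale_complexify[OF z, of "aut_factor A \<tau>"], of u w] c by simp
qed

text \<open>
  The values at a single point \<open>\<tau>\<close> of the upper half-plane already determine \<open>v'\<close>.
\<close>
lemma weil_rel_unique:
  assumes g: "g \<in> Mp2Z" and r: "weil_rel g v v1" "weil_rel g v v2"
  shows "v1 = v2"
proof -
  obtain A \<phi> where ge: "g = (A, \<phi>)" by (cases g)
  have A: "A \<in> SL2Z" using g by (simp add: ge Mp2Z_iff)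
  have i: "\<i> \<in> UHP" by (simp add: UHP_def)
  have "\<phi> \<i> \<noteq> 0" using Mp2Z_nonzero[OF _ i] g ge by blast
  then have c: "\<phi> \<i> powi (- int (dim L)) \<noteq> 0" by simp
  show ?thesis
    by (rule jtheta_transform_inj[OF A i weil_rel_V(2)[OF r(1)] weil_rel_V(2)[OF r(2)] c])
       (use weil_relD[OF r(1)[unfolded ge] i] weil_relD[OF r(2)[unfolded ge] i] in simp)
qed

lemma weil_rel_one: "v \<in> V \<Longrightarrow> weil_rel mp_one v v"
  by (simp add: weil_rel_def mp_one_def)

lemma V_add: "v \<in> V \<Longrightarrow> v' \<in> V \<Longrightarrow> (\<lambda>x. \<alpha> * v x + \<beta> * v' x) \<in> V"
  by (simp add: group_ring_def)

lemma weil_rel_add: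
  assumes g: "g \<in> Mp2Z" and "weil_rel g v w" "weil_rel g v' w'"
  shows "weil_rel g (\<lambda>x. \<alpha> * v x + \<beta> * v' x) (\<lambda>x. \<alpha> * w x + \<beta> * w' x)"
proof -
  obtain A \<phi> where ge: "g = (A, \<phi>)" by (cases g)
  have A: "A \<in> SL2Z" using g by (simp add: ge Mp2Z_iff)
  show ?thesis
    unfolding weil_rel_def ge fst_conv snd_conv
  proof (intro conjI ballI allI V_add)
    fix \<tau> z u s assume \<tau>: "\<tau> \<in> UHP" and z: "z \<in> complexify L"
    note e = weil_relD[OF assms(2)[unfolded ge] \<tau> z, of u s] weil_relD[OF assms(3)[unfolded ge] \<tau> z, of u s]
    show "\<phi> \<tau> powi - int (dim L) * index_factor A \<tau> z * jtheta (\<lambda>x. \<alpha> * w x + \<beta> * w' x) (moebius_act A \<tau>) (cscale (1 / aut_factor A \<tau>) z) u s =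
       jtheta (\<lambda>x. \<alpha> * v x + \<beta> * v' x) \<tau> z (u * A $ 1 $ 1 + s * A $ 2 $ 1) (u * A $ 1 $ 2 + s * A $ 2 $ 2)"
      unfolding jtheta_add[OF \<tau>] jtheta_add[OF moebius_act_UHP[OF A \<tau>]] e[symmetric] by (simp add: algebra_simps)
  qed (use weil_rel_V assms in blast)+
qed

text \<open>
  Automorphy factors are cocycles, and \<open>(u, w) (A B) = ((u, w) A) B\<close>.
\<close>
lemma weil_rel_mult:
  assumes g: "g \<in> Mp2Z" and h: "h \<in> Mp2Z" and rg: "weil_rel g v' v''" and rh: "weil_rel h v v'"
  shows "weil_rel (mp_mult g h) v v''"
proof -
  obtain A \<phi> where ge: "g = (A, \<phi>)" by (cases g)
  obtain B \<psi> where he: "h = (B, \<psi>)" by (cases h)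
  have A: "A \<in> SL2Z" and B: "B \<in> SL2Z" using g h by (simp_all add: ge he Mp2Z_iff)
  define gh where "gh = (\<lambda>\<tau>. if \<tau> \<in> UHP then \<phi> (moebius_act B \<tau>) * \<psi> \<tau> else 0)"
  have mult: "mp_mult g h = (A ** B, gh)" by (simp add: ge he mp_mult_def gh_def)
  show ?thesis
    unfolding weil_rel_def mult fst_conv snd_conv
  proof (intro conjI ballI allI)
    fix \<tau> z u w assume \<tau>: "\<tau> \<in> UHP" and z: "z \<in> complexify L"
    have B\<tau>: "moebius_act B \<tau> \<in> UHP" using moebius_act_UHP[OF B \<tau>] .
    have zB: "cscale (1 / aut_factor B \<tau>) z \<in> complexify L" using cscale_complexify[OF z] .
    have e: "gh \<tau> powi - int (dim L) = \<psi> \<tau> powi - int (dim L) * \<phi> (moebius_act B \<tau>) powi - int (dim L)"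
      using \<tau> by (simp add: gh_def power_int_mult_distrib)
    have cs: "cscale (1 / aut_factor (A ** B) \<tau>) z = cscale (1 / aut_factor A (moebius_act B \<tau>)) (cscale (1 / aut_factor B \<tau>) z)"
      by (simp add: aut_factor_mult[OF B \<tau>] cscale_cscale)
    have "gh \<tau> powi - int (dim L) * index_factor (A ** B) \<tau> z * jtheta v'' (moebius_act (A ** B) \<tau>) (cscale (1 / aut_factor (A ** B) \<tau>) z) u w
       = \<psi> \<tau> powi - int (dim L) * index_factor B \<tau> z *
        (\<phi> (moebius_act B \<tau>) powi - int (dim L) * index_factor A (moebius_act B \<tau>) (cscale (1 / aut_factor B \<tau>) z) *
          jtheta v'' (moebius_act A (moebius_act B \<tau>)) (cscale (1 / aut_factor A (moebius_act B \<tau>)) (cscale (1 / aut_factor B \<tau>) z)) u w)"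
      unfolding e index_factor_mult[OF A B \<tau>] moebius_act_mult[OF A B \<tau>] cs by (simp only: mult_ac)
    also have "\<dots> = \<psi> \<tau> powi - int (dim L) * index_factor B \<tau> z *
        jtheta v' (moebius_act B \<tau>) (cscale (1 / aut_factor B \<tau>) z) (u * A $ 1 $ 1 + w * A $ 2 $ 1) (u * A $ 1 $ 2 + w * A $ 2 $ 2)"
      unfolding weil_relD[OF rg[unfolded ge] B\<tau> zB] ..
    also have "\<dots> = jtheta v \<tau> z ((u * A $ 1 $ 1 + w * A $ 2 $ 1) * B $ 1 $ 1 + (u * A $ 1 $ 2 + w * A $ 2 $ 2) * B $ 2 $ 1)
        ((u * A $ 1 $ 1 + w * A $ 2 $ 1) * B $ 1 $ 2 + (u * A $ 1 $ 2 + w * A $ 2 $ 2) * B $ 2 $ 2)"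
      by (rule weil_relD[OF rh[unfolded he] \<tau> z])
    finally show "gh \<tau> powi - int (dim L) * index_factor (A ** B) \<tau> z * jtheta v'' (moebius_act (A ** B) \<tau>) (cscale (1 / aut_factor (A ** B) \<tau>) z) u w
       = jtheta v \<tau> z (u * (A ** B) $ 1 $ 1 + w * (A ** B) $ 2 $ 1) (u * (A ** B) $ 1 $ 2 + w * (A ** B) $ 2 $ 2)"
      by (simp add: algebra_simps)
  qed (use weil_rel_V[OF rg] weil_rel_V[OF rh] in auto)
qed

text \<open>
  The linear operators that the defining formulas of the Weil representation prescribe for \<open>T\<close>, its inverse and
  \<open>S\<close>. The signature of \<open>U(N) \<oplus> L\<close> is the rank of \<open>L\<close>.
\<close>
definition opT :: "((real \<times> real \<times> 'a) set \<Rightarrow> complex) \<Rightarrow> (real \<times> real \<times> 'a) set \<Rightarrow> complex" where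
  "opT v x = ee (- of_real (disc_quad (UN_plus_form N) x)) * v x"

definition opTinv :: "((real \<times> real \<times> 'a) set \<Rightarrow> complex) \<Rightarrow> (real \<times> real \<times> 'a) set \<Rightarrow> complex" where
  "opTinv v x = ee (of_real (disc_quad (UN_plus_form N) x)) * v x"

definition opS :: "((real \<times> real \<times> 'a) set \<Rightarrow> complex) \<Rightarrow> (real \<times> real \<times> 'a) set \<Rightarrow> complex" where
  "opS v y = (if y \<in> X then ee (of_nat (dim L) / 8) / of_real (sqrt (real (card X))) *
     (\<Sum>x\<in>X. v x * ee (of_real (disc_bilin (UN_plus_form N) x y))) else 0)"

lemma op_V: "v \<in> V \<Longrightarrow> opT v \<in> V" "v \<in> V \<Longrightarrow> opTinv v \<in> V" "opS v \<in> V"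
  by (simp_all add: group_ring_def opT_def opTinv_def opS_def)

text \<open>
  The phase \<open>ab/N\<close> of the discriminant form turns into the translation \<open>w \<mapsto> u + w\<close> of the Fourier variable,
  which is the action of \<open>T\<close> on the row vector \<open>(u, w)\<close>.
\<close>
lemma fcoef_opT:
  assumes "l \<in> Ld" shows "fcoef (opT v) u w l = ee (- of_real (l \<bullet> l / 2)) * fcoef v u (u + w) l"
  unfolding fcoef_def sum_distrib_left
proof (rule sum.cong[OF refl])
  fix a :: nat
  have "ee (- of_real (disc_quad (UN_plus_form N) (cls (int a) (- u) l))) = ee (of_int (int a * u) / of_nat N) * ee (- of_real (l \<bullet> l / 2))"
    unfolding ee_minus ee_disc_quad[OF assms] by (simp flip: ee_minus)
  moreover have "ee (of_int (int a * (u + w)) / of_nat N) = ee (of_int (int a * w) / of_nat N) * ee (of_int (int a * u) / of_nat N)"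
    unfolding ee_add[symmetric] by (simp add: algebra_simps add_divide_distrib)
  ultimately show "ee (of_int (int a * w) / of_nat N) * opT v (cls (int a) (- u) l) =
      ee (- of_real (l \<bullet> l / 2)) * (ee (of_int (int a * (u + w)) / of_nat N) * v (cls (int a) (- u) l))"
    by (simp add: opT_def mult_ac)
qed

lemma fcoef_opTinv:
  assumes "l \<in> Ld" shows "fcoef (opTinv v) u w l = ee (of_real (l \<bullet> l / 2)) * fcoef v u (w - u) l"
proof -
  have "opT (opTinv v) = v" by (simp add: opT_def opTinv_def fun_eq_iff flip: mult.assoc)
  then have "fcoef v u (w - u) l = ee (- of_real (l \<bullet> l / 2)) * fcoef (opTinv v) u w l"
    using fcoef_opT[OF assms, of "opTinv v" u "w - u"] fcoef_opT[OF assms, of "opTinv v" u w] by simp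
  then show ?thesis by (simp flip: mult.assoc)
qed

lemma weil_rel_T: assumes v: "v \<in> V" shows "weil_rel mp_T v (opT v)"
  unfolding weil_rel_def
proof (intro conjI ballI allI)
  fix \<tau> z u w assume \<tau>: "\<tau> \<in> UHP" and "z \<in> complexify L"
  have "jtheta (opT v) (\<tau> + 1) z u w = jtheta v \<tau> z u (u + w)"
    unfolding jtheta_def theta_T by (rule theta_cong) (simp add: fcoef_opT mult_ac)
  then show "snd mp_T \<tau> powi - int (dim L) * index_factor (fst mp_T) \<tau> z * jtheta (opT v) (moebius_act (fst mp_T) \<tau>) (cscale (1 / aut_factor (fst mp_T) \<tau>) z) u w =
     jtheta v \<tau> z (u * fst mp_T $ 1 $ 1 + w * fst mp_T $ 2 $ 1) (u * fst mp_T $ 1 $ 2 + w * fst mp_T $ 2 $ 2)"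
    using \<tau> by (simp add: mp_T_eq moebius_act_def aut_factor_def index_factor_def)
qed (use v op_V in auto)

lemma weil_rel_Tinv: assumes v: "v \<in> V" shows "weil_rel mp_Tinv v (opTinv v)"
  unfolding weil_rel_def
proof (intro conjI ballI allI)
  fix \<tau> z u w assume \<tau>: "\<tau> \<in> UHP" and "z \<in> complexify L"
  have "jtheta v \<tau> z u (w - u) = theta L (fcoef v u (w - u)) ((\<tau> - 1) + 1) z" by (simp add: jtheta_def)
  also have "\<dots> = jtheta (opTinv v) (\<tau> - 1) z u w"
    unfolding jtheta_def theta_T by (rule theta_cong) (simp add: fcoef_opTinv mult_ac)
  finally show "snd mp_Tinv \<tau> powi - int (dim L) * index_factor (fst mp_Tinv) \<tau> z * jtheta (opTinv v) (moebius_act (fst mp_Tinv) \<tau>) (cscale (1 / aut_factor (fst mp_Tinv) \<tau>) z) u w =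
     jtheta v \<tau> z (u * fst mp_Tinv $ 1 $ 1 + w * fst mp_Tinv $ 2 $ 1) (u * fst mp_Tinv $ 1 $ 2 + w * fst mp_Tinv $ 2 $ 2)"
    using \<tau> by (simp add: mp_Tinv_def moebius_act_def aut_factor_def index_factor_def)
qed (use v op_V in auto)

text \<open>
  The Fourier transform on \<open>U(N)\<close> that is part of \<open>S\<close>, preceded and followed by the partial transform,
  collapses by orthogonality of characters modulo \<open>N\<close> to \<open>(u, w) \<mapsto> (w, - u)\<close>, the action of \<open>S\<close> on row vectors.
\<close>
lemma fcoef_opS:
  assumes l: "l \<in> Ld"
  shows "fcoef (opS v) u w l = ee (of_nat (dim L) / 8) / of_real (sqrt disc) * (\<Sum>r\<in>coset_reps L. ee (of_real (r \<bullet> l)) * fcoef v w (- u) r)"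
proof -
  define C where "C = ee (of_nat (dim L) / 8) / of_real (sqrt (real (card X)))"
  have CN: "C * of_nat N = ee (of_nat (dim L) / 8) / of_real (sqrt disc)"
  proof -
    have "sqrt (real (card X)) = real N * sqrt (real disc)"
      by (simp add: card_X real_sqrt_mult)
    then show ?thesis using N_pos by (simp add: C_def)
  qed
  define T where "T a' b' r a = v (cls (int a') (int b') r) * ee (of_real (r \<bullet> l)) * ee (- (of_int (int a' * u) / of_nat N)) * ee (of_int (int a * (w + int b')) / of_nat N)" for a' b' r and a :: nat
  have "fcoef (opS v) u w l = (\<Sum>a<N. C * (\<Sum>a'<N. \<Sum>b'<N. \<Sum>r\<in>coset_reps L. T a' b' r a))"
    unfolding fcoef_def
  proof (rule sum.cong[OF refl])
    fix a :: nat
    have TT: "ee (of_int (int a * w) / of_nat N) * (v (cls (int a') (int b') r) * ee (of_real (disc_bilin (UN_plus_form N) (cls (int a') (int b') r) (cls (int a) (- u) l)))) = T a' b' r a"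
      if r: "r \<in> coset_reps L" for a' b' r
    proof -
      have e: "of_int (int a * w) / of_nat N + of_int (int a' * - u + int a * int b') / of_nat N =
         (- (of_int (int a' * u) / of_nat N) + of_int (int a * (w + int b')) / of_nat N :: complex)"
        by (simp add: algebra_simps add_divide_distrib diff_divide_distrib)
      have "ee (of_int (int a * w) / of_nat N) * ee (of_int (int a' * - u + int a * int b') / of_nat N) =
         ee (- (of_int (int a' * u) / of_nat N)) * ee (of_int (int a * (w + int b')) / of_nat N)"
        unfolding ee_add[symmetric] e ..
      then have "ee (of_int (int a * w) / of_nat N) * (c * (ee (of_int (int a' * - u + int a * int b') / of_nat N) * d)) =
          c * d * ee (- (of_int (int a' * u) / of_nat N)) * ee (of_int (int a * (w + int b')) / of_nat N)" for c d
      proof -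
        have "x * (c * (y * d)) = c * d * (x * y)" for x y :: complex by (simp only: mult_ac)
        then show ?thesis using \<open>ee (of_int (int a * w) / of_nat N) * ee (of_int (int a' * - u + int a * int b') / of_nat N) = _\<close>
          by (simp only: mult.assoc)
      qed
      then show ?thesis unfolding ee_disc_bilin[OF coset_reps_Ld[OF r] l] T_def .
    qed
    define E where "E = ee (of_int (int a * w) / of_nat N)"
    have "E * opS v (cls (int a) (- u) l) = E * (C * (\<Sum>a'<N. \<Sum>b'<N. \<Sum>r\<in>coset_reps L. v (cls (int a') (int b') r) * ee (of_real (disc_bilin (UN_plus_form N) (cls (int a') (int b') r) (cls (int a) (- u) l)))))"
      using cls_X[OF l] by (simp add: opS_def C_def sum_X)
    also have "\<dots> = C * (\<Sum>a'<N. \<Sum>b'<N. \<Sum>r\<in>coset_reps L. E * (v (cls (int a') (int b') r) * ee (of_real (disc_bilin (UN_plus_form N) (cls (int a') (int b') r) (cls (int a) (- u) l)))))"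
      by (simp only: sum_distrib_left mult.left_commute[of E C])
    also have "\<dots> = C * (\<Sum>a'<N. \<Sum>b'<N. \<Sum>r\<in>coset_reps L. T a' b' r a)"
      unfolding E_def by (intro arg_cong[of _ _ "(*) C"] sum.cong refl TT)
    finally show "ee (of_int (int a * w) / of_nat N) * opS v (cls (int a) (- u) l) = C * (\<Sum>a'<N. \<Sum>b'<N. \<Sum>r\<in>coset_reps L. T a' b' r a)"
      unfolding E_def .
  qed
  also have "\<dots> = C * (\<Sum>a<N. \<Sum>a'<N. \<Sum>b'<N. \<Sum>r\<in>coset_reps L. T a' b' r a)"
    by (simp only: sum_distrib_left)
  also have "(\<Sum>a<N. \<Sum>a'<N. \<Sum>b'<N. \<Sum>r\<in>coset_reps L. T a' b' r a) = (\<Sum>r\<in>coset_reps L. \<Sum>a'<N. \<Sum>b'<N. \<Sum>a<N. T a' b' r a)"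
  proof -
    have "(\<Sum>a<N. \<Sum>a'<N. \<Sum>b'<N. \<Sum>r\<in>coset_reps L. T a' b' r a) = (\<Sum>a'<N. \<Sum>a<N. \<Sum>b'<N. \<Sum>r\<in>coset_reps L. T a' b' r a)"
      by (rule sum.swap)
    also have "\<dots> = (\<Sum>a'<N. \<Sum>b'<N. \<Sum>a<N. \<Sum>r\<in>coset_reps L. T a' b' r a)"
      by (intro sum.cong refl sum.swap)
    also have "\<dots> = (\<Sum>a'<N. \<Sum>b'<N. \<Sum>r\<in>coset_reps L. \<Sum>a<N. T a' b' r a)"
      by (intro sum.cong refl sum.swap)
    also have "\<dots> = (\<Sum>a'<N. \<Sum>r\<in>coset_reps L. \<Sum>b'<N. \<Sum>a<N. T a' b' r a)"
      by (intro sum.cong refl sum.swap)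
    also have "\<dots> = (\<Sum>r\<in>coset_reps L. \<Sum>a'<N. \<Sum>b'<N. \<Sum>a<N. T a' b' r a)"
      by (rule sum.swap)
    finally show ?thesis .
  qed
  also have "\<dots> = (\<Sum>r\<in>coset_reps L. \<Sum>a'<N. of_nat N * (v (cls (int a') (- w) r) * ee (of_real (r \<bullet> l)) * ee (- (of_int (int a' * u) / of_nat N))))"
  proof (intro sum.cong refl)
    fix r a'
    define F where "F b = of_nat N * (v (cls (int a') b r) * ee (of_real (r \<bullet> l)) * ee (- (of_int (int a' * u) / of_nat N)))" for b
    have "(\<Sum>b'<N. \<Sum>a<N. T a' b' r a) = (\<Sum>b'<N. if int N dvd int b' - (- w) then F (int b') else 0)"
      unfolding T_def sum_distrib_left[symmetric] finite_orthogonality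
      by (intro sum.cong refl) (simp add: F_def add.commute)
    also have "\<dots> = F (- w)"
    proof (rule sum_residue)
      fix b b' assume "int N dvd b - b'"
      then have "cls (int a') b r = cls (int a') b' r" by (simp add: cls_eq_iff)
      then show "F b = F b'" by (simp add: F_def)
    qed
    finally show "(\<Sum>b'<N. \<Sum>a<N. T a' b' r a) = of_nat N * (v (cls (int a') (- w) r) * ee (of_real (r \<bullet> l)) * ee (- (of_int (int a' * u) / of_nat N)))"
      by (simp add: F_def)
  qed
  also have "\<dots> = of_nat N * (\<Sum>r\<in>coset_reps L. ee (of_real (r \<bullet> l)) * fcoef v w (- u) r)"
    unfolding fcoef_def sum_distrib_left by (intro sum.cong refl) (simp add: mult_ac)
  finally show ?thesis using CN by (simp only: mult.assoc[symmetric])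
qed

text \<open>
  Theta inversion for the coefficients \<open>fcoef (opS v) u w\<close>: the finite Fourier transform on \<open>L'/L\<close> produced by
  inversion undoes the one contained in \<open>opS\<close>, and the eighth roots of unity cancel.
\<close>
lemma weil_rel_S: assumes v: "v \<in> V" shows "weil_rel mp_S v (opS v)"
  unfolding weil_rel_def
proof (intro conjI ballI allI)
  fix \<tau> z u w assume \<tau>: "\<tau> \<in> UHP" and z: "z \<in> complexify L"
  define K where "K = ee (of_nat (dim L) / 8) / complex_of_real (sqrt disc)"
  have hat: "(\<Sum>r'\<in>coset_reps L. fcoef (opS v) u w r' * ee (- of_real (r' \<bullet> y))) = K * of_nat disc * fcoef v w (- u) y" if y: "y \<in> Ld" for y
  proof -
    have "(\<Sum>r'\<in>coset_reps L. fcoef (opS v) u w r' * ee (- of_real (r' \<bullet> y))) =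
       (\<Sum>r'\<in>coset_reps L. \<Sum>r\<in>coset_reps L. K * fcoef v w (- u) r * ee (of_real (r' \<bullet> (r - y))))"
    proof (rule sum.cong[OF refl])
      fix r' assume r': "r' \<in> coset_reps L"
      show "fcoef (opS v) u w r' * ee (- of_real (r' \<bullet> y)) = (\<Sum>r\<in>coset_reps L. K * fcoef v w (- u) r * ee (of_real (r' \<bullet> (r - y))))"
        unfolding fcoef_opS[OF coset_reps_Ld[OF r']] K_def[symmetric] sum_distrib_left sum_distrib_right
        by (rule sum.cong[OF refl]) (simp add: inner_diff_right inner_commute ee_diff ee_minus divide_inverse mult_ac)
    qed
    also have "\<dots> = (\<Sum>r\<in>coset_reps L. K * fcoef v w (- u) r * (\<Sum>r'\<in>coset_reps L. ee (of_real (r' \<bullet> (r - y)))))"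
      unfolding sum_distrib_left by (rule sum.swap)
    also have "\<dots> = (\<Sum>r\<in>coset_reps L. if r = coset_rep L y then K * of_nat disc * fcoef v w (- u) r else 0)"
    proof (rule sum.cong[OF refl])
      fix r assume r: "r \<in> coset_reps L"
      have "r - y \<in> L \<longleftrightarrow> r = coset_rep L y"
        using coset_rep_eq_iff[OF r y] L_minus[of "r - y"] L_minus[of "y - r"] by auto
      then show "K * fcoef v w (- u) r * (\<Sum>r'\<in>coset_reps L. ee (of_real (r' \<bullet> (r - y)))) = (if r = coset_rep L y then K * of_nat disc * fcoef v w (- u) r else 0)"
        unfolding dual_orthogonality[OF Ld_diff[OF coset_reps_Ld[OF r] y]] by simp
    qed
    also have "\<dots> = K * of_nat disc * fcoef v w (- u) (coset_rep L y)"
      using finite_coset_reps coset_rep_in[OF y] by simp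
    also have "\<dots> = K * of_nat disc * fcoef v w (- u) y"
      using periodic_coset_rep[OF fcoef_periodic y] by simp
    finally show ?thesis .
  qed
  have inv: "jtheta (opS v) (- 1 / \<tau>) (cscale (1 / \<tau>) z) u w =
     of_real (1 / sqrt disc) * (csqrt \<tau> * ee (- 1 / 8)) ^ dim L * ee (cform z z / (2 * \<tau>)) * (K * of_nat disc * jtheta v \<tau> z w (- u))"
  proof -
    have "theta L (\<lambda>y. \<Sum>r\<in>coset_reps L. fcoef (opS v) u w r * ee (- of_real (r \<bullet> y))) \<tau> z =
        theta L (\<lambda>y. K * of_nat disc * fcoef v w (- u) y) \<tau> z"
      by (rule theta_cong) (rule hat)
    then show ?thesis
      unfolding jtheta_def theta_inversion[OF fcoef_periodic \<tau> z] theta_scale by simp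
  qed
  have sd: "complex_of_real (sqrt disc) * of_real (sqrt disc) = of_nat disc" by (simp flip: of_real_mult)
  have d0: "complex_of_real (sqrt disc) \<noteq> 0" using disc_pos by simp
  have 1: "of_real (1 / sqrt disc) * (K * of_nat disc) = ee (of_nat (dim L) / 8)"
    unfolding K_def sd[symmetric] using d0 by simp
  have 2: "ee (- 1 / 8) ^ dim L * ee (of_nat (dim L) / 8) = 1"
    by (simp add: ee_of_nat_mult[symmetric] flip: ee_add)
  have 3: "csqrt \<tau> powi (- int (dim L)) * csqrt \<tau> ^ dim L = 1"
    using csqrt_nonzero_UHP[OF \<tau>] by (simp add: power_int_minus)
  have 4: "exp (- \<i> * of_real pi * (cform z z / \<tau>)) * ee (cform z z / (2 * \<tau>)) = 1"
    unfolding ee_def exp_add[symmetric] by simp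
  have "csqrt \<tau> powi (- int (dim L)) * exp (- \<i> * of_real pi * (cform z z / \<tau>)) * jtheta (opS v) (- 1 / \<tau>) (cscale (1 / \<tau>) z) u w
     = (csqrt \<tau> powi (- int (dim L)) * csqrt \<tau> ^ dim L) * (exp (- \<i> * of_real pi * (cform z z / \<tau>)) * ee (cform z z / (2 * \<tau>))) *
       (ee (- 1 / 8) ^ dim L * (of_real (1 / sqrt disc) * (K * of_nat disc))) * jtheta v \<tau> z w (- u)"
    unfolding inv power_mult_distrib by (simp only: mult_ac)
  also have "\<dots> = jtheta v \<tau> z w (- u)" unfolding 1 2 3 4 by simp
  finally show "snd mp_S \<tau> powi - int (dim L) * index_factor (fst mp_S) \<tau> z * jtheta (opS v) (moebius_act (fst mp_S) \<tau>) (cscale (1 / aut_factor (fst mp_S) \<tau>) z) u w =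
     jtheta v \<tau> z (u * fst mp_S $ 1 $ 1 + w * fst mp_S $ 2 $ 1) (u * fst mp_S $ 1 $ 2 + w * fst mp_S $ 2 $ 2)"
    using \<tau> by (simp add: mp_S_eq moebius_act_def aut_factor_def index_factor_def)
qed (use v op_V in auto)

lemma weil_rel_exists: "g \<in> Mp2Z \<Longrightarrow> v \<in> V \<Longrightarrow> \<exists>v'. weil_rel g v v'"
proof (induction g rule: Mp2Z_induct)
  case one then show ?case using weil_rel_one by blast
next
  case (S g) then show ?case using weil_rel_mult[OF mp_S_Mp2Z S(1) weil_rel_S] weil_rel_V by blast
next
  case (T g) then show ?case using weil_rel_mult[OF mp_T_Mp2Z T(1) weil_rel_T] weil_rel_V by blast
next
  case (Tinv g) then show ?case using weil_rel_mult[OF mp_Tinv_Mp2Z Tinv(1) weil_rel_Tinv] weil_rel_V by blast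
qed

lemma basis_vec_V: "x \<in> X \<Longrightarrow> basis_vec x \<in> V"
  by (auto simp: group_ring_def basis_vec_def)

lemma opT_basis: "opT (basis_vec x) = (\<lambda>y. ee (- of_real (disc_quad (UN_plus_form N) x)) * basis_vec x y)"
  by (auto simp: opT_def basis_vec_def)

lemma opS_basis: "x \<in> X \<Longrightarrow> opS (basis_vec x) = (\<lambda>z. ee (of_int (signature_diff (UN_plus_form N) M) / 8) / of_real (sqrt (real (card X))) *
            (\<Sum>y\<in>X. ee (of_real (disc_bilin (UN_plus_form N) x y)) * basis_vec y z))"
proof
  fix z assume x: "x \<in> X"
  have "(\<Sum>y\<in>X. ee (of_real (disc_bilin (UN_plus_form N) x y)) * basis_vec y z) = (\<Sum>y\<in>X. if y = z then ee (of_real (disc_bilin (UN_plus_form N) x z)) else 0)"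
    by (rule sum.cong) (auto simp: basis_vec_def)
  then have 1: "(\<Sum>y\<in>X. ee (of_real (disc_bilin (UN_plus_form N) x y)) * basis_vec y z) = (if z \<in> X then ee (of_real (disc_bilin (UN_plus_form N) x z)) else 0)"
    using finite_X by simp
  have "(\<Sum>x'\<in>X. basis_vec x x' * ee (of_real (disc_bilin (UN_plus_form N) x' z))) = (\<Sum>x'\<in>X. if x' = x then ee (of_real (disc_bilin (UN_plus_form N) x z)) else 0)"
    by (rule sum.cong) (auto simp: basis_vec_def)
  then have 2: "(\<Sum>x'\<in>X. basis_vec x x' * ee (of_real (disc_bilin (UN_plus_form N) x' z))) = ee (of_real (disc_bilin (UN_plus_form N) x z))"
    using finite_X x by simp
  show "opS (basis_vec x) z = ee (of_int (signature_diff (UN_plus_form N) M) / 8) / of_real (sqrt (real (card X))) *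
            (\<Sum>y\<in>X. ee (of_real (disc_bilin (UN_plus_form N) x y)) * basis_vec y z)"
    unfolding opS_def 1 2 signature_diff_UN by simp
qed

text \<open>
  Since the relation \<open>weil_rel\<close> is functional, total and multiplicative, it defines a representation, and this
  representation has the required values on the generators.
\<close>
lemma weil_rep_exists: "\<exists>\<rho>. is_weil_rep (UN_plus_form N) M \<rho>"
proof -
  define \<rho> where "\<rho> g v = (SOME v'. weil_rel g v v')" for g v
  have \<rho>: "weil_rel g v (\<rho> g v)" if "g \<in> Mp2Z" "v \<in> V" for g v
    using someI_ex[OF weil_rel_exists[OF that]] by (simp add: \<rho>_def)
  have eq: "\<rho> g v = v'" if "g \<in> Mp2Z" "weil_rel g v v'" for g v v'
    using weil_rel_unique[OF that(1) \<rho>[OF that(1) weil_rel_V(1)[OF that(2)]] that(2)] .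
  have "is_weil_rep (UN_plus_form N) M \<rho>"
    unfolding is_weil_rep_def Let_def
  proof (intro conjI ballI allI)
    fix g assume g: "g \<in> Mp2Z"
    show "\<rho> g ` V \<subseteq> V" using \<rho>[OF g] weil_rel_V by blast
    fix v w \<alpha> \<beta> assume "v \<in> V" "w \<in> V"
    then show "\<rho> g (\<lambda>x. \<alpha> * v x + \<beta> * w x) = (\<lambda>x. \<alpha> * \<rho> g v x + \<beta> * \<rho> g w x)"
      using eq[OF g weil_rel_add[OF g \<rho>[OF g] \<rho>[OF g]]] by blast
  next
    fix v assume "v \<in> V" then show "\<rho> mp_one v = v" using eq[OF mp_one_Mp2Z weil_rel_one] by blast
  next
    fix g h v assume g: "g \<in> Mp2Z" and h: "h \<in> Mp2Z" and v: "v \<in> V"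
    show "\<rho> (mp_mult g h) v = \<rho> g (\<rho> h v)"
      by (rule eq[OF mp_mult_Mp2Z[OF g h] weil_rel_mult[OF g h \<rho>[OF g weil_rel_V(2)[OF \<rho>[OF h v]]] \<rho>[OF h v]]])
  next
    fix x assume x: "x \<in> X"
    show "\<rho> mp_T (basis_vec x) = (\<lambda>y. ee (- of_real (disc_quad (UN_plus_form N) x)) * basis_vec x y)"
      using eq[OF mp_T_Mp2Z weil_rel_T[OF basis_vec_V[OF x]]] opT_basis by simp
    show "\<rho> mp_S (basis_vec x) = (\<lambda>z. ee (of_int (signature_diff (UN_plus_form N) M) / 8) / of_real (sqrt (real (card X))) *
            (\<Sum>y\<in>X. ee (of_real (disc_bilin (UN_plus_form N) x y)) * basis_vec y z))"
      using eq[OF mp_S_Mp2Z weil_rel_S[OF basis_vec_V[OF x]]] opS_basis[OF x] by simp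
  qed
  then show ?thesis by blast
qed

lemma group_ring_expand: "v \<in> V \<Longrightarrow> v = (\<lambda>y. \<Sum>x\<in>X. v x * basis_vec x y)"
proof
  fix y assume v: "v \<in> V"
  have "(\<Sum>x\<in>X. v x * basis_vec x y) = (\<Sum>x\<in>X. if x = y then v y else 0)"
    by (rule sum.cong) (auto simp: basis_vec_def)
  then show "v y = (\<Sum>x\<in>X. v x * basis_vec x y)" using finite_X v by (auto simp: group_ring_def)
qed

lemma linear_on_group_ring_eq:
  assumes R: "\<And>v w \<alpha> \<beta>. v \<in> V \<Longrightarrow> w \<in> V \<Longrightarrow> R (\<lambda>x. \<alpha> * v x + \<beta> * w x) = (\<lambda>x. \<alpha> * R v x + \<beta> * R w x)"
    and R': "\<And>v w \<alpha> \<beta>. v \<in> V \<Longrightarrow> w \<in> V \<Longrightarrow> R' (\<lambda>x. \<alpha> * v x + \<beta> * w x) = (\<lambda>x. \<alpha> * R' v x + \<beta> * R' w x)"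
    and eq: "\<And>x. x \<in> X \<Longrightarrow> R (basis_vec x) = R' (basis_vec x)" and v: "v \<in> V"
  shows "(R v :: 'b \<Rightarrow> complex) = R' v"
proof -
  have "R (\<lambda>y. \<Sum>x\<in>Y. v x * basis_vec x y) = R' (\<lambda>y. \<Sum>x\<in>Y. v x * basis_vec x y) \<and> (\<lambda>y. \<Sum>x\<in>Y. v x * basis_vec x y) \<in> V"
    if "finite Y" "Y \<subseteq> X" for Y
    using that
  proof (induction Y)
    case empty
    have 0: "(\<lambda>y. 0) \<in> V" by (simp add: group_ring_def)
    show ?case using R[OF 0 0, of 0 0] R'[OF 0 0, of 0 0] 0 by simp
  next
    case (insert x Y)
    then have IH: "R (\<lambda>y. \<Sum>x\<in>Y. v x * basis_vec x y) = R' (\<lambda>y. \<Sum>x\<in>Y. v x * basis_vec x y)" "(\<lambda>y. \<Sum>x\<in>Y. v x * basis_vec x y) \<in> V"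
      and x: "x \<in> X" by auto
    have "(\<lambda>y. \<Sum>x\<in>insert x Y. v x * basis_vec x y) = (\<lambda>y. v x * basis_vec x y + 1 * (\<Sum>x\<in>Y. v x * basis_vec x y))"
      using insert.hyps by simp
    then show ?case
      using R[OF basis_vec_V[OF x] IH(2), of "v x" 1] R'[OF basis_vec_V[OF x] IH(2), of "v x" 1] eq[OF x] IH V_add[OF basis_vec_V[OF x] IH(2), of "v x" 1]
      by simp
  qed
  from this[OF finite_X order_refl] show ?thesis using group_ring_expand[OF v] by simp
qed

lemma opS_linear: "opS (\<lambda>x. \<alpha> * v x + \<beta> * w x) = (\<lambda>x. \<alpha> * opS v x + \<beta> * opS w x)"
proof
  fix y
  have "(\<Sum>x\<in>X. (\<alpha> * v x + \<beta> * w x) * e x) = \<alpha> * (\<Sum>x\<in>X. v x * e x) + \<beta> * (\<Sum>x\<in>X. w x * e x)" for e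
    by (simp add: sum_distrib_left sum.distrib[symmetric] algebra_simps)
  then have "c * (\<Sum>x\<in>X. (\<alpha> * v x + \<beta> * w x) * e x) = \<alpha> * (c * (\<Sum>x\<in>X. v x * e x)) + \<beta> * (c * (\<Sum>x\<in>X. w x * e x))" for c e
    by (simp only: ring_distribs mult_ac)
  then show "opS (\<lambda>x. \<alpha> * v x + \<beta> * w x) y = \<alpha> * opS v y + \<beta> * opS w y"
    by (simp only: opS_def split: if_split) simp
qed

text \<open>
  The abstract representation is an unspecified one among those with the prescribed values on generators. It
  agrees with \<open>opT\<close> and \<open>opS\<close> by linearity, and induction over words in the generators extends this to the
  whole group.
\<close>
theorem weil_rep_characterisation:
  assumes "g \<in> Mp2Z" "v \<in> V"
  shows "weil_rel g v (weil_rep (UN_plus_form N) M g v)"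
proof -
  define \<rho> where "\<rho> = weil_rep (UN_plus_form N) M"
  have w: "is_weil_rep (UN_plus_form N) M \<rho>"
    unfolding \<rho>_def weil_rep_def by (rule someI_ex[OF weil_rep_exists])
  have V: "\<rho> g v \<in> V" if "g \<in> Mp2Z" "v \<in> V" for g v
    using w that unfolding is_weil_rep_def Let_def by blast
  have lin: "\<rho> g (\<lambda>x. \<alpha> * v x + \<beta> * w x) = (\<lambda>x. \<alpha> * \<rho> g v x + \<beta> * \<rho> g w x)" if "g \<in> Mp2Z" "v \<in> V" "w \<in> V" for g v w \<alpha> \<beta>
    using w that unfolding is_weil_rep_def Let_def by blast
  have one: "\<rho> mp_one v = v" if "v \<in> V" for v
    using w that unfolding is_weil_rep_def Let_def by blast
  have mult: "\<rho> (mp_mult g h) v = \<rho> g (\<rho> h v)" if "g \<in> Mp2Z" "h \<in> Mp2Z" "v \<in> V" for g h v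
    using w that unfolding is_weil_rep_def Let_def by blast
  have T: "\<rho> mp_T v = opT v" if "v \<in> V" for v
  proof (rule linear_on_group_ring_eq[OF lin _ _ that])
    show "opT (\<lambda>x. \<alpha> * v x + \<beta> * w x) = (\<lambda>x. \<alpha> * opT v x + \<beta> * opT w x)" for v w \<alpha> \<beta>
      by (simp add: opT_def fun_eq_iff algebra_simps)
    show "\<rho> mp_T (basis_vec x) = opT (basis_vec x)" if "x \<in> X" for x
      using w that unfolding is_weil_rep_def Let_def opT_basis by blast
  qed (use mp_T_Mp2Z in auto)
  have S: "\<rho> mp_S v = opS v" if "v \<in> V" for v
  proof (rule linear_on_group_ring_eq[OF lin _ _ that])
    show "\<rho> mp_S (basis_vec x) = opS (basis_vec x)" if "x \<in> X" for x
      using w that unfolding is_weil_rep_def Let_def opS_basis[OF that] by blast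
  qed (use mp_S_Mp2Z opS_linear in auto)
  have "weil_rel g v (\<rho> g v)"
    using assms
  proof (induction g arbitrary: v rule: Mp2Z_induct)
    case one then show ?case using weil_rel_one \<open>\<And>v. v \<in> V \<Longrightarrow> \<rho> mp_one v = v\<close> by simp
  next
    case (S g)
    have "\<rho> (mp_mult mp_S g) v = opS (\<rho> g v)"
      using mult[OF mp_S_Mp2Z S(1,3)] \<open>\<And>v. v \<in> V \<Longrightarrow> \<rho> mp_S v = opS v\<close>[OF V[OF S(1,3)]] by simp
    then show ?case using weil_rel_mult[OF mp_S_Mp2Z S(1) weil_rel_S[OF V[OF S(1,3)]] S(2)[OF S(3)]] by simp
  next
    case (T g)
    have "\<rho> (mp_mult mp_T g) v = opT (\<rho> g v)"
      using mult[OF mp_T_Mp2Z T(1,3)] \<open>\<And>v. v \<in> V \<Longrightarrow> \<rho> mp_T v = opT v\<close>[OF V[OF T(1,3)]] by simp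
    then show ?case using weil_rel_mult[OF mp_T_Mp2Z T(1) weil_rel_T[OF V[OF T(1,3)]] T(2)[OF T(3)]] by simp
  next
    case (Tinv g)
    have gi: "mp_mult mp_Tinv g \<in> Mp2Z" using mp_mult_Mp2Z[OF mp_Tinv_Mp2Z Tinv(1)] .
    have "mp_mult mp_T (mp_mult mp_Tinv g) = g"
    proof -
      obtain A \<phi> where ge: "g = (A, \<phi>)" by (cases g)
      have 1: "mp_mult mp_Tinv g = (mat2 1 (-1) 0 1 ** A, \<phi>)"
        unfolding mp_Tinv_def ge by (rule mp_mult_translation) (use Tinv(1) ge in simp)
      have "mp_mult mp_T (mat2 1 (-1) 0 1 ** A, \<phi>) = (mat2 1 1 0 1 ** (mat2 1 (-1) 0 1 ** A), \<phi>)"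
        unfolding mp_T_eq by (rule mp_mult_translation) (use gi 1 in simp)
      moreover have "mat2 1 1 0 1 ** (mat2 1 (-1) 0 1 ** A) = A" by (simp add: mat2_eq_iff algebra_simps)
      ultimately show ?thesis using 1 ge by simp
    qed
    then have "\<rho> g v = opT (\<rho> (mp_mult mp_Tinv g) v)"
      using mult[OF mp_T_Mp2Z gi Tinv(3)] \<open>\<And>v. v \<in> V \<Longrightarrow> \<rho> mp_T v = opT v\<close>[OF V[OF gi Tinv(3)]] by simp
    then have "opTinv (\<rho> g v) = \<rho> (mp_mult mp_Tinv g) v"
      by (simp add: opT_def opTinv_def fun_eq_iff flip: mult.assoc)
    then show ?case using weil_rel_mult[OF mp_Tinv_Mp2Z Tinv(1) weil_rel_Tinv[OF V[OF Tinv(1,3)]] Tinv(2)[OF Tinv(3)]] by simp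
  qed
  then show ?thesis by (simp add: \<rho>_def)
qed

end

section \<open>Modular transformation law\<close>

lemma Mp2Z_lift: assumes A: "A \<in> SL2Z" obtains \<phi> where "(A, \<phi>) \<in> Mp2Z"
proof -
  obtain g where g: "g holomorphic_on UHP" "\<And>\<tau>. \<tau> \<in> UHP \<Longrightarrow> aut_factor A \<tau> = (g \<tau>)\<^sup>2"
    using contractible_imp_holomorphic_sqrt[OF aut_factor_holomorphic convex_imp_contractible[OF convex_UHP], of A]
      aut_factor_nonzero[OF A] by blast
  have "(A, \<lambda>\<tau>. if \<tau> \<in> UHP then g \<tau> else 0) \<in> Mp2Z"
    using A g by (simp add: Mp2Z_iff holomorphic_on_if_UHP)
  then show ?thesis by (rule that)
qed

text \<open>
  The automorphy factor of weight \<open>k\<close> in the slash operator and that of weight \<open>k - n/2\<close> in the law for \<open>F\<close> leave the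
  weight \<open>n/2\<close> of theta functions.
\<close>
lemma weight_cancel:
  assumes "(\<phi> :: complex)\<^sup>2 = j" "\<phi> \<noteq> 0"
  shows "j powi (- k) * \<phi> powi (2 * k - n) = \<phi> powi (- n)"
proof -
  have "\<phi> powi (2 * - k) = (\<phi> powi 2) powi (- k)" by (rule power_int_mult)
  then have "j powi (- k) = \<phi> powi (- (2 * k))" by (simp add: assms(1)[symmetric])
  then show ?thesis using assms(2) by (simp flip: power_int_add)
qed

context UN_lattice
begin

text \<open>
  The function \<open>\<Phi>(u, w)\<close> attached to the values of a vector-valued function \<open>F\<close>.
\<close>
definition Phi :: "(complex \<Rightarrow> (real \<times> real \<times> 'a) set \<Rightarrow> complex) \<Rightarrow> int \<Rightarrow> int \<Rightarrow> complex \<Rightarrow> 'a \<times> 'a \<Rightarrow> complex" where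
  "Phi F u w \<tau> z = jtheta (F \<tau>) \<tau> z u w"

lemma jtheta_scale: "\<tau> \<in> UHP \<Longrightarrow> jtheta (\<lambda>x. c * v x) \<tau> z u w = c * jtheta v \<tau> z u w"
  using jtheta_add[of \<tau> c v 0 v z u w] by simp

text \<open>
  By the characterisation of the Weil representation, the modular law for \<open>F\<close> at \<open>A\<close> says that both sides have the
  same theta functions.
\<close>
lemma modular_law_iff:
  assumes F: "\<And>\<tau>. \<tau> \<in> UHP \<Longrightarrow> F \<tau> \<in> V"
  shows "(\<forall>(A, \<phi>)\<in>Mp2Z. \<forall>\<tau>\<in>UHP. F (moebius_act A \<tau>) = (\<lambda>x. \<phi> \<tau> powi (2 * k - int (dim L)) * weil_rep (UN_plus_form N) M (A, \<phi>) (F \<tau>) x))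
     \<longleftrightarrow> (\<forall>A\<in>SL2Z. \<forall>\<tau>\<in>UHP. \<forall>z\<in>complexify L. \<forall>u w.
            jslash k A (Phi F u w) \<tau> z = Phi F (u * A $ 1 $ 1 + w * A $ 2 $ 1) (u * A $ 1 $ 2 + w * A $ 2 $ 2) \<tau> z)"
    (is "?L \<longleftrightarrow> ?R")
proof -
  have key: "aut_factor A \<tau> powi (- k) * index_factor A \<tau> z *
      jtheta (\<lambda>x. \<phi> \<tau> powi (2 * k - int (dim L)) * weil_rep (UN_plus_form N) M (A, \<phi>) (F \<tau>) x) (moebius_act A \<tau>) (cscale (1 / aut_factor A \<tau>) z) u w =
      Phi F (u * A $ 1 $ 1 + w * A $ 2 $ 1) (u * A $ 1 $ 2 + w * A $ 2 $ 2) \<tau> z"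
    if g: "(A, \<phi>) \<in> Mp2Z" and \<tau>: "\<tau> \<in> UHP" and z: "z \<in> complexify L" for A \<phi> \<tau> z u w
  proof -
    have A: "A \<in> SL2Z" and j: "(\<phi> \<tau>)\<^sup>2 = aut_factor A \<tau>" using g \<tau> by (auto simp: Mp2Z_iff)
    note wc = weight_cancel[OF j Mp2Z_nonzero[OF g \<tau>], of k "int (dim L)"]
    note rel = weil_relD[OF weil_rep_characterisation[OF g F[OF \<tau>]] \<tau> z, of u w]
    show ?thesis
      unfolding jtheta_scale[OF moebius_act_UHP[OF A \<tau>]] Phi_def rel[symmetric] wc[symmetric] by (simp only: mult_ac)
  qed
  show ?thesis
  proof
    assume L: ?L
    show ?R
    proof (intro ballI allI)
      fix A \<tau> z u w assume A: "A \<in> SL2Z" and \<tau>: "\<tau> \<in> UHP" and z: "z \<in> complexify L"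
      obtain \<phi> where g: "(A, \<phi>) \<in> Mp2Z" using Mp2Z_lift[OF A] .
      have "F (moebius_act A \<tau>) = (\<lambda>x. \<phi> \<tau> powi (2 * k - int (dim L)) * weil_rep (UN_plus_form N) M (A, \<phi>) (F \<tau>) x)"
        using L g \<tau> by blast
      then show "jslash k A (Phi F u w) \<tau> z = Phi F (u * A $ 1 $ 1 + w * A $ 2 $ 1) (u * A $ 1 $ 2 + w * A $ 2 $ 2) \<tau> z"
        unfolding jslash_index_factor Phi_def[of F u w] using key[OF g \<tau> z, of u w] by simp
    qed
  next
    assume R: ?R
    show ?L
    proof clarify
      fix A \<phi> \<tau> assume g: "(A, \<phi>) \<in> Mp2Z" and \<tau>: "\<tau> \<in> UHP"
      have A: "A \<in> SL2Z" using g by (simp add: Mp2Z_iff)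
      have "weil_rep (UN_plus_form N) M (A, \<phi>) (F \<tau>) \<in> V"
        using weil_rel_V(2)[OF weil_rep_characterisation[OF g F[OF \<tau>]]] .
      then have V2: "(\<lambda>x. \<phi> \<tau> powi (2 * k - int (dim L)) * weil_rep (UN_plus_form N) M (A, \<phi>) (F \<tau>) x) \<in> V"
        by (simp add: group_ring_def)
      have c: "aut_factor A \<tau> powi (- k) \<noteq> 0" using aut_factor_nonzero[OF A \<tau>] by simp
      show "F (moebius_act A \<tau>) = (\<lambda>x. \<phi> \<tau> powi (2 * k - int (dim L)) * weil_rep (UN_plus_form N) M (A, \<phi>) (F \<tau>) x)"
      proof (rule jtheta_transform_inj[OF A \<tau> F[OF moebius_act_UHP[OF A \<tau>]] V2 c])
        fix z u w assume z: "z \<in> complexify L"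
        have "jslash k A (Phi F u w) \<tau> z = Phi F (u * A $ 1 $ 1 + w * A $ 2 $ 1) (u * A $ 1 $ 2 + w * A $ 2 $ 2) \<tau> z"
          using R A \<tau> z by blast
        then show "aut_factor A \<tau> powi - k * index_factor A \<tau> z * jtheta (F (moebius_act A \<tau>)) (moebius_act A \<tau>) (cscale (1 / aut_factor A \<tau>) z) u w =
          aut_factor A \<tau> powi - k * index_factor A \<tau> z * jtheta (\<lambda>x. \<phi> \<tau> powi (2 * k - int (dim L)) * weil_rep (UN_plus_form N) M (A, \<phi>) (F \<tau>) x)
           (moebius_act A \<tau>) (cscale (1 / aut_factor A \<tau>) z) u w"
          unfolding key[OF g \<tau> z] by (simp only: jslash_index_factor Phi_def)
      qed
    qed
  qed
qed

end

section \<open>Elliptic transformation law\<close>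

text \<open>
  The transformation law under the lattice, separated from the definition of Jacobi forms because it is used for
  their transforms under the whole modular group.
\<close>
definition elliptic :: "'a::euclidean_space set \<Rightarrow> (complex \<Rightarrow> 'a \<times> 'a \<Rightarrow> complex) \<Rightarrow> bool" where
  "elliptic L \<phi> \<longleftrightarrow> (\<forall>\<tau>\<in>UHP. \<forall>z\<in>complexify L. \<forall>x\<in>L. \<forall>y\<in>L.
        \<phi> \<tau> (z + cscale \<tau> (x, 0) + (y, 0)) =
          exp (- \<i> * of_real pi * (of_real (x \<bullet> x) * \<tau> + 2 * cform (x, 0) z)) * \<phi> \<tau> z)"

lemma ellipticD:
  "elliptic L \<phi> \<Longrightarrow> \<tau> \<in> UHP \<Longrightarrow> z \<in> complexify L \<Longrightarrow> x \<in> L \<Longrightarrow> y \<in> L \<Longrightarrow>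
     \<phi> \<tau> (z + cscale \<tau> (x, 0) + (y, 0)) = exp (- \<i> * of_real pi * (of_real (x \<bullet> x) * \<tau> + 2 * cform (x, 0) z)) * \<phi> \<tau> z"
  by (simp add: elliptic_def)

context even_lattice
begin

lemma L_scale_int: "x \<in> L \<Longrightarrow> of_int n *\<^sub>R x \<in> L"
proof (induction n rule: int_induct[where k=0])
  case (step1 i) then show ?case using L_add[of "of_int i *\<^sub>R x" x] by (simp add: scaleR_add_left)
next
  case (step2 i) then show ?case using L_diff[of "of_int i *\<^sub>R x" x] by (simp add: scaleR_diff_left)
qed simp

text \<open>
  With \<open>\<tau>' = A \<tau>\<close> and \<open>j = c \<tau> + d\<close>, translation of \<open>z\<close> by \<open>x \<tau> + y\<close> becomes translation of \<open>z / j\<close> by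
  \<open>x' \<tau>' + y'\<close>, where \<open>(x', y') = (x, y) A\<inverse>\<close> again consists of vectors of \<open>L\<close>. The exponents on both sides
  differ by \<open>\<pi> i\<close> times an even integer, because \<open>L\<close> is even.
\<close>
lemma elliptic_jslash:
  assumes \<phi>: "elliptic L \<phi>" and A: "A \<in> SL2Z"
  shows "elliptic L (jslash k A \<phi>)"
  unfolding elliptic_def
proof (intro ballI)
  fix \<tau> z x y assume \<tau>: "\<tau> \<in> UHP" and z: "z \<in> complexify L" and x: "x \<in> L" and y: "y \<in> L"
  define a b c d where "a = A$1$1" and "b = A$1$2" and "c = A$2$1" and "d = A$2$2"
  define j where "j = aut_factor A \<tau>"
  define \<tau>' where "\<tau>' = moebius_act A \<tau>"
  have j: "j = of_int c * \<tau> + of_int d" by (simp add: j_def aut_factor_def c_def d_def)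
  have j0: "j \<noteq> 0" using aut_factor_nonzero[OF A \<tau>] by (simp add: j_def)
  have \<tau>'j: "\<tau>' * j = of_int a * \<tau> + of_int b" using j0 by (simp add: \<tau>'_def moebius_act_def j_def a_def b_def)
  have \<tau>'U: "\<tau>' \<in> UHP" unfolding \<tau>'_def by (rule moebius_act_UHP[OF A \<tau>])
  have deti: "a * d - b * c = 1" using A by (simp add: SL2Z_iff a_def b_def c_def d_def)
  have det: "of_int a * of_int d - of_int b * of_int c = (1::complex)"
    using arg_cong[OF deti, of "of_int :: int \<Rightarrow> complex"] by simp
  have inv1: "1 / j = of_int a - of_int c * \<tau>'"
  proof -
    have "(of_int a - of_int c * \<tau>') * j = of_int a * j - of_int c * (\<tau>' * j)" by (simp add: algebra_simps)
    also have "\<dots> = of_int a * of_int d - of_int b * of_int c" unfolding \<tau>'j unfolding j by (simp add: algebra_simps)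
    finally show ?thesis using j0 det by (simp add: field_simps)
  qed
  have inv2: "\<tau> / j = of_int d * \<tau>' - of_int b"
  proof -
    have "(of_int d * \<tau>' - of_int b) * j = of_int d * (\<tau>' * j) - of_int b * j" by (simp add: algebra_simps)
    also have "\<dots> = (of_int a * of_int d - of_int b * of_int c) * \<tau>" unfolding \<tau>'j unfolding j by (simp add: algebra_simps)
    finally show ?thesis using j0 det by (simp add: field_simps)
  qed
  define x' where "x' = of_int d *\<^sub>R x - of_int c *\<^sub>R y"
  define y' where "y' = of_int a *\<^sub>R y - of_int b *\<^sub>R x"
  have x'y': "x' \<in> L" "y' \<in> L" unfolding x'_def y'_def by (intro L_diff L_scale_int x y)+
  define zt where "zt = z + cscale \<tau> (x, 0) + (y, 0)"
  have "cscale (1 / j) zt = cscale (1 / j) z + (cscale (\<tau> / j) (x, 0) + cscale (1 / j) (y, 0))"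
  proof -
    have add: "cscale v (p + q) = cscale v p + cscale v q" for v p and q :: "'a \<times> 'a"
      by (cases p; cases q) (simp add: cscale_def algebra_simps)
    show ?thesis unfolding zt_def add cscale_cscale by (simp add: add.assoc)
  qed
  also have "cscale (\<tau> / j) (x, 0) + cscale (1 / j) (y, 0) = cscale \<tau>' (x', 0) + (y', 0)"
    unfolding inv1 inv2 x'_def y'_def by (simp add: cscale_def algebra_simps)
  finally have zt': "cscale (1 / j) zt = cscale (1 / j) z + cscale \<tau>' (x', 0) + (y', 0)" by (simp add: add.assoc)
  have z'c: "cscale (1 / j) z \<in> complexify L" using cscale_complexify[OF z] .
  define X Y Z where "X = complex_of_real (x \<bullet> x)" and "Y = complex_of_real (y \<bullet> y)" and "Z = complex_of_real (x \<bullet> y)"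
  have cz: "cform zt zt = cform z z + 2 * (\<tau> * cform (x, 0) z + cform (y, 0) z) + (X * \<tau>\<^sup>2 + 2 * Z * \<tau> + Y)"
  proof -
    have add_left: "cform (p + q) v = cform p v + cform q v" for p q and v :: "'a \<times> 'a"
      using cform_add_right cform_commute by metis
    have c1: "cform z (x, 0) = cform (x, 0) z" "cform z (y, 0) = cform (y, 0) z"
      by (rule cform_commute)+
    show ?thesis
      unfolding zt_def add_left cform_add_right c1 cform_scale_left cform_scale_right cform_real X_def Y_def Z_def
      by (simp add: inner_commute power2_eq_square algebra_simps)
  qed
  have x'2: "complex_of_real (x' \<bullet> x') = of_int d ^ 2 * X - 2 * of_int c * of_int d * Z + of_int c ^ 2 * Y"
    unfolding x'_def X_def Y_def Z_def by (simp add: inner_simps inner_commute power2_eq_square algebra_simps)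
  have cx': "cform (x', 0) (cscale (1 / j) z) = (of_int d * cform (x, 0) z - of_int c * cform (y, 0) z) / j"
  proof -
    have "cform (x', 0) z = of_int d * cform (x, 0) z - of_int c * cform (y, 0) z"
      unfolding x'_def by (cases z) (simp add: cform_dual inner_simps complex_eq_iff)
    then show ?thesis by (simp add: cform_scale_right)
  qed
  \<comment> \<open>the discrepancy between the two exponents, an even integer\<close>
  define R where "R = of_int (b * d) * X + of_int (a * c) * Y - 2 * of_int (b * c) * Z"
  have quad: "of_int c * (X * \<tau>\<^sup>2 + 2 * Z * \<tau> + Y) / j + (of_int d ^ 2 * X - 2 * of_int c * of_int d * Z + of_int c ^ 2 * Y) * \<tau>' = X * \<tau> + R"
  proof -
    have e1: "of_int c * \<tau>\<^sup>2 + of_int d ^ 2 * (of_int a * \<tau> + of_int b) = (\<tau> + of_int b * of_int d) * j"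
      unfolding j using det by algebra
    have e2: "of_int c + of_int c ^ 2 * (of_int a * \<tau> + of_int b) = of_int a * of_int c * j"
      unfolding j using det by algebra
    have e3: "of_int c * (2 * \<tau>) - 2 * of_int c * of_int d * (of_int a * \<tau> + of_int b) = - 2 * of_int b * of_int c * j"
      unfolding j using det by algebra
    have "(of_int c * (X * \<tau>\<^sup>2 + 2 * Z * \<tau> + Y) / j + (of_int d ^ 2 * X - 2 * of_int c * of_int d * Z + of_int c ^ 2 * Y) * \<tau>') * j
       = of_int c * (X * \<tau>\<^sup>2 + 2 * Z * \<tau> + Y) + (of_int d ^ 2 * X - 2 * of_int c * of_int d * Z + of_int c ^ 2 * Y) * (\<tau>' * j)"
    proof -
      have "(p / j + q * \<tau>') * j = p + q * (\<tau>' * j)" for p q using j0 by (simp add: ring_distribs)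
      then show ?thesis .
    qed
    also have "\<dots> = X * (of_int c * \<tau>\<^sup>2 + of_int d ^ 2 * (of_int a * \<tau> + of_int b)) + Y * (of_int c + of_int c ^ 2 * (of_int a * \<tau> + of_int b)) +
       Z * (of_int c * (2 * \<tau>) - 2 * of_int c * of_int d * (of_int a * \<tau> + of_int b))"
      unfolding \<tau>'j by (simp add: algebra_simps)
    also have "\<dots> = (X * \<tau> + R) * j" unfolding e1 e2 e3 R_def by (simp add: algebra_simps)
    finally show ?thesis using j0 by simp
  qed
  have lin: "of_int c * (2 * (\<tau> * cform (x, 0) z + cform (y, 0) z)) / j + 2 * ((of_int d * cform (x, 0) z - of_int c * cform (y, 0) z) / j) = 2 * cform (x, 0) z"
  proof -
    have e: "of_int c * (2 * (\<tau> * cform (x, 0) z + cform (y, 0) z)) + 2 * (of_int d * cform (x, 0) z - of_int c * cform (y, 0) z) = 2 * cform (x, 0) z * j"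
      unfolding j by (simp add: algebra_simps)
    have g: "p / j + 2 * (q / j) = (p + 2 * q) / j" for p q by (simp add: add_divide_distrib)
    show ?thesis unfolding g e using j0 by simp
  qed
  have expo: "of_int c * cform zt zt / j + (complex_of_real (x' \<bullet> x') * \<tau>' + 2 * cform (x', 0) (cscale (1 / j) z)) =
     of_int c * cform z z / j + (X * \<tau> + 2 * cform (x, 0) z) + R"
  proof -
    have "of_int c * cform zt zt / j = of_int c * cform z z / j + of_int c * (2 * (\<tau> * cform (x, 0) z + cform (y, 0) z)) / j + of_int c * (X * \<tau>\<^sup>2 + 2 * Z * \<tau> + Y) / j"
      unfolding cz by (simp add: ring_distribs add_divide_distrib)
    then show ?thesis unfolding x'2 cx' using quad lin by (simp add: algebra_simps)
  qed
  obtain m1 m2 m3 where m: "x \<bullet> x / 2 = of_int m1" "y \<bullet> y / 2 = of_int m2" "x \<bullet> y = of_int m3"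
    using L_even[OF x] L_even[OF y] L_integral[OF x y] by (auto elim!: Ints_cases)
  have R2: "R = 2 * of_int (b * d * m1 + a * c * m2 - b * c * m3)"
  proof -
    have "x \<bullet> x = 2 * of_int m1" "y \<bullet> y = 2 * of_int m2" using m by simp_all
    then show ?thesis unfolding R_def X_def Y_def Z_def m(3) by (simp add: algebra_simps)
  qed
  have expR: "exp (- \<i> * of_real pi * R) = 1"
  proof -
    have "- \<i> * of_real pi * R = 2 * of_real pi * \<i> * of_int (- (b * d * m1 + a * c * m2 - b * c * m3))" unfolding R2 by (simp add: algebra_simps)
    then show ?thesis using ee_of_int[of "- (b * d * m1 + a * c * m2 - b * c * m3)"] unfolding ee_def by (simp only:)
  qed
  have "index_factor A \<tau> zt * exp (- \<i> * of_real pi * (of_real (x' \<bullet> x') * \<tau>' + 2 * cform (x', 0) (cscale (1 / j) z))) =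
     exp (- \<i> * of_real pi * (of_int c * cform zt zt / j + (complex_of_real (x' \<bullet> x') * \<tau>' + 2 * cform (x', 0) (cscale (1 / j) z))))"
    unfolding index_factor_def exp_add[symmetric] j_def[symmetric] c_def[symmetric] by (simp only: ring_distribs)
  also have "\<dots> = index_factor A \<tau> z * exp (- \<i> * of_real pi * (X * \<tau> + 2 * cform (x, 0) z)) * exp (- \<i> * of_real pi * R)"
    unfolding expo index_factor_def exp_add[symmetric] j_def[symmetric] c_def[symmetric] by (simp only: ring_distribs)
  finally have fac: "index_factor A \<tau> zt * exp (- \<i> * of_real pi * (of_real (x' \<bullet> x') * \<tau>' + 2 * cform (x', 0) (cscale (1 / j) z))) =
     exp (- \<i> * of_real pi * (X * \<tau> + 2 * cform (x, 0) z)) * index_factor A \<tau> z"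
    unfolding expR by simp
  have "jslash k A \<phi> \<tau> zt = j powi (- k) * index_factor A \<tau> zt * \<phi> \<tau>' (cscale (1 / j) z + cscale \<tau>' (x', 0) + (y', 0))"
    unfolding jslash_index_factor j_def[symmetric] \<tau>'_def[symmetric] zt' ..
  also have "\<phi> \<tau>' (cscale (1 / j) z + cscale \<tau>' (x', 0) + (y', 0)) =
     exp (- \<i> * of_real pi * (of_real (x' \<bullet> x') * \<tau>' + 2 * cform (x', 0) (cscale (1 / j) z))) * \<phi> \<tau>' (cscale (1 / j) z)"
    by (rule ellipticD[OF \<phi> \<tau>'U z'c x'y'])
  finally have "jslash k A \<phi> \<tau> zt = j powi (- k) * (index_factor A \<tau> zt * exp (- \<i> * of_real pi * (of_real (x' \<bullet> x') * \<tau>' + 2 * cform (x', 0) (cscale (1 / j) z)))) * \<phi> \<tau>' (cscale (1 / j) z)"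
    by (simp only: mult_ac)
  then have "jslash k A \<phi> \<tau> zt = exp (- \<i> * of_real pi * (X * \<tau> + 2 * cform (x, 0) z)) * jslash k A \<phi> \<tau> z"
    unfolding fac jslash_index_factor j_def[symmetric] \<tau>'_def[symmetric] by (simp only: mult_ac)
  then show "jslash k A \<phi> \<tau> (z + cscale \<tau> (x, 0) + (y, 0)) =
       exp (- \<i> * of_real pi * (of_real (x \<bullet> x) * \<tau> + 2 * cform (x, 0) z)) * jslash k A \<phi> \<tau> z"
    unfolding zt_def X_def .
qed

section \<open>Fourier--Jacobi coefficients and theta decomposition\<close>

text \<open>
  For \<open>\<tau> = t + i\<close> and real \<open>z\<close> the series is a Fourier series on the product of the real line and the span
  of \<open>L\<close>.
\<close>
lemma jacobi_coefficients_zero: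
  assumes zero: "\<And>\<tau> z. \<tau> \<in> UHP \<Longrightarrow> z \<in> complexify L \<Longrightarrow>
      ((\<lambda>(n, l). f n l * ee (of_real n * \<tau>) * ee (cform (l, 0) z)) has_sum 0) (S \<times> Ld)"
    and nl: "n \<in> S" "l \<in> Ld"
  shows "f n l = 0"
proof -
  have "(\<lambda>(n, l). f n l * ee (of_real n * \<i>)) (n, l) = 0"
  proof (rule fourier_series_zero[of "UNIV \<times> span L" "S \<times> Ld"])
    show "subspace (UNIV \<times> span L :: (real \<times> 'a) set)" by (intro subspace_Times subspace_UNIV subspace_span)
    show "S \<times> Ld \<subseteq> UNIV \<times> span L" using Ld_span by auto
    show "(n, l) \<in> S \<times> Ld" using nl by simp
    fix p :: "real \<times> 'a" assume "p \<in> UNIV \<times> span L"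
    then obtain t v where p: "p = (t, v)" and v: "v \<in> span L" by auto
    have "of_real t + \<i> \<in> UHP" by (simp add: UHP_def)
    from zero[OF this complexify_real[OF v]]
    show "((\<lambda>l. (case l of (n, l) \<Rightarrow> f n l * ee (of_real n * \<i>)) * ee (of_real (l \<bullet> p))) has_sum 0) (S \<times> Ld)"
    proof (rule has_sum_cong[THEN iffD1, rotated])
      fix q :: "real \<times> 'a"
      obtain n l where q: "q = (n, l)" by (cases q)
      have "ee (of_real n * (of_real t + \<i>)) * ee (of_real (l \<bullet> v)) = ee (of_real n * \<i>) * ee (of_real (n * t + l \<bullet> v))"
        unfolding ee_add[symmetric] by (simp add: algebra_simps)
      then show "(case q of (n, l) \<Rightarrow> f n l * ee (of_real n * (of_real t + \<i>)) * ee (cform (l, 0) (v, 0))) =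
          (case q of (n, l) \<Rightarrow> f n l * ee (of_real n * \<i>)) * ee (of_real (q \<bullet> p))"
        unfolding q p prod.case cform_real inner_Pair inner_real_def by (simp only: mult.assoc)
    qed
  qed
  then show ?thesis by simp
qed

text \<open>
  Multiplication of expansions in \<open>q\<close> with theta functions. The rearrangement to a double series in
  \<open>(n, l)\<close> with \<open>n = m + Q(l)\<close> is justified by absolute convergence: only finitely many series in \<open>m\<close> occur, since \<open>h\<close> is periodic in \<open>l\<close>.
\<close>
lemma theta_series:
  assumes per: "\<And>l x m. l \<in> Ld \<Longrightarrow> x \<in> L \<Longrightarrow> h (l + x) m = h l m"
    and sum: "\<And>l. l \<in> Ld \<Longrightarrow> ((\<lambda>m. h l m * ee (of_real m * \<tau>)) has_sum g l) UNIV"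
    and \<tau>: "\<tau> \<in> UHP"
  shows "((\<lambda>(n, l). h l (n - l \<bullet> l / 2) * ee (of_real n * \<tau>) * ee (cform (l, 0) z)) has_sum theta L g \<tau> z) (UNIV \<times> Ld)"
proof -
  define \<theta> where "\<theta> l = ee (of_real (l \<bullet> l / 2) * \<tau>) * ee (cform (l, 0) z)" for l
  have gper: "periodic L g"
    unfolding periodic_def
  proof (intro ballI)
    fix l x assume lx: "l \<in> Ld" "x \<in> L"
    have "((\<lambda>m. h l m * ee (of_real m * \<tau>)) has_sum g (l + x)) UNIV"
      using sum[OF Ld_add[OF lx(1) L_Ld[OF lx(2)]]] per[OF lx] by simp
    then show "g (l + x) = g l" using sum[OF lx(1)] has_sum_unique by blast
  qed
  define P where "P l = (\<Sum>\<^sub>\<infinity>m. norm (h l m * ee (of_real m * \<tau>)))" for l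
  have Psum: "((\<lambda>m. norm (h l m * ee (of_real m * \<tau>))) has_sum P l) UNIV" if "l \<in> Ld" for l
    unfolding P_def using has_sum_imp_summable[OF sum[OF that]]
    by (intro has_sum_infsum) (simp only: summable_on_iff_abs_summable_on_complex[symmetric])
  have P0: "P l \<ge> 0" for l unfolding P_def by (rule infsum_nonneg) auto
  have Pper: "periodic L (\<lambda>l. complex_of_real (P l))"
    unfolding periodic_def P_def using per by simp
  define H where "H = (\<lambda>(l, m). h l m * ee (of_real m * \<tau>) * \<theta> l)"
  have "(\<lambda>p. norm (H p)) summable_on (Ld \<times> UNIV)"
  proof (rule summable_on_SigmaI[where g="\<lambda>l. P l * norm (\<theta> l)"])
    fix l assume "l \<in> Ld"
    from has_sum_cmult_left[OF Psum[OF this], of "norm (\<theta> l)"]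
    show "((\<lambda>m. norm (H (l, m))) has_sum P l * norm (\<theta> l)) UNIV" by (simp add: H_def norm_mult)
  next
    have "(\<lambda>l. norm (complex_of_real (P l) * \<theta> l)) summable_on Ld"
      unfolding \<theta>_def by (rule theta_abs_summable[OF Pper \<tau>])
    then show "(\<lambda>l. P l * norm (\<theta> l)) summable_on Ld" using P0 by (simp add: norm_mult)
  qed auto
  then have Hs: "H summable_on (Ld \<times> UNIV)" by (rule abs_summable_summable)
  have "(H has_sum theta L g \<tau> z) (Ld \<times> UNIV)"
  proof (rule has_sum_SigmaI[OF _ _ Hs])
    fix l assume "l \<in> Ld"
    from has_sum_cmult_left[OF sum[OF this], of "\<theta> l"]
    show "((\<lambda>m. H (l, m)) has_sum g l * \<theta> l) UNIV" by (simp add: H_def)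
  next
    show "((\<lambda>l. g l * \<theta> l) has_sum theta L g \<tau> z) Ld" unfolding \<theta>_def by (rule theta_has_sum[OF gper \<tau>])
  qed
  moreover have bij: "bij_betw (\<lambda>(n, l). (l, n - l \<bullet> l / 2)) (UNIV \<times> Ld) (Ld \<times> UNIV)"
    by (rule bij_betwI[of _ _ _ "\<lambda>(l, m). (m + l \<bullet> l / 2, l)"]) auto
  ultimately have "((\<lambda>p. H ((\<lambda>(n, l). (l, n - l \<bullet> l / 2)) p)) has_sum theta L g \<tau> z) (UNIV \<times> Ld)"
    using has_sum_reindex_bij_betw[OF bij, of H] by blast
  moreover have "H ((\<lambda>(n, l). (l, n - l \<bullet> l / 2)) p) = (\<lambda>(n, l). h l (n - l \<bullet> l / 2) * ee (of_real n * \<tau>) * ee (cform (l, 0) z)) p" for p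
  proof (cases p)
    case (Pair n l)
    have "ee (of_real (n - l \<bullet> l / 2) * \<tau>) * ee (of_real (l \<bullet> l / 2) * \<tau>) = ee (of_real n * \<tau>)"
    proof -
      have "of_real (n - q) * \<tau> + of_real q * \<tau> = of_real n * \<tau>" for q by (simp add: algebra_simps)
      then show ?thesis unfolding ee_add[symmetric] by (rule arg_cong)
    qed
    then have "c * ee (of_real (n - l \<bullet> l / 2) * \<tau>) * (ee (of_real (l \<bullet> l / 2) * \<tau>) * e) = c * ee (of_real n * \<tau>) * e" for c e
      by (metis mult.assoc)
    then show ?thesis unfolding Pair H_def \<theta>_def prod.case .
  qed
  ultimately show ?thesis by simp
qed

text \<open>
  The two sides of the elliptic law for translation by \<open>x \<tau>\<close> have expansions with coefficients
  \<open>f (n - (l, x), l)\<close> and \<open>f (n + Q(x), l + x)\<close>; now compare coefficients.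
\<close>
lemma elliptic_coefficients:
  assumes \<phi>: "elliptic L \<phi>"
    and sum: "\<And>\<tau> z. \<tau> \<in> UHP \<Longrightarrow> z \<in> complexify L \<Longrightarrow>
      ((\<lambda>(n, l). f n l * ee (of_real n * \<tau>) * ee (cform (l, 0) z)) has_sum \<phi> \<tau> z) (\<rat> \<times> Ld)"
    and n: "n \<in> \<rat>" and l: "l \<in> Ld" and x: "x \<in> L"
  shows "f (n + l \<bullet> x + x \<bullet> x / 2) (l + x) = f n l"
proof -
  have Qx: "x \<bullet> x / 2 \<in> \<rat>" using L_even[OF x] Ints_subset_Rats by blast
  have lx: "l \<bullet> x \<in> \<rat>" if "l \<in> Ld" for l using Ld_integral(1)[OF that x] Ints_subset_Rats by blast
  have "f (n - l \<bullet> x) l - f (n + x \<bullet> x / 2) (l + x) = 0" if n: "n \<in> \<rat>" and l: "l \<in> Ld" for n l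
  proof (rule jacobi_coefficients_zero[where S="\<rat>" and n=n and l=l and f="\<lambda>n l. f (n - l \<bullet> x) l - f (n + x \<bullet> x / 2) (l + x)"])
    fix \<tau> z assume \<tau>: "\<tau> \<in> UHP" and z: "z \<in> complexify L"
    have z': "z + cscale \<tau> (x, 0) + (0, 0) \<in> complexify L"
      using z cscale_complexify[OF complexify_real[OF L_span[OF x]]] by (intro complexify_add) (auto simp: complexify_def span_zero)
    let ?E = "\<lambda>n l. ee (of_real n * \<tau>) * ee (cform (l, 0) z)"
    have s1: "((\<lambda>(n, l). f (n - l \<bullet> x) l * ?E n l) has_sum \<phi> \<tau> (z + cscale \<tau> (x, 0) + (0, 0))) (\<rat> \<times> Ld)"
    proof -
      have bij: "bij_betw (\<lambda>(n, l). (n - l \<bullet> x, l)) (\<rat> \<times> Ld) (\<rat> \<times> Ld)"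
        by (rule bij_betwI[of _ _ _ "\<lambda>(n, l). (n + l \<bullet> x, l)"]) (auto simp: lx)
      have key: "(case (n - l \<bullet> x, l) of (n, l) \<Rightarrow> f n l * ee (of_real n * \<tau>) * ee (cform (l, 0) (z + cscale \<tau> (x, 0) + (0, 0)))) = f (n - l \<bullet> x) l * ?E n l" for n l
      proof -
        have "of_real (n - l \<bullet> x) * \<tau> + cform (l, 0) (z + cscale \<tau> (x, 0) + (0, 0)) = of_real n * \<tau> + cform (l, 0) z"
          by (simp add: cform_add_right cform_scale_right cform_real algebra_simps)
        then show ?thesis by (simp add: mult.assoc flip: ee_add)
      qed
      from iffD2[OF has_sum_reindex_bij_betw[OF bij] sum[OF \<tau> z']] show ?thesis
        by (rule has_sum_cong[THEN iffD1, rotated]) (clarsimp simp only: prod.case key[simplified prod.case])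
    qed
    have s2: "((\<lambda>(n, l). f (n + x \<bullet> x / 2) (l + x) * ?E n l) has_sum \<phi> \<tau> (z + cscale \<tau> (x, 0) + (0, 0))) (\<rat> \<times> Ld)"
    proof -
      have bij: "bij_betw (\<lambda>(n, l). (n + x \<bullet> x / 2, l + x)) (\<rat> \<times> Ld) (\<rat> \<times> Ld)"
        by (rule bij_betwI[of _ _ _ "\<lambda>(n, l). (n - x \<bullet> x / 2, l - x)"]) (use Qx L_Ld[OF x] Ld_add Ld_diff in auto)
      define e where "e = exp (- \<i> * of_real pi * (of_real (x \<bullet> x) * \<tau> + 2 * cform (x, 0) z))"
      have e: "e = ee (- (of_real (x \<bullet> x / 2) * \<tau> + cform (x, 0) z))"
        unfolding e_def ee_def by (rule arg_cong[of _ _ exp]) (simp add: algebra_simps)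
      have ev: "\<phi> \<tau> (z + cscale \<tau> (x, 0) + (0, 0)) = e * \<phi> \<tau> z"
        unfolding e_def by (rule ellipticD[OF \<phi> \<tau> z x L_0])
      have key: "e * (case (n + x \<bullet> x / 2, l + x) of (n, l) \<Rightarrow> f n l * ee (of_real n * \<tau>) * ee (cform (l, 0) z)) = f (n + x \<bullet> x / 2) (l + x) * ?E n l" for n l
      proof -
        have "- (of_real (x \<bullet> x / 2) * \<tau> + cform (x, 0) z) + (of_real (n + x \<bullet> x / 2) * \<tau> + cform (l + x, 0) z) = of_real n * \<tau> + cform (l, 0) z"
          by (simp add: cform_dual_add algebra_simps)
        from arg_cong[OF this, of ee]
        have "e * (ee (of_real (n + x \<bullet> x / 2) * \<tau>) * ee (cform (l + x, 0) z)) = ?E n l"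
          by (simp only: e ee_add)
        then show ?thesis by (simp add: mult_ac)
      qed
      from has_sum_cmult_right[OF iffD2[OF has_sum_reindex_bij_betw[OF bij] sum[OF \<tau> z]], of e] show ?thesis
        unfolding ev by (rule has_sum_cong[THEN iffD1, rotated]) (clarsimp simp only: prod.case key[simplified prod.case])
    qed
    from has_sum_add[OF s1 has_sum_uminusI[OF s2]]
    show "((\<lambda>(n, l). (f (n - l \<bullet> x) l - f (n + x \<bullet> x / 2) (l + x)) * ee (of_real n * \<tau>) * ee (cform (l, 0) z)) has_sum 0) (\<rat> \<times> Ld)"
      by (simp add: case_prod_unfold algebra_simps)
  qed (use n l in auto)
  from this[of "n + l \<bullet> x" l] show ?thesis using n l lx by simp
qed

text \<open>
  The coefficient \<open>f n l\<close> depends only on \<open>n - Q(l)\<close> and on the class of \<open>l\<close> modulo \<open>L\<close>. Hence the series in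
  \<open>n\<close> for fixed \<open>l\<close> is a power of \<open>q\<close> times a function that is periodic in \<open>l\<close>.
\<close>
lemma theta_decomposition:
  assumes \<phi>: "elliptic L \<phi>"
    and sum: "\<And>\<tau> z. \<tau> \<in> UHP \<Longrightarrow> z \<in> complexify L \<Longrightarrow>
      ((\<lambda>(n, l). f n l * ee (of_real n * \<tau>) * ee (cform (l, 0) z)) has_sum \<phi> \<tau> z) (\<rat> \<times> Ld)"
  obtains h where "\<And>\<tau>. \<tau> \<in> UHP \<Longrightarrow> periodic L (h \<tau>)"
    and "\<And>\<tau> l. \<tau> \<in> UHP \<Longrightarrow> l \<in> Ld \<Longrightarrow> ((\<lambda>n. f n l * ee (of_real (n - l \<bullet> l / 2) * \<tau>)) has_sum h \<tau> l) \<rat>"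
    and "\<And>\<tau> z. \<tau> \<in> UHP \<Longrightarrow> z \<in> complexify L \<Longrightarrow> \<phi> \<tau> z = theta L (h \<tau>) \<tau> z"
proof -
  define h where "h \<tau> l = (\<Sum>\<^sub>\<infinity>n\<in>\<rat>. f n l * ee (of_real (n - l \<bullet> l / 2) * \<tau>))" for \<tau> l
  have swap: "((\<lambda>(l, n). f n l * ee (of_real n * \<tau>) * ee (cform (l, 0) z)) has_sum \<phi> \<tau> z) (Ld \<times> \<rat>)"
    if "\<tau> \<in> UHP" "z \<in> complexify L" for \<tau> z
    using sum[OF that] by (subst (asm) has_sum_swap) (simp add: case_prod_unfold)
  have z0: "0 \<in> complexify L" by (auto simp: complexify_def zero_prod_def span_zero)
  have shift: "ee (of_real (n - l \<bullet> l / 2) * \<tau>) = ee (- (of_real (l \<bullet> l / 2) * \<tau>)) * ee (of_real n * \<tau>)" for n l \<tau>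
  proof -
    have "of_real (n - q) * \<tau> = - (of_real q * \<tau>) + of_real n * \<tau>" for q by (simp add: algebra_simps)
    then show ?thesis unfolding ee_add[symmetric] by (rule arg_cong)
  qed
  have hs: "((\<lambda>n. f n l * ee (of_real (n - l \<bullet> l / 2) * \<tau>)) has_sum h \<tau> l) \<rat>" if \<tau>: "\<tau> \<in> UHP" and l: "l \<in> Ld" for \<tau> l
  proof -
    have "(\<lambda>(l, n). f n l * ee (of_real n * \<tau>) * ee (cform (l, 0) 0)) summable_on (Ld \<times> \<rat>)"
      using has_sum_imp_summable[OF swap[OF \<tau> z0]] .
    from summable_on_SigmaD1[OF this l]
    have "(\<lambda>n. f n l * ee (of_real n * \<tau>)) summable_on \<rat>" by (simp add: zero_prod_def cform_real)
    from summable_on_cmult_right[OF this, of "ee (- (of_real (l \<bullet> l / 2) * \<tau>))"]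
    have "(\<lambda>n. f n l * ee (of_real (n - l \<bullet> l / 2) * \<tau>)) summable_on \<rat>"
      unfolding shift[of _ l \<tau>] by (simp only: mult_ac)
    then show ?thesis unfolding h_def by (rule has_sum_infsum)
  qed
  have per: "periodic L (h \<tau>)" if \<tau>: "\<tau> \<in> UHP" for \<tau>
    unfolding periodic_def
  proof (intro ballI)
    fix l x assume l: "l \<in> Ld" and x: "x \<in> L"
    define s where "s = l \<bullet> x + x \<bullet> x / 2"
    have s: "s \<in> \<rat>" unfolding s_def using Ld_integral(1)[OF l x] L_even[OF x] Ints_subset_Rats by (intro Rats_add) auto
    have bij: "bij_betw (\<lambda>n. n + s) \<rat> \<rat>"
      by (rule bij_betwI[of _ _ _ "\<lambda>n. n - s"]) (use s in auto)
    have Q: "n + s - (l + x) \<bullet> (l + x) / 2 = n - l \<bullet> l / 2" for n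
      by (simp add: s_def inner_simps inner_commute field_simps)
    have "((\<lambda>n. f (n + s) (l + x) * ee (of_real (n + s - (l + x) \<bullet> (l + x) / 2) * \<tau>)) has_sum h \<tau> (l + x)) \<rat>"
      using iffD2[OF has_sum_reindex_bij_betw[OF bij] hs[OF \<tau> Ld_add[OF l L_Ld[OF x]]]] .
    then have "((\<lambda>n. f n l * ee (of_real (n - l \<bullet> l / 2) * \<tau>)) has_sum h \<tau> (l + x)) \<rat>"
      unfolding Q
    proof (rule has_sum_cong[THEN iffD1, rotated])
      fix n :: real assume "n \<in> \<rat>"
      from elliptic_coefficients[OF \<phi> sum this l x]
      show "f (n + s) (l + x) * ee (of_real (n - l \<bullet> l / 2) * \<tau>) = f n l * ee (of_real (n - l \<bullet> l / 2) * \<tau>)"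
        by (simp add: s_def add.assoc)
    qed
    with hs[OF \<tau> l] show "h \<tau> (l + x) = h \<tau> l" using has_sum_unique by blast
  qed
  have "\<phi> \<tau> z = theta L (h \<tau>) \<tau> z" if \<tau>: "\<tau> \<in> UHP" and z: "z \<in> complexify L" for \<tau> z
  proof -
    define \<theta> where "\<theta> l = ee (of_real (l \<bullet> l / 2) * \<tau>) * ee (cform (l, 0) z)" for l
    have "((\<lambda>l. h \<tau> l * \<theta> l) has_sum \<phi> \<tau> z) Ld"
    proof (rule has_sum_SigmaD[OF swap[OF \<tau> z]])
      fix l assume "l \<in> Ld"
      have canc: "p * (m * r) * (t * e) = p * r * e" if "m * t = 1" for p m r t e :: complex
      proof -
        have "p * (m * r) * (t * e) = (m * t) * (p * r * e)" by (simp only: mult_ac)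
        then show ?thesis using that by simp
      qed
      from has_sum_cmult_left[OF hs[OF \<tau> \<open>l \<in> Ld\<close>], of "\<theta> l"]
      show "((\<lambda>n. case (l, n) of (l, n) \<Rightarrow> f n l * ee (of_real n * \<tau>) * ee (cform (l, 0) z)) has_sum h \<tau> l * \<theta> l) \<rat>"
        unfolding \<theta>_def prod.case shift[of _ l \<tau>] canc[OF ee_minus_mult(1)] .
    qed
    with theta_has_sum[OF per[OF \<tau>] \<tau>, of z] show ?thesis
      unfolding \<theta>_def using has_sum_unique by blast
  qed
  then show ?thesis using that per hs by blast
qed

end

section \<open>Orbits of row vectors\<close>

lemma SL2Z_bottom_row: assumes "coprime c (d :: int)" obtains A where "A \<in> SL2Z" "A$2$1 = c" "A$2$2 = d"
proof -
  obtain x y where "x * c + y * d = 1" using assms bezout_int[of c d] by (auto simp: coprime_iff_gcd_eq_1)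
  then have "mat2 y (- x) c d \<in> SL2Z" by (simp add: SL2Z_iff algebra_simps)
  then show ?thesis using that by simp
qed

text \<open>
  Every row vector modulo \<open>N\<close> is \<open>(0, d) A\<close>: first make its first entry zero, so that it becomes \<open>(0, g)\<close>, and
  then replace \<open>g\<close> by its greatest common divisor with \<open>N\<close>, using a matrix whose bottom row is \<open>(N/d, g/d)\<close>.
\<close>
lemma row_orbit:
  fixes u w :: int
  assumes N: "N > 0"
  obtains d A where "d dvd N" "A \<in> SL2Z" "int N dvd int d * A$2$1 - u" "int N dvd int d * A$2$2 - w"
proof -
  define g where "g = gcd u w"
  obtain A1 where A1: "A1 \<in> SL2Z" "g * A1$2$1 = u" "g * A1$2$2 = w"
  proof (cases "g = 0")
    case True
    then have "u = 0" "w = 0" by (auto simp: g_def)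
    then show ?thesis using that[of "mat 1"] True by simp
  next
    case False
    then have "coprime (u div g) (w div g)" unfolding g_def by (intro div_gcd_coprime) auto
    then obtain A where "A \<in> SL2Z" "A$2$1 = u div g" "A$2$2 = w div g" by (rule SL2Z_bottom_row)
    then show ?thesis using that[of A] by (simp add: g_def)
  qed
  define d where "d = nat (gcd g (int N))"
  have d: "int d = gcd g (int N)" by (simp add: d_def)
  have dN: "d dvd N" using d by (metis gcd_dvd2 int_dvd_int_iff)
  have d0: "int d \<noteq> 0" using d N by simp
  define m where "m = int N div int d"
  define s where "s = g div int d"
  have m: "int N = int d * m" using dN by (simp add: m_def)
  have s: "g = int d * s" using d by (simp add: s_def)
  have "coprime m s" using div_gcd_coprime[of g "int N"] N unfolding m_def s_def d by (simp add: coprime_commute)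
  then obtain B where B: "B \<in> SL2Z" "B$2$1 = m" "B$2$2 = s" by (rule SL2Z_bottom_row)
  have "int d * (B ** A1)$2$1 - u = int N * A1$1$1"
    unfolding A1(2)[symmetric] by (simp add: B s m algebra_simps)
  moreover have "int d * (B ** A1)$2$2 - w = int N * A1$1$2"
    unfolding A1(3)[symmetric] by (simp add: B s m algebra_simps)
  ultimately show ?thesis using that[OF dN SL2Z_mult[OF B(1) A1(1)]] by simp
qed

text \<open>
  If \<open>(0, d) B\<close> is congruent to \<open>(0, d')\<close> then \<open>d\<close> divides \<open>d'\<close>. By symmetry \<open>d = d'\<close>, and the bottom row of
  \<open>B\<close> is congruent to \<open>(0, 1)\<close> modulo \<open>N/d\<close>; the determinant gives the remaining congruence.
\<close>
lemma row_orbit_unique: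
  assumes N: "N > 0" and d: "d dvd N" "d' dvd N" and A: "A \<in> SL2Z" and A': "A' \<in> SL2Z"
    and eq: "int N dvd int d * A$2$1 - int d' * A'$2$1" "int N dvd int d * A$2$2 - int d' * A'$2$2"
  shows "d = d'" and "A ** adj2 A' \<in> Gamma1 (N div d)"
proof -
  have key: "int N dvd int d * (A ** adj2 A')$2$1 \<and> int N dvd int d * (A ** adj2 A')$2$2 - int d'"
    if A: "A \<in> SL2Z" and A': "A' \<in> SL2Z"
      and eq: "int N dvd int d * A$2$1 - int d' * A'$2$1" "int N dvd int d * A$2$2 - int d' * A'$2$2" for d d' A A'
  proof -
    have "int d * (A ** adj2 A')$2$1 = (int d * A$2$1 - int d' * A'$2$1) * A'$2$2 - (int d * A$2$2 - int d' * A'$2$2) * A'$2$1"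
      by (simp add: adj2_def algebra_simps)
    moreover have "int d * (A ** adj2 A')$2$2 - int d' = (int d * A$2$2 - int d' * A'$2$2) * A'$1$1 - (int d * A$2$1 - int d' * A'$2$1) * A'$1$2"
    proof -
      have "int d' = int d' * (A'$1$1 * A'$2$2 - A'$1$2 * A'$2$1)" using A' by (simp add: SL2Z_iff)
      then show ?thesis by (simp add: adj2_def algebra_simps)
    qed
    ultimately show ?thesis using eq by simp
  qed
  have dd: "d dvd d'" if "d dvd N" "int N dvd int d * b - int d'" for d d' and b :: int
  proof -
    have "int d dvd int d * b - int d'" using that by (meson dvd_trans int_dvd_int_iff)
    then have "int d dvd int d'" by (metis dvd_diff_right_iff dvd_triv_left)
    then show ?thesis by simp
  qed
  have "int N dvd int d' * A'$2$1 - int d * A$2$1" "int N dvd int d' * A'$2$2 - int d * A$2$2"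
    using eq by (simp_all add: dvd_diff_commute)
  from key[OF A' A this] have "d' dvd d" using dd[OF d(2)] by blast
  moreover have k: "int N dvd int d * (A ** adj2 A')$2$1" "int N dvd int d * (A ** adj2 A')$2$2 - int d'"
    using key[OF A A' eq] by blast+
  then have "d dvd d'" using dd[OF d(1)] by blast
  ultimately show dd': "d = d'" by (simp add: dvd_antisym)
  define B where "B = A ** adj2 A'"
  define m where "m = int (N div d)"
  have Nm: "int N = int d * m" using d(1) by (simp add: m_def flip: of_nat_mult)
  have d0: "int d \<noteq> 0" using d(1) N by (auto intro: Nat.gr0I)
  have B: "B \<in> SL2Z" unfolding B_def by (intro SL2Z_mult A adj2_SL2Z A')
  have b21: "m dvd B$2$1" using k(1) d0 unfolding Nm B_def[symmetric] by simp
  have "int d * B$2$2 - int d' = int d * (B$2$2 - 1)" using dd' by (simp add: algebra_simps)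
  then have b22: "m dvd B$2$2 - 1" using k(2) d0 unfolding Nm B_def[symmetric] by simp
  have "B$1$1 - 1 = B$1$2 * B$2$1 - B$1$1 * (B$2$2 - 1)" using B by (simp add: SL2Z_iff algebra_simps)
  then have b11: "m dvd B$1$1 - 1" using b21 b22 by simp
  show "A ** adj2 A' \<in> Gamma1 (N div d)"
    unfolding Gamma1_def B_def[symmetric] m_def[symmetric]
    using B b11 b22 b21 by (simp add: cong_iff_dvd_diff)
qed

section \<open>Closure properties of holomorphic functions of several variables\<close>

lemma jointly_holomorphic_cong:
  assumes \<phi>: "jointly_holomorphic L \<phi>" and eq: "\<And>\<tau> z. \<tau> \<in> UHP \<Longrightarrow> z \<in> complexify L \<Longrightarrow> \<psi> \<tau> z = \<phi> \<tau> z"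
  shows "jointly_holomorphic L \<psi>"
  unfolding jointly_holomorphic_def
proof (intro ballI)
  fix \<tau> z assume \<tau>: "\<tau> \<in> UHP" and z: "z \<in> complexify L"
  obtain D where D: "((\<lambda>(\<tau>, z). \<phi> \<tau> z) has_derivative D) (at (\<tau>, z) within UHP \<times> complexify L)"
    and lin: "\<forall>w s. \<forall>y\<in>complexify L. D (w * s, cscale w y) = w * D (s, y)"
    using \<phi> \<tau> z unfolding jointly_holomorphic_def by blast
  have "((\<lambda>(\<tau>, z). \<psi> \<tau> z) has_derivative D) (at (\<tau>, z) within UHP \<times> complexify L)"
    by (rule has_derivative_transform[OF _ _ D]) (use \<tau> z eq in auto)
  then show "\<exists>D. ((\<lambda>(\<tau>, z). \<psi> \<tau> z) has_derivative D) (at (\<tau>, z) within UHP \<times> complexify L) \<and>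
       (\<forall>w s. \<forall>y\<in>complexify L. D (w * s, cscale w y) = w * D (s, y))"
    using lin by blast
qed

lemma jointly_holomorphic_mult:
  assumes f: "f holomorphic_on UHP" and \<phi>: "jointly_holomorphic L \<phi>"
  shows "jointly_holomorphic L (\<lambda>\<tau> z. f \<tau> * \<phi> \<tau> z)"
  unfolding jointly_holomorphic_def
proof (intro ballI)
  fix \<tau> z assume \<tau>: "\<tau> \<in> UHP" and z: "z \<in> complexify L"
  obtain D where D: "((\<lambda>(\<tau>, z). \<phi> \<tau> z) has_derivative D) (at (\<tau>, z) within UHP \<times> complexify L)"
    and lin: "\<And>w s y. y \<in> complexify L \<Longrightarrow> D (w * s, cscale w y) = w * D (s, y)"
    using \<phi> \<tau> z unfolding jointly_holomorphic_def by blast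
  obtain f' where f': "(f has_field_derivative f') (at \<tau>)"
    using f \<tau> open_UHP holomorphic_on_imp_differentiable_at field_differentiable_def by metis
  have "((\<lambda>p. f (fst p)) has_derivative (\<lambda>p. f' * fst p)) (at (\<tau>, z) within UHP \<times> complexify L)"
    using has_derivative_compose[OF has_derivative_fst[OF has_derivative_ident], of f "(*) f'" "(\<tau>, z)" "UHP \<times> complexify L"] f'
    by (simp add: has_field_derivative_def)
  from has_derivative_mult[OF this D]
  have "((\<lambda>(\<tau>, z). f \<tau> * \<phi> \<tau> z) has_derivative (\<lambda>p. f \<tau> * D p + f' * fst p * \<phi> \<tau> z)) (at (\<tau>, z) within UHP \<times> complexify L)"
    by (simp add: case_prod_unfold)
  moreover have "f \<tau> * D (w * s, cscale w y) + f' * fst (w * s, cscale w y) * \<phi> \<tau> z = w * (f \<tau> * D (s, y) + f' * fst (s, y) * \<phi> \<tau> z)"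
    if "y \<in> complexify L" for w s y
    unfolding lin[OF that] fst_conv by (simp only: ring_distribs mult_ac)
  ultimately show "\<exists>D. ((\<lambda>(\<tau>, z). f \<tau> * \<phi> \<tau> z) has_derivative D) (at (\<tau>, z) within UHP \<times> complexify L) \<and>
       (\<forall>w s. \<forall>y\<in>complexify L. D (w * s, cscale w y) = w * D (s, y))"
    by blast
qed

lemma jointly_holomorphic_sum:
  assumes "finite R" and \<phi>: "\<And>r. r \<in> R \<Longrightarrow> jointly_holomorphic L (\<phi> r)"
  shows "jointly_holomorphic L (\<lambda>\<tau> z. \<Sum>r\<in>R. \<phi> r \<tau> z)"
  unfolding jointly_holomorphic_def
proof (intro ballI)
  fix \<tau> z assume \<tau>: "\<tau> \<in> UHP" and z: "z \<in> complexify L"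
  have "\<forall>r\<in>R. \<exists>D. ((\<lambda>p. \<phi> r (fst p) (snd p)) has_derivative D) (at (\<tau>, z) within UHP \<times> complexify L) \<and>
      (\<forall>w s. \<forall>y\<in>complexify L. D (w * s, cscale w y) = w * D (s, y))"
    using \<phi> \<tau> z unfolding jointly_holomorphic_def case_prod_unfold by blast
  from bchoice[OF this] obtain D where DD: "\<forall>r\<in>R. ((\<lambda>p. \<phi> r (fst p) (snd p)) has_derivative D r) (at (\<tau>, z) within UHP \<times> complexify L) \<and>
      (\<forall>w s. \<forall>y\<in>complexify L. D r (w * s, cscale w y) = w * D r (s, y))" ..
  then have D: "((\<lambda>p. \<phi> r (fst p) (snd p)) has_derivative D r) (at (\<tau>, z) within UHP \<times> complexify L)" if "r \<in> R" for r
    using that by blast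
  have lin: "D r (w * s, cscale w y) = w * D r (s, y)" if "r \<in> R" "y \<in> complexify L" for r w s y
    using DD that by blast
  have "((\<lambda>(\<tau>, z). \<Sum>r\<in>R. \<phi> r \<tau> z) has_derivative (\<lambda>p. \<Sum>r\<in>R. D r p)) (at (\<tau>, z) within UHP \<times> complexify L)"
    unfolding case_prod_unfold by (rule has_derivative_sum) (rule D)
  moreover have "(\<Sum>r\<in>R. D r (w * s, cscale w y)) = w * (\<Sum>r\<in>R. D r (s, y))" if "y \<in> complexify L" for w s y
    using lin that by (simp add: sum_distrib_left)
  ultimately show "\<exists>D. ((\<lambda>(\<tau>, z). \<Sum>r\<in>R. \<phi> r \<tau> z) has_derivative D) (at (\<tau>, z) within UHP \<times> complexify L) \<and>
       (\<forall>w s. \<forall>y\<in>complexify L. D (w * s, cscale w y) = w * D (s, y))"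
    by blast
qed

lemma jslash_cong:
  assumes "A \<in> SL2Z" "\<tau> \<in> UHP" "z \<in> complexify L" "\<And>\<tau> z. \<tau> \<in> UHP \<Longrightarrow> z \<in> complexify L \<Longrightarrow> \<phi> \<tau> z = \<psi> \<tau> z"
  shows "jslash k A \<phi> \<tau> z = jslash k A \<psi> \<tau> z"
  unfolding jslash_def by (simp add: assms moebius_act_UHP cscale_complexify)

lemma floor_weight: "\<lfloor>2 * (of_int k - real n / 2)\<rfloor> = 2 * k - int n"
proof -
  have "2 * (of_int k - real n / 2) = of_int (2 * k - int n)" by simp
  then show ?thesis by (simp only: floor_of_int)
qed

section \<open>From vector-valued forms to Jacobi forms\<close>

context UN_lattice
begin

abbreviation weak_forms where
  "weak_forms k \<equiv> weak_vv_forms (of_int k - real (dim L) / 2) (UN_plus_form N) (UN_plus L)"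

abbreviation weak_families where
  "weak_families k \<equiv> divisor_sum N (\<lambda>d. weak_jacobi_forms k L (Gamma1 (N div d)))"

abbreviation holomorphic_families where
  "holomorphic_families k \<equiv> divisor_sum N (\<lambda>d. jacobi_forms k L (Gamma1 (N div d)))"

lemma weak_formsD:
  assumes "F \<in> weak_forms k"
  shows "\<tau> \<notin> UHP \<Longrightarrow> F \<tau> = (\<lambda>_. 0)" and "\<tau> \<in> UHP \<Longrightarrow> F \<tau> \<in> V"
    and "x \<in> X \<Longrightarrow> (\<lambda>\<tau>. F \<tau> x) holomorphic_on UHP" and "\<exists>c. vv_expansion (UN_plus_form N) M F c"
  using assms unfolding weak_vv_forms_def by blast+

lemma weak_forms_modular:
  assumes F: "F \<in> weak_forms k" and "A \<in> SL2Z" "\<tau> \<in> UHP" "z \<in> complexify L"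
  shows "jslash k A (Phi F u w) \<tau> z = Phi F (u * A $ 1 $ 1 + w * A $ 2 $ 1) (u * A $ 1 $ 2 + w * A $ 2 $ 2) \<tau> z"
proof -
  have "\<forall>(A, \<phi>)\<in>Mp2Z. \<forall>\<tau>\<in>UHP. F (moebius_act A \<tau>) = (\<lambda>x. \<phi> \<tau> powi (2 * k - int (dim L)) * weil_rep (UN_plus_form N) M (A, \<phi>) (F \<tau>) x)"
    using F unfolding weak_vv_forms_def floor_weight by blast
  from iffD1[OF modular_law_iff[OF weak_formsD(2)[OF F]] this] show ?thesis using assms by blast
qed

lemma vv_exponents_cls:
  "l \<in> Ld \<Longrightarrow> m \<in> vv_exponents (UN_plus_form N) (cls a b l) \<longleftrightarrow> m + of_int (a * b) / real N + l \<bullet> l / 2 \<in> \<int>"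
proof -
  assume l: "l \<in> Ld"
  define q where "q = disc_quad (UN_plus_form N) (cls a b l)"
  have i: "q - (of_int (a * b) / real N + l \<bullet> l / 2) \<in> \<int>"
    unfolding q_def using disc_quad_cls[OF l, of a b] by simp
  have "m + q = (m + of_int (a * b) / real N + l \<bullet> l / 2) + (q - (of_int (a * b) / real N + l \<bullet> l / 2))" by simp
  then have "m + q \<in> \<int> \<longleftrightarrow> m + of_int (a * b) / real N + l \<bullet> l / 2 \<in> \<int>"
    using i by (metis Ints_add Ints_diff add_diff_cancel_right')
  then show ?thesis by (simp add: vv_exponents_def q_def)
qed

text \<open>
  Coefficients extended by \<open>0\<close> to all real exponents, so that the partial Fourier transform can mix coefficients of
  classes with different sets of exponents.
\<close>
definition vvc :: "((real \<times> real \<times> 'a) set \<Rightarrow> real \<Rightarrow> complex) \<Rightarrow> real \<Rightarrow> (real \<times> real \<times> 'a) set \<Rightarrow> complex" where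
  "vvc c m x = (if m \<in> vv_exponents (UN_plus_form N) x then c x m else 0)"

text \<open>
  The coefficient of \<open>\<Phi>(u, w)\<close> at \<open>(n, l)\<close>.
\<close>
definition jcoef :: "((real \<times> real \<times> 'a) set \<Rightarrow> real \<Rightarrow> complex) \<Rightarrow> int \<Rightarrow> int \<Rightarrow> real \<Rightarrow> 'a \<Rightarrow> complex" where
  "jcoef c u w n l = fcoef (vvc c (n - l \<bullet> l / 2)) u w l"

lemma vvc_has_sum:
  assumes c: "vv_expansion (UN_plus_form N) M F c" and \<tau>: "\<tau> \<in> UHP" and x: "x \<in> X"
  shows "((\<lambda>m. vvc c m x * ee (of_real m * \<tau>)) has_sum F \<tau> x) UNIV"
proof (rule has_sum_cong_neutral[THEN iffD1])
  show "((\<lambda>m. c x m * ee (of_real m * \<tau>)) has_sum F \<tau> x) (vv_exponents (UN_plus_form N) x)"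
    using c \<tau> x unfolding vv_expansion_def by blast
qed (simp_all add: vvc_def)

lemma fcoef_has_sum:
  assumes c: "vv_expansion (UN_plus_form N) M F c" and \<tau>: "\<tau> \<in> UHP" and l: "l \<in> Ld"
  shows "((\<lambda>m. fcoef (vvc c m) u w l * ee (of_real m * \<tau>)) has_sum fcoef (F \<tau>) u w l) UNIV"
proof -
  have "((\<lambda>m. \<Sum>a<N. ee (of_int (int a * w) / of_nat N) * (vvc c m (cls (int a) (- u) l) * ee (of_real m * \<tau>))) has_sum fcoef (F \<tau>) u w l) UNIV"
    unfolding fcoef_def by (intro has_sum_finite_sum has_sum_cmult_right vvc_has_sum[OF c \<tau>] cls_X l finite_lessThan)
  then show ?thesis unfolding fcoef_def by (simp only: sum_distrib_right mult.assoc)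
qed

lemma Phi_has_sum:
  assumes c: "vv_expansion (UN_plus_form N) M F c" and \<tau>: "\<tau> \<in> UHP"
  shows "((\<lambda>(n, l). jcoef c u w n l * ee (of_real n * \<tau>) * ee (cform (l, 0) z)) has_sum Phi F u w \<tau> z) (UNIV \<times> Ld)"
  unfolding Phi_def jtheta_def jcoef_def
proof (rule theta_series[OF _ _ \<tau>, where h="\<lambda>l m. fcoef (vvc c m) u w l"])
  show "fcoef (vvc c m) u w (l + x) = fcoef (vvc c m) u w l" if "l \<in> Ld" "x \<in> L" for l x m
    using periodicD[OF fcoef_periodic that] .
  show "((\<lambda>m. fcoef (vvc c m) u w l * ee (of_real m * \<tau>)) has_sum fcoef (F \<tau>) u w l) UNIV" if "l \<in> Ld" for l
    by (rule fcoef_has_sum[OF c \<tau> that])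
qed

lemma jcoef_nonzero:
  assumes l: "l \<in> Ld" and nz: "jcoef c u w n l \<noteq> 0"
  obtains a :: nat where "n - of_int (int a * u) / real N \<in> \<int>" "n - l \<bullet> l / 2 \<in> vv_exponents (UN_plus_form N) (cls (int a) (- u) l)"
    "c (cls (int a) (- u) l) (n - l \<bullet> l / 2) \<noteq> 0"
proof -
  from nz obtain a where "vvc c (n - l \<bullet> l / 2) (cls (int a) (- u) l) \<noteq> 0"
    unfolding jcoef_def fcoef_def by (metis (no_types, lifting) mult_zero_right sum.neutral)
  then have e: "n - l \<bullet> l / 2 \<in> vv_exponents (UN_plus_form N) (cls (int a) (- u) l)" "c (cls (int a) (- u) l) (n - l \<bullet> l / 2) \<noteq> 0"
    unfolding vvc_def by (auto split: if_splits)
  then have "n - of_int (int a * u) / real N \<in> \<int>" unfolding vv_exponents_cls[OF l] by simp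
  then show ?thesis using that e by blast
qed

text \<open>
  The class of \<open>(a, - u, l)\<close> carries exponents in \<open>\<int> + a u / N - Q(l)\<close>.
\<close>
lemma jcoef_denominator:
  assumes "l \<in> Ld" "jcoef c u w n l \<noteq> 0" shows "real N * n \<in> \<int>" "n \<in> \<rat>" "u = 0 \<Longrightarrow> n \<in> \<int>"
proof -
  obtain a where a: "n - of_int (int a * u) / real N \<in> \<int>" using jcoef_nonzero[OF assms] by blast
  then obtain j where j: "n - of_int (int a * u) / real N = of_int j" by (auto elim: Ints_cases)
  have "real N * n = real N * (n - of_int (int a * u) / real N) + of_int (int a * u)" using N_pos by (simp add: field_simps)
  then have "real N * n = of_int (int N * j + int a * u)" unfolding j by simp
  then show i: "real N * n \<in> \<int>" by (metis Ints_of_int)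
  have "n = (real N * n) / real N" using N_pos by simp
  then show "n \<in> \<rat>" using i Ints_subset_Rats by (metis Rats_divide Rats_of_nat subsetD)
  show "n \<in> \<int>" if "u = 0" using a that by simp
qed

lemma jcoef_cong: "int N dvd u - u' \<Longrightarrow> int N dvd w - w' \<Longrightarrow> jcoef c u w n l = jcoef c u' w' n l"
  unfolding jcoef_def by (rule fcoef_cong)

text \<open>
  The family \<open>\<phi>\<^sub>d = \<Phi>(0, d)\<close>. It is set to \<open>0\<close> outside its domain, according to the convention for Jacobi forms.
\<close>
definition jacobi_map :: "(complex \<Rightarrow> (real \<times> real \<times> 'a) set \<Rightarrow> complex) \<Rightarrow> nat \<Rightarrow> complex \<Rightarrow> 'a \<times> 'a \<Rightarrow> complex" where
  "jacobi_map F d \<tau> z = (if \<tau> \<in> UHP \<and> z \<in> complexify L \<and> d dvd N then Phi F 0 (int d) \<tau> z else 0)"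

lemma jslash_jacobi_map:
  assumes F: "F \<in> weak_forms k" and A: "A \<in> SL2Z" and \<tau>: "\<tau> \<in> UHP" and z: "z \<in> complexify L" and d: "d dvd N"
  shows "jslash k A (jacobi_map F d) \<tau> z = Phi F (int d * A $ 2 $ 1) (int d * A $ 2 $ 2) \<tau> z"
proof -
  have "jslash k A (jacobi_map F d) \<tau> z = jslash k A (Phi F 0 (int d)) \<tau> z"
    by (rule jslash_cong[OF A \<tau> z]) (simp add: jacobi_map_def d)
  then show ?thesis using weak_forms_modular[OF F A \<tau> z, of 0 "int d"] by simp
qed

lemma jacobi_map_expansion:
  assumes F: "F \<in> weak_forms k" and c: "vv_expansion (UN_plus_form N) M F c" and d: "d dvd N" and A: "A \<in> SL2Z"
  shows "jacobi_expansion L (jslash k A (jacobi_map F d)) (jcoef c (int d * A $ 2 $ 1) (int d * A $ 2 $ 2))"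
  unfolding jacobi_expansion_def
proof (intro conjI exI[of _ N] ballI N_pos)
  let ?f = "jcoef c (int d * A $ 2 $ 1) (int d * A $ 2 $ 2)"
  obtain n0 where n0: "\<And>x n. x \<in> X \<Longrightarrow> n \<in> vv_exponents (UN_plus_form N) x \<Longrightarrow> n < n0 \<Longrightarrow> c x n = 0"
    using c unfolding vv_expansion_def by blast
  have "real N * n \<in> \<int> \<and> n0 \<le> n" if l: "l \<in> Ld" and nz: "?f n l \<noteq> 0" for n l
  proof -
    obtain a where a: "n - l \<bullet> l / 2 \<in> vv_exponents (UN_plus_form N) (cls (int a) (- (int d * A $ 2 $ 1)) l)"
      "c (cls (int a) (- (int d * A $ 2 $ 1)) l) (n - l \<bullet> l / 2) \<noteq> 0"
      using jcoef_nonzero[OF l nz] by blast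
    then have "n0 \<le> n - l \<bullet> l / 2" using n0[OF cls_X[OF l]] by (meson not_le)
    moreover have "0 \<le> l \<bullet> l / 2" by simp
    ultimately have "n0 \<le> n" by linarith
    then show ?thesis using jcoef_denominator(1)[OF l nz] by simp
  qed
  then show "\<exists>n0. \<forall>n\<in>\<rat>. \<forall>l\<in>Ld. ?f n l \<noteq> 0 \<longrightarrow> real N * n \<in> \<int> \<and> n0 \<le> n" by blast
  fix \<tau> z assume \<tau>: "\<tau> \<in> UHP" and z: "z \<in> complexify L"
  show "((\<lambda>(n, l). ?f n l * ee (of_real n * \<tau>) * ee (cform (l, 0) z)) has_sum jslash k A (jacobi_map F d) \<tau> z) (\<rat> \<times> Ld)"
    unfolding jslash_jacobi_map[OF F A \<tau> z d]
    by (rule has_sum_cong_neutral[THEN iffD1, OF _ _ _ Phi_has_sum[OF c \<tau>]]) (use jcoef_denominator(2) in auto)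
qed

lemma jcoef_negative:
  assumes c: "\<And>x n. x \<in> X \<Longrightarrow> n \<in> vv_exponents (UN_plus_form N) x \<Longrightarrow> n < 0 \<Longrightarrow> c x n = 0"
    and l: "l \<in> Ld" and n: "2 * n - l \<bullet> l < 0"
  shows "jcoef c u w n l = 0"
proof (rule ccontr)
  assume "jcoef c u w n l \<noteq> 0"
  then obtain a where "n - l \<bullet> l / 2 \<in> vv_exponents (UN_plus_form N) (cls (int a) (- u) l)"
      "c (cls (int a) (- u) l) (n - l \<bullet> l / 2) \<noteq> 0"
    using jcoef_nonzero[OF l] by blast
  then show False using c[OF cls_X[OF l]] n by auto
qed

text \<open>
  The group \<open>\<Gamma>\<^sub>1(N/d)\<close> fixes the row vector \<open>(0, d)\<close> modulo \<open>N\<close>.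
\<close>
lemma Gamma1_row:
  assumes d: "d dvd N" and A: "A \<in> Gamma1 (N div d)"
  shows "int N dvd int d * A $ 2 $ 1 - 0" "int N dvd int d * A $ 2 $ 2 - int d"
proof -
  have N: "int N = int d * int (N div d)" using d by (simp flip: of_nat_mult)
  have "int (N div d) dvd A $ 2 $ 1" "int (N div d) dvd A $ 2 $ 2 - 1"
    using A unfolding Gamma1_def by (auto simp: cong_iff_dvd_diff)
  then have "int d * int (N div d) dvd int d * A $ 2 $ 1" "int d * int (N div d) dvd int d * (A $ 2 $ 2 - 1)"
    by (auto intro: mult_dvd_mono)
  then show "int N dvd int d * A $ 2 $ 1 - 0" "int N dvd int d * A $ 2 $ 2 - int d"
    unfolding N by (simp_all add: algebra_simps)
qed

lemma fcoef_holomorphic: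
  assumes F: "F \<in> weak_forms k" and l: "l \<in> Ld"
  shows "(\<lambda>\<tau>. fcoef (F \<tau>) u w l) holomorphic_on UHP"
  unfolding fcoef_def by (intro holomorphic_intros weak_formsD(3)[OF F] cls_X l)

text \<open>
  By the theta decomposition it is a finite combination of theta functions of cosets, with coefficients that are
  holomorphic in \<open>\<tau>\<close>.
\<close>
lemma jacobi_map_jointly_holomorphic:
  assumes F: "F \<in> weak_forms k" and d: "d dvd N"
  shows "jointly_holomorphic L (jacobi_map F d)"
proof (rule jointly_holomorphic_cong)
  show "jointly_holomorphic L (\<lambda>\<tau> z. \<Sum>r\<in>coset_reps L. fcoef (F \<tau>) 0 (int d) r * theta L (\<lambda>l. if l - r \<in> L then 1 else 0) \<tau> z)"
    by (intro jointly_holomorphic_sum jointly_holomorphic_mult finite_coset_reps theta_jointly_holomorphic periodic_indicator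
        fcoef_holomorphic[OF F] coset_reps_Ld)
  fix \<tau> z assume \<tau>: "\<tau> \<in> UHP" and z: "z \<in> complexify L"
  show "jacobi_map F d \<tau> z = (\<Sum>r\<in>coset_reps L. fcoef (F \<tau>) 0 (int d) r * theta L (\<lambda>l. if l - r \<in> L then 1 else 0) \<tau> z)"
    using \<tau> z d theta_decompose[OF fcoef_periodic \<tau>, of "F \<tau>" 0 "int d" z] by (simp add: jacobi_map_def Phi_def jtheta_def)
qed

lemma jacobi_map_weak:
  assumes F: "F \<in> weak_forms k" and d: "d dvd N"
  shows "jacobi_map F d \<in> weak_jacobi_forms k L (Gamma1 (N div d))"
  unfolding weak_jacobi_forms_def
proof (intro CollectI conjI ballI allI impI)
  fix \<tau> z assume "\<not> (\<tau> \<in> UHP \<and> z \<in> complexify L)"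
  then show "jacobi_map F d \<tau> z = 0" unfolding jacobi_map_def by auto
next
  show "jointly_holomorphic L (jacobi_map F d)" by (rule jacobi_map_jointly_holomorphic[OF F d])
next
  fix A \<tau> z assume A: "A \<in> Gamma1 (N div d)" and \<tau>: "\<tau> \<in> UHP" and z: "z \<in> complexify L"
  have S: "A \<in> SL2Z" using A by (simp add: Gamma1_def)
  show "jslash k A (jacobi_map F d) \<tau> z = jacobi_map F d \<tau> z"
    unfolding jslash_jacobi_map[OF F S \<tau> z d] using \<tau> z d jtheta_cong[OF Gamma1_row[OF d A]]
    by (simp add: jacobi_map_def Phi_def)
next
  fix \<tau> z x y assume \<tau>: "\<tau> \<in> UHP" and z: "z \<in> complexify L" and x: "x \<in> L" and y: "y \<in> L"
  have z': "z + cscale \<tau> (x, 0) + (y, 0) \<in> complexify L"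
    by (intro complexify_add z cscale_complexify complexify_real L_span x y)
  have e: "exp (- \<i> * of_real pi * (of_real (x \<bullet> x) * \<tau> + 2 * cform (x, 0) z)) = ee (- (of_real (x \<bullet> x / 2) * \<tau> + cform (x, 0) z))"
    unfolding ee_def by (rule arg_cong[of _ _ exp]) (simp add: algebra_simps)
  show "jacobi_map F d \<tau> (z + cscale \<tau> (x, 0) + (y, 0)) = exp (- \<i> * of_real pi * (of_real (x \<bullet> x) * \<tau> + 2 * cform (x, 0) z)) * jacobi_map F d \<tau> z"
    unfolding e using theta_elliptic[OF fcoef_periodic x y] \<tau> z z' d by (simp add: jacobi_map_def Phi_def jtheta_def)
next
  fix A assume A: "A \<in> SL2Z"
  obtain c where "vv_expansion (UN_plus_form N) M F c" using weak_formsD(4)[OF F] by blast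
  from jacobi_map_expansion[OF F this d A] show "\<exists>f. jacobi_expansion L (jslash k A (jacobi_map F d)) f" by blast
qed

lemma jacobi_map_weak_families: "F \<in> weak_forms k \<Longrightarrow> jacobi_map F \<in> weak_families k"
  unfolding divisor_sum_def using jacobi_map_weak by (auto simp: jacobi_map_def fun_eq_iff)

lemma jacobi_map_holomorphic_families:
  assumes "F \<in> vv_forms (of_int k - real (dim L) / 2) (UN_plus_form N) M"
  shows "jacobi_map F \<in> holomorphic_families k"
proof -
  have F: "F \<in> weak_forms k" using assms by (simp add: vv_forms_def)
  obtain c where c: "vv_expansion (UN_plus_form N) M F c" "\<And>x n. x \<in> X \<Longrightarrow> n \<in> vv_exponents (UN_plus_form N) x \<Longrightarrow> n < 0 \<Longrightarrow> c x n = 0"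
    using assms unfolding vv_forms_def by blast
  have "jacobi_map F d \<in> jacobi_forms k L (Gamma1 (N div d))" if d: "d dvd N" for d
    unfolding jacobi_forms_def
  proof (intro CollectI conjI ballI jacobi_map_weak[OF F d])
    fix A assume A: "A \<in> SL2Z"
    show "\<exists>f. jacobi_expansion L (jslash k A (jacobi_map F d)) f \<and> (\<forall>n\<in>\<rat>. \<forall>l\<in>Ld. 2 * n - l \<bullet> l < 0 \<longrightarrow> f n l = 0)"
      using jacobi_map_expansion[OF F c(1) d A] jcoef_negative[of c, OF c(2)] by blast
  qed
  then show ?thesis unfolding divisor_sum_def by (auto simp: jacobi_map_def fun_eq_iff)
qed

lemma jacobi_map_formula:
  assumes c: "vv_expansion (UN_plus_form N) M F c" and d: "d dvd N" and \<tau>: "\<tau> \<in> UHP" and z: "z \<in> complexify L"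
  shows "((\<lambda>(n::int, l). (\<Sum>a<N. ee (of_nat (a * d) / of_nat N) * c (UN_class N L a 0 l) (of_int n - l \<bullet> l / 2)) *
           ee (of_int n * \<tau>) * ee (cform (l, 0) z)) has_sum jacobi_map F d \<tau> z) (UNIV \<times> Ld)"
proof -
  have J: "jacobi_map F d \<tau> z = Phi F 0 (int d) \<tau> z" using \<tau> z d by (simp add: jacobi_map_def)
  have s: "((\<lambda>(n, l). jcoef c 0 (int d) n l * ee (of_real n * \<tau>) * ee (cform (l, 0) z)) has_sum jacobi_map F d \<tau> z) (\<int> \<times> Ld)"
    unfolding J by (rule has_sum_cong_neutral[THEN iffD1, OF _ _ _ Phi_has_sum[OF c \<tau>]]) (use jcoef_denominator(3) in auto)
  have bij: "bij_betw (\<lambda>(n::int, l). (real_of_int n, l)) (UNIV \<times> Ld) (\<int> \<times> Ld)"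
    by (rule bij_betwI[of _ _ _ "\<lambda>(n, l). (\<lfloor>n\<rfloor>, l)"]) (auto elim: Ints_cases)
  have co: "jcoef c 0 (int d) (of_int n) l = (\<Sum>a<N. ee (of_nat (a * d) / of_nat N) * c (UN_class N L a 0 l) (of_int n - l \<bullet> l / 2))"
    if l: "l \<in> Ld" for n l
  proof -
    have "of_int n - l \<bullet> l / 2 \<in> vv_exponents (UN_plus_form N) (cls (int a) 0 l)" for a
      unfolding vv_exponents_cls[OF l] by simp
    then show ?thesis unfolding jcoef_def fcoef_def vvc_def UN_class_cls by simp
  qed
  from iffD2[OF has_sum_reindex_bij_betw[OF bij] s] show ?thesis
    by (rule has_sum_cong[THEN iffD1, rotated]) (auto simp: co)
qed

lemma jacobi_map_linear:
  "jacobi_map (\<lambda>\<tau> x. \<alpha> * F \<tau> x + \<beta> * G \<tau> x) = (\<lambda>d \<tau> z. \<alpha> * jacobi_map F d \<tau> z + \<beta> * jacobi_map G d \<tau> z)"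
  by (intro ext) (simp add: jacobi_map_def Phi_def jtheta_add)

text \<open>
  The \<open>\<phi>\<^sub>d\<close> determine all \<open>\<Phi>(u, w)\<close>, because every row vector modulo \<open>N\<close> lies in the orbit of some
  \<open>(0, d)\<close>, and these determine \<open>F\<close>.
\<close>
lemma jacobi_map_inj:
  assumes F: "F \<in> weak_forms k" and G: "G \<in> weak_forms k" and eq: "jacobi_map F = jacobi_map G"
  shows "F = G"
proof
  fix \<tau>
  show "F \<tau> = G \<tau>"
  proof (cases "\<tau> \<in> UHP")
    case \<tau>: True
    show ?thesis
    proof (rule jtheta_inj[OF weak_formsD(2)[OF F \<tau>] weak_formsD(2)[OF G \<tau>] \<tau>])
      fix z u w assume z: "z \<in> complexify L"
      obtain d A where dA: "d dvd N" "A \<in> SL2Z" "int N dvd int d * A$2$1 - u" "int N dvd int d * A$2$2 - w"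
        using row_orbit[OF N_pos] .
      have "Phi F (int d * A $ 2 $ 1) (int d * A $ 2 $ 2) \<tau> z = Phi G (int d * A $ 2 $ 1) (int d * A $ 2 $ 2) \<tau> z"
        using jslash_jacobi_map[OF F dA(2) \<tau> z dA(1)] jslash_jacobi_map[OF G dA(2) \<tau> z dA(1)] eq by simp
      then show "jtheta (F \<tau>) \<tau> z u w = jtheta (G \<tau>) \<tau> z u w"
        using jtheta_cong[OF dA(3,4), of "F \<tau>" \<tau> z] jtheta_cong[OF dA(3,4), of "G \<tau>" \<tau> z] by (simp add: Phi_def)
    qed
  qed (simp add: weak_formsD(1)[OF F] weak_formsD(1)[OF G])
qed

text \<open>
  The expansion of \<open>\<phi>\<^sub>d | A\<close> is unique, so the condition on its coefficients is a condition on \<open>jcoef\<close>. Since all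
  pairs \<open>(u, w)\<close> are reached, the inverse Fourier transform gives the vanishing of the negative
  coefficients of \<open>F\<close>.
\<close>
lemma jacobi_map_reflects_holomorphic:
  assumes F: "F \<in> weak_forms k" and J: "jacobi_map F \<in> holomorphic_families k"
  shows "F \<in> vv_forms (of_int k - real (dim L) / 2) (UN_plus_form N) M"
proof -
  obtain c where c: "vv_expansion (UN_plus_form N) M F c" using weak_formsD(4)[OF F] by blast
  have zero: "jcoef c u w n l = 0" if l: "l \<in> Ld" and n: "2 * n - l \<bullet> l < 0" for u w n l
  proof (cases "n \<in> \<rat>")
    case False
    then show ?thesis using jcoef_denominator(2)[OF l] by blast
  next
    case True
    obtain d A where dA: "d dvd N" "A \<in> SL2Z" "int N dvd int d * A$2$1 - u" "int N dvd int d * A$2$2 - w"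
      using row_orbit[OF N_pos] .
    define f where "f = jcoef c (int d * A $ 2 $ 1) (int d * A $ 2 $ 2)"
    have "jacobi_map F d \<in> jacobi_forms k L (Gamma1 (N div d))" using J dA(1) by (simp add: divisor_sum_def)
    then obtain g where g: "jacobi_expansion L (jslash k A (jacobi_map F d)) g" "\<And>n l. n \<in> \<rat> \<Longrightarrow> l \<in> Ld \<Longrightarrow> 2 * n - l \<bullet> l < 0 \<Longrightarrow> g n l = 0"
      unfolding jacobi_forms_def using dA(2) by blast
    have f: "jacobi_expansion L (jslash k A (jacobi_map F d)) f" unfolding f_def by (rule jacobi_map_expansion[OF F c dA(1,2)])
    have "f n l - g n l = 0"
    proof (rule jacobi_coefficients_zero[where S="\<rat>" and f="\<lambda>n l. f n l - g n l"])
      fix \<tau> z assume "\<tau> \<in> UHP" "z \<in> complexify L"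
      then have "((\<lambda>(n, l). f n l * ee (of_real n * \<tau>) * ee (cform (l, 0) z)) has_sum jslash k A (jacobi_map F d) \<tau> z) (\<rat> \<times> Ld)"
        "((\<lambda>(n, l). g n l * ee (of_real n * \<tau>) * ee (cform (l, 0) z)) has_sum jslash k A (jacobi_map F d) \<tau> z) (\<rat> \<times> Ld)"
        using f g(1) unfolding jacobi_expansion_def by blast+
      from has_sum_add[OF this(1) has_sum_uminusI[OF this(2)]]
      show "((\<lambda>(n, l). (f n l - g n l) * ee (of_real n * \<tau>) * ee (cform (l, 0) z)) has_sum 0) (\<rat> \<times> Ld)"
        by (simp add: case_prod_unfold algebra_simps)
    qed (use True l in auto)
    then have "f n l = 0" using g(2)[OF True l n] by simp
    then show ?thesis unfolding f_def using jcoef_cong[OF dA(3,4)] by simp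
  qed
  have "c x m = 0" if x: "x \<in> X" and m: "m \<in> vv_exponents (UN_plus_form N) x" "m < 0" for x m
  proof -
    obtain a b l where abl: "x = cls a b l" "l \<in> Ld" using x unfolding X_eq by blast
    have "fcoef (vvc c m) (- b) (int w) l = 0" for w
      using zero[OF abl(2), of "m + l \<bullet> l / 2" "- b" "int w"] m(2) by (simp add: jcoef_def)
    then have "vvc c m x = 0" unfolding abl(1) fcoef_inversion[of "vvc c m" a b l] by simp
    then show ?thesis using m(1) by (simp add: vvc_def)
  qed
  then show ?thesis unfolding vv_forms_def using F c by blast
qed

end

section \<open>Expansions in powers of q\<close>

lemma ee_surj_punctured_disc:
  assumes "w \<noteq> 0" "norm w < 1" obtains \<tau> where "\<tau> \<in> UHP" "ee \<tau> = w"
proof -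
  define \<tau> where "\<tau> = Ln w / (2 * of_real pi * \<i>)"
  have "2 * of_real pi * \<i> * \<tau> = Ln w" by (simp add: \<tau>_def)
  then have e: "ee \<tau> = w" unfolding ee_def using assms by simp
  then have "norm (ee \<tau>) < 1" using assms by simp
  then have "\<tau> \<in> UHP" by (simp add: ee_def UHP_def zero_less_mult_iff)
  then show ?thesis using e by (rule that)
qed

text \<open>
  Up to the factor \<open>q^p\<close> the function is a power series in \<open>q\<close>, convergent in the unit disc.
\<close>
lemma q_series_holomorphic:
  assumes supp: "\<And>m. C m \<noteq> 0 \<Longrightarrow> \<exists>i::nat. m = p + real i"
    and sum: "\<And>\<tau>. \<tau> \<in> UHP \<Longrightarrow> ((\<lambda>m. C m * ee (of_real m * \<tau>)) has_sum f \<tau>) UNIV"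
  shows "f holomorphic_on UHP"
proof -
  define a where "a i = C (p + real i)" for i :: nat
  have s: "((\<lambda>i. ee (of_real p * \<tau>) * (a i * ee \<tau> ^ i)) has_sum f \<tau>) UNIV" if \<tau>: "\<tau> \<in> UHP" for \<tau>
  proof -
    have "((\<lambda>m. C m * ee (of_real m * \<tau>)) has_sum f \<tau>) (range (\<lambda>i::nat. p + real i))"
      by (rule has_sum_cong_neutral[THEN iffD1, OF _ _ _ sum[OF \<tau>]]) (use supp in auto)
    then have "((\<lambda>i. C (p + real i) * ee (of_real (p + real i) * \<tau>)) has_sum f \<tau>) UNIV"
      by (subst (asm) has_sum_reindex) (auto simp: inj_on_def o_def)
    moreover have "C (p + real i) * ee (of_real (p + real i) * \<tau>) = ee (of_real p * \<tau>) * (a i * ee \<tau> ^ i)" for i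
    proof -
      have "of_real (p + real i) * \<tau> = of_real p * \<tau> + of_nat i * \<tau>" by (simp add: algebra_simps)
      then show ?thesis by (simp add: ee_add ee_of_nat_mult a_def)
    qed
    ultimately show ?thesis by simp
  qed
  define g where "g w = (\<Sum>i. a i * w ^ i)" for w
  have sums: "(\<lambda>i. a i * (w - 0) ^ i) sums g w" if w: "w \<in> ball 0 1" for w
  proof (cases "w = 0")
    case True
    then show ?thesis unfolding g_def by (auto intro!: summable_sums sums_summable[OF powser_sums_zero])
  next
    case False
    then obtain \<tau> where \<tau>: "\<tau> \<in> UHP" "ee \<tau> = w" using w ee_surj_punctured_disc by auto
    from has_sum_cmult_right[OF s[OF \<tau>(1)], of "inverse (ee (of_real p * \<tau>))"]
    have "((\<lambda>i. a i * w ^ i) has_sum inverse (ee (of_real p * \<tau>)) * f \<tau>) UNIV"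
      using \<tau>(2) by (simp flip: mult.assoc)
    then show ?thesis unfolding g_def using has_sum_imp_sums sums_summable summable_sums by force
  qed
  have g: "g holomorphic_on ball 0 1" by (rule power_series_holomorphic[OF sums])
  have "(\<lambda>\<tau>. ee (of_real p * \<tau>) * g (ee \<tau>)) holomorphic_on UHP"
  proof (rule holomorphic_on_mult)
    show "(\<lambda>\<tau>. ee (of_real p * \<tau>)) holomorphic_on UHP" unfolding ee_def by (intro holomorphic_intros)
    have "(g \<circ> ee) holomorphic_on UHP"
    proof (rule holomorphic_on_compose_gen[OF _ g])
      show "ee holomorphic_on UHP" unfolding ee_def by (intro holomorphic_intros)
      show "ee ` UHP \<subseteq> ball 0 1" by (auto simp: ee_def UHP_def)
    qed
    then show "(\<lambda>\<tau>. g (ee \<tau>)) holomorphic_on UHP" by (simp add: o_def)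
  qed
  then show ?thesis
  proof (rule holomorphic_transform)
    fix \<tau> assume \<tau>: "\<tau> \<in> UHP"
    have "ee \<tau> \<in> ball 0 1" using \<tau> by (auto simp: ee_def UHP_def)
    from sums_mult[OF sums[OF this], of "ee (of_real p * \<tau>)"] has_sum_imp_sums[OF s[OF \<tau>]]
    show "ee (of_real p * \<tau>) * g (ee \<tau>) = f \<tau>" by (simp add: sums_iff)
  qed
qed

lemma q_series_unique:
  fixes C :: "real \<Rightarrow> complex"
  assumes "\<And>\<tau>. \<tau> \<in> UHP \<Longrightarrow> ((\<lambda>m. C m * ee (of_real m * \<tau>)) has_sum 0) UNIV"
  shows "C m = 0"
proof -
  have "C m * ee (of_real m * \<i>) = 0"
  proof (rule fourier_series_zero[of UNIV UNIV "\<lambda>m. C m * ee (of_real m * \<i>)"])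
    fix t :: real
    have "of_real t + \<i> \<in> UHP" by (simp add: UHP_def)
    from assms[OF this] show "((\<lambda>m. C m * ee (of_real m * \<i>) * ee (of_real (m \<bullet> t))) has_sum 0) UNIV"
    proof (rule has_sum_cong[THEN iffD1, rotated])
      fix m
      have "of_real m * (of_real t + \<i>) = of_real m * \<i> + of_real (m \<bullet> t)" by (simp add: algebra_simps)
      then show "C m * ee (of_real m * (of_real t + \<i>)) = C m * ee (of_real m * \<i>) * ee (of_real (m \<bullet> t))"
        by (simp only: ee_add mult.assoc)
    qed
  qed (simp_all add: subspace_UNIV)
  then show ?thesis by simp
qed

section \<open>From Jacobi forms to vector-valued forms\<close>

context UN_lattice
begin

text \<open>
  The functions \<open>\<Phi>((0, d) A) = \<phi>\<^sub>d | A\<close>. They are well defined because two matrices that lead to the same row vector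
  modulo \<open>N\<close> differ by an element of \<open>\<Gamma>\<^sub>1(N/d)\<close>, under which \<open>\<phi>\<^sub>d\<close> is invariant.
\<close>
lemma Jacobi_family_orbit:
  assumes \<phi>: "\<phi> \<in> weak_families k"
  obtains P where
    "\<And>u w d A \<tau> z. \<lbrakk>d dvd N; A \<in> SL2Z; int N dvd int d * A$2$1 - u; int N dvd int d * A$2$2 - w; \<tau> \<in> UHP; z \<in> complexify L\<rbrakk>
        \<Longrightarrow> P u w \<tau> z = jslash k A (\<phi> d) \<tau> z"
    and "\<And>u w. elliptic L (P u w)" and "\<And>u w. \<exists>f. jacobi_expansion L (P u w) f"
proof -
  have ex: "\<exists>p. fst p dvd N \<and> snd p \<in> SL2Z \<and> int N dvd int (fst p) * snd p$2$1 - u \<and> int N dvd int (fst p) * snd p$2$2 - w" for u w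
  proof -
    obtain d A where "d dvd N" "A \<in> SL2Z" "int N dvd int d * A$2$1 - u" "int N dvd int d * A$2$2 - w"
      using row_orbit[OF N_pos] .
    then show ?thesis by (intro exI[of _ "(d, A)"]) simp
  qed
  define p where "p u w = (SOME p. fst p dvd N \<and> snd p \<in> SL2Z \<and> int N dvd int (fst p) * snd p$2$1 - u \<and> int N dvd int (fst p) * snd p$2$2 - w)" for u w
  define dd AA where "dd u w = fst (p u w)" and "AA u w = snd (p u w)" for u w
  have dA: "dd u w dvd N" "AA u w \<in> SL2Z" "int N dvd int (dd u w) * AA u w$2$1 - u" "int N dvd int (dd u w) * AA u w$2$2 - w" for u w
    using someI_ex[OF ex[of u w]] unfolding p_def[symmetric] dd_def AA_def by blast+
  have W: "\<phi> d \<in> weak_jacobi_forms k L (Gamma1 (N div d))" if "d dvd N" for d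
    using \<phi> that by (simp add: divisor_sum_def)
  define P where "P u w = jslash k (AA u w) (\<phi> (dd u w))" for u w
  show ?thesis
  proof (rule that[of P])
    fix u w d A \<tau> z
    assume d: "d dvd N" and A: "A \<in> SL2Z" and e: "int N dvd int d * A$2$1 - u" "int N dvd int d * A$2$2 - w"
      and \<tau>: "\<tau> \<in> UHP" and z: "z \<in> complexify L"
    have diff: "int N dvd x - y" if "int N dvd x - v" "int N dvd y - v" for x y v
      using dvd_diff[OF that] by simp
    note u = row_orbit_unique[OF N_pos d dA(1) A dA(2) diff[OF e(1) dA(3)] diff[OF e(2) dA(4)]]
    define B where "B = A ** adj2 (AA u w)"
    have BG: "B \<in> Gamma1 (N div d)" unfolding B_def by (rule u(2))
    then have B: "B \<in> SL2Z" by (simp add: Gamma1_def)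
    have AB: "A = B ** AA u w"
      unfolding B_def by (simp add: adj2_mult(1)[OF dA(2)] matrix_mul_rid flip: matrix_mul_assoc)
    have inv: "jslash k B (\<phi> d) \<tau> z = \<phi> d \<tau> z" if "\<tau> \<in> UHP" "z \<in> complexify L" for \<tau> z
      using W[OF d] BG that unfolding weak_jacobi_forms_def by blast
    have "jslash k A (\<phi> d) \<tau> z = jslash k (AA u w) (jslash k B (\<phi> d)) \<tau> z"
      unfolding jslash_mult[OF B dA(2) \<tau>] AB[symmetric] ..
    also have "\<dots> = jslash k (AA u w) (\<phi> d) \<tau> z" by (rule jslash_cong[OF dA(2) \<tau> z inv])
    finally show "P u w \<tau> z = jslash k A (\<phi> d) \<tau> z" unfolding P_def u(1) by simp
  next
    fix u w
    have "elliptic L (\<phi> (dd u w))"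
      using W[OF dA(1)] unfolding weak_jacobi_forms_def elliptic_def by blast
    then show "elliptic L (P u w)" unfolding P_def by (rule elliptic_jslash[OF _ dA(2)])
    show "\<exists>f. jacobi_expansion L (P u w) f"
      using W[OF dA(1)] dA(2) unfolding weak_jacobi_forms_def P_def by blast
  qed
qed

text \<open>
  The theta coefficients of the rebuilt family are inverted by the partial Fourier transform. The resulting \<open>F\<close>
  satisfies the modular law by construction of the family. Its expansion comes from those of the \<open>\<phi>\<^sub>d | A\<close>, at
  first without control of the exponents modulo \<open>1\<close>; the action of \<open>T\<close> restricts these to the required classes, and
  then holomorphy follows since the expansion is essentially a power series in \<open>q\<close>.
\<close>
lemma jacobi_map_surj:
  assumes \<phi>: "\<phi> \<in> weak_families k"
  obtains F where "F \<in> weak_forms k" "jacobi_map F = \<phi>"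
proof -
  obtain P where
    P: "\<And>u w d A \<tau> z. \<lbrakk>d dvd N; A \<in> SL2Z; int N dvd int d * A$2$1 - u; int N dvd int d * A$2$2 - w; \<tau> \<in> UHP; z \<in> complexify L\<rbrakk>
        \<Longrightarrow> P u w \<tau> z = jslash k A (\<phi> d) \<tau> z"
    and Pe: "\<And>u w. elliptic L (P u w)" and Px: "\<And>u w. \<exists>f. jacobi_expansion L (P u w) f"
    using Jacobi_family_orbit[OF \<phi>] by metis
  define f where "f u w = (SOME f. jacobi_expansion L (P u w) f)" for u w
  have f: "jacobi_expansion L (P u w) (f u w)" for u w
    unfolding f_def by (rule someI_ex[OF Px])
  have fs: "((\<lambda>(n, l). f u w n l * ee (of_real n * \<tau>) * ee (cform (l, 0) z)) has_sum P u w \<tau> z) (\<rat> \<times> Ld)"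
    if "\<tau> \<in> UHP" "z \<in> complexify L" for u w \<tau> z
    using f that unfolding jacobi_expansion_def by blast
  define D where "D u w h \<longleftrightarrow> (\<forall>\<tau>\<in>UHP. periodic L (h \<tau>)) \<and>
      (\<forall>\<tau>\<in>UHP. \<forall>l\<in>Ld. ((\<lambda>n. f u w n l * ee (of_real (n - l \<bullet> l / 2) * \<tau>)) has_sum h \<tau> l) \<rat>) \<and>
      (\<forall>\<tau>\<in>UHP. \<forall>z\<in>complexify L. P u w \<tau> z = theta L (h \<tau>) \<tau> z)" for u w and h :: "complex \<Rightarrow> 'a \<Rightarrow> complex"
  have ex: "\<exists>h. D u w h" for u w
  proof -
    show ?thesis
    proof (rule theta_decomposition[OF Pe[of u w] fs[of _ _ u w]])
      fix h :: "complex \<Rightarrow> 'a \<Rightarrow> complex"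
      assume "\<And>\<tau>. \<tau> \<in> UHP \<Longrightarrow> periodic L (h \<tau>)"
        and "\<And>\<tau> l. \<tau> \<in> UHP \<Longrightarrow> l \<in> Ld \<Longrightarrow> ((\<lambda>n. f u w n l * ee (of_real (n - l \<bullet> l / 2) * \<tau>)) has_sum h \<tau> l) \<rat>"
        and "\<And>\<tau> z. \<tau> \<in> UHP \<Longrightarrow> z \<in> complexify L \<Longrightarrow> P u w \<tau> z = theta L (h \<tau>) \<tau> z"
      then show "\<exists>h. D u w h" unfolding D_def by blast
    qed
  qed
  define h where "h u w = (SOME h. D u w h)" for u w
  have h: "D u w (h u w)" for u w unfolding h_def by (rule someI_ex[OF ex])
  have hper: "periodic L (h u w \<tau>)" if "\<tau> \<in> UHP" for u w \<tau> using h that unfolding D_def by blast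
  have hsum: "((\<lambda>n. f u w n l * ee (of_real (n - l \<bullet> l / 2) * \<tau>)) has_sum h u w \<tau> l) \<rat>" if "\<tau> \<in> UHP" "l \<in> Ld" for u w \<tau> l
    using h that unfolding D_def by blast
  have htheta: "P u w \<tau> z = theta L (h u w \<tau>) \<tau> z" if "\<tau> \<in> UHP" "z \<in> complexify L" for u w \<tau> z
    using h that unfolding D_def by blast
  have Pcong: "P u w \<tau> z = P u' w' \<tau> z"
    if uw: "int N dvd u - u'" "int N dvd w - w'" and \<tau>: "\<tau> \<in> UHP" and z: "z \<in> complexify L" for u u' w w' \<tau> z
  proof -
    obtain d A where dA: "d dvd N" "A \<in> SL2Z" "int N dvd int d * A$2$1 - u" "int N dvd int d * A$2$2 - w"
      using row_orbit[OF N_pos] .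
    have "int N dvd int d * A$2$1 - u'" "int N dvd int d * A$2$2 - w'"
      using dvd_add[OF dA(3) uw(1)] dvd_add[OF dA(4) uw(2)] by simp_all
    from P[OF dA(1,2) this \<tau> z] P[OF dA \<tau> z] show ?thesis by simp
  qed
  have hcong: "h u w \<tau> (l + x) = h u' w' \<tau> l"
    if uw: "int N dvd u - u'" "int N dvd w - w'" and l: "l \<in> Ld" and x: "x \<in> L" and \<tau>: "\<tau> \<in> UHP" for u u' w w' l x \<tau>
  proof -
    have "h u w \<tau> l = h u' w' \<tau> l"
      by (rule theta_unique[OF hper[OF \<tau>] hper[OF \<tau>] \<tau> _ l]) (use Pcong[OF uw \<tau>] htheta[OF \<tau>] in simp)
    then show ?thesis using periodicD[OF hper[OF \<tau>] l x] by simp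
  qed
  define F where "F \<tau> = (if \<tau> \<in> UHP then unfcoef (\<lambda>u w. h u w \<tau>) else (\<lambda>_. 0))" for \<tau>
  have FV: "F \<tau> \<in> V" if "\<tau> \<in> UHP" for \<tau> using that unfcoef_V by (simp add: F_def)
  have fF: "fcoef (F \<tau>) u w l = h u w \<tau> l" if \<tau>: "\<tau> \<in> UHP" and l: "l \<in> Ld" for \<tau> u w l
  proof -
    have "fcoef (unfcoef (\<lambda>u w. h u w \<tau>)) u w l = h u w \<tau> l"
      by (rule fcoef_unfcoef[OF _ l]) (rule hcong[OF _ _ _ _ \<tau>])
    then show ?thesis using \<tau> by (simp add: F_def)
  qed
  have PhiF: "Phi F u w \<tau> z = P u w \<tau> z" if \<tau>: "\<tau> \<in> UHP" and z: "z \<in> complexify L" for u w \<tau> z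
    unfolding Phi_def jtheta_def htheta[OF \<tau> z] by (rule theta_cong) (rule fF[OF \<tau>])
  have law: "jslash k A (Phi F u w) \<tau> z = Phi F (u * A $ 1 $ 1 + w * A $ 2 $ 1) (u * A $ 1 $ 2 + w * A $ 2 $ 2) \<tau> z"
    if A: "A \<in> SL2Z" and \<tau>: "\<tau> \<in> UHP" and z: "z \<in> complexify L" for A \<tau> z u w
  proof -
    obtain d B where dB: "d dvd N" "B \<in> SL2Z" "int N dvd int d * B$2$1 - u" "int N dvd int d * B$2$2 - w"
      using row_orbit[OF N_pos] .
    have "jslash k A (Phi F u w) \<tau> z = jslash k A (jslash k B (\<phi> d)) \<tau> z"
      by (rule jslash_cong[OF A \<tau> z]) (simp add: PhiF P[OF dB])
    also have "\<dots> = jslash k (B ** A) (\<phi> d) \<tau> z" by (rule jslash_mult[OF dB(2) A \<tau>])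
    also have "\<dots> = P (u * A $ 1 $ 1 + w * A $ 2 $ 1) (u * A $ 1 $ 2 + w * A $ 2 $ 2) \<tau> z"
    proof (rule P[OF dB(1) SL2Z_mult[OF dB(2) A] _ _ \<tau> z, symmetric])
      have "int N dvd (int d * B$2$1 - u) * A $ 1 $ j + (int d * B$2$2 - w) * A $ 2 $ j" for j
        using dB(3,4) by simp
      moreover have "int d * (B ** A) $ 2 $ j - (u * A $ 1 $ j + w * A $ 2 $ j) = (int d * B$2$1 - u) * A $ 1 $ j + (int d * B$2$2 - w) * A $ 2 $ j" for j
        by (simp add: algebra_simps)
      ultimately show "int N dvd int d * (B ** A) $ 2 $ 1 - (u * A $ 1 $ 1 + w * A $ 2 $ 1)"
        "int N dvd int d * (B ** A) $ 2 $ 2 - (u * A $ 1 $ 2 + w * A $ 2 $ 2)" by simp_all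
    qed
    finally show ?thesis using PhiF[OF \<tau> z] by simp
  qed
  then have law': "\<forall>A\<in>SL2Z. \<forall>\<tau>\<in>UHP. \<forall>z\<in>complexify L. \<forall>u w.
      jslash k A (Phi F u w) \<tau> z = Phi F (u * A $ 1 $ 1 + w * A $ 2 $ 1) (u * A $ 1 $ 2 + w * A $ 2 $ 2) \<tau> z"
    by blast
  note mod = iffD2[OF modular_law_iff[OF FV] law']
  \<comment> \<open>The Weil representation of \<open>T\<close> is diagonal.\<close>
  have FT: "F (\<tau> + 1) x = ee (- of_real (disc_quad (UN_plus_form N) x)) * F \<tau> x" if \<tau>: "\<tau> \<in> UHP" for \<tau> x
  proof -
    obtain A \<phi> where T: "mp_T = (A, \<phi>)" by (cases mp_T)
    have "weil_rep (UN_plus_form N) M mp_T (F \<tau>) = opT (F \<tau>)"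
      by (rule weil_rel_unique[OF mp_T_Mp2Z weil_rep_characterisation[OF mp_T_Mp2Z FV[OF \<tau>]] weil_rel_T[OF FV[OF \<tau>]]])
    moreover have "F (moebius_act A \<tau>) x = \<phi> \<tau> powi (2 * k - int (dim L)) * weil_rep (UN_plus_form N) M mp_T (F \<tau>) x"
      using mod mp_T_Mp2Z \<tau> unfolding T by (auto dest: bspec)
    moreover have "moebius_act A \<tau> = \<tau> + 1" "\<phi> \<tau> = 1"
      using T \<tau> by (auto simp: mp_T_eq moebius_act_def aut_factor_def)
    ultimately show ?thesis by (simp add: opT_def)
  qed
  have series: "\<exists>C n0. (\<forall>m<n0. C m = 0) \<and> (\<forall>\<tau>\<in>UHP. ((\<lambda>m. C m * ee (of_real m * \<tau>)) has_sum F \<tau> x) UNIV)" if x: "x \<in> X" for x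
  proof -
    obtain a b l where abl: "x = cls a b l" "l \<in> Ld" using x unfolding X_eq by blast
    define g where "g w m = (if m + l \<bullet> l / 2 \<in> \<rat> then f (- b) (int w) (m + l \<bullet> l / 2) l else 0)" for w :: nat and m
    define C where "C m = (1 / of_nat N) * (\<Sum>w<N. ee (- (of_int (a * int w) / of_nat N)) * g w m)" for m
    have gs: "((\<lambda>m. g w m * ee (of_real m * \<tau>)) has_sum h (- b) (int w) \<tau> l) UNIV" if \<tau>: "\<tau> \<in> UHP" for w \<tau>
    proof -
      have "((\<lambda>n. g w (n - l \<bullet> l / 2) * ee (of_real (n - l \<bullet> l / 2) * \<tau>)) has_sum h (- b) (int w) \<tau> l) UNIV"
        by (rule has_sum_cong_neutral[THEN iffD1, OF _ _ _ hsum[OF \<tau> abl(2)]]) (auto simp: g_def)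
      moreover have "bij_betw (\<lambda>n. n - l \<bullet> l / 2) UNIV UNIV"
        by (rule bij_betwI[of _ _ _ "\<lambda>n. n + l \<bullet> l / 2"]) auto
      ultimately show ?thesis using has_sum_reindex_bij_betw[of "\<lambda>n. n - l \<bullet> l / 2" UNIV UNIV "\<lambda>m. g w m * ee (of_real m * \<tau>)"] by blast
    qed
    have Cs: "((\<lambda>m. C m * ee (of_real m * \<tau>)) has_sum F \<tau> x) UNIV" if \<tau>: "\<tau> \<in> UHP" for \<tau>
    proof -
      have Fx: "F \<tau> x = (1 / of_nat N) * (\<Sum>w<N. ee (- (of_int (a * int w) / of_nat N)) * h (- b) (int w) \<tau> l)"
        unfolding abl(1) fcoef_inversion[of "F \<tau>" a b l] fF[OF \<tau> abl(2)] ..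
      have "((\<lambda>m. (1 / of_nat N) * (\<Sum>w<N. ee (- (of_int (a * int w) / of_nat N)) * (g w m * ee (of_real m * \<tau>)))) has_sum F \<tau> x) UNIV"
        unfolding Fx by (intro has_sum_cmult_right has_sum_finite_sum gs \<tau> finite_lessThan)
      then show ?thesis unfolding C_def by (simp only: sum_distrib_right mult.assoc)
    qed
    have "\<exists>n0. \<forall>m<n0. g w m = 0" for w
    proof -
      obtain n0 where n0: "\<And>n. n \<in> \<rat> \<Longrightarrow> f (- b) (int w) n l \<noteq> 0 \<Longrightarrow> n0 \<le> n"
        using f[of "- b" "int w"] abl(2) unfolding jacobi_expansion_def by blast
      have "g w m = 0" if "m < n0 - l \<bullet> l / 2" for m
        using n0[of "m + l \<bullet> l / 2"] that unfolding g_def by force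
      then show ?thesis by blast
    qed
    then obtain n0 where n0: "\<And>w m. m < n0 w \<Longrightarrow> g w m = 0" by metis
    have "C m = 0" if m: "m < Min (n0 ` {..<N})" for m
    proof -
      have "g w m = 0" if "w < N" for w
        using m that by (intro n0) (auto intro: less_le_trans Min_le)
      then show ?thesis unfolding C_def by simp
    qed
    then show ?thesis using Cs by blast
  qed
  then have "\<forall>x\<in>X. \<exists>p. (\<forall>m<snd p. fst p m = 0) \<and> (\<forall>\<tau>\<in>UHP. ((\<lambda>m. fst p m * ee (of_real m * \<tau>)) has_sum F \<tau> x) UNIV)"
    by (metis fst_conv snd_conv)
  from bchoice[OF this] obtain p where p: "\<forall>x\<in>X. (\<forall>m<snd (p x). fst (p x) m = 0) \<and> (\<forall>\<tau>\<in>UHP. ((\<lambda>m. fst (p x) m * ee (of_real m * \<tau>)) has_sum F \<tau> x) UNIV)" ..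
  define c n0 where "c x = fst (p x)" and "n0 x = snd (p x)" for x
  have c0: "c x m = 0" if "x \<in> X" "m < n0 x" for x m
    using p that unfolding c_def n0_def by blast
  have cs: "((\<lambda>m. c x m * ee (of_real m * \<tau>)) has_sum F \<tau> x) UNIV" if "x \<in> X" "\<tau> \<in> UHP" for x \<tau>
    using p that unfolding c_def by blast
  have cexp: "m \<in> vv_exponents (UN_plus_form N) x" if x: "x \<in> X" and nz: "c x m \<noteq> 0" for x m
  proof -
    define q where "q = disc_quad (UN_plus_form N) x"
    have "c x m * ee (of_real m) - ee (- of_real q) * c x m = 0"
    proof (rule q_series_unique[of "\<lambda>m. c x m * ee (of_real m) - ee (- of_real q) * c x m"])
      fix \<tau> assume \<tau>: "\<tau> \<in> UHP"
      then have "\<tau> + 1 \<in> UHP" by (simp add: UHP_def)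
      from has_sum_add[OF cs[OF x this] has_sum_uminusI[OF has_sum_cmult_right[OF cs[OF x \<tau>], of "ee (- of_real q)"]]]
      show "((\<lambda>m. (c x m * ee (of_real m) - ee (- of_real q) * c x m) * ee (of_real m * \<tau>)) has_sum 0) UNIV"
        unfolding FT[OF \<tau>] q_def by (simp add: ring_distribs ee_add mult_ac)
    qed
    then have "ee (of_real m) = ee (- of_real q)" using nz by simp
    then have "ee (of_real (m + q)) = 1" by (simp add: ee_add)
    then show ?thesis unfolding vv_exponents_def q_def[symmetric] using ee_eq_1_imp by blast
  qed
  have hol: "(\<lambda>\<tau>. F \<tau> x) holomorphic_on UHP" if x: "x \<in> X" for x
  proof (rule q_series_holomorphic[OF _ cs[OF x]])
    define q where "q = disc_quad (UN_plus_form N) x"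
    fix m assume nz: "c x m \<noteq> 0"
    obtain j where j: "m + q = of_int j" using cexp[OF x nz] by (auto simp: vv_exponents_def q_def elim: Ints_cases)
    have "n0 x \<le> m" using c0[OF x] nz by (meson not_le)
    then have "\<lfloor>n0 x + q\<rfloor> \<le> j" using j by linarith
    then have "m = of_int \<lfloor>n0 x + q\<rfloor> - q + real (nat (j - \<lfloor>n0 x + q\<rfloor>))" using j by simp
    then show "\<exists>i::nat. m = of_int \<lfloor>n0 x + disc_quad (UN_plus_form N) x\<rfloor> - disc_quad (UN_plus_form N) x + real i"
      unfolding q_def by blast
  qed
  have "vv_expansion (UN_plus_form N) M F c"
    unfolding vv_expansion_def
  proof (intro conjI exI[of _ "Min (n0 ` X)"] ballI impI)
    fix x n assume x: "x \<in> X" and "n < Min (n0 ` X)"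
    then have "n < n0 x" using finite_X by (auto intro: less_le_trans Min_le)
    then show "c x n = 0" by (rule c0[OF x])
  next
    fix \<tau> x assume \<tau>: "\<tau> \<in> UHP" and x: "x \<in> X"
    show "((\<lambda>n. c x n * ee (of_real n * \<tau>)) has_sum F \<tau> x) (vv_exponents (UN_plus_form N) x)"
      by (rule has_sum_cong_neutral[THEN iffD1, OF _ _ _ cs[OF x \<tau>]]) (use cexp[OF x] in auto)
  qed
  then have Fk: "F \<in> weak_forms k"
    unfolding weak_vv_forms_def floor_weight using mod FV hol by (auto simp: F_def)
  have "jacobi_map F = \<phi>"
  proof (intro ext)
    fix d \<tau> z
    show "jacobi_map F d \<tau> z = \<phi> d \<tau> z"
    proof (cases "d dvd N")
      case d: True
      have "\<phi> d \<tau> z = 0" if "\<not> (\<tau> \<in> UHP \<and> z \<in> complexify L)"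
        using \<phi> d that unfolding divisor_sum_def weak_jacobi_forms_def by blast
      then show ?thesis using PhiF P[OF d SL2Z_one, of 0 "int d"] d by (auto simp: jacobi_map_def)
    next
      case False
      then show ?thesis using \<phi> by (simp add: divisor_sum_def jacobi_map_def)
    qed
  qed
  with Fk show ?thesis by (rule that)
qed

lemma holomorphic_families_weak: "\<phi> \<in> holomorphic_families k \<Longrightarrow> \<phi> \<in> weak_families k"
  by (auto simp: divisor_sum_def jacobi_forms_def)

lemma jacobi_map_bij: "bij_betw jacobi_map (weak_forms k) (weak_families k)"
  by (rule bij_betw_imageI)
    (use jacobi_map_inj jacobi_map_weak_families jacobi_map_surj in \<open>auto simp: inj_on_def image_iff, metis\<close>)

lemma jacobi_map_bij_holomorphic:
  "bij_betw jacobi_map (vv_forms (of_int k - real (dim L) / 2) (UN_plus_form N) M) (holomorphic_families k)"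
proof (rule bij_betw_imageI)
  show "inj_on jacobi_map (vv_forms (of_int k - real (dim L) / 2) (UN_plus_form N) M)"
    using jacobi_map_inj by (auto simp: inj_on_def vv_forms_def)
  show "jacobi_map ` vv_forms (of_int k - real (dim L) / 2) (UN_plus_form N) M = holomorphic_families k"
  proof (intro equalityI subsetI)
    fix \<phi> assume \<phi>: "\<phi> \<in> holomorphic_families k"
    obtain F where "F \<in> weak_forms k" "jacobi_map F = \<phi>" using jacobi_map_surj[OF holomorphic_families_weak[OF \<phi>]] .
    then show "\<phi> \<in> jacobi_map ` vv_forms (of_int k - real (dim L) / 2) (UN_plus_form N) M"
      using jacobi_map_reflects_holomorphic \<phi> by blast
  qed (use jacobi_map_holomorphic_families in blast)
qed

end

section \<open>The isomorphism\<close>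

theorem theorem4p1:
  fixes L :: "'a::euclidean_space set" and N :: nat and k :: int
  assumes "even_posdef_lattice L" and "N > 0"
  shows "\<exists>J :: (complex \<Rightarrow> (real \<times> real \<times> 'a) set \<Rightarrow> complex) \<Rightarrow>
                nat \<Rightarrow> complex \<Rightarrow> 'a \<times> 'a \<Rightarrow> complex.
    complex_linear_iso J
      (weak_vv_forms (of_int k - real (dim L) / 2) (UN_plus_form N) (UN_plus L))
      (divisor_sum N (\<lambda>d. weak_jacobi_forms k L (Gamma1 (N div d)))) \<and>
    (\<forall>F \<in> weak_vv_forms (of_int k - real (dim L) / 2) (UN_plus_form N) (UN_plus L).
      \<forall>c. vv_expansion (UN_plus_form N) (UN_plus L) F c \<longrightarrow>
        (\<forall>d. d dvd N \<longrightarrow> (\<forall>\<tau>\<in>UHP. \<forall>z\<in>complexify L.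
          ((\<lambda>(n::int, l).
              (\<Sum>a<N. ee (of_nat (a * d) / of_nat N) *
                 c (UN_class N L a 0 l) (of_int n - l \<bullet> l / 2)) *
              ee (of_int n * \<tau>) * ee (cform (l, 0) z))
            has_sum J F d \<tau> z) (UNIV \<times> dual_lattice (\<bullet>) L)))) \<and>
    complex_linear_iso J
      (vv_forms (of_int k - real (dim L) / 2) (UN_plus_form N) (UN_plus L))
      (divisor_sum N (\<lambda>d. jacobi_forms k L (Gamma1 (N div d))))"
proof -
  interpret UN_lattice L N
    using assms by unfold_locales
  show ?thesis
    by (intro exI[of _ jacobi_map] conjI ballI allI impI jacobi_map_formula)
      (simp_all add: complex_linear_iso_def jacobi_map_bij jacobi_map_bij_holomorphic jacobi_map_linear)
qed

end
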